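(* Let $\beta>0$. If $\delta_N\to0$, $\rho_N\to0$ and $n_N\to\infty$ tend to their limits slowly enough, then for any $t,c>0$ there is $N_0$ such that for all $N\ge N_0$, $$\mathbb P\Big(\max_{\|m\|^2<N}\big|\widetilde F_{N,\beta}(m)-\mathbb E\,\widetilde F_{N,\beta}(m)\big|<t\Big)>1-e^{-Nc},$$ where $\widetilde F_{N,\beta}(m)=\widetilde F_{N,\beta}(m,n_N,\rho_N,\delta_N)$.
   Context: Let $\gamma_p\ge0$, $p\ge1$, decay exponentially fast in $p$, and let $\nu(x)=\sum_{p\ge1}\gamma_p^2x^p$ (the mixture). Let $\mathbb S^{N-1}=\{\boldsymbol\sigma\in\mathbb R^N:\|\boldsymbol\sigma\|=\sqrt N\}$, $d\boldsymbol\sigma$ its normalized Haar (uniform) measure, and $R(\boldsymbol\sigma,\boldsymbol\sigma')=\frac1N\boldsymbol\sigma\cdot\boldsymbol\sigma'$. For $m\in\mathbb R^N$ with $\|m\|\le\sqrt N$ the Hamiltonian is $H_N(m)=\sum_{p\ge1}\frac{\gamma_p}{N^{(p-1)/2}}\sum_{i_1,\dots,i_p=1}^N J^{(p)}_{i_1,\dots,i_p}m_{i_1}\cdots m_{i_p}$ with $J^{(p)}_{i_1,\dots,i_p}$ i.i.d. standard Gaussian. For $\|m\|<\sqrt N$ let $\mathrm{Band}(m,\delta)=\{\boldsymbol\sigma\in\mathbb S^{N-1}:|R(\boldsymbol\sigma-m,m)|\le\delta\|m\|/\sqrt N\}$, $$B_N(m,n,\rho,\delta)=\{(\boldsymbol\sigma_1,\dots,\boldsymbol\sigma_n)\in\mathrm{Band}(m,\delta)^n:\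 |R(\boldsymbol\sigma_i,\boldsymbol\sigma_j)-R(m,m)|<\rho\ \ \forall i\ne j\},$$ $$\widetilde F_{N,\beta}(m,n,\rho,\delta)=\frac1{Nn}\log\int_{B_N(m,n,\rho,\delta)}\exp\Big\{\beta\sum_{i=1}^n\big(H_N(\boldsymbol\sigma_i)-H_N(m)\big)\Big\}d\boldsymbol\sigma_1\cdots d\boldsymbol\sigma_n .$$ "Tend to their limits slowly enough" means: there exist $\delta_N^0,\rho_N^0\to0$ and $n_N^0\to\infty$ (depending only on $\nu$ and the fixed $\beta$) such that the statement holds for any sequences $\delta_N\ge\delta_N^0$, $\rho_N\ge\rho_N^0$ (positive) and integers $n_N\le n_N^0$ with $\delta_N,\rho_N\to0$ and $n_N\to\infty$. *)

theory Defs
  imports "HOL-Probability.Probability"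
begin

text \<open>
  The dimension N varies inside the statement, so a vector of \<open>\<real>\<^sup>N\<close> is an element of
  \<open>{..<N} \<rightarrow>\<^sub>E UNIV\<close>, the space of the product Borel space \<open>PiM {..<N} (\<lambda>_. borel)\<close>.
  Its Euclidean norm is \<open>L2_set x {..<N}\<close>.
\<close>

definition overlap :: "nat \<Rightarrow> (nat \<Rightarrow> real) \<Rightarrow> (nat \<Rightarrow> real) \<Rightarrow> real" where
  "overlap N x y = (\<Sum>i<N. x i * y i) / real N"

definition sphere_N :: "nat \<Rightarrow> (nat \<Rightarrow> real) set" where
  "sphere_N N = {x \<in> {..<N} \<rightarrow>\<^sub>E UNIV. L2_set x {..<N} = sqrt (real N)}"

definition open_ball_N :: "nat \<Rightarrow> (nat \<Rightarrow> real) set" where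
  "open_ball_N N = {m \<in> {..<N} \<rightarrow>\<^sub>E UNIV. (L2_set m {..<N})\<^sup>2 < real N}"

definition orthogonal_entries :: "nat \<Rightarrow> (nat \<Rightarrow> nat \<Rightarrow> real) \<Rightarrow> bool" where
  "orthogonal_entries N Q \<longleftrightarrow>
     (\<forall>i<N. \<forall>j<N. (\<Sum>k<N. Q k i * Q k j) = (if i = j then 1 else 0))"

definition apply_entries :: "nat \<Rightarrow> (nat \<Rightarrow> nat \<Rightarrow> real) \<Rightarrow> (nat \<Rightarrow> real) \<Rightarrow> nat \<Rightarrow> real" where
  "apply_entries N Q x = (\<lambda>i\<in>{..<N}. \<Sum>j<N. Q i j * x j)"

text \<open>
  The normalized Haar measure on the sphere of radius \<open>sqrt N\<close>: for \<open>N \<ge> 1\<close> this predicate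
  holds of exactly one measure, the Borel probability measure invariant under the
  orthogonal group O(N).
\<close>

definition sphere_haar :: "nat \<Rightarrow> (nat \<Rightarrow> real) measure \<Rightarrow> bool" where
  "sphere_haar N \<mu> \<longleftrightarrow>
     prob_space \<mu> \<and>
     sets \<mu> = sets (restrict_space (PiM {..<N} (\<lambda>_. borel)) (sphere_N N)) \<and>
     (\<forall>Q. orthogonal_entries N Q \<longrightarrow> distr \<mu> \<mu> (apply_entries N Q) = \<mu>)"

text \<open>
  A multi-index \<open>(i_1, ..., i_p)\<close> is a list of length p with entries below N; the order p of
  the interaction is the length of the list, so \<open>J\<close> carries no separate argument p.
\<close>

definition multi_indices :: "nat \<Rightarrow> nat \<Rightarrow> nat list set" where
  "multi_indices N p = {is. length is = p \<and> set is \<subseteq> {..<N}}"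

definition iid_gaussian_disorder :: "nat \<Rightarrow> 'a measure \<Rightarrow> (nat list \<Rightarrow> 'a \<Rightarrow> real) \<Rightarrow> bool" where
  "iid_gaussian_disorder N M J \<longleftrightarrow>
     prob_space M \<and>
     prob_space.indep_vars M (\<lambda>_. borel) J (\<Union>p\<in>{1..}. multi_indices N p) \<and>
     (\<forall>p\<ge>1. \<forall>is\<in>multi_indices N p. distributed M lborel (J is) std_normal_density)"

definition decays_exponentially :: "(nat \<Rightarrow> real) \<Rightarrow> bool" where
  "decays_exponentially \<gamma> \<longleftrightarrow> (\<exists>C a. a > 0 \<and> (\<forall>p\<ge>1. \<gamma> p \<le> C * exp (- a * real p)))"

definition pure_hamiltonian ::
    "nat \<Rightarrow> (nat \<Rightarrow> real) \<Rightarrow> (nat list \<Rightarrow> real) \<Rightarrow> nat \<Rightarrow> (nat \<Rightarrow> real) \<Rightarrow> real" where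
  "pure_hamiltonian N \<gamma> J p m =
     \<gamma> p / real N powr ((real p - 1) / 2) *
     (\<Sum>is\<in>multi_indices N p. J is * prod_list (map m is))"

text \<open>
  Here \<open>J\<close> is one realization of the disorder. Almost surely the series converges
  for every m with norm at most \<open>sqrt N\<close>; the shift by \<open>Suc\<close> makes it start at \<open>p = 1\<close>.
\<close>

definition hamiltonian ::
    "nat \<Rightarrow> (nat \<Rightarrow> real) \<Rightarrow> (nat list \<Rightarrow> real) \<Rightarrow> (nat \<Rightarrow> real) \<Rightarrow> real" where
  "hamiltonian N \<gamma> J m = (\<Sum>p. pure_hamiltonian N \<gamma> J (Suc p) m)"

definition Band :: "nat \<Rightarrow> (nat \<Rightarrow> real) \<Rightarrow> real \<Rightarrow> (nat \<Rightarrow> real) set" where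
  "Band N m \<delta> =
     {\<sigma> \<in> sphere_N N.
        \<bar>overlap N (\<lambda>i. \<sigma> i - m i) m\<bar> \<le> \<delta> * L2_set m {..<N} / sqrt (real N)}"

definition replica_band ::
    "nat \<Rightarrow> (nat \<Rightarrow> real) \<Rightarrow> nat \<Rightarrow> real \<Rightarrow> real \<Rightarrow> (nat \<Rightarrow> nat \<Rightarrow> real) set" where
  "replica_band N m n \<rho> \<delta> =
     {\<sigma> \<in> {..<n} \<rightarrow>\<^sub>E Band N m \<delta>.
        \<forall>i<n. \<forall>j<n. i \<noteq> j \<longrightarrow> \<bar>overlap N (\<sigma> i) (\<sigma> j) - overlap N m m\<bar> < \<rho>}"

text \<open>
  \<open>h\<close> stands for a realization of the Hamiltonian and \<open>\<mu>\<close> for the Haar measure on the sphere.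
  If the replica band is a null set the logarithm is minus infinity on paper, but
  \<open>ln 0 = 0\<close> here. For fixed \<open>\<rho>, \<delta> > 0\<close> and \<open>n\<close> smaller than \<open>N\<close> the replica band has positive
  measure: it contains a neighbourhood of the points \<open>m + sqrt (N - |m|^2) e_i\<close> with
  \<open>e_1, ..., e_n\<close> orthonormal and orthogonal to m.
\<close>

definition multi_free_energy ::
    "nat \<Rightarrow> (nat \<Rightarrow> real) measure \<Rightarrow> real \<Rightarrow> ((nat \<Rightarrow> real) \<Rightarrow> real) \<Rightarrow>
     (nat \<Rightarrow> real) \<Rightarrow> nat \<Rightarrow> real \<Rightarrow> real \<Rightarrow> real" where
  "multi_free_energy N \<mu> \<beta> h m n \<rho> \<delta> =
     1 / (real N * real n) *
     ln (LINT \<sigma>:replica_band N m n \<rho> \<delta>|PiM {..<n} (\<lambda>_. \<mu>).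
           exp (\<beta> * (\<Sum>i<n. h (\<sigma> i) - h m)))"

end

theory Submission
  imports Defs "HOL-Real_Asymp.Real_Asymp"
begin

text \<open>
  For fixed \<open>m\<close>, the constraints on the overlaps make the variance of
  \<open>\<Sum>i<n. H (\<sigma> i) - H m\<close> at most \<open>N n\<^sup>2 \<epsilon>\<close> with \<open>\<epsilon>\<close> of order \<open>1/n + \<rho> + \<delta>\<close>.  Rotating
  the Gaussian disorder in small steps towards an independent copy (Maurey and Pisier) bounds
  the exponential moments of the free energy by those of a single energy, so that a deviation by \<open>t\<close>
  has probability at most \<open>2 exp (- N t\<^sup>2 / o(1))\<close>, which is smaller than any fixed exponential.

  It remains to compare \<open>m\<close> with a point of a net of exponential size, without knowing the volume
  of the replica band.  A change of direction is undone by reflections, which preserve the Haar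
  measure.  To change the radius, every replica is pulled by a small amount \<open>\<alpha>\<close> towards a point built
  from nearly orthogonal coordinate axes; this lands in the band of the new radius with room to
  spare, and costs a factor \<open>(1 + \<alpha>)\<^sup>N / (1 - \<alpha>)\<close> of density per replica.  The energies
  move by at most the Lipschitz constant of the Hamiltonian, which is bounded by injective norms of
  Gaussian tensors.
\<close>

text \<open>\<open>sphere_haar\<close> supplies invariance only, while a pull is not an isometry and
  its density has to be bounded. Hence a detour: the invariant measure is identified with the radial
  image of Lebesgue measure on the ball, where a pull along an axis becomes an explicit change of
  one coordinate.

  A pull creates room because its targets have exactly the overlaps that the centre of the band
  prescribes: every defect shrinks by the factor 1 / (1 + \<open>\<alpha>\<^sup>2\<close>). The
  change of radius and the imperfect orthogonality must fit into the share of order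
  \<open>\<alpha>\<^sup>2\<close> of the tolerances that is freed. This limits how fast
  \<open>\<delta>\<close> and \<open>\<rho>\<close> may shrink and, since every replica spoils some
  axes, how fast n may grow. Which axes are suitable depends on the configuration; summing over all
  choices costs \<open>N ^ (n + 1)\<close>, negligible after taking the logarithm and dividing by N
  n.

  The parameter \<alpha> stays fixed as N grows, so the net has at most exp (C N) points with a
  fixed C, which the vanishing rate beats. Bands of measure zero have free energy 0 by
  \<open>ln 0 = 0\<close>, and the centre 0, which has no direction, is a net point of its
  own.\<close>

section \<open>Shears, rotations and stretches of Lebesgue measure\<close>

lemma nn_integral_lborel_shift:
  fixes f :: "real \<Rightarrow> ennreal"
  assumes [measurable]: "f \<in> borel_measurable borel"
  shows "(\<integral>\<^sup>+x. f (x + t) \<partial>lborel) = (\<integral>\<^sup>+x. f x \<partial>lborel)"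
  using nn_integral_real_affine[OF assms, of 1 t] by (simp add: add.commute)

lemma nn_integral_lborel_shear_snd:
  fixes f :: "real \<Rightarrow> real \<Rightarrow> ennreal"
  assumes [measurable]: "case_prod f \<in> borel_measurable (borel \<Otimes>\<^sub>M borel)"
  shows "(\<integral>\<^sup>+a. \<integral>\<^sup>+b. f a (b + k * a) \<partial>lborel \<partial>lborel) = (\<integral>\<^sup>+a. \<integral>\<^sup>+b. f a b \<partial>lborel \<partial>lborel)"
  by (intro nn_integral_cong nn_integral_lborel_shift) measurable

lemma nn_integral_lborel_swap:
  fixes f :: "real \<Rightarrow> real \<Rightarrow> ennreal"
  assumes [measurable]: "case_prod f \<in> borel_measurable (borel \<Otimes>\<^sub>M borel)"
  shows "(\<integral>\<^sup>+a. \<integral>\<^sup>+b. f a b \<partial>lborel \<partial>lborel) = (\<integral>\<^sup>+b. \<integral>\<^sup>+a. f a b \<partial>lborel \<partial>lborel)"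
proof -
  have "case_prod f \<in> borel_measurable (lborel \<Otimes>\<^sub>M lborel)" by measurable
  then show ?thesis by (rule lborel_pair.Fubini'[symmetric])
qed

lemma nn_integral_lborel_shear_fst:
  fixes f :: "real \<Rightarrow> real \<Rightarrow> ennreal"
  assumes [measurable]: "case_prod f \<in> borel_measurable (borel \<Otimes>\<^sub>M borel)"
  shows "(\<integral>\<^sup>+a. \<integral>\<^sup>+b. f (a + k * b) b \<partial>lborel \<partial>lborel) = (\<integral>\<^sup>+a. \<integral>\<^sup>+b. f a b \<partial>lborel \<partial>lborel)"
proof -
  have "(\<integral>\<^sup>+a. \<integral>\<^sup>+b. f (a + k * b) b \<partial>lborel \<partial>lborel) = (\<integral>\<^sup>+b. \<integral>\<^sup>+a. f (a + k * b) b \<partial>lborel \<partial>lborel)"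
    by (rule nn_integral_lborel_swap) measurable
  also have "\<dots> = (\<integral>\<^sup>+b. \<integral>\<^sup>+a. f a b \<partial>lborel \<partial>lborel)"
    by (intro nn_integral_cong nn_integral_lborel_shift) measurable
  also have "\<dots> = (\<integral>\<^sup>+a. \<integral>\<^sup>+b. f a b \<partial>lborel \<partial>lborel)"
    by (rule nn_integral_lborel_swap[symmetric]) measurable
  finally show ?thesis .
qed

text \<open>A plane rotation is a product of three shears.\<close>

lemma nn_integral_lborel_rotate:
  fixes f :: "real \<Rightarrow> real \<Rightarrow> ennreal"
  assumes [measurable]: "case_prod f \<in> borel_measurable (borel \<Otimes>\<^sub>M borel)"
    and cs: "c\<^sup>2 + s\<^sup>2 = 1" and s: "s \<noteq> 0"
  shows "(\<integral>\<^sup>+a. \<integral>\<^sup>+b. f (c * a + s * b) (- s * a + c * b) \<partial>lborel \<partial>lborel)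
       = (\<integral>\<^sup>+a. \<integral>\<^sup>+b. f a b \<partial>lborel \<partial>lborel)"
proof -
  define k where "k = (c - 1) / s"
  have ks: "1 + k * s = c" using s by (simp add: k_def)
  have "(1 + c) * (c - 1) = - (s * s)" using cs by (simp add: power2_eq_square algebra_simps)
  then have kc: "k * (1 + c) = - s" using s by (simp add: k_def field_simps)
  have eq: "f (c * a + s * b) (- s * a + c * b)
      = f (a + s * (b + k * a)) ((b + k * a) + k * (a + s * (b + k * a)))" for a b
  proof -
    have 1: "a + s * (b + k * a) = (1 + k * s) * a + s * b" by (simp add: algebra_simps)
    have "(b + k * a) + k * ((1 + k * s) * a + s * b) = k * (1 + (1 + k * s)) * a + (1 + k * s) * b"
      by (simp add: algebra_simps)
    then show ?thesis unfolding 1 ks by (simp only: kc)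
  qed
  have "(\<integral>\<^sup>+a. \<integral>\<^sup>+b. f (c * a + s * b) (- s * a + c * b) \<partial>lborel \<partial>lborel)
     = (\<integral>\<^sup>+a. \<integral>\<^sup>+b. f (a + s * (b + k * a)) ((b + k * a) + k * (a + s * (b + k * a))) \<partial>lborel \<partial>lborel)"
    by (simp only: eq)
  also have "\<dots> = (\<integral>\<^sup>+a. \<integral>\<^sup>+b. f (a + s * b) (b + k * (a + s * b)) \<partial>lborel \<partial>lborel)"
    by (rule nn_integral_lborel_shear_snd) measurable
  also have "\<dots> = (\<integral>\<^sup>+a. \<integral>\<^sup>+b. f a (b + k * a) \<partial>lborel \<partial>lborel)"
    by (rule nn_integral_lborel_shear_fst) measurable
  also have "\<dots> = (\<integral>\<^sup>+a. \<integral>\<^sup>+b. f a b \<partial>lborel \<partial>lborel)"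
    by (rule nn_integral_lborel_shear_snd) measurable
  finally show ?thesis .
qed

text \<open>The map t + \<alpha> sqrt (t^2 + q^2) has derivative at least 1 - \<alpha>, because |t|
  is at most sqrt (t^2 + q^2). With q the norm of the remaining coordinates this is the density cost
  of moving a vector along one axis by \<alpha> times its norm.\<close>

lemma nn_integral_lborel_stretch:
  fixes f :: "real \<Rightarrow> ennreal"
  assumes [measurable]: "f \<in> borel_measurable borel" and \<alpha>: "0 \<le> \<alpha>" "\<alpha> < 1"
  shows "(\<integral>\<^sup>+t. f (t + \<alpha> * sqrt (t\<^sup>2 + q\<^sup>2)) \<partial>lborel) \<le> ennreal (1 / (1 - \<alpha>)) * (\<integral>\<^sup>+t. f t \<partial>lborel)"
proof (cases "q = 0")
  \<comment> \<open>For q = 0 the map has a kink at 0 and is linear on both half-lines, with slopes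
    1 + \<alpha> and 1 - \<alpha>; f is split accordingly.\<close>
  case True
  have sq: "sqrt (t\<^sup>2 + q\<^sup>2) = \<bar>t\<bar>" for t using True by simp
  define g where "g = (\<lambda>t. f t * indicator {0..} t)"
  define h where "h = (\<lambda>t. f t * indicator {..<0} t)"
  have [measurable]: "g \<in> borel_measurable borel" "h \<in> borel_measurable borel"
    unfolding g_def h_def by measurable
  have fgh: "f t = g t + h t" for t by (auto simp: g_def h_def indicator_def)
  have scale: "(\<integral>\<^sup>+t. F (k * t) \<partial>lborel) \<le> ennreal (1 / (1 - \<alpha>)) * (\<integral>\<^sup>+t. F t \<partial>lborel)"
    if "1 - \<alpha> \<le> k" and [measurable]: "F \<in> borel_measurable borel" for k :: real and F :: "real \<Rightarrow> ennreal"
  proof -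
    have k: "k > 0" using that \<alpha> by simp
    have "ennreal (1/k) * (\<integral>\<^sup>+t. F t \<partial>lborel) = ennreal (1/k) * (ennreal k * (\<integral>\<^sup>+t. F (k * t) \<partial>lborel))"
      using nn_integral_real_affine[of F k 0] k by simp
    also have "\<dots> = (\<integral>\<^sup>+t. F (k * t) \<partial>lborel)"
      using k by (simp add: mult.assoc[symmetric] ennreal_mult''[symmetric])
    finally have "(\<integral>\<^sup>+t. F (k * t) \<partial>lborel) = ennreal (1/k) * (\<integral>\<^sup>+t. F t \<partial>lborel)" by simp
    also have "\<dots> \<le> ennreal (1 / (1 - \<alpha>)) * (\<integral>\<^sup>+t. F t \<partial>lborel)"
      using that \<alpha> by (intro mult_right_mono ennreal_leI) (auto intro!: divide_left_mono)
    finally show ?thesis .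
  qed
  have "(\<integral>\<^sup>+t. f (t + \<alpha> * sqrt (t\<^sup>2 + q\<^sup>2)) \<partial>lborel) \<le> (\<integral>\<^sup>+t. g ((1 + \<alpha>) * t) + h ((1 - \<alpha>) * t) \<partial>lborel)"
  proof (intro nn_integral_mono)
    fix t :: real
    show "f (t + \<alpha> * sqrt (t\<^sup>2 + q\<^sup>2)) \<le> g ((1 + \<alpha>) * t) + h ((1 - \<alpha>) * t)"
    proof (cases "t \<ge> 0")
      case True
      then have "(1 + \<alpha>) * t \<ge> 0" using \<alpha> by simp
      then show ?thesis using True unfolding sq by (simp add: g_def algebra_simps)
    next
      case False
      then have "(1 - \<alpha>) * t < 0" using \<alpha> by (simp add: mult_pos_neg)
      then show ?thesis using False unfolding sq by (simp add: h_def algebra_simps)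
    qed
  qed
  also have "\<dots> = (\<integral>\<^sup>+t. g ((1 + \<alpha>) * t) \<partial>lborel) + (\<integral>\<^sup>+t. h ((1 - \<alpha>) * t) \<partial>lborel)"
    by (rule nn_integral_add) measurable
  also have "\<dots> \<le> ennreal (1 / (1 - \<alpha>)) * (\<integral>\<^sup>+t. g t \<partial>lborel) + ennreal (1 / (1 - \<alpha>)) * (\<integral>\<^sup>+t. h t \<partial>lborel)"
    using \<alpha> by (intro add_mono scale) auto
  also have "\<dots> = ennreal (1 / (1 - \<alpha>)) * (\<integral>\<^sup>+t. f t \<partial>lborel)"
    unfolding fgh by (subst nn_integral_add) (auto simp: distrib_left)
  finally show ?thesis .
next
  case False
  then have q: "q\<^sup>2 > 0" by simp
  define \<phi> where "\<phi> t = t + \<alpha> * sqrt (t\<^sup>2 + q\<^sup>2)" for t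
  define \<phi>' where "\<phi>' t = 1 + \<alpha> * (t / sqrt (t\<^sup>2 + q\<^sup>2))" for t
  have pos: "t\<^sup>2 + q\<^sup>2 > 0" for t using q by (simp add: add_nonneg_pos)
  have [measurable]: "\<phi> \<in> borel_measurable borel" unfolding \<phi>_def by measurable
  have der: "(\<phi> has_real_derivative \<phi>' t) (at t)" for t
    unfolding \<phi>_def \<phi>'_def using pos[of t]
    by (auto intro!: derivative_eq_intros simp: field_simps)
  have lower: "\<phi>' t \<ge> 1 - \<alpha>" for t
  proof -
    have "\<bar>t\<bar> \<le> sqrt (t\<^sup>2 + q\<^sup>2)" by (metis le_add_same_cancel1 real_sqrt_abs real_sqrt_le_mono zero_le_power2)
    then have "- 1 \<le> t / sqrt (t\<^sup>2 + q\<^sup>2)"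
      using pos[of t] by (simp add: field_simps abs_le_iff)
    then have "\<alpha> * (- 1) \<le> \<alpha> * (t / sqrt (t\<^sup>2 + q\<^sup>2))" using \<alpha> by (intro mult_left_mono) auto
    then show ?thesis unfolding \<phi>'_def by simp
  qed
  \<comment> \<open>The substitution rule works on compact intervals. The bound is uniform in n, so
    monotone convergence gives the whole line.\<close>
  have bound: "(\<integral>\<^sup>+t. f (\<phi> t) * indicator {- real (Suc n)..real (Suc n)} t \<partial>lborel) \<le> ennreal (1 / (1 - \<alpha>)) * (\<integral>\<^sup>+t. f t \<partial>lborel)" for n
  proof -
    have "(\<integral>\<^sup>+t. f (\<phi> t) * indicator {- real (Suc n)..real (Suc n)} t \<partial>lborel)
        \<le> (\<integral>\<^sup>+t. ennreal (1 / (1 - \<alpha>)) * (f (\<phi> t) * \<phi>' t * indicator {- real (Suc n)..real (Suc n)} t) \<partial>lborel)"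
    proof (intro nn_integral_mono)
      fix t
      have "1 = ennreal (1 / (1 - \<alpha>)) * ennreal (1 - \<alpha>)"
        using \<alpha> by (subst ennreal_mult[symmetric]) auto
      also have "\<dots> \<le> ennreal (1 / (1 - \<alpha>)) * ennreal (\<phi>' t)"
        by (intro mult_left_mono ennreal_leI lower) auto
      finally have "f (\<phi> t) * indicator {- real (Suc n)..real (Suc n)} t * 1 \<le> f (\<phi> t) * indicator {- real (Suc n)..real (Suc n)} t * (ennreal (1 / (1 - \<alpha>)) * ennreal (\<phi>' t))"
        by (intro mult_left_mono) auto
      then show "f (\<phi> t) * indicator {- real (Suc n)..real (Suc n)} t \<le> ennreal (1 / (1 - \<alpha>)) * (f (\<phi> t) * \<phi>' t * indicator {- real (Suc n)..real (Suc n)} t)"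
        by (simp add: mult_ac)
    qed
    also have "\<dots> = ennreal (1 / (1 - \<alpha>)) * (\<integral>\<^sup>+t. f (\<phi> t) * \<phi>' t * indicator {- real (Suc n)..real (Suc n)} t \<partial>lborel)"
      unfolding \<phi>'_def by (rule nn_integral_cmult) measurable
    also have "(\<integral>\<^sup>+t. f (\<phi> t) * \<phi>' t * indicator {- real (Suc n)..real (Suc n)} t \<partial>lborel)
       = (\<integral>\<^sup>+t. f t * indicator {\<phi> (- real (Suc n))..\<phi> (real (Suc n))} t \<partial>lborel)"
    proof (rule nn_integral_substitution_aux[symmetric])
      show "continuous_on {- real (Suc n)..real (Suc n)} \<phi>'"
        unfolding \<phi>'_def using pos
        by (intro continuous_intros) (auto simp: less_imp_neq[symmetric] sum_power2_eq_zero_iff False q) 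
      show "\<phi>' x \<ge> 0" for x using lower[of x] \<alpha> by simp
    qed (use der in auto)
    also have "\<dots> \<le> (\<integral>\<^sup>+t. f t \<partial>lborel)"
      by (intro nn_integral_mono) (auto split: split_indicator)
    finally show ?thesis by (simp add: mult_left_mono)
  qed
  have "(\<integral>\<^sup>+t. f (\<phi> t) \<partial>lborel) = (\<integral>\<^sup>+t. (SUP n. f (\<phi> t) * indicator {- real (Suc n)..real (Suc n)} t) \<partial>lborel)"
  proof (intro nn_integral_cong)
    fix t
    obtain n where "\<bar>t\<bar> \<le> real n" using real_arch_simple by blast
    then have n: "\<bar>t\<bar> \<le> real (Suc n)" by simp
    show "f (\<phi> t) = (SUP n. f (\<phi> t) * indicator {- real (Suc n)..real (Suc n)} t)"
    proof (rule antisym)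
      show "f (\<phi> t) \<le> (SUP n. f (\<phi> t) * indicator {- real (Suc n)..real (Suc n)} t)"
        by (rule SUP_upper2[of n]) (use n in \<open>auto simp: indicator_def abs_le_iff\<close>)
      show "(SUP n. f (\<phi> t) * indicator {- real (Suc n)..real (Suc n)} t) \<le> f (\<phi> t)"
        by (rule SUP_least) (auto split: split_indicator)
    qed
  qed
  also have "\<dots> = (SUP n. \<integral>\<^sup>+t. f (\<phi> t) * indicator {- real (Suc n)..real (Suc n)} t \<partial>lborel)"
    by (rule nn_integral_monotone_convergence_SUP)
       (auto simp: incseq_def le_fun_def split: split_indicator)
  also have "\<dots> \<le> ennreal (1 / (1 - \<alpha>)) * (\<integral>\<^sup>+t. f t \<partial>lborel)"
    by (rule SUP_least) (rule bound)
  finally show ?thesis unfolding \<phi>_def .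
qed

section \<open>Lebesgue measure on finite products\<close>

abbreviation leb_PiM :: "nat set \<Rightarrow> (nat \<Rightarrow> real) measure" where
  "leb_PiM I \<equiv> PiM I (\<lambda>_. lborel)"

interpretation lb: product_sigma_finite "\<lambda>_::nat. lborel :: real measure" ..

lemma measurable_leb_PiM_iff: "measurable (leb_PiM I) M = measurable (PiM I (\<lambda>_. borel)) M"
  by (intro measurable_cong_sets sets_PiM_cong) auto

lemma nn_integral_leb_PiM_scale:
  fixes c :: real
  assumes I: "finite I" and c: "c > 0" and f: "f \<in> borel_measurable (leb_PiM I)"
  shows "(\<integral>\<^sup>+x. f x \<partial>leb_PiM I) = ennreal (c ^ card I) * (\<integral>\<^sup>+x. f (\<lambda>i\<in>I. c * x i) \<partial>leb_PiM I)"
  using I f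
proof (induction I arbitrary: f)
  case empty
  then show ?case by (simp add: lb.nn_integral_empty restrict_def space_PiM_empty)
next
  case (insert k I)
  note [measurable] = insert.prems
  have m1[measurable]: "(\<lambda>(x, y). f (x(k := y))) \<in> borel_measurable (leb_PiM I \<Otimes>\<^sub>M lborel)"
    by measurable
  have m2[measurable]: "(\<lambda>x. \<integral>\<^sup>+y. f (x(k := y)) \<partial>lborel) \<in> borel_measurable (leb_PiM I)"
    by measurable
  have "(\<integral>\<^sup>+x. f x \<partial>leb_PiM (insert k I)) = (\<integral>\<^sup>+x. \<integral>\<^sup>+y. f (x(k := y)) \<partial>lborel \<partial>leb_PiM I)"
    using insert by (intro lb.product_nn_integral_insert) auto
  also have "\<dots> = ennreal (c ^ card I) * (\<integral>\<^sup>+x. \<integral>\<^sup>+y. f ((\<lambda>i\<in>I. c * x i)(k := y)) \<partial>lborel \<partial>leb_PiM I)"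
    by (rule insert.IH) (rule m2)
  also have "(\<integral>\<^sup>+x. \<integral>\<^sup>+y. f ((\<lambda>i\<in>I. c * x i)(k := y)) \<partial>lborel \<partial>leb_PiM I)
    = (\<integral>\<^sup>+x. ennreal c * \<integral>\<^sup>+y. f ((\<lambda>i\<in>I. c * x i)(k := c * y)) \<partial>lborel \<partial>leb_PiM I)"
  proof (intro nn_integral_cong)
    fix x
    have "(\<lambda>i\<in>I. c * x i) \<in> space (leb_PiM I)" by (simp add: space_PiM)
    then have "(\<lambda>y. f ((\<lambda>i\<in>I. c * x i)(k := y))) \<in> borel_measurable borel"
      using measurable_Pair2[OF m1] by simp
    from nn_integral_real_affine[OF this, of c 0] c
    show "(\<integral>\<^sup>+y. f ((\<lambda>i\<in>I. c * x i)(k := y)) \<partial>lborel) = ennreal c * \<integral>\<^sup>+y. f ((\<lambda>i\<in>I. c * x i)(k := c * y)) \<partial>lborel"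
      by simp
  qed
  also have "\<dots> = ennreal c * (\<integral>\<^sup>+x. \<integral>\<^sup>+y. f ((\<lambda>i\<in>I. c * x i)(k := c * y)) \<partial>lborel \<partial>leb_PiM I)"
    by (rule nn_integral_cmult) measurable
  also have "(\<integral>\<^sup>+x. \<integral>\<^sup>+y. f ((\<lambda>i\<in>I. c * x i)(k := c * y)) \<partial>lborel \<partial>leb_PiM I)
     = (\<integral>\<^sup>+x. \<integral>\<^sup>+y. f (\<lambda>i\<in>insert k I. c * (x(k := y)) i) \<partial>lborel \<partial>leb_PiM I)"
    using insert.hyps by (intro nn_integral_cong arg_cong[where f=f]) (auto simp: fun_eq_iff)
  also have "\<dots> = (\<integral>\<^sup>+x. f (\<lambda>i\<in>insert k I. c * x i) \<partial>leb_PiM (insert k I))"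
    using insert by (intro lb.product_nn_integral_insert[symmetric]) auto
  finally have "(\<integral>\<^sup>+x. f x \<partial>leb_PiM (insert k I))
    = ennreal (c ^ card I) * (ennreal c * (\<integral>\<^sup>+x. f (\<lambda>i\<in>insert k I. c * x i) \<partial>leb_PiM (insert k I)))" .
  moreover have "ennreal (c ^ card (insert k I)) = ennreal (c ^ card I) * ennreal c"
    using insert.hyps c by (simp add: ennreal_mult' mult.commute)
  ultimately show ?case by (simp only: mult.assoc)
qed

lemma nn_integral_leb_PiM_rotate:
  fixes c s :: real
  assumes I: "finite I" "i \<in> I" "j \<in> I" "i \<noteq> j" and f[measurable]: "f \<in> borel_measurable (leb_PiM I)"
    and cs: "c\<^sup>2 + s\<^sup>2 = 1" "s \<noteq> 0"
  shows "(\<integral>\<^sup>+x. f (x(i := c * x i + s * x j, j := - s * x i + c * x j)) \<partial>leb_PiM I) = (\<integral>\<^sup>+x. f x \<partial>leb_PiM I)"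
proof -
  define K where "K = I - {i, j}"
  have K: "I = insert i (insert j K)" "finite K" "i \<notin> K" "j \<notin> K" "i \<notin> insert j K" "finite (insert j K)"
    using I by (auto simp: K_def)
  have split: "(\<integral>\<^sup>+x. g x \<partial>leb_PiM I) = (\<integral>\<^sup>+x. \<integral>\<^sup>+b. \<integral>\<^sup>+a. g (x(j := b, i := a)) \<partial>lborel \<partial>lborel \<partial>leb_PiM K)"
    if g[measurable]: "g \<in> borel_measurable (leb_PiM I)" for g
  proof -
    have [measurable]: "g \<in> borel_measurable (leb_PiM (insert i (insert j K)))" using g K(1) by simp
    have "(\<integral>\<^sup>+x. g x \<partial>leb_PiM I) = (\<integral>\<^sup>+x. \<integral>\<^sup>+a. g (x(i := a)) \<partial>lborel \<partial>leb_PiM (insert j K))"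
      unfolding K(1) by (rule lb.product_nn_integral_insert[OF K(6,5)]) fact
    also have "\<dots> = (\<integral>\<^sup>+x. \<integral>\<^sup>+b. \<integral>\<^sup>+a. g (x(j := b, i := a)) \<partial>lborel \<partial>lborel \<partial>leb_PiM K)"
      by (rule lb.product_nn_integral_insert[OF K(2,4)]) measurable
    finally show ?thesis .
  qed
  have f'[measurable]: "f \<in> borel_measurable (leb_PiM (insert i (insert j K)))" using f K(1) by simp
  let ?R = "\<lambda>x. x(i := c * x i + s * x j, j := - s * x i + c * x j)"
  have "?R \<in> measurable (leb_PiM I) (leb_PiM I)"
    using I(2,3) by (intro measurable_fun_upd[where J=I]) auto
  from measurable_compose[OF this f]
  have R: "(\<lambda>x. f (?R x)) \<in> borel_measurable (leb_PiM I)" .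
  have "(\<integral>\<^sup>+x. f (?R x) \<partial>leb_PiM I) = (\<integral>\<^sup>+x. \<integral>\<^sup>+b. \<integral>\<^sup>+a. f (x(j := - s * a + c * b, i := c * a + s * b)) \<partial>lborel \<partial>lborel \<partial>leb_PiM K)"
    by (subst split[OF R]) (use I(4) in \<open>simp add: fun_upd_twist fun_upd_upd\<close>)
  also have "\<dots> = (\<integral>\<^sup>+x. \<integral>\<^sup>+b. \<integral>\<^sup>+a. f (x(j := b, i := a)) \<partial>lborel \<partial>lborel \<partial>leb_PiM K)"
  proof (rule nn_integral_cong)
    fix x assume "x \<in> space (leb_PiM K)"
    then have [measurable]: "(\<lambda>(a, b). f (x(j := b, i := a))) \<in> borel_measurable (borel \<Otimes>\<^sub>M borel)"
      by measurable
    have "(\<integral>\<^sup>+b. \<integral>\<^sup>+a. f (x(j := - s * a + c * b, i := c * a + s * b)) \<partial>lborel \<partial>lborel)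
       = (\<integral>\<^sup>+a. \<integral>\<^sup>+b. f (x(j := - s * a + c * b, i := c * a + s * b)) \<partial>lborel \<partial>lborel)"
      by (rule nn_integral_lborel_swap) (use \<open>x \<in> space (leb_PiM K)\<close> in measurable)
    also have "\<dots> = (\<integral>\<^sup>+a. \<integral>\<^sup>+b. f (x(j := b, i := a)) \<partial>lborel \<partial>lborel)"
      by (rule nn_integral_lborel_rotate[where f="\<lambda>a b. f (x(j := b, i := a))", OF _ cs]) measurable
    also have "\<dots> = (\<integral>\<^sup>+b. \<integral>\<^sup>+a. f (x(j := b, i := a)) \<partial>lborel \<partial>lborel)"
      by (rule nn_integral_lborel_swap) measurable
    finally show "(\<integral>\<^sup>+b. \<integral>\<^sup>+a. f (x(j := - s * a + c * b, i := c * a + s * b)) \<partial>lborel \<partial>lborel) = \<dots>" .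
  qed
  also have "\<dots> = (\<integral>\<^sup>+x. f x \<partial>leb_PiM I)" by (rule split[symmetric]) measurable
  finally show ?thesis .
qed

text \<open>Fubini in coordinate k: with the other coordinates fixed, the norm is sqrt (y^2 + q^2)
  for a constant q, which is the one-dimensional stretch.\<close>

lemma nn_integral_leb_PiM_stretch:
  assumes I: "finite I" "k \<in> I" and f[measurable]: "f \<in> borel_measurable (leb_PiM I)"
    and \<alpha>: "0 \<le> \<alpha>" "\<alpha> < 1"
  shows "(\<integral>\<^sup>+x. f (x(k := x k + \<alpha> * L2_set x I)) \<partial>leb_PiM I) \<le> ennreal (1 / (1 - \<alpha>)) * (\<integral>\<^sup>+x. f x \<partial>leb_PiM I)"
proof -
  define K where "K = I - {k}"
  have K: "I = insert k K" "finite K" "k \<notin> K" using I by (auto simp: K_def)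
  have f'[measurable]: "f \<in> borel_measurable (leb_PiM (insert k K))" using f K(1) by simp
  have L: "L2_set (x(k := y)) I = sqrt (y\<^sup>2 + (L2_set x K)\<^sup>2)" for x y
  proof -
    have "L2_set (x(k := y)) I = sqrt (y\<^sup>2 + (\<Sum>i\<in>K. ((x(k := y)) i)\<^sup>2))"
      unfolding L2_set_def K(1) using K by (subst sum.insert) auto
    also have "(\<Sum>i\<in>K. ((x(k := y)) i)\<^sup>2) = (\<Sum>i\<in>K. (x i)\<^sup>2)"
      using K by (intro sum.cong) auto
    also have "\<dots> = (L2_set x K)\<^sup>2" by (simp add: L2_set_def sum_nonneg)
    finally show ?thesis .
  qed
  have [measurable]: "(\<lambda>x. x k) \<in> borel_measurable (leb_PiM I)" "(\<lambda>x. L2_set x I) \<in> borel_measurable (leb_PiM I)"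
    using I unfolding L2_set_def by measurable
  have "(\<lambda>x. x(k := x k + \<alpha> * L2_set x I)) \<in> measurable (leb_PiM I) (leb_PiM I)"
    using I(2) by (intro measurable_fun_upd[where J=I]) auto
  from measurable_compose[OF this f]
  have m: "(\<lambda>x. f (x(k := x k + \<alpha> * L2_set x I))) \<in> borel_measurable (leb_PiM I)" .
  have "(\<integral>\<^sup>+x. f (x(k := x k + \<alpha> * L2_set x I)) \<partial>leb_PiM I)
     = (\<integral>\<^sup>+x. \<integral>\<^sup>+y. f (x(k := y + \<alpha> * sqrt (y\<^sup>2 + (L2_set x K)\<^sup>2))) \<partial>lborel \<partial>leb_PiM K)"
    using lb.product_nn_integral_insert[OF K(2,3), of "\<lambda>x. f (x(k := x k + \<alpha> * L2_set x I))"] m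
    unfolding K(1)[symmetric] by (simp add: L)
  also have "\<dots> \<le> (\<integral>\<^sup>+x. ennreal (1 / (1 - \<alpha>)) * \<integral>\<^sup>+y. f (x(k := y)) \<partial>lborel \<partial>leb_PiM K)"
  proof (intro nn_integral_mono)
    fix x assume "x \<in> space (leb_PiM K)"
    then have "(\<lambda>y. f (x(k := y))) \<in> borel_measurable borel" by measurable
    from nn_integral_lborel_stretch[OF this \<alpha>]
    show "(\<integral>\<^sup>+y. f (x(k := y + \<alpha> * sqrt (y\<^sup>2 + (L2_set x K)\<^sup>2))) \<partial>lborel)
       \<le> ennreal (1 / (1 - \<alpha>)) * \<integral>\<^sup>+y. f (x(k := y)) \<partial>lborel" .
  qed
  also have "\<dots> = ennreal (1 / (1 - \<alpha>)) * (\<integral>\<^sup>+x. \<integral>\<^sup>+y. f (x(k := y)) \<partial>lborel \<partial>leb_PiM K)"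
    by (rule nn_integral_cmult) measurable
  also have "(\<integral>\<^sup>+x. \<integral>\<^sup>+y. f (x(k := y)) \<partial>lborel \<partial>leb_PiM K) = (\<integral>\<^sup>+x. f x \<partial>leb_PiM I)"
    unfolding K(1) by (rule lb.product_nn_integral_insert[OF K(2,3), symmetric]) measurable
  finally show ?thesis .
qed

section \<open>Overlaps, the sphere and reflections\<close>

abbreviation vec_borel :: "nat \<Rightarrow> (nat \<Rightarrow> real) measure" where
  "vec_borel N \<equiv> PiM {..<N} (\<lambda>_. borel)"

lemma overlap_commute: "overlap N x y = overlap N y x"
  by (simp add: overlap_def mult.commute)

lemma overlap_add_left: "overlap N (\<lambda>i. x i + y i) z = overlap N x z + overlap N y z"
  by (simp add: overlap_def distrib_right sum.distrib add_divide_distrib)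

lemma overlap_diff_left: "overlap N (\<lambda>i. x i - y i) z = overlap N x z - overlap N y z"
  by (simp add: overlap_def left_diff_distrib sum_subtractf diff_divide_distrib)

lemma overlap_scale_left: "overlap N (\<lambda>i. c * x i) z = c * overlap N x z"
  by (simp add: overlap_def sum_distrib_left mult.assoc)

lemma overlap_add_right: "overlap N z (\<lambda>i. x i + y i) = overlap N z x + overlap N z y"
  by (simp add: overlap_def distrib_left sum.distrib add_divide_distrib)

lemma overlap_diff_right: "overlap N z (\<lambda>i. x i - y i) = overlap N z x - overlap N z y"
  by (simp add: overlap_def right_diff_distrib sum_subtractf diff_divide_distrib)

lemma overlap_scale_right: "overlap N z (\<lambda>i. c * x i) = c * overlap N z x"
  by (simp add: overlap_def sum_distrib_left mult_ac)

lemmas overlap_linear = overlap_add_left overlap_diff_left overlap_scale_left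
  overlap_add_right overlap_diff_right overlap_scale_right

lemma overlap_restrict [simp]:
  "overlap N (restrict x {..<N}) y = overlap N x y" "overlap N y (restrict x {..<N}) = overlap N y x"
  by (simp_all add: overlap_def)

lemma L2_set_restrict [simp]: "L2_set (restrict x I) I = L2_set x I"
  by (simp add: L2_set_def)

lemma overlap_self: "overlap N x x = (L2_set x {..<N})\<^sup>2 / real N"
  by (simp add: overlap_def L2_set_def sum_nonneg power2_eq_square[symmetric])

lemma L2_set_overlap: "N \<ge> 1 \<Longrightarrow> L2_set x {..<N} = sqrt (real N) * sqrt (overlap N x x)"
  by (simp add: overlap_self real_sqrt_divide)

lemma abs_overlap_le: "\<bar>overlap N x y\<bar> \<le> L2_set x {..<N} * L2_set y {..<N} / real N"
proof -
  have "\<bar>\<Sum>i<N. x i * y i\<bar> \<le> (\<Sum>i<N. \<bar>x i\<bar> * \<bar>y i\<bar>)"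
    by (rule order_trans[OF sum_abs]) (simp add: abs_mult)
  also have "\<dots> \<le> L2_set x {..<N} * L2_set y {..<N}" by (rule L2_set_mult_ineq)
  finally show ?thesis by (simp add: overlap_def divide_right_mono)
qed

lemma sphere_N_iff: "N \<ge> 1 \<Longrightarrow> x \<in> sphere_N N \<longleftrightarrow> x \<in> {..<N} \<rightarrow>\<^sub>E UNIV \<and> overlap N x x = 1"
proof -
  assume N: "N \<ge> 1"
  have "L2_set x {..<N} = sqrt (real N) \<longleftrightarrow> (L2_set x {..<N})\<^sup>2 = real N"
  proof
    assume "(L2_set x {..<N})\<^sup>2 = real N"
    then have "sqrt (real N) = \<bar>L2_set x {..<N}\<bar>" by (metis real_sqrt_abs)
    then show "L2_set x {..<N} = sqrt (real N)" by simp
  qed simp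
  moreover have "a\<^sup>2 / real N = 1 \<longleftrightarrow> a\<^sup>2 = real N" for a :: real
    using N by (simp add: divide_eq_eq)
  ultimately show ?thesis unfolding sphere_N_def overlap_self by blast
qed

lemma sphere_N_L2: "x \<in> sphere_N N \<Longrightarrow> L2_set x {..<N} = sqrt (real N)"
  by (simp add: sphere_N_def)

lemma sphere_N_abs_overlap_le: "N \<ge> 1 \<Longrightarrow> x \<in> sphere_N N \<Longrightarrow> y \<in> sphere_N N \<Longrightarrow> \<bar>overlap N x y\<bar> \<le> 1"
  using abs_overlap_le[of N x y] by (simp add: sphere_N_L2)

lemma measurable_overlap [measurable (raw)]:
  assumes "\<And>i. i < N \<Longrightarrow> (\<lambda>w. f w i) \<in> borel_measurable M" "\<And>i. i < N \<Longrightarrow> (\<lambda>w. g w i) \<in> borel_measurable M"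
  shows "(\<lambda>w. overlap N (f w) (g w)) \<in> borel_measurable M"
  unfolding overlap_def using assms by measurable

lemma measurable_L2_set [measurable (raw)]:
  assumes "\<And>i. i \<in> I \<Longrightarrow> (\<lambda>w. f w i) \<in> borel_measurable M"
  shows "(\<lambda>w. L2_set (f w) I) \<in> borel_measurable M"
  unfolding L2_set_def using assms by measurable

text \<open>Radial projection to the sphere of radius sqrt N. Division by zero sends a null vector
  to 0, off the sphere, so results about landing on the sphere assume a nonzero norm.\<close>

definition vdir :: "nat \<Rightarrow> (nat \<Rightarrow> real) \<Rightarrow> nat \<Rightarrow> real" where
  "vdir N y = (\<lambda>i\<in>{..<N}. sqrt (real N) * y i / L2_set y {..<N})"

lemma measurable_vdir [measurable (raw)]:
  assumes "\<And>i. i < N \<Longrightarrow> (\<lambda>w. f w i) \<in> borel_measurable M"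
  shows "(\<lambda>w. vdir N (f w)) \<in> measurable M (vec_borel N)"
  unfolding vdir_def using assms by measurable

lemma overlap_vdir_left: "overlap N (vdir N x) y = sqrt (real N) / L2_set x {..<N} * overlap N x y"
proof -
  have "vdir N x = restrict (\<lambda>i. sqrt (real N) / L2_set x {..<N} * x i) {..<N}"
    by (simp add: vdir_def)
  then show ?thesis by (simp only: overlap_restrict overlap_scale_left)
qed

lemma overlap_vdir_right: "overlap N y (vdir N x) = sqrt (real N) / L2_set x {..<N} * overlap N y x"
  using overlap_vdir_left[of N x y] by (simp only: overlap_commute[of N y])

lemma vdir_in_sphere_N: "N \<ge> 1 \<Longrightarrow> L2_set y {..<N} \<noteq> 0 \<Longrightarrow> vdir N y \<in> sphere_N N"
proof -
  assume N: "N \<ge> 1" and L: "L2_set y {..<N} \<noteq> 0"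
  have "overlap N (vdir N y) (vdir N y) = (sqrt (real N) / L2_set y {..<N})\<^sup>2 * ((L2_set y {..<N})\<^sup>2 / real N)"
    unfolding overlap_vdir_left overlap_vdir_right overlap_self[symmetric] by (simp add: power2_eq_square)
  also have "\<dots> = 1" using N L by (simp add: power_divide)
  finally show ?thesis using N by (simp add: sphere_N_iff vdir_def)
qed

lemma vdir_scale: "c > 0 \<Longrightarrow> vdir N (\<lambda>i. c * y i) = vdir N y"
proof -
  assume c: "c > 0"
  then have "L2_set (\<lambda>i. c * y i) {..<N} = c * L2_set y {..<N}"
    by (simp add: L2_set_right_distrib)
  with c show ?thesis by (auto simp: vdir_def fun_eq_iff)
qed

lemma vdir_restrict [simp]: "vdir N (restrict y {..<N}) = vdir N y"
  by (auto simp: vdir_def fun_eq_iff)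

text \<open>Householder reflection along v. For a null v, division by zero turns it into the
  identity on the coordinates below N, so it is an isometry for every v.\<close>

definition reflection :: "nat \<Rightarrow> (nat \<Rightarrow> real) \<Rightarrow> (nat \<Rightarrow> real) \<Rightarrow> nat \<Rightarrow> real" where
  "reflection N v x = (\<lambda>i\<in>{..<N}. x i - 2 * overlap N v x / overlap N v v * v i)"

lemma overlap_reflection_left:
  "overlap N (reflection N v x) y = overlap N x y - 2 * overlap N v x / overlap N v v * overlap N v y"
  unfolding reflection_def overlap_restrict overlap_linear ..

lemma overlap_reflection_right:
  "overlap N y (reflection N v x) = overlap N y x - 2 * overlap N v x / overlap N v v * overlap N y v"
  unfolding reflection_def overlap_restrict overlap_linear ..

lemma overlap_reflection_swap: "overlap N (reflection N v x) y = overlap N x (reflection N v y)"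
  by (simp add: overlap_reflection_left overlap_reflection_right overlap_commute[of N x v])

lemma overlap_reflection: "overlap N (reflection N v x) (reflection N v y) = overlap N x y"
proof (cases "overlap N v v = 0")
  case True
  then show ?thesis by (simp add: overlap_reflection_left overlap_reflection_right)
next
  case False
  then show ?thesis
    by (simp add: overlap_reflection_left overlap_reflection_right overlap_commute[of N x v] overlap_commute[of N y v])
qed

lemma reflection_sphere_N: "N \<ge> 1 \<Longrightarrow> x \<in> sphere_N N \<Longrightarrow> reflection N v x \<in> sphere_N N"
  by (simp add: sphere_N_iff overlap_reflection) (simp add: reflection_def)

lemma measurable_reflection [measurable (raw)]:
  assumes "\<And>i. i < N \<Longrightarrow> (\<lambda>w. f w i) \<in> borel_measurable M"
  shows "(\<lambda>w. reflection N v (f w)) \<in> measurable M (vec_borel N)"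
  unfolding reflection_def using assms by measurable

text \<open>Links reflections to the invariance in \<open>sphere_haar\<close>, which speaks of
  matrices. The witness is the matrix I - 2 v v^T / |v|^2; for a null v the convention 2 / 0 = 0
  makes it the identity.\<close>

lemma reflection_conv_apply_entries:
  assumes "N \<ge> 1"
  shows "\<exists>Q. orthogonal_entries N Q \<and> (\<forall>x. apply_entries N Q x = reflection N v x)"
proof -
  define q where "q = (\<Sum>k<N. v k * v k)"
  define Q where "Q i j = (if i = j then 1 else 0) - 2 / q * v i * v j" for i j
  have ov: "overlap N v x / overlap N v v = (\<Sum>j<N. v j * x j) / q" for x
    using assms by (simp add: overlap_def q_def)
  have "apply_entries N Q x = reflection N v x" for x
  proof -
    have "(\<Sum>j<N. Q i j * x j) = x i - 2 * overlap N v x / overlap N v v * v i" if "i < N" for i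
    proof -
      have "(\<Sum>j<N. Q i j * x j) = (\<Sum>j<N. (if i = j then x j else 0) - 2 / q * v i * (v j * x j))"
        by (intro sum.cong) (auto simp: Q_def algebra_simps)
      also have "\<dots> = x i - 2 / q * v i * (\<Sum>j<N. v j * x j)"
        using that by (simp add: sum_subtractf sum_distrib_left)
      also have "2 / q * v i * (\<Sum>j<N. v j * x j) = 2 * (overlap N v x / overlap N v v) * v i"
        unfolding ov by simp
      finally show ?thesis by simp
    qed
    then show ?thesis by (auto simp: apply_entries_def reflection_def fun_eq_iff)
  qed
  moreover have "orthogonal_entries N Q"
    unfolding orthogonal_entries_def
  proof (intro allI impI)
    fix i j assume ij: "i < N" "j < N"
    have "(\<Sum>k<N. Q k i * Q k j) = (\<Sum>k<N. (if k = i then (if i = j then 1 else 0) else 0)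
        - 2 / q * v j * (if k = i then v k else 0) - 2 / q * v i * (if k = j then v k else 0)
        + (2 / q)\<^sup>2 * v i * v j * (v k * v k))"
      by (intro sum.cong) (auto simp: Q_def algebra_simps power2_eq_square)
    also have "\<dots> = (if i = j then 1 else 0) - 2 / q * v j * v i - 2 / q * v i * v j + (2 / q)\<^sup>2 * v i * v j * q"
      using ij unfolding sum.distrib sum_subtractf sum_distrib_left[symmetric] by (simp add: q_def)
    also have "\<dots> = (if i = j then 1 else 0)" by (cases "q = 0") (auto simp: power2_eq_square)
    finally show "(\<Sum>k<N. Q k i * Q k j) = (if i = j then 1 else 0)" .
  qed
  ultimately show ?thesis by blast
qed

text \<open>Points of equal norm are exchanged by the reflection along their difference. If their
  overlap is 1 they coincide, and the degenerate reflection fixes them.\<close>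

lemma reflection_swap:
  assumes "N \<ge> 1" "x \<in> sphere_N N" "y \<in> sphere_N N"
  shows "reflection N (\<lambda>i. x i - y i) x = y"
proof (cases "overlap N x y = 1")
  case True
  define v where "v = (\<lambda>i. x i - y i)"
  have "overlap N v v = 0"
    using assms True by (simp add: v_def overlap_linear sphere_N_iff overlap_commute)
  then have "L2_set v {..<N} = 0" using assms by (simp add: overlap_self)
  then have z: "v i = 0" if "i < N" for i using that by (simp add: L2_set_eq_0_iff)
  have "reflection N v x = y"
    using assms(2,3) z by (auto simp: reflection_def fun_eq_iff v_def sphere_N_def PiE_def extensional_def)
  then show ?thesis by (simp add: v_def)
next
  case False
  have "overlap N (\<lambda>i. x i - y i) x = 1 - overlap N x y"
       "overlap N (\<lambda>i. x i - y i) (\<lambda>i. x i - y i) = 2 * (1 - overlap N x y)"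
    using assms by (simp_all add: overlap_linear sphere_N_iff overlap_commute)
  with False show ?thesis using assms(2,3)
    by (auto simp: reflection_def fun_eq_iff sphere_N_def PiE_def extensional_def)
qed

section \<open>Consequences of orthogonal invariance\<close>

text \<open>N = 1 is excluded because the sphere then has two points: slices may carry mass, and
  there is no plane to rotate.\<close>

locale haar =
  fixes N :: nat and \<mu> :: "(nat \<Rightarrow> real) measure"
  assumes N2: "N \<ge> 2" and haar: "sphere_haar N \<mu>"
begin

lemma N1: "N \<ge> 1" using N2 by simp

lemma N_nonempty: "{..<N} \<noteq> {}"
proof -
  have "0 \<in> {..<N}" using N2 by simp
  then show ?thesis by blast
qed

sublocale prob_space \<mu> using haar by (simp add: sphere_haar_def)

lemma sets_haar: "sets \<mu> = sets (restrict_space (vec_borel N) (sphere_N N))"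
  using haar by (simp add: sphere_haar_def)

lemma space_haar: "space \<mu> = sphere_N N"
  using sets_eq_imp_space_eq[OF sets_haar] by (auto simp: space_restrict_space space_PiM sphere_N_def)

lemma sphere_N_sets: "sphere_N N \<in> sets (vec_borel N)"
proof -
  have "sphere_N N = {x \<in> space (vec_borel N). L2_set x {..<N} = sqrt (real N)}"
    by (simp add: sphere_N_def space_PiM)
  also have "\<dots> \<in> sets (vec_borel N)" by measurable
  finally show ?thesis .
qed

lemma measurable_haarI:
  assumes "f \<in> measurable M (vec_borel N)" "\<And>w. w \<in> space M \<Longrightarrow> f w \<in> sphere_N N"
  shows "f \<in> measurable M \<mu>"
proof -
  have "f \<in> measurable M (restrict_space (vec_borel N) (sphere_N N))"
    using assms by (intro measurable_restrict_space2) auto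
  then show ?thesis using measurable_cong_sets[OF refl sets_haar] by blast
qed

lemma measurable_haar_id [measurable]: "(\<lambda>x. x) \<in> measurable \<mu> (vec_borel N)"
proof -
  have "(\<lambda>x. x) \<in> measurable (restrict_space (vec_borel N) (sphere_N N)) (vec_borel N)"
    by (intro measurable_restrict_space1) simp
  then show ?thesis using measurable_cong_sets[OF sets_haar refl] by blast
qed

lemma measurable_haar: "f \<in> measurable (vec_borel N) M \<Longrightarrow> f \<in> measurable \<mu> M"
  using measurable_compose[OF measurable_haar_id] by blast

lemma reflection_invariant:
  fixes f :: "_ \<Rightarrow> ennreal"
  assumes [measurable]: "f \<in> borel_measurable \<mu>"
  shows "(\<integral>\<^sup>+\<sigma>. f (reflection N v \<sigma>) \<partial>\<mu>) = (\<integral>\<^sup>+\<sigma>. f \<sigma> \<partial>\<mu>)"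
proof -
  obtain Q where Q: "orthogonal_entries N Q" "apply_entries N Q = reflection N v"
    using reflection_conv_apply_entries[OF N1, of v] by blast
  have "distr \<mu> \<mu> (reflection N v) = \<mu>"
    using haar Q unfolding sphere_haar_def by metis
  moreover have "reflection N v \<in> measurable \<mu> \<mu>"
    by (rule measurable_haarI) (auto intro!: reflection_sphere_N[OF N1] simp: space_haar)
  ultimately show ?thesis using nn_integral_distr[of "reflection N v" \<mu> \<mu> f] by simp
qed

text \<open>The reflection that exchanges the two directions preserves the measure and is
  self-adjoint for \<open>overlap\<close>, so it can be moved from one argument to the
  other.\<close>

lemma overlap_integral_haar:
  fixes F :: "real \<Rightarrow> ennreal"
  assumes [measurable]: "F \<in> borel_measurable borel" and "\<tau> \<in> sphere_N N" "\<tau>' \<in> sphere_N N"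
  shows "(\<integral>\<^sup>+\<sigma>. F (overlap N \<sigma> \<tau>) \<partial>\<mu>) = (\<integral>\<^sup>+\<sigma>. F (overlap N \<sigma> \<tau>') \<partial>\<mu>)"
proof -
  let ?v = "\<lambda>i. \<tau> i - \<tau>' i"
  have "(\<integral>\<^sup>+\<sigma>. F (overlap N \<sigma> \<tau>) \<partial>\<mu>) = (\<integral>\<^sup>+\<sigma>. F (overlap N (reflection N ?v \<sigma>) \<tau>) \<partial>\<mu>)"
    by (rule reflection_invariant[symmetric]) measurable
  also have "\<dots> = (\<integral>\<^sup>+\<sigma>. F (overlap N \<sigma> \<tau>') \<partial>\<mu>)"
    using reflection_swap[OF N1 assms(2,3)] by (simp add: overlap_reflection_swap)
  finally show ?thesis .
qed

end

section \<open>Uniqueness of the invariant measure on the sphere\<close>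

text \<open>Lebesgue measure on the ball of radius sqrt N, projected radially and left unnormalised.
  It turns out to be a multiple of every measure satisfying \<open>sphere_haar N\<close>, and on it
  maps of the sphere can be computed by substitution in the ball.\<close>

definition cone_measure :: "nat \<Rightarrow> (nat \<Rightarrow> real) measure" where
  "cone_measure N = distr (density (leb_PiM {..<N}) (indicator {x. L2_set x {..<N} \<le> sqrt (real N)})) (vec_borel N) (vdir N)"

lemma sets_leb_PiM: "sets (leb_PiM I) = sets (PiM I (\<lambda>_. borel))"
  by (intro sets_PiM_cong) auto

lemma borel_measurable_leb_PiM: "f \<in> measurable (PiM I (\<lambda>_. borel)) M \<Longrightarrow> f \<in> measurable (leb_PiM I) M"
  by (simp add: measurable_leb_PiM_iff)

lemma leb_PiM_component [measurable]: "i \<in> I \<Longrightarrow> (\<lambda>x. x i) \<in> borel_measurable (leb_PiM I)"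
  by (rule borel_measurable_leb_PiM) simp

lemma L2_ball_indicator_measurable [measurable]:
  "(indicator {x. L2_set x {..<N} \<le> r} :: _ \<Rightarrow> ennreal) \<in> borel_measurable (leb_PiM {..<N})"
  by measurable

lemma nn_integral_cone_measure:
  assumes [measurable]: "f \<in> borel_measurable (vec_borel N)"
  shows "(\<integral>\<^sup>+\<sigma>. f \<sigma> \<partial>cone_measure N) = (\<integral>\<^sup>+x. indicator {x. L2_set x {..<N} \<le> sqrt (real N)} x * f (vdir N x) \<partial>leb_PiM {..<N})"
proof -
  have v[measurable]: "vdir N \<in> measurable (leb_PiM {..<N}) (vec_borel N)"
    by (rule measurable_vdir) simp
  have "(\<integral>\<^sup>+\<sigma>. f \<sigma> \<partial>cone_measure N) = (\<integral>\<^sup>+x. f (vdir N x) \<partial>density (leb_PiM {..<N}) (indicator {x. L2_set x {..<N} \<le> sqrt (real N)}))"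
    unfolding cone_measure_def by (rule nn_integral_distr) measurable
  also have "\<dots> = (\<integral>\<^sup>+x. indicator {x. L2_set x {..<N} \<le> sqrt (real N)} x * f (vdir N x) \<partial>leb_PiM {..<N})"
    by (rule nn_integral_density) measurable
  finally show ?thesis .
qed

lemma sets_cone_measure [simp, measurable_cong]: "sets (cone_measure N) = sets (vec_borel N)"
  by (simp add: cone_measure_def)

lemma leb_PiM_zero_null:
  assumes "finite I" "I \<noteq> {}" shows "AE x in leb_PiM I. L2_set x I \<noteq> 0"
proof (rule AE_I)
  have *: "{x \<in> space (leb_PiM I). \<not> L2_set x I \<noteq> 0} = (I \<rightarrow>\<^sub>E {0})"
    using assms by (auto simp: space_PiM L2_set_eq_0_iff PiE_def Pi_def extensional_def)
  show "{x \<in> space (leb_PiM I). \<not> L2_set x I \<noteq> 0} \<subseteq> (I \<rightarrow>\<^sub>E {0})"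
    unfolding * ..
  have "emeasure (leb_PiM I) (I \<rightarrow>\<^sub>E {0}) = (\<Prod>i\<in>I. emeasure lborel {0})"
    using lb.emeasure_PiM[of I "\<lambda>_. {0}"] assms by simp
  then show "emeasure (leb_PiM I) (I \<rightarrow>\<^sub>E {0}) = 0" using assms by (simp add: card_gt_0_iff)
  show "(I \<rightarrow>\<^sub>E {0}) \<in> sets (leb_PiM I)"
    using assms by (intro sets_PiM_I_finite) auto
qed

lemma cone_measure_finite: "emeasure (cone_measure N) (space (cone_measure N)) < top"
proof -
  have "emeasure (cone_measure N) (space (cone_measure N)) = (\<integral>\<^sup>+\<sigma>. 1 \<partial>cone_measure N)" by simp
  also have "\<dots> = (\<integral>\<^sup>+x. indicator {x. L2_set x {..<N} \<le> sqrt (real N)} x \<partial>leb_PiM {..<N})"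
    by (subst nn_integral_cone_measure) auto
  also have "\<dots> \<le> (\<integral>\<^sup>+x. indicator ({..<N} \<rightarrow>\<^sub>E {- sqrt (real N)..sqrt (real N)}) x \<partial>leb_PiM {..<N})"
  proof (rule nn_integral_mono)
    fix x assume x: "x \<in> space (leb_PiM {..<N})"
    have "\<bar>x i\<bar> \<le> sqrt (real N)" if "L2_set x {..<N} \<le> sqrt (real N)" "i < N" for i
      using member_le_L2_set[of "{..<N}" i x] that by (simp add: L2_set_def) 
         (metis (no_types, lifting) finite_lessThan lessThan_iff member_le_sum order_trans real_sqrt_abs real_sqrt_le_iff zero_le_power2)
    with x show "(indicator {x. L2_set x {..<N} \<le> sqrt (real N)} x :: ennreal)
        \<le> indicator ({..<N} \<rightarrow>\<^sub>E {- sqrt (real N)..sqrt (real N)}) x"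
      by (auto simp: space_PiM split: split_indicator) (force simp: abs_le_iff)+
  qed
  also have "\<dots> = emeasure (leb_PiM {..<N}) ({..<N} \<rightarrow>\<^sub>E {- sqrt (real N)..sqrt (real N)})"
    by (rule nn_integral_indicator) (rule sets_PiM_I_finite, auto)
  also have "\<dots> = (\<Prod>i<N. emeasure lborel {- sqrt (real N)..sqrt (real N)})"
    by (rule lb.emeasure_PiM) auto
  also have "\<dots> < top"
    by (simp add: ennreal_power less_top[symmetric])
  finally show ?thesis .
qed

lemma sum_fun_upd2:
  fixes x y :: "nat \<Rightarrow> real"
  assumes "finite I" "i \<in> I" "j \<in> I" "i \<noteq> j"
  shows "(\<Sum>k\<in>I. (x(i := a, j := b)) k * (y(i := a', j := b')) k)
    = (\<Sum>k\<in>I. x k * y k) + (a * a' - x i * y i) + (b * b' - x j * y j)"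
proof -
  have "(\<Sum>k\<in>I. (x(i := a, j := b)) k * (y(i := a', j := b')) k)
    = (\<Sum>k\<in>I. x k * y k + (if k = i then a * a' - x i * y i else 0) + (if k = j then b * b' - x j * y j else 0))"
    using assms by (intro sum.cong) auto
  also have "\<dots> = (\<Sum>k\<in>I. x k * y k) + (a * a' - x i * y i) + (b * b' - x j * y j)"
    using assms by (simp add: sum.distrib)
  finally show ?thesis .
qed

definition givens :: "nat \<Rightarrow> nat \<Rightarrow> real \<Rightarrow> real \<Rightarrow> (nat \<Rightarrow> real) \<Rightarrow> nat \<Rightarrow> real" where
  "givens i j c s x = x(i := c * x i + s * x j, j := - s * x i + c * x j)"

lemma overlap_givens:
  assumes "i < N" "j < N" "i \<noteq> j" "c\<^sup>2 + s\<^sup>2 = 1"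
  shows "overlap N (givens i j c s x) (givens i j c s y) = overlap N x y"
proof -
  have "(c * x i + s * x j) * (c * y i + s * y j) - x i * y i + ((- s * x i + c * x j) * (- s * y i + c * y j) - x j * y j)
     = (c\<^sup>2 + s\<^sup>2 - 1) * (x i * y i) + (c\<^sup>2 + s\<^sup>2 - 1) * (x j * y j)"
    by (simp add: algebra_simps power2_eq_square)
  then show ?thesis
    using assms unfolding overlap_def givens_def by (subst sum_fun_upd2) (auto simp: algebra_simps)
qed

lemma L2_set_givens:
  assumes "i < N" "j < N" "i \<noteq> j" "c\<^sup>2 + s\<^sup>2 = 1"
  shows "L2_set (givens i j c s x) {..<N} = L2_set x {..<N}"
  using overlap_givens[OF assms, of x x] assms(1) by (simp add: L2_set_overlap)

text \<open>Rotating vector and direction together changes neither their overlap nor the ball. Plane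
  rotations take the place of reflections here, because they are what the shears provide for
  Lebesgue measure.\<close>

lemma overlap_integral_cone_givens:
  fixes F :: "real \<Rightarrow> ennreal"
  assumes [measurable]: "F \<in> borel_measurable borel" and ij: "i < N" "j < N" "i \<noteq> j" and cs: "c\<^sup>2 + s\<^sup>2 = 1" "s \<noteq> 0"
  shows "(\<integral>\<^sup>+\<sigma>. F (overlap N \<sigma> (givens i j c s \<tau>)) \<partial>cone_measure N) = (\<integral>\<^sup>+\<sigma>. F (overlap N \<sigma> \<tau>) \<partial>cone_measure N)"
proof -
  define H where "H \<tau> x = indicator {x. L2_set x {..<N} \<le> sqrt (real N)} x * F (overlap N (vdir N x) \<tau>)" for \<tau> x
  have [measurable]: "(\<lambda>x. F (overlap N x \<tau>)) \<in> borel_measurable (vec_borel N)" for \<tau> by measurable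
  have H: "(\<integral>\<^sup>+\<sigma>. F (overlap N \<sigma> \<tau>) \<partial>cone_measure N) = (\<integral>\<^sup>+x. H \<tau> x \<partial>leb_PiM {..<N})" for \<tau>
    unfolding H_def by (rule nn_integral_cone_measure) measurable
  have [measurable]: "H \<tau> \<in> borel_measurable (leb_PiM {..<N})" for \<tau>
    unfolding H_def overlap_vdir_left by measurable
  have "H (givens i j c s \<tau>) (givens i j c s x) = H \<tau> x" for x
    using ij cs(1) by (simp add: H_def overlap_vdir_left overlap_givens L2_set_givens indicator_def)
  moreover have "(\<integral>\<^sup>+x. H (givens i j c s \<tau>) (givens i j c s x) \<partial>leb_PiM {..<N}) = (\<integral>\<^sup>+x. H (givens i j c s \<tau>) x \<partial>leb_PiM {..<N})"
    unfolding givens_def using ij cs by (intro nn_integral_leb_PiM_rotate) auto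
  ultimately show ?thesis unfolding H by simp
qed

text \<open>Givens rotations in the planes \<open>(0, j)\<close> move every vector to a multiple of the first basis vector.\<close>

lemma overlap_integral_cone_axis:
  fixes F :: "real \<Rightarrow> ennreal"
  assumes [measurable]: "F \<in> borel_measurable borel" and N: "N \<ge> 2"
  shows "(\<integral>\<^sup>+\<sigma>. F (overlap N \<sigma> \<tau>) \<partial>cone_measure N)
    = (\<integral>\<^sup>+\<sigma>. F (overlap N \<sigma> (\<lambda>i. if i = 0 then L2_set \<tau> {..<N} else 0)) \<partial>cone_measure N)"
proof -
  define G where "G \<tau> = (\<integral>\<^sup>+\<sigma>. F (overlap N \<sigma> \<tau>) \<partial>cone_measure N)" for \<tau>
  have Gcong: "G \<tau> = G \<tau>'" if "\<And>i. i < N \<Longrightarrow> \<tau> i = \<tau>' i" for \<tau> \<tau>'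
    unfolding G_def overlap_def using that by simp
  have rot: "G (givens i j c s \<tau>) = G \<tau>" if "i < N" "j < N" "i \<noteq> j" "c\<^sup>2 + s\<^sup>2 = 1" "s \<noteq> 0" for i j c s \<tau>
    unfolding G_def using that by (intro overlap_integral_cone_givens) auto
  have L: "L2_set (givens i j c s \<tau>) {..<N} = L2_set \<tau> {..<N}" if "i < N" "j < N" "i \<noteq> j" "c\<^sup>2 + s\<^sup>2 = 1" for i j c s \<tau>
    using that by (rule L2_set_givens)
  have "(\<And>j. Suc k \<le> j \<Longrightarrow> j < N \<Longrightarrow> \<tau> j = 0) \<Longrightarrow> G \<tau> = G (\<lambda>i. if i = 0 then L2_set \<tau> {..<N} else 0)" if "Suc k \<le> N" for k \<tau>
    using that
  proof (induction k arbitrary: \<tau>)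
    case 0
    have L2: "L2_set \<tau> {..<N} = \<bar>\<tau> 0\<bar>"
    proof -
      have "(\<Sum>i<N. (\<tau> i)\<^sup>2) = (\<Sum>i\<in>{0}. (\<tau> i)\<^sup>2)"
        using 0 N by (intro sum.mono_neutral_right) auto
      then show ?thesis by (simp add: L2_set_def)
    qed
    show ?case
    proof (cases "\<tau> 0 \<ge> 0")
      case True
      then show ?thesis using 0 by (intro Gcong) (auto simp: L2)
    next
      case False
      \<comment> \<open>Two quarter turns in the plane (0, 1) negate both coordinates; coordinate 1
        is already 0, so only the sign of coordinate 0 changes.\<close>
      have "G \<tau> = G (givens 0 1 0 1 (givens 0 1 0 1 \<tau>))"
        using rot[of 0 1 0 1 "givens 0 1 0 1 \<tau>"] rot[of 0 1 0 1 \<tau>] N by simp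
      also have "\<dots> = G (\<lambda>i. if i = 0 then L2_set \<tau> {..<N} else 0)"
        using 0 N False by (intro Gcong) (auto simp: L2 givens_def)
      finally show ?thesis .
    qed
  next
    case (Suc k)
    show ?case
    proof (cases "\<tau> (Suc k) = 0")
      case True
      then have "\<tau> j = 0" if "Suc k \<le> j" "j < N" for j
        using that Suc.prems by (cases "j = Suc k") auto
      with Suc.prems show ?thesis by (intro Suc.IH) auto
    next
      case False
      define r where "r = sqrt ((\<tau> 0)\<^sup>2 + (\<tau> (Suc k))\<^sup>2)"
      have r: "r > 0" "r\<^sup>2 = (\<tau> 0)\<^sup>2 + (\<tau> (Suc k))\<^sup>2" using False by (auto simp: r_def add_nonneg_pos)
      define c s where "c = \<tau> 0 / r" and "s = \<tau> (Suc k) / r"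
      have cs: "c\<^sup>2 + s\<^sup>2 = 1" "s \<noteq> 0"
        using r False by (auto simp: c_def s_def power_divide add_divide_distrib[symmetric])
      have lt: "0 < N" "Suc k < N" using Suc.prems by auto
      let ?\<tau> = "givens 0 (Suc k) c s \<tau>"
      have "- s * \<tau> 0 + c * \<tau> (Suc k) = 0" by (simp add: c_def s_def)
      then have "?\<tau> j = 0" if "Suc k \<le> j" "j < N" for j
        using that Suc.prems(1)[of j] by (cases "j = Suc k") (auto simp: givens_def)
      then have "G ?\<tau> = G (\<lambda>i. if i = 0 then L2_set ?\<tau> {..<N} else 0)"
        using lt by (intro Suc.IH) auto
      moreover have "G ?\<tau> = G \<tau>" "L2_set ?\<tau> {..<N} = L2_set \<tau> {..<N}"
        using lt cs by (intro rot L; simp)+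
      ultimately show ?thesis by (simp only:)
    qed
  qed
  from this[of "N - 1" \<tau>] N have "G \<tau> = G (\<lambda>i. if i = 0 then L2_set \<tau> {..<N} else 0)" by fastforce
  then show ?thesis unfolding G_def .
qed

lemma overlap_integral_cone:
  fixes F :: "real \<Rightarrow> ennreal"
  assumes "F \<in> borel_measurable borel" "N \<ge> 2" "\<tau> \<in> sphere_N N" "\<tau>' \<in> sphere_N N"
  shows "(\<integral>\<^sup>+\<sigma>. F (overlap N \<sigma> \<tau>) \<partial>cone_measure N) = (\<integral>\<^sup>+\<sigma>. F (overlap N \<sigma> \<tau>') \<partial>cone_measure N)"
  unfolding overlap_integral_cone_axis[OF assms(1,2), of \<tau>] overlap_integral_cone_axis[OF assms(1,2), of \<tau>']
  using assms(3,4) by (simp only: sphere_N_L2)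

text \<open>The metric on functions is a sum over the coordinates with weights (1/2)^n, which add up
  to 2.\<close>

lemma dist_fun_le:
  fixes x y :: "nat \<Rightarrow> real"
  assumes "\<And>i. \<bar>x i - y i\<bar> \<le> D"
  shows "dist x y \<le> 2 * D"
proof -
  have "D \<ge> 0" using assms[of 0] by linarith
  have "dist x y = (\<Sum>n. (1/2)^n * min (dist (x (from_nat n)) (y (from_nat n))) 1)" unfolding dist_fun_def ..
  also have "\<dots> \<le> (\<Sum>n. (1/2)^n * D)"
  proof (rule suminf_le)
    show "(1/2)^n * min (dist (x (from_nat n)) (y (from_nat n))) 1 \<le> (1/2)^n * D" for n
      using assms[of "from_nat n"] by (intro mult_left_mono) (auto simp: dist_real_def)
    show "summable (\<lambda>n. (1/2)^n * min (dist (x (from_nat n)) (y (from_nat n))) 1)"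
      by (rule summable_comparison_test[of _ "\<lambda>n. (1/2)^n"]) (auto intro!: exI[of _ 0] mult_left_le summable_geometric)
    show "summable (\<lambda>n. (1/2)^n * D)" by (intro summable_mult2 summable_geometric) simp
  qed
  also have "\<dots> = 2 * D" by (subst suminf_mult2[symmetric]) (auto simp: suminf_geometric summable_geometric)
  finally show ?thesis .
qed

text \<open>Lets closeness in overlap control the metric of the function space. The coordinates from
  N on agree, being \<open>undefined\<close> in both points.\<close>

lemma sphere_N_dist_le:
  assumes "N \<ge> 1" "x \<in> sphere_N N" "y \<in> sphere_N N"
  shows "dist x y \<le> 2 * sqrt (2 * real N * (1 - overlap N x y))"
proof (rule dist_fun_le)
  fix i
  show "\<bar>x i - y i\<bar> \<le> sqrt (2 * real N * (1 - overlap N x y))"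
  proof (cases "i < N")
    case True
    have "overlap N (\<lambda>i. x i - y i) (\<lambda>i. x i - y i) = 2 * (1 - overlap N x y)"
      using assms by (simp add: overlap_linear sphere_N_iff overlap_commute[of N y x])
    moreover have "overlap N (\<lambda>i. x i - y i) (\<lambda>i. x i - y i) = (\<Sum>i<N. (x i - y i)\<^sup>2) / real N"
      by (simp add: overlap_def power2_eq_square)
    ultimately have "(\<Sum>i<N. (x i - y i)\<^sup>2) = 2 * real N * (1 - overlap N x y)"
      using assms(1) by (simp add: divide_eq_eq)
    moreover have "(x i - y i)\<^sup>2 \<le> (\<Sum>i<N. (x i - y i)\<^sup>2)"
      using True by (intro member_le_sum) auto
    ultimately show ?thesis by (metis real_sqrt_abs real_sqrt_le_iff)
  next
    case False
    then have "x i = y i" using assms(2,3) by (auto simp: sphere_N_def PiE_def extensional_def)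
    then show ?thesis using sphere_N_abs_overlap_le[OF assms] by simp
  qed
qed

lemma measurable_vec_borel_borel: "(\<lambda>x. x) \<in> measurable (vec_borel N) borel"
proof (rule measurable_coordinatewise_then_product)
  fix i :: nat
  show "(\<lambda>x. x i) \<in> borel_measurable (vec_borel N)"
  proof (cases "i < N")
    case False
    then have "x i = undefined" if "x \<in> space (vec_borel N)" for x :: "nat \<Rightarrow> real"
      using that by (auto simp: space_PiM PiE_def extensional_def)
    then show ?thesis by (subst measurable_cong[where g="\<lambda>_. undefined"]) auto
  qed simp
qed

context haar
begin

lemma cone_measure_AE_sphere: "AE \<sigma> in cone_measure N. \<sigma> \<in> sphere_N N"
  unfolding cone_measure_def
proof (subst AE_distr_iff)
  show "vdir N \<in> measurable (density (leb_PiM {..<N}) (indicator {x. L2_set x {..<N} \<le> sqrt (real N)})) (vec_borel N)"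
    by (rule measurable_vdir) (simp add: sets_leb_PiM[symmetric], measurable)
  show "{x \<in> space (vec_borel N). x \<in> sphere_N N} \<in> sets (vec_borel N)"
    using sphere_N_sets by (simp add: sets.sets_into_space Int_absorb1 Collect_conj_eq)
  show "AE x in density (leb_PiM {..<N}) (indicator {x. L2_set x {..<N} \<le> sqrt (real N)}). vdir N x \<in> sphere_N N"
    using leb_PiM_zero_null[OF finite_lessThan N_nonempty]
    by (subst AE_density, measurable) (auto elim!: eventually_mono intro: vdir_in_sphere_N N1)
qed

lemma finite_measure_cone: "finite_measure (cone_measure N)"
  using cone_measure_finite[of N] by (intro finite_measureI) auto

definition cone_total where "cone_total = emeasure (cone_measure N) (space (cone_measure N))"

text \<open>Integrating the cap kernel against both measures in either order compares them.\<close>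

lemma cap_kernel_comparison:
  assumes [measurable]: "f \<in> borel_measurable (vec_borel N)"
    and close: "\<And>\<sigma> \<tau>. \<sigma> \<in> sphere_N N \<Longrightarrow> \<tau> \<in> sphere_N N \<Longrightarrow> overlap N \<sigma> \<tau> > t \<Longrightarrow> f \<sigma> \<le> f \<tau> + ennreal e"
    and e: "e \<ge> 0" and u: "u \<in> sphere_N N"
  defines "a \<equiv> (\<integral>\<^sup>+\<sigma>. indicator {t<..} (overlap N \<sigma> u) \<partial>\<mu>)"
    and "b \<equiv> (\<integral>\<^sup>+\<sigma>. indicator {t<..} (overlap N \<sigma> u) \<partial>cone_measure N)"
  shows "b * (\<integral>\<^sup>+\<sigma>. f \<sigma> \<partial>\<mu>) \<le> a * (\<integral>\<^sup>+\<sigma>. f \<sigma> \<partial>cone_measure N) + ennreal e * a * cone_total"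
    and "a * (\<integral>\<^sup>+\<sigma>. f \<sigma> \<partial>cone_measure N) \<le> b * (\<integral>\<^sup>+\<sigma>. f \<sigma> \<partial>\<mu>) + ennreal e * b"
proof -
  define k :: "(nat \<Rightarrow> real) \<Rightarrow> (nat \<Rightarrow> real) \<Rightarrow> ennreal" where "k \<sigma> \<tau> = indicator {t<..} (overlap N \<sigma> \<tau>)" for \<sigma> \<tau>
  interpret C: finite_measure "cone_measure N" by (rule finite_measure_cone)
  interpret P: pair_sigma_finite \<mu> "cone_measure N" ..
  have c[measurable]: "i < N \<Longrightarrow> (\<lambda>x. x i) \<in> borel_measurable (cone_measure N)" for i
    by (simp add: measurable_cong_sets[OF sets_cone_measure refl])
  have [measurable]: "(\<lambda>(\<sigma>, \<tau>). k \<sigma> \<tau>) \<in> borel_measurable (\<mu> \<Otimes>\<^sub>M cone_measure N)"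
    unfolding k_def by measurable
  have f1[measurable]: "f \<in> borel_measurable \<mu>" by (rule measurable_haar) simp
  have f2[measurable]: "f \<in> borel_measurable (cone_measure N)"
    by (simp add: measurable_cong_sets[OF sets_cone_measure refl])
  have b: "(\<integral>\<^sup>+\<tau>. k \<sigma> \<tau> \<partial>cone_measure N) = b" if "\<sigma> \<in> sphere_N N" for \<sigma>
    unfolding b_def k_def overlap_commute[of N \<sigma>] using that u N2
    by (intro overlap_integral_cone) auto
  have a: "(\<integral>\<^sup>+\<sigma>. k \<sigma> \<tau> \<partial>\<mu>) = a" if "\<tau> \<in> sphere_N N" for \<tau>
    unfolding a_def k_def using that u by (intro overlap_integral_haar) auto
  have k: "k \<sigma> \<tau> * f \<sigma> \<le> k \<sigma> \<tau> * (f \<tau> + ennreal e)" "k \<sigma> \<tau> * f \<tau> \<le> k \<sigma> \<tau> * (f \<sigma> + ennreal e)"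
    if "\<sigma> \<in> sphere_N N" "\<tau> \<in> sphere_N N" for \<sigma> \<tau>
    using close[OF that] close[OF that(2,1)] by (auto simp: k_def overlap_commute[of N \<tau>] indicator_def)
  have 1: "(\<integral>\<^sup>+\<sigma>. \<integral>\<^sup>+\<tau>. k \<sigma> \<tau> * g \<sigma> \<partial>cone_measure N \<partial>\<mu>) = b * (\<integral>\<^sup>+\<sigma>. g \<sigma> \<partial>\<mu>)"
    if [measurable]: "g \<in> borel_measurable \<mu>" for g
  proof -
    have "(\<integral>\<^sup>+\<sigma>. \<integral>\<^sup>+\<tau>. k \<sigma> \<tau> * g \<sigma> \<partial>cone_measure N \<partial>\<mu>) = (\<integral>\<^sup>+\<sigma>. b * g \<sigma> \<partial>\<mu>)"
      by (intro nn_integral_cong) (auto simp: nn_integral_multc space_haar b)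
    then show ?thesis by (simp add: nn_integral_cmult)
  qed
  have 2: "(\<integral>\<^sup>+\<sigma>. \<integral>\<^sup>+\<tau>. k \<sigma> \<tau> * g \<tau> \<partial>cone_measure N \<partial>\<mu>) = a * (\<integral>\<^sup>+\<tau>. g \<tau> \<partial>cone_measure N)"
    if [measurable]: "g \<in> borel_measurable (cone_measure N)" for g
  proof -
    have "(\<integral>\<^sup>+\<sigma>. \<integral>\<^sup>+\<tau>. k \<sigma> \<tau> * g \<tau> \<partial>cone_measure N \<partial>\<mu>) = (\<integral>\<^sup>+\<tau>. \<integral>\<^sup>+\<sigma>. k \<sigma> \<tau> * g \<tau> \<partial>\<mu> \<partial>cone_measure N)"
      by (rule P.Fubini'[symmetric]) measurable
    also have "\<dots> = (\<integral>\<^sup>+\<tau>. a * g \<tau> \<partial>cone_measure N)"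
      using cone_measure_AE_sphere
      by (intro nn_integral_cong_AE) (auto elim!: eventually_mono simp: nn_integral_multc a)
    finally show ?thesis by (simp add: nn_integral_cmult)
  qed
  have sphere_AE: "(\<integral>\<^sup>+\<sigma>. \<integral>\<^sup>+\<tau>. g \<sigma> \<tau> \<partial>cone_measure N \<partial>\<mu>) \<le> (\<integral>\<^sup>+\<sigma>. \<integral>\<^sup>+\<tau>. h \<sigma> \<tau> \<partial>cone_measure N \<partial>\<mu>)"
    if "\<And>\<sigma> \<tau>. \<sigma> \<in> sphere_N N \<Longrightarrow> \<tau> \<in> sphere_N N \<Longrightarrow> g \<sigma> \<tau> \<le> h \<sigma> \<tau>" for g h :: "_ \<Rightarrow> _ \<Rightarrow> ennreal"
    using cone_measure_AE_sphere that
    by (intro nn_integral_mono nn_integral_mono_AE) (auto elim!: eventually_mono simp: space_haar)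
  have "b * (\<integral>\<^sup>+\<sigma>. f \<sigma> \<partial>\<mu>) \<le> a * (\<integral>\<^sup>+\<tau>. f \<tau> + ennreal e \<partial>cone_measure N)"
    unfolding 1[OF f1, symmetric] by (subst 2[symmetric], measurable) (intro sphere_AE k(1))
  also have "\<dots> = a * (\<integral>\<^sup>+\<sigma>. f \<sigma> \<partial>cone_measure N) + ennreal e * a * cone_total"
    by (subst nn_integral_add) (auto simp: cone_total_def distrib_left mult_ac)
  finally show "b * (\<integral>\<^sup>+\<sigma>. f \<sigma> \<partial>\<mu>) \<le> a * (\<integral>\<^sup>+\<sigma>. f \<sigma> \<partial>cone_measure N) + ennreal e * a * cone_total" .
  have "a * (\<integral>\<^sup>+\<sigma>. f \<sigma> \<partial>cone_measure N) \<le> b * (\<integral>\<^sup>+\<tau>. f \<tau> + ennreal e \<partial>\<mu>)"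
    unfolding 2[OF f2, symmetric] by (subst 1[symmetric], measurable) (intro sphere_AE k(2))
  also have "\<dots> = b * (\<integral>\<^sup>+\<sigma>. f \<sigma> \<partial>\<mu>) + ennreal e * b"
    by (subst nn_integral_add) (auto simp: distrib_left mult_ac emeasure_space_1)
  finally show "a * (\<integral>\<^sup>+\<sigma>. f \<sigma> \<partial>cone_measure N) \<le> b * (\<integral>\<^sup>+\<sigma>. f \<sigma> \<partial>\<mu>) + ennreal e * b" .
qed

text \<open>Caps of equal height have equal measure, and the countably many caps centred at a dense
  subset cover the sphere. If one were null, the whole sphere would be null.\<close>

lemma cap_pos:
  assumes u: "u \<in> sphere_N N" and t: "t < 1"
  shows "(\<integral>\<^sup>+\<sigma>. indicator {t<..} (overlap N \<sigma> u) \<partial>\<mu>) \<noteq> 0"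
proof
  assume 0: "(\<integral>\<^sup>+\<sigma>. indicator {t<..} (overlap N \<sigma> u) \<partial>\<mu>) = 0"
  obtain D where D: "countable D" "D \<subseteq> sphere_N N" "sphere_N N \<subseteq> closure D"
    using separable[of "sphere_N N"] by blast
  define A where "A \<tau> = {\<sigma> \<in> space \<mu>. t < overlap N \<sigma> \<tau>}" for \<tau>
  have [measurable]: "A \<tau> \<in> sets \<mu>" for \<tau> unfolding A_def by measurable
  have "emeasure \<mu> (A \<tau>) = 0" if "\<tau> \<in> D" for \<tau>
  proof -
    have "emeasure \<mu> (A \<tau>) = (\<integral>\<^sup>+\<sigma>. indicator (A \<tau>) \<sigma> \<partial>\<mu>)"
      by (rule nn_integral_indicator[symmetric]) measurable
    also have "\<dots> = (\<integral>\<^sup>+\<sigma>. indicator {t<..} (overlap N \<sigma> \<tau>) \<partial>\<mu>)"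
      by (intro nn_integral_cong) (auto simp: A_def indicator_def)
    also have "\<dots> = (\<integral>\<^sup>+\<sigma>. indicator {t<..} (overlap N \<sigma> u) \<partial>\<mu>)"
      using that D u by (intro overlap_integral_haar) auto
    finally show ?thesis using 0 by simp
  qed
  then have "(\<Union>\<tau>\<in>D. A \<tau>) \<in> null_sets \<mu>"
    using D(1) by (intro null_sets_UN') (auto intro!: null_setsI)
  then have "emeasure \<mu> (\<Union>\<tau>\<in>D. A \<tau>) = 0" by (rule null_setsD1)
  moreover have "space \<mu> \<subseteq> (\<Union>\<tau>\<in>D. A \<tau>)"
  proof
    fix \<sigma> assume \<sigma>: "\<sigma> \<in> space \<mu>"
    then have "\<sigma> \<in> closure D" using D by (auto simp: space_haar)
    then obtain x where x: "\<And>n. x n \<in> D" "x \<longlonglongrightarrow> \<sigma>" by (auto simp: closure_sequential)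
    have "(\<lambda>n. x n i) \<longlonglongrightarrow> \<sigma> i" for i
      by (rule continuous_on_tendsto_compose[OF continuous_on_product_coordinates x(2)]) auto
    then have "(\<lambda>n. overlap N \<sigma> (x n)) \<longlonglongrightarrow> overlap N \<sigma> \<sigma>"
      unfolding overlap_def divide_inverse by (intro tendsto_intros)
    moreover have "overlap N \<sigma> \<sigma> = 1" using \<sigma> N1 by (simp add: space_haar sphere_N_iff)
    ultimately have "\<forall>\<^sub>F n in sequentially. overlap N \<sigma> (x n) > t"
      using t by (intro order_tendstoD(1)[of _ "overlap N \<sigma> \<sigma>"]) (simp_all only:)
    then obtain n where "overlap N \<sigma> (x n) > t" unfolding eventually_sequentially by blast
    with x(1) \<sigma> show "\<sigma> \<in> (\<Union>\<tau>\<in>D. A \<tau>)" by (auto simp: A_def)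
  qed
  moreover have "(\<Union>\<tau>\<in>D. A \<tau>) \<in> sets \<mu>"
    using D(1) by (rule sets.countable_UN') auto
  ultimately have "emeasure \<mu> (space \<mu>) \<le> 0"
    using emeasure_mono[of "space \<mu>" "\<Union>\<tau>\<in>D. A \<tau>" \<mu>] by simp
  then show False by (simp add: emeasure_space_1)
qed

lemma sphere_N_nonempty: "\<exists>u. u \<in> sphere_N N"
  using not_empty by (auto simp: space_haar)

lemma cone_total_finite: "cone_total < top" unfolding cone_total_def by (rule cone_measure_finite)

text \<open>The kernel comparison holds with error e times the mass of a cap; dividing by that mass,
  which \<open>cap_pos\<close> shows to be nonzero, and letting e tend to 0 gives equality for
  functions that are uniformly continuous on the sphere.\<close>

lemma haar_close:
  assumes f[measurable]: "f \<in> borel_measurable (vec_borel N)"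
    and close: "\<And>e. e > 0 \<Longrightarrow> \<exists>t<1. \<forall>\<sigma>\<in>sphere_N N. \<forall>\<tau>\<in>sphere_N N. overlap N \<sigma> \<tau> > t \<longrightarrow> f \<sigma> \<le> f \<tau> + ennreal e"
  shows "cone_total * (\<integral>\<^sup>+\<sigma>. f \<sigma> \<partial>\<mu>) = (\<integral>\<^sup>+\<sigma>. f \<sigma> \<partial>cone_measure N)"
proof -
  obtain u where u: "u \<in> sphere_N N" using sphere_N_nonempty by blast
  let ?I = "\<integral>\<^sup>+\<sigma>. f \<sigma> \<partial>\<mu>" and ?J = "\<integral>\<^sup>+\<sigma>. f \<sigma> \<partial>cone_measure N"
  have main: "cone_total * ?I \<le> ?J + ennreal e * cone_total" "?J \<le> cone_total * ?I + ennreal e * cone_total" if e: "e > 0" for e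
  proof -
    obtain t where t: "t < 1" "\<And>\<sigma> \<tau>. \<sigma> \<in> sphere_N N \<Longrightarrow> \<tau> \<in> sphere_N N \<Longrightarrow> overlap N \<sigma> \<tau> > t \<Longrightarrow> f \<sigma> \<le> f \<tau> + ennreal e"
      using close[OF e] by blast
    define a b where "a = (\<integral>\<^sup>+\<sigma>. indicator {t<..} (overlap N \<sigma> u) \<partial>\<mu>)"
      and "b = (\<integral>\<^sup>+\<sigma>. indicator {t<..} (overlap N \<sigma> u) \<partial>cone_measure N)"
    have a0: "a \<noteq> 0" unfolding a_def by (rule cap_pos[OF u t(1)])
    have "a \<le> (\<integral>\<^sup>+\<sigma>. 1 \<partial>\<mu>)" unfolding a_def by (intro nn_integral_mono) (auto split: split_indicator)
    also have "\<dots> = 1" by (simp add: emeasure_space_1)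
    finally have at: "a \<noteq> top" by (auto simp: top_unique)
    \<comment> \<open>The comparison for the constant function 1 has no error and fixes the ratio of
      the two cap masses.\<close>
    have "b * (\<integral>\<^sup>+\<sigma>. 1 \<partial>\<mu>) \<le> a * (\<integral>\<^sup>+\<sigma>. 1 \<partial>cone_measure N) + ennreal 0 * a * cone_total"
      unfolding a_def b_def by (rule cap_kernel_comparison(1)[OF _ _ _ u]) auto
    moreover have "a * (\<integral>\<^sup>+\<sigma>. 1 \<partial>cone_measure N) \<le> b * (\<integral>\<^sup>+\<sigma>. 1 \<partial>\<mu>) + ennreal 0 * b"
      unfolding a_def b_def by (rule cap_kernel_comparison(2)[OF _ _ _ u]) auto
    ultimately have b: "b = a * cone_total" by (simp add: cone_total_def emeasure_space_1)
    have "b * ?I \<le> a * ?J + ennreal e * a * cone_total"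
      unfolding a_def b_def by (rule cap_kernel_comparison(1)[OF f t(2) _ u]) (use e in auto)
    then have "a * (cone_total * ?I) \<le> a * (?J + ennreal e * cone_total)" by (simp add: b distrib_left mult_ac)
    then show "cone_total * ?I \<le> ?J + ennreal e * cone_total" using a0 at by (simp add: ennreal_mult_le_mult_iff)
    have "a * ?J \<le> b * ?I + ennreal e * b"
      unfolding a_def b_def by (rule cap_kernel_comparison(2)[OF f t(2) _ u]) (use e in auto)
    then have "a * ?J \<le> a * (cone_total * ?I + ennreal e * cone_total)" by (simp add: b distrib_left mult_ac)
    then show "?J \<le> cone_total * ?I + ennreal e * cone_total" using a0 at by (simp add: ennreal_mult_le_mult_iff)
  qed
  have eps: "x \<le> y" if "\<And>e::real. e > 0 \<Longrightarrow> x \<le> y + ennreal e * cone_total" for x y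
  proof (rule ennreal_le_epsilon)
    fix e :: real assume e: "e > 0"
    obtain T where T: "cone_total = ennreal T" "T \<ge> 0" using cone_total_finite by (cases cone_total) auto
    have 1: "x \<le> y + ennreal (e / (T + 1)) * cone_total" using e T(2) by (intro that) auto
    have "ennreal (e / (T + 1)) * cone_total = ennreal (e / (T + 1) * T)"
      unfolding T(1) using e T(2) by (intro ennreal_mult[symmetric]) auto
    also have "\<dots> \<le> ennreal e" using e T by (intro ennreal_leI) (simp add: field_simps)
    finally have 2: "ennreal (e / (T + 1)) * cone_total \<le> ennreal e" .
    show "x \<le> y + ennreal e" by (rule order_trans[OF 1 add_left_mono[OF 2]])
  qed
  show ?thesis by (rule antisym; rule eps; rule main; assumption)
qed

text \<open>The indicator of U is the increasing limit of the Lipschitz functions min 1 (n d), where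
  d is the distance to the complement of U, and \<open>haar_close\<close> applies to each of
  them.\<close>

lemma haar_open:
  assumes U: "open U"
  shows "cone_total * emeasure \<mu> (U \<inter> space \<mu>) = emeasure (cone_measure N) (U \<inter> space (cone_measure N))"
proof -
  have [measurable]: "(\<lambda>x. x) \<in> measurable (vec_borel N) borel" by (rule measurable_vec_borel_borel)
  have id\<mu>: "(\<lambda>x. x) \<in> measurable \<mu> borel" by (rule measurable_haar) simp
  have idc: "(\<lambda>x. x) \<in> measurable (cone_measure N) borel"
    using measurable_vec_borel_borel by (simp add: measurable_cong_sets[OF sets_cone_measure refl])
  have U': "U \<in> sets borel" using U by simp
  show ?thesis
  \<comment> \<open>\<open>infdist\<close> to the empty set is 0 by convention, so the approximating
    functions would vanish for the full space.\<close>
  proof (cases "U = UNIV")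
    case True
    then show ?thesis by (simp add: emeasure_space_1 cone_total_def)
  next
    case False
    define f where "f n x = ennreal (min 1 (real n * infdist x (- U)))" for n x
    have [measurable]: "f n \<in> borel_measurable borel" for n
      unfolding f_def by (intro measurable_compose[OF _ measurable_ennreal] borel_measurable_continuous_onI continuous_intros)
    have fm[measurable]: "f n \<in> borel_measurable (vec_borel N)" for n
      by (rule measurable_compose[OF measurable_vec_borel_borel]) simp
    have fc: "f n \<in> borel_measurable (cone_measure N)" for n
      using fm by (simp add: measurable_cong_sets[OF sets_cone_measure refl])
    have fl: "(\<lambda>n. f n x) \<longlonglongrightarrow> indicator U x" for x
    proof (cases "x \<in> U")
      case True
      have "infdist x (- U) > 0"
        using True False U in_closed_iff_infdist_zero[of "- U" x] infdist_nonneg[of x "- U"]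
        by (auto simp: closed_Compl less_le)
      then obtain n0 where n0: "real n0 * infdist x (- U) > 1" using reals_Archimedean3 by blast
      have "\<forall>\<^sub>F n in sequentially. f n x = 1"
        using eventually_ge_at_top[of n0]
      proof eventually_elim
        case (elim n)
        then have "real n0 * infdist x (- U) \<le> real n * infdist x (- U)"
          by (intro mult_right_mono infdist_nonneg) auto
        with n0 show ?case by (simp add: f_def)
      qed
      then show ?thesis using True by (simp add: tendsto_eventually)
    next
      case False
      then show ?thesis by (simp add: f_def)
    qed
    have inc: "incseq f"
      by (auto simp: incseq_def le_fun_def f_def intro!: ennreal_leI min.mono mult_right_mono infdist_nonneg)
    have L1: "(\<lambda>n. cone_total * (\<integral>\<^sup>+\<sigma>. f n \<sigma> \<partial>\<mu>)) \<longlonglongrightarrow> cone_total * (\<integral>\<^sup>+\<sigma>. indicator U \<sigma> \<partial>\<mu>)"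
      using inc fl cone_total_finite by (intro ennreal_tendsto_cmult nn_integral_LIMSEQ) (auto intro!: measurable_haar)
    have L2: "(\<lambda>n. \<integral>\<^sup>+\<sigma>. f n \<sigma> \<partial>cone_measure N) \<longlonglongrightarrow> (\<integral>\<^sup>+\<sigma>. indicator U \<sigma> \<partial>cone_measure N)"
      using inc fl fc by (intro nn_integral_LIMSEQ) auto
    have eq: "cone_total * (\<integral>\<^sup>+\<sigma>. f n \<sigma> \<partial>\<mu>) = (\<integral>\<^sup>+\<sigma>. f n \<sigma> \<partial>cone_measure N)" for n
    proof (rule haar_close)
      fix e :: real assume e: "e > 0"
      \<comment> \<open>An overlap above 1 - q forces a distance of at most e / (n + 1) by
        \<open>sphere_N_dist_le\<close>, and \<open>f n\<close> comes from an n-Lipschitz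
        function.\<close>
      define q where "q = (e / (2 * (real n + 1)))\<^sup>2 / (2 * real N)"
      have q: "q > 0" using e N2 by (simp add: q_def)
      show "\<exists>t<1. \<forall>\<sigma>\<in>sphere_N N. \<forall>\<tau>\<in>sphere_N N. overlap N \<sigma> \<tau> > t \<longrightarrow> f n \<sigma> \<le> f n \<tau> + ennreal e"
      proof (intro exI[of _ "1 - q"] conjI ballI impI)
        show "1 - q < 1" using q by simp
        fix \<sigma> \<tau> assume st: "\<sigma> \<in> sphere_N N" "\<tau> \<in> sphere_N N" "1 - q < overlap N \<sigma> \<tau>"
        have "sqrt (2 * real N * (1 - overlap N \<sigma> \<tau>)) \<le> sqrt (2 * real N * q)"
          using st by (intro real_sqrt_le_mono mult_left_mono) auto
        also have "\<dots> = e / (2 * (real n + 1))"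
          using N2 e by (simp add: q_def real_sqrt_unique)
        finally have "dist \<sigma> \<tau> \<le> 2 * (e / (2 * (real n + 1)))"
          using sphere_N_dist_le[OF N1 st(1,2)] by linarith
        then have d: "dist \<sigma> \<tau> \<le> e / (real n + 1)" by (simp add: field_simps)
        have "real n * infdist \<sigma> (- U) \<le> real n * (infdist \<tau> (- U) + dist \<sigma> \<tau>)"
          by (intro mult_left_mono infdist_triangle) auto
        also have "\<dots> \<le> real n * infdist \<tau> (- U) + e"
        proof -
          have "real n * dist \<sigma> \<tau> \<le> real n * (e / (real n + 1))" using d by (intro mult_left_mono) auto
          also have "\<dots> \<le> e" using e by (simp add: field_simps)
          finally show ?thesis by (simp add: distrib_left)
        qed
        finally have "min 1 (real n * infdist \<sigma> (- U)) \<le> min 1 (real n * infdist \<tau> (- U)) + e"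
          using e by auto
        then show "f n \<sigma> \<le> f n \<tau> + ennreal e"
          unfolding f_def using e infdist_nonneg
          by (subst ennreal_plus[symmetric]) (auto intro!: ennreal_leI mult_nonneg_nonneg)
      qed
    qed simp
    have "cone_total * (\<integral>\<^sup>+\<sigma>. indicator U \<sigma> \<partial>\<mu>) = (\<integral>\<^sup>+\<sigma>. indicator U \<sigma> \<partial>cone_measure N)"
      using L1 unfolding eq by (rule LIMSEQ_unique[OF _ L2])
    moreover have "(\<integral>\<^sup>+\<sigma>. indicator U \<sigma> \<partial>\<mu>) = emeasure \<mu> (U \<inter> space \<mu>)"
      using measurable_sets[OF id\<mu> U'] by (intro nn_integral_indicator') (simp add: vimage_def Int_def)
    moreover have "(\<integral>\<^sup>+\<sigma>. indicator U \<sigma> \<partial>cone_measure N) = emeasure (cone_measure N) (U \<inter> space (cone_measure N))"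
      using measurable_sets[OF idc U'] by (intro nn_integral_indicator') (simp add: vimage_def Int_def)
    ultimately show ?thesis by simp
  qed
qed


text \<open>Uniqueness of the invariant measure: open sets are stable under intersection and
  generate the Borel sets. Since they live in the space of all functions, both measures are pushed
  there, and f is extended to it by precomposition with restriction.\<close>

lemma haar_eq_cone_measure:
  assumes [measurable]: "f \<in> borel_measurable (vec_borel N)"
  shows "cone_total * (\<integral>\<^sup>+\<sigma>. f \<sigma> \<partial>\<mu>) = (\<integral>\<^sup>+\<sigma>. f \<sigma> \<partial>cone_measure N)"
proof -
  have id\<mu>[measurable]: "(\<lambda>x. x) \<in> measurable \<mu> borel"
    by (rule measurable_haar) (rule measurable_vec_borel_borel)
  have idc[measurable]: "(\<lambda>x. x) \<in> measurable (cone_measure N) borel"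
    using measurable_vec_borel_borel by (simp add: measurable_cong_sets[OF sets_cone_measure refl])
  define P where "P = scale_measure cone_total (distr \<mu> borel (\<lambda>x. x))"
  define Q where "Q = distr (cone_measure N) borel (\<lambda>x. x)"
  have PQ: "P = Q"
  proof (rule measure_eqI_generator_eq[where E="{S. open S}" and \<Omega>=UNIV and A="\<lambda>_. UNIV"])
    show "emeasure P X = emeasure Q X" if "X \<in> {S. open S}" for X
      using that haar_open[of X]
      by (simp add: P_def Q_def emeasure_distr vimage_def)
    show "emeasure P UNIV \<noteq> \<infinity>"
      using cone_total_finite by (simp add: P_def emeasure_distr emeasure_space_1 ennreal_mult_eq_top_iff less_top[symmetric])
  qed (auto simp: Int_stable_def P_def Q_def borel_def)
  define g where "g x = f (restrict x {..<N})" for x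
  have res: "(\<lambda>x. restrict x {..<N}) \<in> measurable borel (vec_borel N)"
    by (intro measurable_restrict) measurable
  have gm[measurable]: "g \<in> borel_measurable borel"
    unfolding g_def using measurable_compose[OF res assms] .
  have gf: "g x = f x" if "x \<in> {..<N} \<rightarrow>\<^sub>E UNIV" for x
    using that by (simp add: g_def)
  have "cone_total * (\<integral>\<^sup>+\<sigma>. f \<sigma> \<partial>\<mu>) = cone_total * (\<integral>\<^sup>+\<sigma>. g \<sigma> \<partial>\<mu>)"
    by (intro arg_cong2[where f="(*)"] nn_integral_cong) (auto simp: gf space_haar sphere_N_def)
  also have "\<dots> = (\<integral>\<^sup>+\<sigma>. g \<sigma> \<partial>P)"
    unfolding P_def by (subst nn_integral_scale_measure) (auto simp: nn_integral_distr)
  also have "\<dots> = (\<integral>\<^sup>+\<sigma>. g \<sigma> \<partial>cone_measure N)"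
    unfolding PQ Q_def by (subst nn_integral_distr) auto
  also have "\<dots> = (\<integral>\<^sup>+\<sigma>. f \<sigma> \<partial>cone_measure N)"
    using sets_eq_imp_space_eq[OF sets_cone_measure, of N]
    by (intro nn_integral_cong) (auto simp: gf space_PiM)
  finally show ?thesis .
qed

lemma cone_total_pos: "cone_total \<noteq> 0"
proof
  assume 0: "cone_total = 0"
  obtain u where u: "u \<in> sphere_N N" using sphere_N_nonempty by blast
  have "emeasure (leb_PiM {..<N}) ({..<N} \<rightarrow>\<^sub>E {-1..1}) = (\<Prod>i<N. emeasure lborel {-1..1::real})"
    using lb.emeasure_PiM[of "{..<N}" "\<lambda>_. {-1..1}"] by simp
  then have pos: "emeasure (leb_PiM {..<N}) ({..<N} \<rightarrow>\<^sub>E {-1..1}) \<noteq> 0" by simp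
  have "cone_total = (\<integral>\<^sup>+\<sigma>. 1 \<partial>cone_measure N)" by (simp add: cone_total_def)
  also have "\<dots> = (\<integral>\<^sup>+x. indicator {x. L2_set x {..<N} \<le> sqrt (real N)} x \<partial>leb_PiM {..<N})"
    by (subst nn_integral_cone_measure) auto
  also have "\<dots> \<ge> (\<integral>\<^sup>+x. indicator ({..<N} \<rightarrow>\<^sub>E {-1..1}) x \<partial>leb_PiM {..<N})"
  proof (intro nn_integral_mono)
    fix x :: "nat \<Rightarrow> real"
    have "L2_set x {..<N} \<le> sqrt (real N)" if "x \<in> {..<N} \<rightarrow>\<^sub>E {-1..1}"
    proof -
      have "(\<Sum>i<N. (x i)\<^sup>2) \<le> (\<Sum>i<N. 1)"
        using that by (intro sum_mono) (fastforce simp: abs_square_le_1 abs_le_iff PiE_def Pi_def)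
      then show ?thesis by (simp add: L2_set_def)
    qed
    then show "(indicator ({..<N} \<rightarrow>\<^sub>E {-1..1}) x :: ennreal) \<le> indicator {x. L2_set x {..<N} \<le> sqrt (real N)} x"
      by (auto simp: indicator_def)
  qed
  moreover have "(\<integral>\<^sup>+x. indicator ({..<N} \<rightarrow>\<^sub>E {-1..1}) x \<partial>leb_PiM {..<N}) = emeasure (leb_PiM {..<N}) ({..<N} \<rightarrow>\<^sub>E {-1..1})"
    by (rule nn_integral_indicator) (rule sets_PiM_I_finite, auto)
  ultimately show False using pos 0 by (metis le_zero_eq)
qed

end

section \<open>Shifts and slices of the sphere\<close>

lemma reflection_involution:
  assumes "i < N" shows "reflection N v (reflection N v x) i = x i"
proof (cases "overlap N v v = 0")
  case True
  then show ?thesis using assms by (simp add: reflection_def)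
next
  case False
  have "overlap N v (reflection N v x) = - overlap N v x"
    using False by (simp add: overlap_reflection_right)
  then show ?thesis using assms by (simp add: reflection_def[of N v "reflection N v x"]) (simp add: reflection_def)
qed

lemma L2_set_reflection: "L2_set (reflection N v x) {..<N} = L2_set x {..<N}"
proof (cases "N \<ge> 1")
  case True
  then show ?thesis by (simp add: L2_set_overlap overlap_reflection)
qed (simp add: L2_set_def not_less_eq_eq)

lemma reflection_vdir: "reflection N v (vdir N y) = vdir N (reflection N v y)"
  unfolding vdir_def[of N "reflection N v y"] L2_set_reflection
  by (auto simp: reflection_def overlap_vdir_right fun_eq_iff)
     (simp add: vdir_def algebra_simps diff_divide_distrib)

lemma reflection_add_scale:
  "reflection N v (\<lambda>i. x i + a * y i) = (\<lambda>i\<in>{..<N}. reflection N v x i + a * reflection N v y i)"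
  by (auto simp: reflection_def fun_eq_iff overlap_linear add_divide_distrib algebra_simps)

lemma vdir_cong: "(\<And>i. i < N \<Longrightarrow> x i = y i) \<Longrightarrow> vdir N x = vdir N y"
proof -
  assume *: "\<And>i. i < N \<Longrightarrow> x i = y i"
  then have "L2_set x {..<N} = L2_set y {..<N}" by (intro L2_set_cong) auto
  with * show ?thesis by (auto simp: vdir_def fun_eq_iff)
qed

definition axis0 :: "nat \<Rightarrow> nat \<Rightarrow> nat \<Rightarrow> real" where
  "axis0 N k = (\<lambda>i\<in>{..<N}. if i = k then sqrt (real N) else 0)"

lemma overlap_axis0: "k < N \<Longrightarrow> overlap N x (axis0 N k) = x k / sqrt (real N)"
proof -
  assume k: "k < N"
  have "overlap N x (axis0 N k) = (\<Sum>i<N. if i = k then x i * sqrt (real N) else 0) / real N"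
    unfolding overlap_def axis0_def by (intro arg_cong2[where f="(/)"] sum.cong) auto
  also have "\<dots> = x k * sqrt (real N) / real N" using k by simp
  also have "\<dots> = x k / sqrt (real N)" using k by (simp add: field_simps)
  finally show ?thesis .
qed

lemma axis0_in_sphere_N: "k < N \<Longrightarrow> axis0 N k \<in> sphere_N N"
proof -
  assume k: "k < N"
  have "axis0 N k \<in> {..<N} \<rightarrow>\<^sub>E UNIV" unfolding axis0_def by simp
  moreover have "axis0 N k k = sqrt (real N)" using k by (simp add: axis0_def)
  ultimately show ?thesis using k by (subst sphere_N_iff) (auto simp: overlap_axis0)
qed

context haar
begin

lemma shift_nonzero:
  assumes "\<sigma> \<in> sphere_N N" "u \<in> sphere_N N" "0 \<le> \<alpha>" "\<alpha> < 1"
  shows "L2_set (\<lambda>i. \<sigma> i + \<alpha> * u i) {..<N} \<noteq> 0"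
proof
  assume "L2_set (\<lambda>i. \<sigma> i + \<alpha> * u i) {..<N} = 0"
  then have *: "\<sigma> i = - \<alpha> * u i" if "i < N" for i using that by (simp add: L2_set_eq_0_iff eq_neg_iff_add_eq_0)
  have "overlap N \<sigma> \<sigma> = overlap N (\<lambda>i. - \<alpha> * u i) (\<lambda>i. - \<alpha> * u i)"
    unfolding overlap_def using * by simp
  also have "\<dots> = \<alpha>\<^sup>2" unfolding overlap_scale_left overlap_scale_right
    using assms(2) N1 by (simp add: sphere_N_iff power2_eq_square)
  finally have "\<alpha>\<^sup>2 = 1" using assms N1 by (simp add: sphere_N_iff)
  then show False using assms by (simp add: power2_eq_1_iff)
qed

text \<open>Lifted to the ball, the pull is x \<mapsto> x + \<alpha> |x| e_0, homogeneous of degree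
  1, hence compatible with radial projection. The stretch of coordinate 0 costs 1 / (1 - \<alpha>).
  The image lies in the ball enlarged by 1 + \<alpha>, and scaling it back costs (1 +
  \<alpha>)^N.\<close>

lemma shift_axis_le:
  assumes [measurable]: "f \<in> borel_measurable (vec_borel N)" and \<alpha>: "0 \<le> \<alpha>" "\<alpha> < 1"
  shows "(\<integral>\<^sup>+\<sigma>. f (vdir N (\<lambda>i. \<sigma> i + \<alpha> * axis0 N 0 i)) \<partial>\<mu>) \<le> ennreal ((1 + \<alpha>) ^ N / (1 - \<alpha>)) * (\<integral>\<^sup>+\<sigma>. f \<sigma> \<partial>\<mu>)"
proof -
  have 0: "0 < N" using N2 by simp
  define c where "c = 1 + \<alpha>"
  have c: "c > 0" using \<alpha> by (simp add: c_def)
  define g where "g y = indicator {x. L2_set x {..<N} \<le> c * sqrt (real N)} y * f (vdir N y)" for y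
  have [measurable]: "(\<lambda>x. f (vdir N x)) \<in> borel_measurable (vec_borel N)" by measurable
  have gm[measurable]: "g \<in> borel_measurable (leb_PiM {..<N})"
    unfolding g_def by (rule borel_measurable_leb_PiM) measurable
  have "cone_total * (\<integral>\<^sup>+\<sigma>. f (vdir N (\<lambda>i. \<sigma> i + \<alpha> * axis0 N 0 i)) \<partial>\<mu>)
      = (\<integral>\<^sup>+\<sigma>. f (vdir N (\<lambda>i. \<sigma> i + \<alpha> * axis0 N 0 i)) \<partial>cone_measure N)"
    by (rule haar_eq_cone_measure) measurable
  also have "\<dots> = (\<integral>\<^sup>+x. indicator {x. L2_set x {..<N} \<le> sqrt (real N)} x *
        f (vdir N (\<lambda>i. vdir N x i + \<alpha> * axis0 N 0 i)) \<partial>leb_PiM {..<N})"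
    by (rule nn_integral_cone_measure) measurable
  also have "\<dots> \<le> (\<integral>\<^sup>+x. g (x(0 := x 0 + \<alpha> * L2_set x {..<N})) \<partial>leb_PiM {..<N})"
  proof (rule nn_integral_mono_AE, rule eventually_mono[OF leb_PiM_zero_null[OF finite_lessThan N_nonempty]])
    fix x assume x: "L2_set x {..<N} \<noteq> 0"
    let ?y = "x(0 := x 0 + \<alpha> * L2_set x {..<N})"
    have pos: "sqrt (real N) / L2_set x {..<N} > 0" using x 0 L2_set_nonneg[of x "{..<N}"] by (intro divide_pos_pos real_sqrt_gt_zero; linarith)
    have "vdir N (\<lambda>i. vdir N x i + \<alpha> * axis0 N 0 i) = vdir N (\<lambda>i. sqrt (real N) / L2_set x {..<N} * ?y i)"
    proof (rule vdir_cong)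
      fix i assume i: "i < N"
      show "vdir N x i + \<alpha> * axis0 N 0 i = sqrt (real N) / L2_set x {..<N} * ?y i"
      proof (cases "i = 0")
        case True
        have "sqrt (real N) * x 0 / L + \<alpha> * sqrt (real N) = sqrt (real N) / L * (x 0 + \<alpha> * L)" if "L \<noteq> 0" for L
          using that by (simp add: field_simps)
        from this[OF x] show ?thesis using True 0 by (simp add: vdir_def axis0_def)
      next
        case False
        then show ?thesis using i by (simp add: vdir_def axis0_def)
      qed
    qed
    also have "\<dots> = vdir N ?y" by (rule vdir_scale[OF pos])
    finally have 1: "vdir N (\<lambda>i. vdir N x i + \<alpha> * axis0 N 0 i) = vdir N ?y" .
    have "L2_set ?y {..<N} = L2_set (\<lambda>i. x i + (if i = 0 then \<alpha> * L2_set x {..<N} else 0)) {..<N}"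
      by (intro L2_set_cong) auto
    also have "\<dots> \<le> L2_set x {..<N} + L2_set (\<lambda>i. if i = 0 then \<alpha> * L2_set x {..<N} else 0) {..<N}"
      by (rule L2_set_triangle_ineq)
    also have "L2_set (\<lambda>i. if i = 0 then \<alpha> * L2_set x {..<N} else 0) {..<N} = \<bar>\<alpha> * L2_set x {..<N}\<bar>"
      using 0 by (simp add: L2_set_def if_distrib[of "\<lambda>x. x\<^sup>2"] cong: if_cong)
    also have "L2_set x {..<N} + \<bar>\<alpha> * L2_set x {..<N}\<bar> = c * L2_set x {..<N}"
      using \<alpha> by (simp add: c_def algebra_simps abs_mult L2_set_nonneg)
    finally have 2: "L2_set ?y {..<N} \<le> c * L2_set x {..<N}" .
    have "L2_set ?y {..<N} \<le> c * sqrt (real N)" if "L2_set x {..<N} \<le> sqrt (real N)"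
      using 2 mult_left_mono[OF that, of c] c by linarith
    then show "indicator {x. L2_set x {..<N} \<le> sqrt (real N)} x * f (vdir N (\<lambda>i. vdir N x i + \<alpha> * axis0 N 0 i)) \<le> g ?y"
      unfolding 1 g_def by (auto split: split_indicator)
  qed
  also have "\<dots> \<le> ennreal (1 / (1 - \<alpha>)) * (\<integral>\<^sup>+x. g x \<partial>leb_PiM {..<N})"
    using 0 \<alpha> by (intro nn_integral_leb_PiM_stretch) auto
  also have "(\<integral>\<^sup>+x. g x \<partial>leb_PiM {..<N}) = ennreal (c ^ N) * (\<integral>\<^sup>+x. g (\<lambda>i\<in>{..<N}. c * x i) \<partial>leb_PiM {..<N})"
    using nn_integral_leb_PiM_scale[OF _ c gm] by simp
  also have "(\<integral>\<^sup>+x. g (\<lambda>i\<in>{..<N}. c * x i) \<partial>leb_PiM {..<N})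
     = (\<integral>\<^sup>+x. indicator {x. L2_set x {..<N} \<le> sqrt (real N)} x * f (vdir N x) \<partial>leb_PiM {..<N})"
  proof (rule nn_integral_cong)
    fix x
    have "L2_set (\<lambda>i. c * x i) {..<N} = c * L2_set x {..<N}" using c by (simp add: L2_set_right_distrib)
    then show "g (\<lambda>i\<in>{..<N}. c * x i) = indicator {x. L2_set x {..<N} \<le> sqrt (real N)} x * f (vdir N x)"
      using c by (simp add: g_def vdir_scale indicator_def)
  qed
  also have "\<dots> = (\<integral>\<^sup>+\<sigma>. f \<sigma> \<partial>cone_measure N)" by (rule nn_integral_cone_measure[symmetric]) measurable
  also have "\<dots> = cone_total * (\<integral>\<^sup>+\<sigma>. f \<sigma> \<partial>\<mu>)" by (rule haar_eq_cone_measure[symmetric]) measurable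
  also have "ennreal (1 / (1 - \<alpha>)) * (ennreal (c ^ N) * (cone_total * (\<integral>\<^sup>+\<sigma>. f \<sigma> \<partial>\<mu>)))
     = cone_total * (ennreal (1 / (1 - \<alpha>) * c ^ N) * (\<integral>\<^sup>+\<sigma>. f \<sigma> \<partial>\<mu>))"
    using \<alpha> c by (subst ennreal_mult) (auto simp: mult_ac)
  finally show ?thesis
    using cone_total_pos cone_total_finite by (simp add: ennreal_mult_le_mult_iff less_top[symmetric] c_def mult_ac)
qed

text \<open>Conjugation by the reflection that exchanges u with the first axis reduces the general
  target to the axis.\<close>

lemma shift_le:
  assumes f[measurable]: "f \<in> borel_measurable (vec_borel N)" and \<alpha>: "0 \<le> \<alpha>" "\<alpha> < 1" and u: "u \<in> sphere_N N"
  shows "(\<integral>\<^sup>+\<sigma>. f (vdir N (\<lambda>i. \<sigma> i + \<alpha> * u i)) \<partial>\<mu>) \<le> ennreal ((1 + \<alpha>) ^ N / (1 - \<alpha>)) * (\<integral>\<^sup>+\<sigma>. f \<sigma> \<partial>\<mu>)"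
proof -
  define e where "e = axis0 N 0"
  have e: "e \<in> sphere_N N" unfolding e_def using N2 by (intro axis0_in_sphere_N) auto
  define R where "R = reflection N (\<lambda>i. u i - e i)"
  have Ru: "R u = e" unfolding R_def using N1 u e by (rule reflection_swap)
  have Rm[measurable]: "R \<in> measurable (vec_borel N) (vec_borel N)"
    unfolding R_def by (rule measurable_reflection) simp
  have RR: "R (R x) = x" if "x \<in> {..<N} \<rightarrow>\<^sub>E UNIV" for x
  proof
    fix i show "R (R x) i = x i"
      using that reflection_involution[of i N "\<lambda>i. u i - e i" x] unfolding R_def
      by (cases "i < N") (auto simp: reflection_def PiE_def extensional_def)
  qed
  have inv: "(\<integral>\<^sup>+\<sigma>. h (R \<sigma>) \<partial>\<mu>) = (\<integral>\<^sup>+\<sigma>. h \<sigma> \<partial>\<mu>)" if "h \<in> borel_measurable (vec_borel N)" for h :: "_ \<Rightarrow> ennreal"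
    unfolding R_def by (rule reflection_invariant) (rule measurable_haar[OF that])
  have "f (vdir N (\<lambda>i. \<sigma> i + \<alpha> * u i)) = f (R (vdir N (\<lambda>i. R \<sigma> i + \<alpha> * e i)))" for \<sigma>
  proof -
    have "R (vdir N (\<lambda>i. \<sigma> i + \<alpha> * u i)) = vdir N (\<lambda>i. R \<sigma> i + \<alpha> * e i)"
      unfolding Ru[symmetric] unfolding R_def reflection_vdir reflection_add_scale vdir_restrict ..
    then have "R (R (vdir N (\<lambda>i. \<sigma> i + \<alpha> * u i))) = R (vdir N (\<lambda>i. R \<sigma> i + \<alpha> * e i))" by simp
    then show ?thesis by (subst (asm) RR) (auto simp: vdir_def)
  qed
  then have "(\<integral>\<^sup>+\<sigma>. f (vdir N (\<lambda>i. \<sigma> i + \<alpha> * u i)) \<partial>\<mu>) = (\<integral>\<^sup>+\<sigma>. f (R (vdir N (\<lambda>i. R \<sigma> i + \<alpha> * e i))) \<partial>\<mu>)" by simp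
  also have "\<dots> = (\<integral>\<^sup>+\<sigma>. f (R (vdir N (\<lambda>i. \<sigma> i + \<alpha> * e i))) \<partial>\<mu>)"
    by (rule inv) measurable
  also have "\<dots> \<le> ennreal ((1 + \<alpha>) ^ N / (1 - \<alpha>)) * (\<integral>\<^sup>+\<sigma>. f (R \<sigma>) \<partial>\<mu>)"
    unfolding e_def using \<alpha> by (intro shift_axis_le) auto
  also have "(\<integral>\<^sup>+\<sigma>. f (R \<sigma>) \<partial>\<mu>) = (\<integral>\<^sup>+\<sigma>. f \<sigma> \<partial>\<mu>)" by (rule inv) measurable
  finally show ?thesis .
qed

text \<open>Up to scaling, the slice \<open>overlap N \<sigma> y = t\<close> is the cone over a quadric in the first coordinate.\<close>

lemma overlap_slice_null:
  assumes y: "L2_set y {..<N} \<noteq> 0"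
  shows "AE \<sigma> in \<mu>. overlap N \<sigma> y \<noteq> t"
proof -
  define L where "L = L2_set y {..<N}"
  have L: "L > 0" using y L2_set_nonneg[of y "{..<N}"] unfolding L_def by linarith
  define F :: "real \<Rightarrow> ennreal" where "F = indicator {t}"
  have [measurable]: "F \<in> borel_measurable borel" unfolding F_def by measurable
  define K where "K = {1..<N}"
  have K: "{..<N} = insert 0 K" "finite K" "0 \<notin> K" "K \<noteq> {}" using N2 by (auto simp: K_def)
  define H where "H x = F (sqrt (real N) / L2_set x {..<N} * (x 0 * L / real N))" for x
  have [measurable]: "H \<in> borel_measurable (leb_PiM {..<N})"
  proof -
    have [measurable]: "(\<lambda>x. x 0) \<in> borel_measurable (vec_borel N)" using N2 by simp
    show ?thesis unfolding H_def by (rule borel_measurable_leb_PiM) measurable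
  qed
  have ax: "overlap N x (\<lambda>i. if i = 0 then L else 0) = x 0 * L / real N" for x
    using N2 by (simp add: overlap_def if_distrib cong: if_cong)
  have "cone_total * (\<integral>\<^sup>+\<sigma>. F (overlap N \<sigma> y) \<partial>\<mu>) = (\<integral>\<^sup>+\<sigma>. F (overlap N \<sigma> y) \<partial>cone_measure N)"
    by (rule haar_eq_cone_measure) measurable
  also have "\<dots> = (\<integral>\<^sup>+\<sigma>. F (overlap N \<sigma> (\<lambda>i. if i = 0 then L else 0)) \<partial>cone_measure N)"
    unfolding L_def using N2 by (intro overlap_integral_cone_axis) auto
  also have "\<dots> = (\<integral>\<^sup>+x. indicator {x. L2_set x {..<N} \<le> sqrt (real N)} x * H x \<partial>leb_PiM {..<N})"
    by (subst nn_integral_cone_measure, measurable) (simp add: overlap_vdir_left ax H_def)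
  also have "\<dots> \<le> (\<integral>\<^sup>+x. H x \<partial>leb_PiM {..<N})"
    by (intro nn_integral_mono) (auto split: split_indicator)
  also have "\<dots> = (\<integral>\<^sup>+x. \<integral>\<^sup>+a. H (x(0 := a)) \<partial>lborel \<partial>leb_PiM K)"
    unfolding K(1) by (rule lb.product_nn_integral_insert[OF K(2,3)]) (simp add: K(1)[symmetric])
  also have "\<dots> = (\<integral>\<^sup>+x. 0 \<partial>leb_PiM K)"
  proof (rule nn_integral_cong_AE, rule eventually_mono[OF leb_PiM_zero_null[OF K(2,4)]])
    fix x :: "nat \<Rightarrow> real" assume q: "L2_set x K \<noteq> 0"
    define q where "q = L2_set x K"
    define c where "c = L / sqrt (real N)"
    have c: "c > 0" using L N2 by (simp add: c_def)
    have Lx: "L2_set (x(0 := a)) {..<N} = sqrt (a\<^sup>2 + q\<^sup>2)" for a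
    proof -
      have "(\<Sum>i\<in>K. ((x(0 := a)) i)\<^sup>2) = (\<Sum>i\<in>K. (x i)\<^sup>2)" using K by (intro sum.cong) auto
      also have "\<dots> = q\<^sup>2" by (simp add: q_def L2_set_def sum_nonneg)
      finally show ?thesis unfolding L2_set_def K(1) using K by (subst sum.insert) auto
    qed
    \<comment> \<open>Squaring c a = t sqrt (a^2 + q^2) gives a^2 (c^2 - t^2) = t^2 q^2. Since q is
      nonzero and c is positive, c^2 = t^2 is impossible, so at most two values of a remain.\<close>
    define S where "S = {sqrt (t\<^sup>2 * q\<^sup>2 / (c\<^sup>2 - t\<^sup>2)), - sqrt (t\<^sup>2 * q\<^sup>2 / (c\<^sup>2 - t\<^sup>2))}"
    have "a \<in> S" if "H (x(0 := a)) \<noteq> 0" for a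
    proof -
      have r: "a\<^sup>2 + q\<^sup>2 > 0" using q by (simp add: q_def add_nonneg_pos)
      have "sqrt (real N) / sqrt (a\<^sup>2 + q\<^sup>2) * (a * L / real N) = t"
        using that by (simp add: H_def F_def Lx indicator_def split: if_splits)
      moreover have "sqrt (real N) / sqrt (a\<^sup>2 + q\<^sup>2) * (a * L / real N) = c * a / sqrt (a\<^sup>2 + q\<^sup>2)"
      proof -
        have *: "s / R * (a * L / (s * s)) = L / s * a / R" if "s > 0" for s R using that by (simp add: mult_ac)
        show ?thesis using *[of "sqrt (real N)"] N2 by (simp add: c_def)
      qed
      ultimately have "c * a = t * sqrt (a\<^sup>2 + q\<^sup>2)" using r by (simp add: field_simps)
      then have "(c * a)\<^sup>2 = (t * sqrt (a\<^sup>2 + q\<^sup>2))\<^sup>2" by simp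
      then have *: "a\<^sup>2 * (c\<^sup>2 - t\<^sup>2) = t\<^sup>2 * q\<^sup>2"
        using r by (simp add: power_mult_distrib algebra_simps)
      have "c\<^sup>2 - t\<^sup>2 \<noteq> 0"
      proof
        assume 0: "c\<^sup>2 - t\<^sup>2 = 0"
        with * q have "t = 0" by (simp add: q_def)
        with 0 c show False by simp
      qed
      with * have "a\<^sup>2 = t\<^sup>2 * q\<^sup>2 / (c\<^sup>2 - t\<^sup>2)" by (simp add: field_simps)
      then have "\<bar>a\<bar> = sqrt (t\<^sup>2 * q\<^sup>2 / (c\<^sup>2 - t\<^sup>2))" by (metis real_sqrt_abs)
      then show ?thesis unfolding S_def by (auto simp: abs_if split: if_splits)
    qed
    then have "(\<integral>\<^sup>+a. H (x(0 := a)) \<partial>lborel) \<le> (\<integral>\<^sup>+a. top * indicator S a \<partial>lborel)"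
      by (intro nn_integral_mono) (auto simp: indicator_def)
    also have "\<dots> = 0" by (subst nn_integral_cmult_indicator) (auto simp: S_def emeasure_lborel_countable)
    finally show "(\<integral>\<^sup>+a. H (x(0 := a)) \<partial>lborel) = 0" by simp
  qed
  finally have "(\<integral>\<^sup>+\<sigma>. F (overlap N \<sigma> y) \<partial>\<mu>) = 0" using cone_total_pos by simp
  then have "AE \<sigma> in \<mu>. F (overlap N \<sigma> y) = 0"
    by (subst (asm) nn_integral_0_iff_AE) auto
  then show ?thesis by eventually_elim (auto simp: F_def indicator_def split: if_splits)
qed

end

text \<open>Tensorises a one-replica bound, with one factor K for each coordinate. The map may
  differ between coordinates because every replica is pulled towards a point of its own.\<close>

lemma (in sigma_finite_measure) nn_integral_PiM_transport:
  fixes F :: "('i \<Rightarrow> 'a) \<Rightarrow> ennreal"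
  assumes I: "finite I"
    and T: "\<And>i. i \<in> I \<Longrightarrow> T i \<in> measurable M M"
    and K: "\<And>i f. i \<in> I \<Longrightarrow> f \<in> borel_measurable M \<Longrightarrow> (\<integral>\<^sup>+x. f (T i x) \<partial>M) \<le> K * (\<integral>\<^sup>+x. f x \<partial>M)"
    and F: "F \<in> borel_measurable (PiM I (\<lambda>_. M))"
  shows "(\<integral>\<^sup>+x. F (\<lambda>i\<in>I. T i (x i)) \<partial>PiM I (\<lambda>_. M)) \<le> K ^ card I * (\<integral>\<^sup>+x. F x \<partial>PiM I (\<lambda>_. M))"
  using I T K F
proof (induction I arbitrary: F)
  case empty
  interpret P: product_sigma_finite "\<lambda>_::'i. M" ..
  show ?case by (simp add: P.nn_integral_empty restrict_def space_PiM_empty)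
next
  case (insert k I)
  interpret P: product_sigma_finite "\<lambda>_::'i. M" ..
  note [measurable] = insert.prems(3)
  have Tm[measurable]: "T i \<in> measurable M M" if "i \<in> insert k I" for i using insert.prems(1) that .
  have Tc: "(\<lambda>x. T i (x i)) \<in> measurable (PiM J (\<lambda>_. M)) M" if "i \<in> J" "i \<in> insert k I" for i J
    by (rule measurable_compose[OF measurable_component_singleton[OF that(1)] Tm[OF that(2)]])
  have Rm[measurable]: "(\<lambda>x. \<lambda>i\<in>I. T i (x i)) \<in> measurable (PiM I (\<lambda>_. M)) (PiM I (\<lambda>_. M))"
    by (intro measurable_restrict Tc) auto
  have Rm': "(\<lambda>x. \<lambda>i\<in>insert k I. T i (x i)) \<in> measurable (PiM (insert k I) (\<lambda>_. M)) (PiM (insert k I) (\<lambda>_. M))"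
    by (intro measurable_restrict Tc) auto
  have m1[measurable]: "(\<lambda>(x, y). F (x(k := y))) \<in> borel_measurable (PiM I (\<lambda>_. M) \<Otimes>\<^sub>M M)" by measurable
  have m2[measurable]: "(\<lambda>x. \<integral>\<^sup>+y. F (x(k := y)) \<partial>M) \<in> borel_measurable (PiM I (\<lambda>_. M))" by measurable
  have "(\<integral>\<^sup>+x. F (\<lambda>i\<in>insert k I. T i (x i)) \<partial>PiM (insert k I) (\<lambda>_. M))
      = (\<integral>\<^sup>+x. \<integral>\<^sup>+y. F (\<lambda>i\<in>insert k I. T i ((x(k := y)) i)) \<partial>M \<partial>PiM I (\<lambda>_. M))"
    using measurable_compose[OF Rm' insert.prems(3)]
    by (intro P.product_nn_integral_insert insert.hyps)
  also have "\<dots> = (\<integral>\<^sup>+x. \<integral>\<^sup>+y. F ((\<lambda>i\<in>I. T i (x i))(k := T k y)) \<partial>M \<partial>PiM I (\<lambda>_. M))"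
    using insert.hyps by (intro nn_integral_cong arg_cong[where f=F]) (auto simp: fun_eq_iff)
  also have "\<dots> \<le> (\<integral>\<^sup>+x. K * \<integral>\<^sup>+y. F ((\<lambda>i\<in>I. T i (x i))(k := y)) \<partial>M \<partial>PiM I (\<lambda>_. M))"
  proof (rule nn_integral_mono)
    fix x assume "x \<in> space (PiM I (\<lambda>_. M))"
    from measurable_space[OF Rm this]
    have "(\<lambda>y. F ((\<lambda>i\<in>I. T i (x i))(k := y))) \<in> borel_measurable M"
      using measurable_Pair2[OF m1] by simp
    from insert.prems(2)[OF _ this, of k]
    show "(\<integral>\<^sup>+y. F ((\<lambda>i\<in>I. T i (x i))(k := T k y)) \<partial>M) \<le> K * \<integral>\<^sup>+y. F ((\<lambda>i\<in>I. T i (x i))(k := y)) \<partial>M" by simp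
  qed
  also have "\<dots> = K * (\<integral>\<^sup>+x. \<integral>\<^sup>+y. F ((\<lambda>i\<in>I. T i (x i))(k := y)) \<partial>M \<partial>PiM I (\<lambda>_. M))"
    by (rule nn_integral_cmult) (rule measurable_compose[OF Rm m2])
  also have "\<dots> \<le> K * (K ^ card I * (\<integral>\<^sup>+x. \<integral>\<^sup>+y. F (x(k := y)) \<partial>M \<partial>PiM I (\<lambda>_. M)))"
    by (intro mult_left_mono insert.IH insert.prems m2) auto
  also have "(\<integral>\<^sup>+x. \<integral>\<^sup>+y. F (x(k := y)) \<partial>M \<partial>PiM I (\<lambda>_. M)) = (\<integral>\<^sup>+x. F x \<partial>PiM (insert k I) (\<lambda>_. M))"
    by (intro P.product_nn_integral_insert[symmetric] insert.hyps insert.prems)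
  finally show ?case using insert.hyps by (simp add: mult_ac)
qed

section \<open>Comparison of partition functions\<close>

text \<open>The integral inside \<open>multi_free_energy\<close> with values in
  \<open>ennreal\<close>, so that comparisons between centres carry no integrability
  conditions.\<close>

definition partition_nn ::
    "nat \<Rightarrow> (nat \<Rightarrow> real) measure \<Rightarrow> real \<Rightarrow> ((nat \<Rightarrow> real) \<Rightarrow> real) \<Rightarrow>
     (nat \<Rightarrow> real) \<Rightarrow> nat \<Rightarrow> real \<Rightarrow> real \<Rightarrow> ennreal" where
  "partition_nn N \<mu> \<beta> h m n \<rho> \<delta> =
     (\<integral>\<^sup>+\<sigma>. indicator (replica_band N m n \<rho> \<delta>) \<sigma> * ennreal (exp (\<beta> * (\<Sum>i<n. h (\<sigma> i) - h m))) \<partial>PiM {..<n} (\<lambda>_. \<mu>))"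

text \<open>Polar coordinates: a nonzero centre m is \<open>scaled N s u\<close> with u on the
  sphere and s = |m| / sqrt N.\<close>

definition scaled :: "nat \<Rightarrow> real \<Rightarrow> (nat \<Rightarrow> real) \<Rightarrow> nat \<Rightarrow> real" where
  "scaled N s u = (\<lambda>i\<in>{..<N}. s * u i)"

lemma overlap_scaled [simp]:
  "overlap N (scaled N s u) x = s * overlap N u x" "overlap N x (scaled N s u) = s * overlap N x u"
  by (simp_all add: scaled_def overlap_linear)

lemma L2_set_scaled: "0 \<le> s \<Longrightarrow> L2_set (scaled N s u) {..<N} = s * L2_set u {..<N}"
  by (simp add: scaled_def L2_set_right_distrib)

text \<open>Both sides of the band condition carry the factor s. Once it is cancelled, the overlap
  with the direction u is confined to an interval around s whose width does not depend on s. This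
  uses s > 0: at the centre 0 the band is the whole sphere.\<close>

lemma replica_band_scaled:
  assumes "u \<in> sphere_N N" "0 < s" "N \<ge> 1"
  shows "replica_band N (scaled N s u) n \<rho> \<delta> = {\<sigma> \<in> {..<n} \<rightarrow>\<^sub>E sphere_N N.
    (\<forall>i<n. \<bar>overlap N (\<sigma> i) u - s\<bar> \<le> \<delta>) \<and> (\<forall>i<n. \<forall>j<n. i \<noteq> j \<longrightarrow> \<bar>overlap N (\<sigma> i) (\<sigma> j) - s\<^sup>2\<bar> < \<rho>)}"
proof -
  have B: "x \<in> Band N (scaled N s u) \<delta> \<longleftrightarrow> x \<in> sphere_N N \<and> \<bar>overlap N x u - s\<bar> \<le> \<delta>" for x
  proof -
    have "overlap N (\<lambda>i. x i - scaled N s u i) (scaled N s u) = s * (overlap N x u - s)"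
      using assms by (simp add: overlap_diff_left sphere_N_iff algebra_simps)
    moreover have "\<delta> * L2_set (scaled N s u) {..<N} / sqrt (real N) = s * \<delta>"
      using assms by (simp add: L2_set_scaled sphere_N_L2)
    ultimately show ?thesis using assms(2) unfolding Band_def by (simp add: abs_mult)
  qed
  have "overlap N (scaled N s u) (scaled N s u) = s\<^sup>2"
    using assms by (simp add: sphere_N_iff power2_eq_square)
  then show ?thesis unfolding replica_band_def using B
    by (auto simp: PiE_iff)
qed

lemma measurable_PiM_comp2:
  assumes "i \<in> I" "j < N" "(\<lambda>x. x) \<in> measurable M (vec_borel N)"
  shows "(\<lambda>\<sigma>. \<sigma> i j) \<in> borel_measurable (PiM I (\<lambda>_. M))"
proof -
  have "(\<lambda>x. x j) \<in> borel_measurable M"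
    using measurable_compose[OF assms(3) measurable_component_singleton, of j] assms(2) by simp
  from measurable_compose[OF measurable_component_singleton[OF assms(1)] this] show ?thesis by simp
qed

context haar
begin

text \<open>The reflection along u followed by the one along u + u' is the rotation in the plane of
  u and u' that takes u to u'. It moves no point of the sphere further than u. A single reflection
  along u - u' would also take u to u', but it negates the direction u - u' and may move other
  points much further.\<close>

lemma rotation_exists:
  assumes u: "u \<in> sphere_N N" "u' \<in> sphere_N N"
  obtains Q where "\<And>x. x \<in> sphere_N N \<Longrightarrow> Q x \<in> sphere_N N" "\<And>x y. overlap N (Q x) (Q y) = overlap N x y"
    "Q u = u'" "\<And>x. x \<in> sphere_N N \<Longrightarrow> overlap N (Q x) x \<ge> overlap N u u'"
    "Q \<in> measurable \<mu> \<mu>" "\<And>f. f \<in> borel_measurable \<mu> \<Longrightarrow> (\<integral>\<^sup>+\<sigma>. f (Q \<sigma>) \<partial>\<mu>) = (\<integral>\<^sup>+\<sigma>. (f \<sigma> :: ennreal) \<partial>\<mu>)"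
proof
  define v where "v = (\<lambda>i. u i + u' i)"
  define Q where "Q x = reflection N v (reflection N u x)" for x
  have uu: "overlap N u u = 1" "overlap N u' u' = 1" using u N1 by (auto simp: sphere_N_iff)
  define c where "c = overlap N u u'"
  have vv: "overlap N v v = 2 * (1 + c)" by (simp add: v_def overlap_linear uu c_def overlap_commute[of N u' u])
  have vu: "overlap N v u = 1 + c" by (simp add: v_def overlap_linear uu c_def overlap_commute[of N u' u])
  have refl_m: "reflection N w \<in> measurable \<mu> \<mu>" for w
    by (rule measurable_haarI) (auto intro!: reflection_sphere_N[OF N1] simp: space_haar)
  show "Q x \<in> sphere_N N" if "x \<in> sphere_N N" for x
    unfolding Q_def using that by (intro reflection_sphere_N N1)
  show "overlap N (Q x) (Q y) = overlap N x y" for x y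
    unfolding Q_def overlap_reflection ..
  show "Q \<in> measurable \<mu> \<mu>" unfolding Q_def by (rule measurable_compose[OF refl_m refl_m])
  show "(\<integral>\<^sup>+\<sigma>. f (Q \<sigma>) \<partial>\<mu>) = (\<integral>\<^sup>+\<sigma>. f \<sigma> \<partial>\<mu>)" if "f \<in> borel_measurable \<mu>" for f :: "_ \<Rightarrow> ennreal"
    unfolding Q_def using reflection_invariant[of "\<lambda>x. f (reflection N v x)" u]
      reflection_invariant[OF that, of v] measurable_compose[OF refl_m that] by simp
  have Ru: "reflection N u u = (\<lambda>i\<in>{..<N}. - u i)"
    by (auto simp: reflection_def uu fun_eq_iff)
  show "Q u = u'"
  proof
    fix i
    show "Q u i = u' i"
    proof (cases "i < N")
      case True
      have ov: "overlap N v (\<lambda>i. - u i) = - (1 + c)"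
        using overlap_scale_right[of N v "-1" u] by (simp add: vu)
      show ?thesis
      \<comment> \<open>In the antipodal case u + u' is null, the second reflection is the identity,
        and the first one already maps u to - u = u'.\<close>
      proof (cases "c = - 1")
        case True
        have "v i = 0"
        proof -
          have "(L2_set v {..<N})\<^sup>2 / real N = 0" using vv True by (simp add: overlap_self[symmetric])
          then show ?thesis using N1 \<open>i < N\<close> by (simp add: L2_set_eq_0_iff)
        qed
        then show ?thesis using \<open>i < N\<close> unfolding Q_def Ru by (simp add: reflection_def v_def)
      next
        case False
        then have frac: "(- 2 - 2 * c) * y / (2 + 2 * c) = - y" for y
          by (simp add: field_simps add_eq_0_iff)
        then show ?thesis using \<open>i < N\<close> unfolding Q_def Ru
          using frac[of "v i"] by (simp add: reflection_def ov vv) (simp add: v_def)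
      qed
    next
      case False
      then show ?thesis using u(2) by (auto simp: Q_def reflection_def sphere_N_def PiE_def extensional_def)
    qed
  qed
  fix x assume x: "x \<in> sphere_N N"
  define p q where "p = overlap N u x" and "q = overlap N u' x"
  have xx: "overlap N x x = 1" using x N1 by (simp add: sphere_N_iff)
  have c1: "\<bar>c\<bar> \<le> 1" unfolding c_def using u N1 by (intro sphere_N_abs_overlap_le)
  have xv: "overlap N v x = p + q" by (simp add: v_def overlap_linear p_def q_def)
  show "overlap N u u' \<le> overlap N (Q x) x"
  proof (cases "c = -1")
    case True
    have "overlap N (Q x) x = overlap N (Q x) x" ..
    have "\<bar>overlap N (Q x) x\<bar> \<le> 1"
      unfolding Q_def using x N1 by (intro sphere_N_abs_overlap_le reflection_sphere_N) auto
    then show ?thesis using True by (simp add: c_def)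
  next
    case False
    then have c2: "1 + c > 0" using c1 by auto
    have "overlap N (Q x) x = overlap N (reflection N u x) (reflection N v x)"
      unfolding Q_def by (rule overlap_reflection_swap)
    also have "\<dots> = 1 - (p + q)\<^sup>2 / (1 + c) + 2 * p * q"
    proof -
      have a1: "overlap N x (reflection N v x) = 1 - 2 * (p + q) / (2 * (1 + c)) * (p + q)"
        unfolding overlap_reflection_right xv vv xx overlap_commute[of N x v] ..
      have a2: "overlap N u (reflection N v x) = p - 2 * (p + q) / (2 * (1 + c)) * (1 + c)"
        unfolding overlap_reflection_right xv vv vu p_def overlap_commute[of N u v] ..
      have "overlap N (reflection N u x) (reflection N v x)
          = (1 - 2 * (p + q) / (2 * (1 + c)) * (p + q)) - 2 * p * (p - 2 * (p + q) / (2 * (1 + c)) * (1 + c))"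
        unfolding overlap_reflection_left[of N u] a1 a2 uu p_def[symmetric] by simp
      also have "2 * (p + q) / (2 * (1 + c)) = (p + q) / (1 + c)" by (rule mult_divide_mult_cancel_left) simp
      also have "(p + q) / (1 + c) * (1 + c) = p + q" using c2 by simp
      also have "(1 - (p + q) / (1 + c) * (p + q)) - 2 * p * (p - (p + q)) = 1 - (p + q)\<^sup>2 / (1 + c) + 2 * p * q"
        by (simp add: power2_eq_square algebra_simps)
      finally show ?thesis .
    qed
    finally have eq: "overlap N (Q x) x = 1 - (p + q)\<^sup>2 / (1 + c) + 2 * p * q" .
    \<comment> \<open>Cauchy-Schwarz for the components of x and u' orthogonal to u, that is,
      nonnegativity of the Gram determinant of u, u' and x.\<close>
    have "(q - c * p)\<^sup>2 \<le> (1 - p\<^sup>2) * (1 - c\<^sup>2)"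
    proof -
      define y w where "y = (\<lambda>i. x i - p * u i)" and "w = (\<lambda>i. u' i - c * u i)"
      have yw: "overlap N y w = q - c * p" "overlap N y y = 1 - p\<^sup>2" "overlap N w w = 1 - c\<^sup>2"
        unfolding y_def w_def overlap_diff_left overlap_diff_right overlap_scale_left overlap_scale_right
        by (simp_all add: xx uu p_def[symmetric] q_def[symmetric] c_def[symmetric] overlap_commute[of N x u]
            overlap_commute[of N x u'] overlap_commute[of N u' u] power2_eq_square algebra_simps)
      have "\<bar>overlap N y w\<bar>\<^sup>2 \<le> (L2_set y {..<N} * L2_set w {..<N} / real N)\<^sup>2"
        by (intro power_mono abs_overlap_le) auto
      also have "\<dots> = overlap N y y * overlap N w w"
        by (simp add: overlap_self power_mult_distrib power_divide power2_eq_square)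
      finally show ?thesis by (simp add: yw)
    qed
    then have "(p + q)\<^sup>2 - 2 * p * q * (1 + c) \<le> (1 - c) * (1 + c)"
      by (simp add: power2_eq_square algebra_simps)
    then have "(p + q)\<^sup>2 / (1 + c) - 2 * p * q \<le> 1 - c" using c2 by (simp add: field_simps)
    then show ?thesis by (simp add: eq c_def[symmetric])
  qed
qed

lemma measurable_PiM_haar [measurable]:
  "i < n \<Longrightarrow> j < N \<Longrightarrow> (\<lambda>\<sigma>. \<sigma> i j) \<in> borel_measurable (PiM {..<n} (\<lambda>_. \<mu>))"
  by (rule measurable_PiM_comp2) auto

lemma sets_replica_band: "replica_band N m n \<rho> \<delta> \<in> sets (PiM {..<n} (\<lambda>_. \<mu>))"
proof -
  have "replica_band N m n \<rho> \<delta> = {\<sigma> \<in> space (PiM {..<n} (\<lambda>_. \<mu>)).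
     (\<forall>i\<in>{..<n}. \<bar>overlap N (\<lambda>k. \<sigma> i k - m k) m\<bar> \<le> \<delta> * L2_set m {..<N} / sqrt (real N)) \<and>
     (\<forall>i\<in>{..<n}. \<forall>j\<in>{..<n}. i \<noteq> j \<longrightarrow> \<bar>overlap N (\<sigma> i) (\<sigma> j) - overlap N m m\<bar> < \<rho>)}"
    unfolding replica_band_def Band_def by (auto simp: space_PiM space_haar PiE_iff)
  also have "\<dots> \<in> sets (PiM {..<n} (\<lambda>_. \<mu>))" by measurable
  finally show ?thesis .
qed

lemma partition_integrand_measurable:
  fixes h :: "(nat \<Rightarrow> real) \<Rightarrow> real"
  assumes h: "h \<in> borel_measurable (vec_borel N)"
  shows "(\<lambda>\<sigma>. exp (\<beta> * (\<Sum>i<n. h (\<sigma> i) - h m))) \<in> borel_measurable (PiM {..<n} (\<lambda>_. \<mu>))"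
proof -
  have hi: "(\<lambda>\<sigma>. h (\<sigma> i)) \<in> borel_measurable (PiM {..<n} (\<lambda>_. \<mu>))" if "i < n" for i
  proof -
    have "(\<lambda>\<sigma>. \<sigma> i) \<in> measurable (PiM {..<n} (\<lambda>_. \<mu>)) \<mu>" using that by simp
    from measurable_compose[OF this measurable_haar[OF h]] show ?thesis .
  qed
  have "(\<lambda>\<sigma>. \<beta> * (\<Sum>i<n. h (\<sigma> i) - h m)) \<in> borel_measurable (PiM {..<n} (\<lambda>_. \<mu>))"
    by (intro borel_measurable_times borel_measurable_sum borel_measurable_diff hi) auto
  from measurable_compose[OF this borel_measurable_exp] show ?thesis .
qed

lemma multi_free_energy_eq:
  assumes h: "h \<in> borel_measurable (vec_borel N)"
  shows "multi_free_energy N \<mu> \<beta> h m n \<rho> \<delta> = 1 / (real N * real n) * ln (enn2real (partition_nn N \<mu> \<beta> h m n \<rho> \<delta>))"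
proof -
  note [measurable] = partition_integrand_measurable[OF h] sets_replica_band
  have "(LINT \<sigma>:replica_band N m n \<rho> \<delta>|PiM {..<n} (\<lambda>_. \<mu>). exp (\<beta> * (\<Sum>i<n. h (\<sigma> i) - h m)))
    = enn2real (\<integral>\<^sup>+\<sigma>. ennreal (indicator (replica_band N m n \<rho> \<delta>) \<sigma> *\<^sub>R exp (\<beta> * (\<Sum>i<n. h (\<sigma> i) - h m))) \<partial>PiM {..<n} (\<lambda>_. \<mu>))"
    unfolding set_lebesgue_integral_def
    by (intro integral_eq_nn_integral borel_measurable_scaleR borel_measurable_indicator
        sets_replica_band partition_integrand_measurable h) auto
  also have "(\<integral>\<^sup>+\<sigma>. ennreal (indicator (replica_band N m n \<rho> \<delta>) \<sigma> *\<^sub>R exp (\<beta> * (\<Sum>i<n. h (\<sigma> i) - h m))) \<partial>PiM {..<n} (\<lambda>_. \<mu>))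
     = partition_nn N \<mu> \<beta> h m n \<rho> \<delta>"
    unfolding partition_nn_def by (intro nn_integral_cong) (auto split: split_indicator)
  finally show ?thesis unfolding multi_free_energy_def by simp
qed

text \<open>Compares centres through moves of configurations. A move may depend on the configuration
  through an index \<kappa> from a finite set, and the sum over all \<kappa> avoids a measurable
  choice. Of the moves themselves only an upper bound on transported integrals enters, not
  injectivity.\<close>

lemma partition_transport:
  fixes T :: "'k \<Rightarrow> nat \<Rightarrow> (nat \<Rightarrow> real) \<Rightarrow> nat \<Rightarrow> real"
  assumes h: "h \<in> borel_measurable (vec_borel N)" and \<beta>: "\<beta> \<ge> 0" and fin: "finite \<K>"
    and T: "\<And>\<kappa> i. \<kappa> \<in> \<K> \<Longrightarrow> i < n \<Longrightarrow> T \<kappa> i \<in> measurable \<mu> \<mu>"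
    and K: "\<And>\<kappa> i f. \<kappa> \<in> \<K> \<Longrightarrow> i < n \<Longrightarrow> f \<in> borel_measurable \<mu> \<Longrightarrow> (\<integral>\<^sup>+\<sigma>. f (T \<kappa> i \<sigma>) \<partial>\<mu>) \<le> K * (\<integral>\<^sup>+\<sigma>. f \<sigma> \<partial>\<mu>)"
    and move: "\<And>\<sigma>. \<sigma> \<in> replica_band N m n \<rho> \<delta> \<Longrightarrow> \<exists>\<kappa>\<in>\<K>. (\<lambda>i\<in>{..<n}. T \<kappa> i (\<sigma> i)) \<in> replica_band N (m' \<kappa>) n \<rho> \<delta> \<and>
      (\<Sum>i<n. h (\<sigma> i) - h m) \<le> (\<Sum>i<n. h (T \<kappa> i (\<sigma> i)) - h (m' \<kappa>)) + D"
  shows "partition_nn N \<mu> \<beta> h m n \<rho> \<delta> \<le> ennreal (exp (\<beta> * D)) * K ^ n * (\<Sum>\<kappa>\<in>\<K>. partition_nn N \<mu> \<beta> h (m' \<kappa>) n \<rho> \<delta>)"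
proof -
  note [measurable] = partition_integrand_measurable[OF h] sets_replica_band
  define G where "G m \<sigma> = indicator (replica_band N m n \<rho> \<delta>) \<sigma> * ennreal (exp (\<beta> * (\<Sum>i<n. h (\<sigma> i) - h m)))" for m \<sigma>
  have Gm[measurable]: "G m \<in> borel_measurable (PiM {..<n} (\<lambda>_. \<mu>))" for m unfolding G_def by measurable
  have Tm: "(\<lambda>\<sigma>. \<lambda>i\<in>{..<n}. T \<kappa> i (\<sigma> i)) \<in> measurable (PiM {..<n} (\<lambda>_. \<mu>)) (PiM {..<n} (\<lambda>_. \<mu>))" if "\<kappa> \<in> \<K>" for \<kappa>
    using that by (intro measurable_restrict measurable_compose[OF measurable_component_singleton] T) auto
  have GTm: "(\<lambda>\<sigma>. G m (\<lambda>i\<in>{..<n}. T \<kappa> i (\<sigma> i))) \<in> borel_measurable (PiM {..<n} (\<lambda>_. \<mu>))" if "\<kappa> \<in> \<K>" for \<kappa> m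
    using measurable_compose[OF Tm[OF that] Gm] .
  have "(\<integral>\<^sup>+\<sigma>. G m \<sigma> \<partial>PiM {..<n} (\<lambda>_. \<mu>))
      \<le> (\<integral>\<^sup>+\<sigma>. ennreal (exp (\<beta> * D)) * (\<Sum>\<kappa>\<in>\<K>. G (m' \<kappa>) (\<lambda>i\<in>{..<n}. T \<kappa> i (\<sigma> i))) \<partial>PiM {..<n} (\<lambda>_. \<mu>))"
  proof (rule nn_integral_mono)
    fix \<sigma>
    show "G m \<sigma> \<le> ennreal (exp (\<beta> * D)) * (\<Sum>\<kappa>\<in>\<K>. G (m' \<kappa>) (\<lambda>i\<in>{..<n}. T \<kappa> i (\<sigma> i)))"
    proof (cases "\<sigma> \<in> replica_band N m n \<rho> \<delta>")
      case True
      from move[OF this] obtain \<kappa> where \<kappa>: "\<kappa> \<in> \<K>" "(\<lambda>i\<in>{..<n}. T \<kappa> i (\<sigma> i)) \<in> replica_band N (m' \<kappa>) n \<rho> \<delta>"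
        "(\<Sum>i<n. h (\<sigma> i) - h m) \<le> (\<Sum>i<n. h (T \<kappa> i (\<sigma> i)) - h (m' \<kappa>)) + D" by blast
      have "exp (\<beta> * (\<Sum>i<n. h (\<sigma> i) - h m)) \<le> exp (\<beta> * D) * exp (\<beta> * (\<Sum>i<n. h (T \<kappa> i (\<sigma> i)) - h (m' \<kappa>)))"
        using mult_left_mono[OF \<kappa>(3) \<beta>] by (simp add: exp_add[symmetric] distrib_left add.commute)
      then have "G m \<sigma> \<le> ennreal (exp (\<beta> * D)) * G (m' \<kappa>) (\<lambda>i\<in>{..<n}. T \<kappa> i (\<sigma> i))"
        using True \<kappa>(2) by (simp add: G_def ennreal_mult''[symmetric] ennreal_leI)
      also have "\<dots> \<le> ennreal (exp (\<beta> * D)) * (\<Sum>\<kappa>\<in>\<K>. G (m' \<kappa>) (\<lambda>i\<in>{..<n}. T \<kappa> i (\<sigma> i)))"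
        using fin \<kappa>(1) by (intro mult_left_mono member_le_sum) auto
      finally show ?thesis .
    qed (simp add: G_def)
  qed
  also have "\<dots> = ennreal (exp (\<beta> * D)) * (\<Sum>\<kappa>\<in>\<K>. \<integral>\<^sup>+\<sigma>. G (m' \<kappa>) (\<lambda>i\<in>{..<n}. T \<kappa> i (\<sigma> i)) \<partial>PiM {..<n} (\<lambda>_. \<mu>))"
    by (subst nn_integral_cmult) (auto intro!: borel_measurable_sum GTm simp: nn_integral_sum GTm)
  also have "\<dots> \<le> ennreal (exp (\<beta> * D)) * (\<Sum>\<kappa>\<in>\<K>. K ^ card {..<n} * (\<integral>\<^sup>+\<sigma>. G (m' \<kappa>) \<sigma> \<partial>PiM {..<n} (\<lambda>_. \<mu>)))"
    by (intro mult_left_mono sum_mono nn_integral_PiM_transport T K Gm) auto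
  finally show ?thesis
    unfolding partition_nn_def G_def by (simp add: sum_distrib_left[symmetric] mult_ac)
qed

end

section \<open>Moving the band: directions by rotation, radii by pulling\<close>

definition lipschitz_N :: "nat \<Rightarrow> real \<Rightarrow> ((nat \<Rightarrow> real) \<Rightarrow> real) \<Rightarrow> bool" where
  "lipschitz_N N L h \<longleftrightarrow> (\<forall>x\<in>{..<N} \<rightarrow>\<^sub>E UNIV. \<forall>y\<in>{..<N} \<rightarrow>\<^sub>E UNIV.
     L2_set x {..<N} \<le> sqrt (real N) \<longrightarrow> L2_set y {..<N} \<le> sqrt (real N) \<longrightarrow>
     \<bar>h x - h y\<bar> \<le> L * L2_set (\<lambda>i. x i - y i) {..<N})"

lemma lipschitz_ND:
  assumes "lipschitz_N N L h" "x \<in> {..<N} \<rightarrow>\<^sub>E UNIV" "y \<in> {..<N} \<rightarrow>\<^sub>E UNIV"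
    "L2_set x {..<N} \<le> sqrt (real N)" "L2_set y {..<N} \<le> sqrt (real N)"
  shows "\<bar>h x - h y\<bar> \<le> L * L2_set (\<lambda>i. x i - y i) {..<N}"
  using assms unfolding lipschitz_N_def by blast

lemma scaled_PiE: "scaled N s u \<in> {..<N} \<rightarrow>\<^sub>E UNIV"
  by (simp add: scaled_def)

lemma sphere_N_PiE: "x \<in> sphere_N N \<Longrightarrow> x \<in> {..<N} \<rightarrow>\<^sub>E UNIV"
  by (simp add: sphere_N_def)

lemma scaled_L2_le: "u \<in> sphere_N N \<Longrightarrow> 0 \<le> s \<Longrightarrow> s \<le> 1 \<Longrightarrow> L2_set (scaled N s u) {..<N} \<le> sqrt (real N)"
  by (simp add: L2_set_scaled sphere_N_L2 mult_left_le_one_le)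

lemma L2_set_diff_sphere:
  assumes "N \<ge> 1" "x \<in> sphere_N N" "y \<in> sphere_N N"
  shows "L2_set (\<lambda>i. x i - y i) {..<N} = sqrt (2 * real N * (1 - overlap N x y))"
proof -
  have "overlap N (\<lambda>i. x i - y i) (\<lambda>i. x i - y i) = 2 * (1 - overlap N x y)"
    using assms by (simp add: overlap_linear sphere_N_iff overlap_commute[of N y x])
  then show ?thesis using assms(1) by (subst L2_set_overlap) (auto simp: real_sqrt_mult[symmetric] mult_ac)
qed

lemma L2_set_triangle_diff:
  "L2_set (\<lambda>i. x i - z i) I \<le> L2_set (\<lambda>i. x i - y i) I + L2_set (\<lambda>i. y i - z i) I"
  using L2_set_triangle_ineq[of "\<lambda>i. x i - y i" "\<lambda>i. y i - z i" I] by simp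

lemma L2_set_minus_commute: "L2_set (\<lambda>i. x i - y i) I = L2_set (\<lambda>i. y i - x i) I"
  by (simp add: L2_set_def power2_commute)

lemma scaled_diff_le:
  assumes "N \<ge> 1" "u \<in> sphere_N N" "u' \<in> sphere_N N" "0 \<le> s'" "s' \<le> 1"
  shows "L2_set (\<lambda>i. scaled N s u i - scaled N s' u' i) {..<N} \<le> \<bar>s - s'\<bar> * sqrt (real N) + L2_set (\<lambda>i. u i - u' i) {..<N}"
proof -
  have "L2_set (\<lambda>i. scaled N s u i - scaled N s' u' i) {..<N} = L2_set (\<lambda>i. (s - s') * u i + s' * (u i - u' i)) {..<N}"
    by (intro L2_set_cong) (auto simp: scaled_def algebra_simps)
  also have "\<dots> \<le> L2_set (\<lambda>i. (s - s') * u i) {..<N} + L2_set (\<lambda>i. s' * (u i - u' i)) {..<N}"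
    by (rule L2_set_triangle_ineq)
  also have "L2_set (\<lambda>i. (s - s') * u i) {..<N} = L2_set (\<lambda>i. \<bar>s - s'\<bar> * u i) {..<N}"
    by (simp add: L2_set_def power_mult_distrib)
  also have "\<dots> = \<bar>s - s'\<bar> * sqrt (real N)"
    using sphere_N_L2[OF assms(2)] L2_set_right_distrib[of "\<bar>s - s'\<bar>" u "{..<N}"] by simp
  also have "L2_set (\<lambda>i. s' * (u i - u' i)) {..<N} = s' * L2_set (\<lambda>i. u i - u' i) {..<N}"
    using assms(4) by (simp add: L2_set_right_distrib)
  also have "\<dots> \<le> L2_set (\<lambda>i. u i - u' i) {..<N}"
    using assms(4,5) by (intro mult_left_le_one_le L2_set_nonneg)
  finally show ?thesis by simp
qed

text \<open>Radial projection moves y by the difference of |y| and sqrt N, which is at most the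
  distance from y to any point x of the sphere; the triangle inequality adds that distance once
  more.\<close>

lemma vdir_dist_le:
  assumes "N \<ge> 1" "x \<in> sphere_N N" "L2_set y {..<N} \<noteq> 0"
  shows "L2_set (\<lambda>i. vdir N y i - x i) {..<N} \<le> 2 * L2_set (\<lambda>i. y i - x i) {..<N}"
proof -
  define l where "l = L2_set y {..<N}"
  have l: "l > 0" using assms(3) L2_set_nonneg[of y "{..<N}"] unfolding l_def by linarith
  have "L2_set (\<lambda>i. vdir N y i - y i) {..<N} = L2_set (\<lambda>i. \<bar>sqrt (real N) / l - 1\<bar> * y i) {..<N}"
  proof -
    have "(vdir N y i - y i)\<^sup>2 = (\<bar>sqrt (real N) / l - 1\<bar> * y i)\<^sup>2" if "i < N" for i
    proof -
      have "vdir N y i - y i = (sqrt (real N) / l - 1) * y i"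
        using that by (simp add: vdir_def l_def algebra_simps)
      then show ?thesis by (simp add: power_mult_distrib)
    qed
    then show ?thesis by (simp add: L2_set_def)
  qed
  also have "\<dots> = \<bar>sqrt (real N) / l - 1\<bar> * l" by (simp add: L2_set_right_distrib l_def)
  also have "\<dots> = \<bar>(sqrt (real N) / l - 1) * l\<bar>" using l by (simp add: abs_mult)
  also have "(sqrt (real N) / l - 1) * l = L2_set x {..<N} - L2_set y {..<N}"
    using l assms(2) by (simp add: sphere_N_L2 l_def left_diff_distrib)
  also have "\<bar>\<dots>\<bar> \<le> L2_set (\<lambda>i. y i - x i) {..<N}"
    using L2_set_triangle_diff[of x "\<lambda>_. 0" "{..<N}" y] L2_set_triangle_diff[of y "\<lambda>_. 0" "{..<N}" x]
      L2_set_minus_commute[of x y] by simp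
  finally show ?thesis
    using L2_set_triangle_diff[of "vdir N y" x "{..<N}" y] by linarith
qed

text \<open>For overlaps of normalised vectors: A is the overlap, P and Q are the squared norms, all
  known up to e. The denominator r lies within e of D, hence above 1/2, and |A - c r| \<le> 2
  e.\<close>

lemma quotient_near:
  fixes A P Q c D e :: real
  assumes "\<bar>A - c * D\<bar> \<le> e" "\<bar>P - D\<bar> \<le> e" "\<bar>Q - D\<bar> \<le> e" "D \<ge> 1" "e \<le> 1/2" "\<bar>c\<bar> \<le> 1"
  shows "\<bar>A / (sqrt P * sqrt Q) - c\<bar> \<le> 4 * e"
proof -
  define r where "r = sqrt P * sqrt Q"
  have e: "e \<ge> 0" using assms(1) by linarith
  have PQ: "D - e \<le> P" "P \<le> D + e" "D - e \<le> Q" "Q \<le> D + e" using assms by linarith+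
  have lo: "D - e \<le> r"
  proof -
    have "sqrt (D - e) * sqrt (D - e) \<le> sqrt P * sqrt Q"
      using PQ assms by (intro mult_mono) auto
    then show ?thesis using assms by (simp add: r_def)
  qed
  have hi: "r \<le> D + e"
  proof -
    have "sqrt P * sqrt Q \<le> sqrt (D + e) * sqrt (D + e)"
      using PQ assms by (intro mult_mono) auto
    then show ?thesis using assms e by (simp add: r_def)
  qed
  have r: "r \<ge> 1/2" using lo assms by linarith
  have "\<bar>c * (D - r)\<bar> \<le> 1 * e"
    unfolding abs_mult using assms lo hi by (intro mult_mono) auto
  moreover have "A - c * r = (A - c * D) + c * (D - r)" by (simp add: algebra_simps)
  ultimately have "\<bar>A - c * r\<bar> \<le> 2 * e" using assms(1) by linarith
  moreover have "A / r - c = (A - c * r) / r" using r by (simp add: field_simps)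
  ultimately have "\<bar>A / r - c\<bar> \<le> 2 * e / r"
    using r by (simp add: abs_divide divide_right_mono)
  also have "\<dots> \<le> 2 * e / (1/2)" using r e by (intro divide_left_mono) auto
  finally show ?thesis by (simp add: r_def)
qed

text \<open>The source of the slack: the mean of a and s with weights 1 and
  \<open>\<alpha>\<^sup>2\<close> differs from s by (a - s) / (1 +
  \<open>\<alpha>\<^sup>2\<close>).\<close>

lemma contraction_near:
  fixes a \<alpha> s :: real
  assumes "\<bar>a - s\<bar> \<le> \<delta>"
  shows "\<bar>(a + \<alpha>\<^sup>2 * s) / (1 + \<alpha>\<^sup>2) - s\<bar> \<le> \<delta> / (1 + \<alpha>\<^sup>2)"
proof -
  have "1 + \<alpha>\<^sup>2 > 0" by (simp add: add_pos_nonneg)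
  then have "(a + \<alpha>\<^sup>2 * s) / (1 + \<alpha>\<^sup>2) - s = (a - s) / (1 + \<alpha>\<^sup>2)"
    by (simp add: field_simps)
  then show ?thesis using assms by (simp add: abs_divide divide_right_mono add_nonneg_nonneg)
qed

text \<open>A unit vector has few large coordinates, so some coordinate axes are almost orthogonal to a given finite family.\<close>

lemma small_coordinates:
  assumes V: "finite V" "V \<subseteq> sphere_N N" and x: "x > 0" and N: "N \<ge> 1"
    and big: "real k + real (card V) / x\<^sup>2 \<le> real N"
  shows "\<exists>G\<subseteq>{..<N}. card G \<ge> k \<and> (\<forall>j\<in>G. \<forall>v\<in>V. \<bar>overlap N v (axis0 N j)\<bar> \<le> x)"
proof -
  define bad where "bad v = {j\<in>{..<N}. \<bar>overlap N v (axis0 N j)\<bar> > x}" for v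
  have card_bad: "real (card (bad v)) \<le> 1 / x\<^sup>2" if "v \<in> V" for v
  proof -
    have v: "v \<in> sphere_N N" using that V by blast
    have "real (card (bad v)) * x\<^sup>2 = (\<Sum>j\<in>bad v. x\<^sup>2)" by simp
    also have "\<dots> \<le> (\<Sum>j\<in>bad v. (v j)\<^sup>2 / real N)"
    proof (rule sum_mono)
      fix j assume j: "j \<in> bad v"
      then have "j < N" "x < \<bar>overlap N v (axis0 N j)\<bar>" by (auto simp: bad_def)
      then have "x < \<bar>v j / sqrt (real N)\<bar>" by (simp add: overlap_axis0)
      then have "x\<^sup>2 \<le> \<bar>v j / sqrt (real N)\<bar>\<^sup>2" using x by (intro power_mono) auto
      then show "x\<^sup>2 \<le> (v j)\<^sup>2 / real N" by (simp add: power_divide)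
    qed
    also have "\<dots> \<le> (\<Sum>j<N. (v j)\<^sup>2 / real N)" by (rule sum_mono2) (auto simp: bad_def)
    also have "\<dots> = overlap N v v" by (simp add: overlap_def sum_divide_distrib power2_eq_square)
    also have "\<dots> = 1" using v N by (simp add: sphere_N_iff)
    finally show ?thesis using x by (simp add: field_simps)
  qed
  define G where "G = {..<N} - (\<Union>v\<in>V. bad v)"
  have "real (card (\<Union>v\<in>V. bad v)) \<le> (\<Sum>v\<in>V. real (card (bad v)))"
    using of_nat_mono[OF card_UN_le[OF V(1), of bad], where 'a=real] by simp
  also have "\<dots> \<le> (\<Sum>v\<in>V. 1 / x\<^sup>2)" by (intro sum_mono card_bad)
  finally have "real (card (\<Union>v\<in>V. bad v)) \<le> real (card V) / x\<^sup>2" by simp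
  moreover have "card G = N - card (\<Union>v\<in>V. bad v)"
    unfolding G_def using V by (subst card_Diff_subset) (auto simp: bad_def)
  moreover have "card (\<Union>v\<in>V. bad v) \<le> N"
    using card_mono[of "{..<N}" "\<Union>v\<in>V. bad v"] by (auto simp: bad_def)
  ultimately have "real k \<le> real (card G)" using big by (simp add: of_nat_diff)
  moreover have "\<bar>overlap N v (axis0 N j)\<bar> \<le> x" if "j \<in> G" "v \<in> V" for j v
    using that by (auto simp: G_def bad_def)
  ultimately show ?thesis by (intro exI[of _ G]) (auto simp: G_def)
qed

lemma overlap_axis0_axis0: "k < N \<Longrightarrow> j < N \<Longrightarrow> overlap N (axis0 N k) (axis0 N j) = (if k = j then 1 else 0)"
  by (simp add: overlap_axis0) (auto simp: axis0_def)

text \<open>A target with ideal overlaps: s with axis k and, for two different j, s^2 with each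
  other. These are the values prescribed at the centre of a band of relative radius s.\<close>

definition mix :: "nat \<Rightarrow> real \<Rightarrow> nat \<Rightarrow> nat \<Rightarrow> nat \<Rightarrow> real" where
  "mix N s k j = (\<lambda>i\<in>{..<N}. s * axis0 N k i + sqrt (1 - s\<^sup>2) * axis0 N j i)"

lemma overlap_mix: 
  "overlap N (mix N s k j) y = s * overlap N (axis0 N k) y + sqrt (1 - s\<^sup>2) * overlap N (axis0 N j) y"
  "overlap N y (mix N s k j) = s * overlap N y (axis0 N k) + sqrt (1 - s\<^sup>2) * overlap N y (axis0 N j)"
  by (simp_all add: mix_def overlap_linear)

lemma mix_in_sphere_N:
  assumes "k < N" "j < N" "k \<noteq> j" "0 \<le> s" "s \<le> 1"
  shows "mix N s k j \<in> sphere_N N"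
proof -
  have s: "s\<^sup>2 \<le> 1" using assms by (simp add: power_le_one)
  have "overlap N (mix N s k j) (mix N s k j) = 1"
    unfolding overlap_mix using assms s by (simp add: overlap_axis0_axis0 power2_eq_square)
  moreover have "mix N s k j \<in> {..<N} \<rightarrow>\<^sub>E UNIV" by (simp add: mix_def)
  ultimately show ?thesis using assms by (subst sphere_N_iff) auto
qed

lemma overlap_vdir_vdir:
  assumes "N \<ge> 1"
  shows "overlap N (vdir N x) (vdir N y) = overlap N x y / (sqrt (overlap N x x) * sqrt (overlap N y y))"
  using assms by (simp add: overlap_vdir_left overlap_vdir_right L2_set_overlap)

context haar
begin

text \<open>Applying to all replicas the rotation that takes u to u' preserves the measure and
  carries one band into the other. A replica and the centre each move by at most the distance
  between u and u', hence the factor 2.\<close>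

lemma partition_rotate_le:
  assumes h: "h \<in> borel_measurable (vec_borel N)" and \<beta>: "\<beta> \<ge> 0" and L: "lipschitz_N N L h" "L \<ge> 0"
    and u: "u \<in> sphere_N N" "u' \<in> sphere_N N" and s: "0 < s" "s \<le> 1"
  shows "partition_nn N \<mu> \<beta> h (scaled N s u) n \<rho> \<delta>
    \<le> ennreal (exp (\<beta> * (real n * (L * (2 * L2_set (\<lambda>i. u i - u' i) {..<N}))))) * partition_nn N \<mu> \<beta> h (scaled N s u') n \<rho> \<delta>"
proof -
  obtain Q where Q: "\<And>x. x \<in> sphere_N N \<Longrightarrow> Q x \<in> sphere_N N" "\<And>x y. overlap N (Q x) (Q y) = overlap N x y"
    "Q u = u'" "\<And>x. x \<in> sphere_N N \<Longrightarrow> overlap N (Q x) x \<ge> overlap N u u'"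
    "Q \<in> measurable \<mu> \<mu>" "\<And>f. f \<in> borel_measurable \<mu> \<Longrightarrow> (\<integral>\<^sup>+\<sigma>. f (Q \<sigma>) \<partial>\<mu>) = (\<integral>\<^sup>+\<sigma>. (f \<sigma> :: ennreal) \<partial>\<mu>)"
    by (rule rotation_exists[OF u]) (rule that)
  let ?d = "L2_set (\<lambda>i. u i - u' i) {..<N}"
  have "partition_nn N \<mu> \<beta> h (scaled N s u) n \<rho> \<delta>
     \<le> ennreal (exp (\<beta> * (real n * (L * (2 * ?d))))) * 1 ^ n * (\<Sum>\<kappa>\<in>{()}. partition_nn N \<mu> \<beta> h (scaled N s u') n \<rho> \<delta>)"
  proof (rule partition_transport[where T="\<lambda>_ _. Q", OF h \<beta>])
    fix \<sigma> assume "\<sigma> \<in> replica_band N (scaled N s u) n \<rho> \<delta>"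
    then have \<sigma>: "\<sigma> \<in> {..<n} \<rightarrow>\<^sub>E sphere_N N" "\<And>i. i < n \<Longrightarrow> \<bar>overlap N (\<sigma> i) u - s\<bar> \<le> \<delta>"
       "\<And>i j. i < n \<Longrightarrow> j < n \<Longrightarrow> i \<noteq> j \<Longrightarrow> \<bar>overlap N (\<sigma> i) (\<sigma> j) - s\<^sup>2\<bar> < \<rho>"
      unfolding replica_band_scaled[OF u(1) s(1) N1] by auto
    have \<sigma>i: "\<sigma> i \<in> sphere_N N" if "i < n" for i using \<sigma>(1) that by (auto simp: PiE_iff)
    have "(\<lambda>i\<in>{..<n}. Q (\<sigma> i)) \<in> replica_band N (scaled N s u') n \<rho> \<delta>"
      unfolding replica_band_scaled[OF u(2) s(1) N1]
      using \<sigma>(2,3) \<sigma>i Q(1,2) Q(2)[of _ u] by (auto simp: Q(3))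
    moreover have "(\<Sum>i<n. h (\<sigma> i) - h (scaled N s u)) \<le> (\<Sum>i<n. (h (Q (\<sigma> i)) - h (scaled N s u')) + L * (2 * ?d))"
    proof (rule sum_mono)
      fix i assume "i \<in> {..<n}"
      then have i: "\<sigma> i \<in> sphere_N N" by (simp add: \<sigma>i)
      have "L2_set (\<lambda>k. \<sigma> i k - Q (\<sigma> i) k) {..<N} \<le> ?d"
        unfolding L2_set_diff_sphere[OF N1 i Q(1)[OF i]] L2_set_diff_sphere[OF N1 u]
        using Q(4)[OF i] by (simp add: overlap_commute[of N "\<sigma> i"] mult_left_mono)
      then have "L * L2_set (\<lambda>k. \<sigma> i k - Q (\<sigma> i) k) {..<N} \<le> L * ?d" using L(2) by (rule mult_left_mono)
      moreover have "\<bar>h (\<sigma> i) - h (Q (\<sigma> i))\<bar> \<le> L * L2_set (\<lambda>k. \<sigma> i k - Q (\<sigma> i) k) {..<N}"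
        using i Q(1)[OF i] by (intro lipschitz_ND[OF L(1)] sphere_N_PiE) (auto simp: sphere_N_L2)
      moreover have "\<bar>h (scaled N s u) - h (scaled N s u')\<bar> \<le> L * L2_set (\<lambda>k. scaled N s u k - scaled N s u' k) {..<N}"
        using s u by (intro lipschitz_ND[OF L(1)] scaled_PiE scaled_L2_le) auto
      moreover have "L * L2_set (\<lambda>k. scaled N s u k - scaled N s u' k) {..<N} \<le> L * ?d"
        using scaled_diff_le[OF N1 u, of s s] s L(2) by (intro mult_left_mono) auto
      ultimately show "h (\<sigma> i) - h (scaled N s u) \<le> (h (Q (\<sigma> i)) - h (scaled N s u')) + L * (2 * ?d)"
        by (simp add: algebra_simps abs_le_iff)
    qed
    ultimately show "\<exists>\<kappa>\<in>{()}. (\<lambda>i\<in>{..<n}. Q (\<sigma> i)) \<in> replica_band N (scaled N s u') n \<rho> \<delta> \<and>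
      (\<Sum>i<n. h (\<sigma> i) - h (scaled N s u)) \<le> (\<Sum>i<n. h (Q (\<sigma> i)) - h (scaled N s u')) + real n * (L * (2 * ?d))"
      by (simp add: sum.distrib)
  qed (use Q(5,6) in auto)
  then show ?thesis by simp
qed

text \<open>The targets have ideal overlaps among themselves and with the axis that pulls u, and
  they are nearly orthogonal to all \<open>\<sigma> i\<close> and to u. All squared norms become 1 +
  \<open>\<alpha>\<^sup>2\<close> up to 2 x, and the defects of the band shrink by that factor. The
  slack of half of \<open>\<alpha>\<^sup>2\<close> times the tolerance pays 8 x for the mixed terms,
  by \<open>quotient_near\<close> with e = 2 x, and at most 2 r for the passage from s to
  s'.\<close>

lemma shifted_replica:
  assumes \<alpha>: "0 < \<alpha>" "\<alpha> \<le> 1/2" and u: "u \<in> sphere_N N" and s: "0 < s" "s \<le> 1" "0 < s'" "s' \<le> 1" "\<bar>s - s'\<bar> \<le> r"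
    and x: "0 \<le> x" "8 * x + 2 * r \<le> \<delta> * \<alpha>\<^sup>2 / 2" "8 * x + 2 * r \<le> \<rho> * \<alpha>\<^sup>2 / 2" "x \<le> 1 / 4"
    and \<sigma>: "\<sigma> \<in> replica_band N (scaled N s u) n \<rho> \<delta>"
    and \<kappa>: "inj_on \<kappa> {..n}" "\<And>i. i \<le> n \<Longrightarrow> \<kappa> i < N"
      "\<And>i. i \<le> n \<Longrightarrow> \<bar>overlap N u (axis0 N (\<kappa> i))\<bar> \<le> x"
      "\<And>i j. i \<le> n \<Longrightarrow> j < n \<Longrightarrow> \<bar>overlap N (\<sigma> j) (axis0 N (\<kappa> i))\<bar> \<le> x"
  shows "(\<lambda>i\<in>{..<n}. vdir N (\<lambda>k. \<sigma> i k + \<alpha> * mix N s (\<kappa> n) (\<kappa> i) k))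
    \<in> replica_band N (scaled N s' (vdir N (\<lambda>k. u k + \<alpha> * axis0 N (\<kappa> n) k))) n \<rho> \<delta>"
proof -
  define D where "D = 1 + \<alpha>\<^sup>2"
  have D: "D \<ge> 1" by (simp add: D_def)
  have \<alpha>2: "\<alpha>\<^sup>2 \<le> 1" using \<alpha> by (simp add: power_le_one)
  have \<sigma>': "\<sigma> \<in> {..<n} \<rightarrow>\<^sub>E sphere_N N" "\<And>i. i < n \<Longrightarrow> \<bar>overlap N (\<sigma> i) u - s\<bar> \<le> \<delta>"
       "\<And>i j. i < n \<Longrightarrow> j < n \<Longrightarrow> i \<noteq> j \<Longrightarrow> \<bar>overlap N (\<sigma> i) (\<sigma> j) - s\<^sup>2\<bar> < \<rho>"
    using \<sigma> unfolding replica_band_scaled[OF u(1) s(1) N1] by auto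
  have \<sigma>i: "\<sigma> i \<in> sphere_N N" if "i < n" for i using \<sigma>'(1) that by (auto simp: PiE_iff)
  have \<kappa>ne: "\<kappa> i \<noteq> \<kappa> j" if "i \<le> n" "j \<le> n" "i \<noteq> j" for i j
    using \<kappa>(1) that by (auto simp: inj_on_def)
  have self: "overlap N v v = 1" if "v \<in> sphere_N N" for v using that N1 by (simp add: sphere_N_iff)
  define w where "w i = mix N s (\<kappa> n) (\<kappa> i)" for i
  define y where "y i = (\<lambda>k. \<sigma> i k + \<alpha> * w i k)" for i
  define z where "z = (\<lambda>k. u k + \<alpha> * axis0 N (\<kappa> n) k)"
  have w: "w i \<in> sphere_N N" if "i < n" for i
    unfolding w_def using that \<kappa>(2) \<kappa>ne s by (intro mix_in_sphere_N) auto
  have a0: "axis0 N (\<kappa> n) \<in> sphere_N N" using \<kappa>(2) by (intro axis0_in_sphere_N) auto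
  have s2: "s\<^sup>2 \<le> 1" "sqrt (1 - s\<^sup>2) \<le> 1" "sqrt (1 - s\<^sup>2) \<ge> 0" using s by (auto simp: power_le_one)
  have mixb: "\<bar>overlap N v (w i)\<bar> \<le> 2 * x"
    if "i < n" "\<bar>overlap N v (axis0 N (\<kappa> n))\<bar> \<le> x" "\<bar>overlap N v (axis0 N (\<kappa> i))\<bar> \<le> x" for v i
  proof -
    have "\<bar>s * overlap N v (axis0 N (\<kappa> n))\<bar> \<le> 1 * x" unfolding abs_mult using s that x by (intro mult_mono) auto
    moreover have "\<bar>sqrt (1 - s\<^sup>2) * overlap N v (axis0 N (\<kappa> i))\<bar> \<le> 1 * x"
      unfolding abs_mult using s2 that x by (intro mult_mono) auto
    ultimately show ?thesis unfolding w_def overlap_mix by linarith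
  qed
  have \<sigma>w: "\<bar>overlap N (\<sigma> j) (w i)\<bar> \<le> 2 * x" if "i < n" "j < n" for i j
    using that \<kappa>(4) by (intro mixb) auto
  have uw: "\<bar>overlap N u (w i)\<bar> \<le> 2 * x" if "i < n" for i
    using that \<kappa>(3) by (intro mixb) auto
  have aw: "overlap N (axis0 N (\<kappa> n)) (w i) = s" if "i < n" for i
    unfolding w_def overlap_mix using that \<kappa>(2) \<kappa>ne by (simp add: overlap_axis0_axis0)
  have ww: "overlap N (w i) (w j) = s\<^sup>2" if "i < n" "j < n" "i \<noteq> j" for i j
    unfolding w_def overlap_mix using that \<kappa>(2) \<kappa>ne by (simp add: overlap_axis0_axis0 power2_eq_square)
  have sm: "\<bar>\<alpha> * t\<bar> \<le> x" if "\<bar>t\<bar> \<le> 2 * x" for t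
    unfolding abs_mult using that \<alpha> x mult_mono[of "\<bar>\<alpha>\<bar>" "1/2" "\<bar>t\<bar>" "2 * x"] by auto
  have yy: "\<bar>overlap N (y i) (y i) - D\<bar> \<le> 2 * x" if "i < n" for i
  proof -
    have "overlap N (y i) (y i) - D = \<alpha> * overlap N (\<sigma> i) (w i) + \<alpha> * overlap N (\<sigma> i) (w i)"
      unfolding y_def D_def overlap_add_left overlap_add_right overlap_scale_left overlap_scale_right
      using self[OF \<sigma>i[OF that]] self[OF w[OF that]]
      by (simp add: overlap_commute[of N "w i" "\<sigma> i"] power2_eq_square algebra_simps)
    then show ?thesis using sm[OF \<sigma>w[OF that that]] by linarith
  qed
  have zz: "\<bar>overlap N z z - D\<bar> \<le> 2 * x"
  proof -
    have "overlap N z z - D = \<alpha> * overlap N u (axis0 N (\<kappa> n)) + \<alpha> * overlap N u (axis0 N (\<kappa> n))"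
      unfolding z_def D_def overlap_add_left overlap_add_right overlap_scale_left overlap_scale_right
      using self[OF u] self[OF a0]
      by (simp add: overlap_commute[of N "axis0 N (\<kappa> n)" u] power2_eq_square algebra_simps)
    then show ?thesis using sm[of "overlap N u (axis0 N (\<kappa> n))"] \<kappa>(3)[of n] x by auto
  qed
  have yz: "\<bar>overlap N (y i) z - (overlap N (\<sigma> i) u + \<alpha>\<^sup>2 * s)\<bar> \<le> 2 * x" if "i < n" for i
  proof -
    have "overlap N (y i) z - (overlap N (\<sigma> i) u + \<alpha>\<^sup>2 * s) = \<alpha> * overlap N (\<sigma> i) (axis0 N (\<kappa> n)) + \<alpha> * overlap N u (w i)"
      unfolding y_def z_def overlap_add_left overlap_add_right overlap_scale_left overlap_scale_right
      using aw[OF that]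
      by (simp add: overlap_commute[of N "w i" u] overlap_commute[of N "w i" "axis0 N (\<kappa> n)"]
          power2_eq_square algebra_simps)
    then show ?thesis using sm[OF uw[OF that]] sm[of "overlap N (\<sigma> i) (axis0 N (\<kappa> n))"] \<kappa>(4)[of n i] that x by auto
  qed
  have yy': "\<bar>overlap N (y i) (y j) - (overlap N (\<sigma> i) (\<sigma> j) + \<alpha>\<^sup>2 * s\<^sup>2)\<bar> \<le> 2 * x" if "i < n" "j < n" "i \<noteq> j" for i j
  proof -
    have "overlap N (y i) (y j) - (overlap N (\<sigma> i) (\<sigma> j) + \<alpha>\<^sup>2 * s\<^sup>2) = \<alpha> * overlap N (\<sigma> i) (w j) + \<alpha> * overlap N (\<sigma> j) (w i)"
      unfolding y_def overlap_add_left overlap_add_right overlap_scale_left overlap_scale_right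
      using ww[OF that] by (simp add: overlap_commute[of N "w i" "\<sigma> j"] power2_eq_square algebra_simps)
    then show ?thesis using sm[OF \<sigma>w[of j i]] sm[OF \<sigma>w[of i j]] that by auto
  qed
  have cle: "\<bar>(a + \<alpha>\<^sup>2 * b) / D\<bar> \<le> 1" if "\<bar>a\<bar> \<le> 1" "\<bar>b\<bar> \<le> 1" for a b
  proof -
    have "\<bar>\<alpha>\<^sup>2 * b\<bar> \<le> \<alpha>\<^sup>2 * 1" unfolding abs_mult using that by (intro mult_mono) auto
    then have "\<bar>a + \<alpha>\<^sup>2 * b\<bar> \<le> D" using that unfolding D_def by linarith
    then show ?thesis using D by (simp add: abs_divide)
  qed
  \<comment> \<open>1 - 1 / D = \<open>\<alpha>\<^sup>2\<close> / D, and D is at most 2.\<close>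
  have slack: "d / D + d * \<alpha>\<^sup>2 / 2 \<le> d" if "d \<ge> 0" for d
  proof -
    have "d / D + d * \<alpha>\<^sup>2 / D = d * D / D" by (simp add: D_def add_divide_distrib distrib_left)
    then have "d / D + d * \<alpha>\<^sup>2 / D = d" using D by simp
    moreover have "d * \<alpha>\<^sup>2 / 2 \<le> d * \<alpha>\<^sup>2 / D"
    proof -
      have "D \<le> 2" using \<alpha>2 by (simp add: D_def)
      then show ?thesis using that D by (intro divide_left_mono) auto
    qed
    ultimately show ?thesis by linarith
  qed
  have r0: "r \<ge> 0" using s by linarith
  have x8: "4 * (2 * x) = 8 * x" by simp
  have y_nz: "L2_set (y i) {..<N} \<noteq> 0" if "i < n" for i
    unfolding y_def using \<sigma>i[OF that] w[OF that] \<alpha> by (intro shift_nonzero) auto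
  have z_nz: "L2_set z {..<N} \<noteq> 0"
    unfolding z_def using u a0 \<alpha> by (intro shift_nonzero) auto
  have vz: "vdir N z \<in> sphere_N N" using z_nz N1 by (intro vdir_in_sphere_N)
  have 1: "\<bar>overlap N (vdir N (y i)) (vdir N z) - s'\<bar> \<le> \<delta>" if i: "i < n" for i
  proof -
    define c where "c = (overlap N (\<sigma> i) u + \<alpha>\<^sup>2 * s) / D"
    have \<delta>: "\<delta> \<ge> 0" using \<sigma>'(2)[OF i] by linarith
    have "\<bar>overlap N (y i) z / (sqrt (overlap N (y i) (y i)) * sqrt (overlap N z z)) - c\<bar> \<le> 4 * (2 * x)"
    proof (rule quotient_near[OF _ yy[OF i] zz D])
      show "\<bar>overlap N (y i) z - c * D\<bar> \<le> 2 * x" using yz[OF i] D by (simp add: c_def)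
      show "\<bar>c\<bar> \<le> 1" unfolding c_def using s \<sigma>i[OF i] u N1 by (intro cle sphere_N_abs_overlap_le) auto
    qed (use x in auto)
    moreover have "\<bar>c - s\<bar> \<le> \<delta> / D"
      unfolding c_def D_def by (rule contraction_near[OF \<sigma>'(2)[OF i]])
    ultimately show ?thesis
      unfolding overlap_vdir_vdir[OF N1] using s(5) x(2) r0 slack[OF \<delta>] unfolding x8 by linarith
  qed
  have 2: "\<bar>overlap N (vdir N (y i)) (vdir N (y j)) - s'\<^sup>2\<bar> < \<rho>" if ij: "i < n" "j < n" "i \<noteq> j" for i j
  proof -
    define c where "c = (overlap N (\<sigma> i) (\<sigma> j) + \<alpha>\<^sup>2 * s\<^sup>2) / D"
    define d where "d = \<bar>overlap N (\<sigma> i) (\<sigma> j) - s\<^sup>2\<bar>"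
    have d: "d \<ge> 0" "d < \<rho>" using \<sigma>'(3)[OF ij] by (auto simp: d_def)
    have "\<bar>overlap N (y i) (y j) / (sqrt (overlap N (y i) (y i)) * sqrt (overlap N (y j) (y j))) - c\<bar> \<le> 4 * (2 * x)"
    proof (rule quotient_near[OF _ yy[OF ij(1)] yy[OF ij(2)] D])
      show "\<bar>overlap N (y i) (y j) - c * D\<bar> \<le> 2 * x" using yy'[OF ij] D by (simp add: c_def)
      show "\<bar>c\<bar> \<le> 1" unfolding c_def using s2 \<sigma>i[OF ij(1)] \<sigma>i[OF ij(2)] N1 by (intro cle sphere_N_abs_overlap_le) auto
    qed (use x in auto)
    moreover have "\<bar>c - s\<^sup>2\<bar> \<le> d / D"
      unfolding c_def D_def by (rule contraction_near) (simp add: d_def)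
    moreover have "d / D < \<rho> / D" using d D by (simp add: divide_strict_right_mono)
    moreover have "\<bar>s\<^sup>2 - s'\<^sup>2\<bar> \<le> 2 * r"
    proof -
      have "s\<^sup>2 - s'\<^sup>2 = (s + s') * (s - s')" by (simp add: power2_eq_square algebra_simps)
      then have "\<bar>s\<^sup>2 - s'\<^sup>2\<bar> = \<bar>s + s'\<bar> * \<bar>s - s'\<bar>" by (simp add: abs_mult)
      also have "\<dots> \<le> 2 * r" using s by (intro mult_mono) auto
      finally show ?thesis .
    qed
    ultimately show ?thesis
      unfolding overlap_vdir_vdir[OF N1] using x(3) slack[of \<rho>] d unfolding x8 by linarith
  qed
  have "(\<lambda>i\<in>{..<n}. vdir N (y i)) \<in> replica_band N (scaled N s' (vdir N z)) n \<rho> \<delta>"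
    unfolding replica_band_scaled[OF vz s(3) N1] using 1 2 y_nz N1 by (auto intro!: vdir_in_sphere_N)
  then show ?thesis unfolding y_def z_def w_def .
qed


text \<open>A pull changes the radius and turns the direction u into \<open>z \<kappa>\<close>; a
  rotation then takes \<open>z \<kappa>\<close> to u'. Axes nearly orthogonal to all replicas depend
  on the configuration, which is why \<kappa> ranges over all injective choices and the factor
  \<open>N ^ (n + 1)\<close> appears.\<close>

lemma partition_compare:
  assumes h: "h \<in> borel_measurable (vec_borel N)" and \<beta>: "\<beta> \<ge> 0" and L: "lipschitz_N N L h" "L \<ge> 0"
    and \<alpha>: "0 < \<alpha>" "\<alpha> \<le> 1/2" and u: "u \<in> sphere_N N" "u' \<in> sphere_N N"
    and s: "0 < s" "s \<le> 1" "0 < s'" "s' \<le> 1" "\<bar>s - s'\<bar> \<le> r"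
    and x: "0 < x" "8 * x + 2 * r \<le> \<delta> * \<alpha>\<^sup>2 / 2" "8 * x + 2 * r \<le> \<rho> * \<alpha>\<^sup>2 / 2" "x \<le> 1 / 4"
    and big: "(real n + 1) * (1 + 1 / x\<^sup>2) \<le> real N"
  shows "partition_nn N \<mu> \<beta> h (scaled N s u) n \<rho> \<delta>
    \<le> ennreal (exp (\<beta> * (real n * (L * (sqrt (real N) * (8 * \<alpha> + r) + 2 * L2_set (\<lambda>i. u i - u' i) {..<N}))))
        * ((1 + \<alpha>) ^ N / (1 - \<alpha>)) ^ n * real N ^ (n + 1))
      * partition_nn N \<mu> \<beta> h (scaled N s' u') n \<rho> \<delta>"
proof -
  \<comment> \<open>\<open>\<kappa> n\<close> is the axis shared by the centre and all replicas,
    \<open>\<kappa> i\<close> the private axis of replica i. Injectivity makes these n + 1 axes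
    pairwise orthogonal.\<close>
  define \<K> where "\<K> = {\<kappa> \<in> {..n} \<rightarrow>\<^sub>E {..<N}. inj_on \<kappa> {..n}}"
  have finK: "finite \<K>" unfolding \<K>_def by (intro finite_subset[OF _ finite_PiE[of "{..n}" "\<lambda>_. {..<N}"]]) auto
  have cardK: "card \<K> \<le> N ^ (n + 1)"
  proof -
    have "card \<K> \<le> card ({..n} \<rightarrow>\<^sub>E {..<N})" unfolding \<K>_def by (intro card_mono finite_PiE) auto
    also have "\<dots> = N ^ (n + 1)" by (simp add: card_PiE)
    finally show ?thesis .
  qed
  define K where "K = (1 + \<alpha>) ^ N / (1 - \<alpha>)"
  have K0: "K \<ge> 0" using \<alpha> by (simp add: K_def)
  define T where "T \<kappa> i \<sigma> = vdir N (\<lambda>k. \<sigma> k + \<alpha> * mix N s (\<kappa> n) (\<kappa> i) k)" for \<kappa> i \<sigma>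
  define z where "z \<kappa> = vdir N (\<lambda>k. u k + \<alpha> * axis0 N (\<kappa> n) k)" for \<kappa> :: "nat \<Rightarrow> nat"
  let ?d = "L2_set (\<lambda>i. u i - u' i) {..<N}"
  have \<kappa>D: "\<kappa> i < N" "i < n \<Longrightarrow> \<kappa> n \<noteq> \<kappa> i" if "\<kappa> \<in> \<K>" "i \<le> n" for \<kappa> i
  proof -
    show "\<kappa> i < N" using that by (auto simp: \<K>_def PiE_iff)
    assume "i < n"
    then show "\<kappa> n \<noteq> \<kappa> i" using that inj_onD[of \<kappa> "{..n}" n i] by (auto simp: \<K>_def)
  qed
  have mix: "mix N s (\<kappa> n) (\<kappa> i) \<in> sphere_N N" if "\<kappa> \<in> \<K>" "i < n" for \<kappa> i
    using \<kappa>D[OF that(1), of i] \<kappa>D(1)[OF that(1), of n] that s by (intro mix_in_sphere_N) auto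
  have shift_dist: "vdir N (\<lambda>k. v k + \<alpha> * w k) \<in> sphere_N N \<and> L2_set (\<lambda>k. vdir N (\<lambda>k. v k + \<alpha> * w k) k - v k) {..<N} \<le> sqrt (real N) * (2 * \<alpha>)"
    if "v \<in> sphere_N N" "w \<in> sphere_N N" for v w
  proof -
    have nz: "L2_set (\<lambda>k. v k + \<alpha> * w k) {..<N} \<noteq> 0" using that \<alpha> by (intro shift_nonzero) auto
    have "L2_set (\<lambda>k. (v k + \<alpha> * w k) - v k) {..<N} = \<alpha> * sqrt (real N)"
      using \<alpha> that(2) by (simp add: L2_set_right_distrib[symmetric] sphere_N_L2)
    with vdir_dist_le[OF N1 that(1) nz] nz show ?thesis by (auto intro!: vdir_in_sphere_N N1 simp: mult_ac)
  qed
  have zs: "z \<kappa> \<in> sphere_N N" "L2_set (\<lambda>k. z \<kappa> k - u k) {..<N} \<le> sqrt (real N) * (2 * \<alpha>)" if "\<kappa> \<in> \<K>" for \<kappa>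
    using shift_dist[OF u(1) axis0_in_sphere_N[OF \<kappa>D(1)[OF that le_refl]]] by (auto simp: z_def)
  have Ts: "T \<kappa> i v \<in> sphere_N N" "L2_set (\<lambda>k. T \<kappa> i v k - v k) {..<N} \<le> sqrt (real N) * (2 * \<alpha>)"
    if "\<kappa> \<in> \<K>" "i < n" "v \<in> sphere_N N" for \<kappa> i v
    using shift_dist[OF that(3) mix[OF that(1,2)]] by (auto simp: T_def)
  have r0: "r \<ge> 0" using s by linarith
  have "partition_nn N \<mu> \<beta> h (scaled N s u) n \<rho> \<delta>
     \<le> ennreal (exp (\<beta> * (real n * (L * (sqrt (real N) * (4 * \<alpha> + r)))))) * ennreal K ^ n * (\<Sum>\<kappa>\<in>\<K>. partition_nn N \<mu> \<beta> h (scaled N s' (z \<kappa>)) n \<rho> \<delta>)"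
  proof (rule partition_transport[where T=T, OF h \<beta> finK])
    show "T \<kappa> i \<in> measurable \<mu> \<mu>" if "\<kappa> \<in> \<K>" "i < n" for \<kappa> i
    proof (rule measurable_haarI)
      show "T \<kappa> i \<in> measurable \<mu> (vec_borel N)" unfolding T_def by (rule measurable_vdir) measurable
    qed (use Ts(1)[OF that] in \<open>auto simp: space_haar\<close>)
    show "(\<integral>\<^sup>+\<sigma>. f (T \<kappa> i \<sigma>) \<partial>\<mu>) \<le> ennreal K * (\<integral>\<^sup>+\<sigma>. f \<sigma> \<partial>\<mu>)"
      if \<kappa>: "\<kappa> \<in> \<K>" "i < n" and f: "f \<in> borel_measurable \<mu>" for \<kappa> i f
    proof -
      \<comment> \<open>\<open>shift_le\<close> speaks of functions measurable on the whole space; f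
        is measurable on the sphere only and is extended by 0.\<close>
      define g where "g \<sigma> = (if \<sigma> \<in> sphere_N N then f \<sigma> else 0)" for \<sigma>
      have "(\<lambda>x. f x) \<in> borel_measurable (restrict_space (vec_borel N) (sphere_N N))"
        using f measurable_cong_sets[OF sets_haar refl] by blast
      then have g: "g \<in> borel_measurable (vec_borel N)"
        unfolding g_def using sphere_N_sets by (subst (asm) measurable_restrict_space_iff[where c=0]) auto
      have "(\<integral>\<^sup>+\<sigma>. f (T \<kappa> i \<sigma>) \<partial>\<mu>) = (\<integral>\<^sup>+\<sigma>. g (T \<kappa> i \<sigma>) \<partial>\<mu>)"
        using Ts(1)[OF \<kappa>] by (intro nn_integral_cong) (auto simp: g_def space_haar)
      also have "\<dots> \<le> ennreal K * (\<integral>\<^sup>+\<sigma>. g \<sigma> \<partial>\<mu>)"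
        unfolding T_def K_def using \<alpha> g mix[OF \<kappa>] by (intro shift_le) auto
      also have "(\<integral>\<^sup>+\<sigma>. g \<sigma> \<partial>\<mu>) = (\<integral>\<^sup>+\<sigma>. f \<sigma> \<partial>\<mu>)"
        by (intro nn_integral_cong) (auto simp: g_def space_haar)
      finally show ?thesis .
    qed
    fix \<sigma> assume \<sigma>: "\<sigma> \<in> replica_band N (scaled N s u) n \<rho> \<delta>"
    then have \<sigma>i: "\<sigma> i \<in> sphere_N N" if "i < n" for i
      using that unfolding replica_band_scaled[OF u(1) s(1) N1] by (auto simp: PiE_iff)
    define V where "V = insert u (\<sigma> ` {..<n})"
    have V: "finite V" "V \<subseteq> sphere_N N" "card V \<le> n + 1"
    proof -
      have "card V \<le> Suc (card (\<sigma> ` {..<n}))" unfolding V_def by (rule card_insert_le_m1[THEN order_trans]) auto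
      also have "card (\<sigma> ` {..<n}) \<le> n" using card_image_le[of "{..<n}" \<sigma>] by simp
      finally show "card V \<le> n + 1" by simp
    qed (use u \<sigma>i in \<open>auto simp: V_def\<close>)
    have "real (n + 1) + real (card V) / x\<^sup>2 \<le> real (n + 1) + real (n + 1) / x\<^sup>2"
      using V(3) by (intro add_left_mono divide_right_mono) auto
    also have "\<dots> \<le> real N" using big by (simp add: algebra_simps add_divide_distrib)
    finally obtain G where G: "G \<subseteq> {..<N}" "card G \<ge> n + 1" "\<And>j v. j \<in> G \<Longrightarrow> v \<in> V \<Longrightarrow> \<bar>overlap N v (axis0 N j)\<bar> \<le> x"
      using small_coordinates[OF V(1,2) x(1) N1, of "n + 1"] by blast
    have "card {..n} \<le> card G" using G(2) by simp
    then obtain f where f: "f ` {..n} \<subseteq> G" "inj_on f {..n}"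
      using card_le_inj[of "{..n}" G] finite_subset[OF G(1)] by auto
    define \<kappa> where "\<kappa> = restrict f {..n}"
    have \<kappa>: "\<kappa> \<in> \<K>" using f G(1) by (auto simp: \<kappa>_def \<K>_def inj_on_def image_subset_iff)
    have \<kappa>G: "\<kappa> i \<in> G" if "i \<le> n" for i using f that by (auto simp: \<kappa>_def)
    have "(\<lambda>i\<in>{..<n}. T \<kappa> i (\<sigma> i)) \<in> replica_band N (scaled N s' (z \<kappa>)) n \<rho> \<delta>"
      unfolding T_def z_def
    proof (rule shifted_replica[OF \<alpha> u(1) s _ x(2-4) \<sigma>])
      show "inj_on \<kappa> {..n}" using \<kappa> by (simp add: \<K>_def)
    qed (use \<kappa>D[OF \<kappa>] \<kappa>G G(3) x(1) in \<open>auto simp: V_def\<close>)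
    moreover have "(\<Sum>i<n. h (\<sigma> i) - h (scaled N s u)) \<le> (\<Sum>i<n. (h (T \<kappa> i (\<sigma> i)) - h (scaled N s' (z \<kappa>))) + L * (sqrt (real N) * (4 * \<alpha> + r)))"
    proof (rule sum_mono)
      fix i assume "i \<in> {..<n}"
      then have i: "i < n" by simp
      note T = Ts[OF \<kappa> i \<sigma>i[OF i]]
      have "\<bar>h (T \<kappa> i (\<sigma> i)) - h (\<sigma> i)\<bar> \<le> L * L2_set (\<lambda>k. T \<kappa> i (\<sigma> i) k - \<sigma> i k) {..<N}"
        using \<sigma>i[OF i] T(1) by (intro lipschitz_ND[OF L(1)] sphere_N_PiE) (auto simp: sphere_N_L2)
      moreover have "L * L2_set (\<lambda>k. T \<kappa> i (\<sigma> i) k - \<sigma> i k) {..<N} \<le> L * (sqrt (real N) * (2 * \<alpha>))"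
        using T(2) L(2) by (rule mult_left_mono)
      moreover have "\<bar>h (scaled N s u) - h (scaled N s' (z \<kappa>))\<bar> \<le> L * L2_set (\<lambda>k. scaled N s u k - scaled N s' (z \<kappa>) k) {..<N}"
        using s u zs[OF \<kappa>] by (intro lipschitz_ND[OF L(1)] scaled_PiE scaled_L2_le) auto
      moreover have "L * L2_set (\<lambda>k. scaled N s u k - scaled N s' (z \<kappa>) k) {..<N} \<le> L * (sqrt (real N) * (r + 2 * \<alpha>))"
      proof (rule mult_left_mono[OF _ L(2)])
        have "\<bar>s - s'\<bar> * sqrt (real N) \<le> r * sqrt (real N)" using s by (intro mult_right_mono) auto
        then show "L2_set (\<lambda>k. scaled N s u k - scaled N s' (z \<kappa>) k) {..<N} \<le> sqrt (real N) * (r + 2 * \<alpha>)"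
          using scaled_diff_le[OF N1 u(1) zs(1)[OF \<kappa>], of s' s] s zs(2)[OF \<kappa>] L2_set_minus_commute[of u "z \<kappa>" "{..<N}"]
          by (simp add: algebra_simps)
      qed
      ultimately show "h (\<sigma> i) - h (scaled N s u) \<le> (h (T \<kappa> i (\<sigma> i)) - h (scaled N s' (z \<kappa>))) + L * (sqrt (real N) * (4 * \<alpha> + r))"
        by (simp add: algebra_simps abs_le_iff)
    qed
    ultimately show "\<exists>\<kappa>\<in>\<K>. (\<lambda>i\<in>{..<n}. T \<kappa> i (\<sigma> i)) \<in> replica_band N (scaled N s' (z \<kappa>)) n \<rho> \<delta> \<and>
      (\<Sum>i<n. h (\<sigma> i) - h (scaled N s u)) \<le> (\<Sum>i<n. h (T \<kappa> i (\<sigma> i)) - h (scaled N s' (z \<kappa>))) + real n * (L * (sqrt (real N) * (4 * \<alpha> + r)))"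
      using \<kappa> by (intro bexI[of _ \<kappa>]) (auto simp: sum.distrib)
  qed
  also have "\<dots> \<le> ennreal (exp (\<beta> * (real n * (L * (sqrt (real N) * (4 * \<alpha> + r)))))) * ennreal K ^ n *
     (\<Sum>\<kappa>\<in>\<K>. ennreal (exp (\<beta> * (real n * (L * (sqrt (real N) * (4 * \<alpha>) + 2 * ?d))))) * partition_nn N \<mu> \<beta> h (scaled N s' u') n \<rho> \<delta>)"
  proof (intro mult_left_mono sum_mono)
    fix \<kappa> assume \<kappa>: "\<kappa> \<in> \<K>"
    have "L2_set (\<lambda>i. z \<kappa> i - u' i) {..<N} \<le> sqrt (real N) * (2 * \<alpha>) + ?d"
      using L2_set_triangle_diff[of "z \<kappa>" u' "{..<N}" u] zs(2)[OF \<kappa>] by linarith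
    then have "exp (\<beta> * (real n * (L * (2 * L2_set (\<lambda>i. z \<kappa> i - u' i) {..<N})))) \<le> exp (\<beta> * (real n * (L * (sqrt (real N) * (4 * \<alpha>) + 2 * ?d))))"
      using \<beta> L(2) by (intro iffD2[OF exp_le_cancel_iff] mult_left_mono) auto
    then have "ennreal (exp (\<beta> * (real n * (L * (2 * L2_set (\<lambda>i. z \<kappa> i - u' i) {..<N}))))) * partition_nn N \<mu> \<beta> h (scaled N s' u') n \<rho> \<delta>
      \<le> ennreal (exp (\<beta> * (real n * (L * (sqrt (real N) * (4 * \<alpha>) + 2 * ?d))))) * partition_nn N \<mu> \<beta> h (scaled N s' u') n \<rho> \<delta>"
      by (intro mult_right_mono ennreal_leI) auto
    with partition_rotate_le[OF h \<beta> L zs(1)[OF \<kappa>] u(2) s(3,4), of n \<rho> \<delta>]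
    show "partition_nn N \<mu> \<beta> h (scaled N s' (z \<kappa>)) n \<rho> \<delta>
      \<le> ennreal (exp (\<beta> * (real n * (L * (sqrt (real N) * (4 * \<alpha>) + 2 * ?d))))) * partition_nn N \<mu> \<beta> h (scaled N s' u') n \<rho> \<delta>"
      by (rule order_trans)
  qed auto
  also have "\<dots> = ennreal (exp (\<beta> * (real n * (L * (sqrt (real N) * (4 * \<alpha> + r)))))) * ennreal K ^ n *
     (ennreal (real (card \<K>)) * (ennreal (exp (\<beta> * (real n * (L * (sqrt (real N) * (4 * \<alpha>) + 2 * ?d))))) * partition_nn N \<mu> \<beta> h (scaled N s' u') n \<rho> \<delta>))"
    by (simp add: ennreal_of_nat_eq_real_of_nat)
  also have "\<dots> \<le> ennreal (exp (\<beta> * (real n * (L * (sqrt (real N) * (4 * \<alpha> + r)))))) * ennreal K ^ n *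
     (ennreal (real N ^ (n + 1)) * (ennreal (exp (\<beta> * (real n * (L * (sqrt (real N) * (4 * \<alpha>) + 2 * ?d))))) * partition_nn N \<mu> \<beta> h (scaled N s' u') n \<rho> \<delta>))"
  proof (intro mult_left_mono mult_right_mono ennreal_leI)
    show "real (card \<K>) \<le> real N ^ (n + 1)" using cardK by (metis of_nat_le_iff of_nat_power)
  qed auto
  also have "\<dots> = ennreal (exp (\<beta> * (real n * (L * (sqrt (real N) * (8 * \<alpha> + r) + 2 * ?d)))) * K ^ n * real N ^ (n + 1))
     * partition_nn N \<mu> \<beta> h (scaled N s' u') n \<rho> \<delta>"
  proof -
    \<comment> \<open>The pull moves replica and centre by 4 \<alpha> + r in units of sqrt N. The
      rotation contributes twice the distance from \<open>z \<kappa>\<close> to u', at most 4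
      \<alpha> in the same units plus 2 d.\<close>
    have "exp (\<beta> * (real n * (L * (sqrt (real N) * (8 * \<alpha> + r) + 2 * ?d))))
      = exp (\<beta> * (real n * (L * (sqrt (real N) * (4 * \<alpha> + r))))) * exp (\<beta> * (real n * (L * (sqrt (real N) * (4 * \<alpha>) + 2 * ?d))))"
      by (subst exp_add[symmetric]) (simp add: algebra_simps)
    then have "ennreal (exp (\<beta> * (real n * (L * (sqrt (real N) * (8 * \<alpha> + r) + 2 * ?d)))) * K ^ n * real N ^ (n + 1))
      = ennreal (exp (\<beta> * (real n * (L * (sqrt (real N) * (4 * \<alpha> + r)))))) * ennreal (exp (\<beta> * (real n * (L * (sqrt (real N) * (4 * \<alpha>) + 2 * ?d)))))
        * ennreal K ^ n * ennreal (real N ^ (n + 1))"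
      using K0 by (simp add: ennreal_mult ennreal_power)
    then show ?thesis by (simp add: mult_ac)
  qed
  finally show ?thesis unfolding K_def .
qed

end

section \<open>Gaussian product measures and concentration\<close>

definition std_normal :: "real measure" where
  "std_normal = density lborel (\<lambda>x. ennreal (std_normal_density x))"

lemma sets_std_normal [simp, measurable_cong]: "sets std_normal = sets borel"
  by (simp add: std_normal_def)

lemma space_std_normal [simp]: "space std_normal = UNIV"
  by (simp add: std_normal_def)

lemma prob_space_std_normal: "prob_space std_normal"
  unfolding std_normal_def by (rule prob_space_normal_density) simp

interpretation sn: prob_space std_normal by (rule prob_space_std_normal)

interpretation sn_pair: pair_prob_space std_normal std_normal ..

lemma nn_integral_std_normal:
  assumes [measurable]: "f \<in> borel_measurable borel"
  shows "(\<integral>\<^sup>+x. f x \<partial>std_normal) = (\<integral>\<^sup>+x. ennreal (std_normal_density x) * f x \<partial>lborel)"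
  unfolding std_normal_def by (subst nn_integral_density) auto

text \<open>The product density depends on a^2 + b^2 only, so the invariance of Lebesgue measure
  carries over.\<close>

lemma nn_integral_std_normal_rotate:
  fixes f :: "real \<Rightarrow> real \<Rightarrow> ennreal"
  assumes f[measurable]: "case_prod f \<in> borel_measurable (borel \<Otimes>\<^sub>M borel)"
    and cs: "c\<^sup>2 + s\<^sup>2 = 1" and s: "s \<noteq> 0"
  shows "(\<integral>\<^sup>+a. \<integral>\<^sup>+b. f (c * a + s * b) (- s * a + c * b) \<partial>std_normal \<partial>std_normal)
       = (\<integral>\<^sup>+a. \<integral>\<^sup>+b. f a b \<partial>std_normal \<partial>std_normal)"
proof -
  define g where "g a b = ennreal (std_normal_density a) * (ennreal (std_normal_density b) * f a b)" for a b
  have [measurable]: "case_prod g \<in> borel_measurable (borel \<Otimes>\<^sub>M borel)" unfolding g_def by measurable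
  have eq: "(\<integral>\<^sup>+a. \<integral>\<^sup>+b. h a b \<partial>std_normal \<partial>std_normal)
    = (\<integral>\<^sup>+a. \<integral>\<^sup>+b. ennreal (std_normal_density a) * (ennreal (std_normal_density b) * h a b) \<partial>lborel \<partial>lborel)"
    if [measurable]: "case_prod h \<in> borel_measurable (borel \<Otimes>\<^sub>M borel)" for h :: "real \<Rightarrow> real \<Rightarrow> ennreal"
    by (simp add: nn_integral_std_normal nn_integral_cmult)
  have "std_normal_density (c * a + s * b) * std_normal_density (- s * a + c * b) = std_normal_density a * std_normal_density b" for a b
  proof -
    have "(c * a + s * b)\<^sup>2 + (- s * a + c * b)\<^sup>2 = (c\<^sup>2 + s\<^sup>2) * (a\<^sup>2 + b\<^sup>2)"
      by (simp add: power2_eq_square algebra_simps)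
    then have "- (c * a + s * b)\<^sup>2 / 2 + - (- s * a + c * b)\<^sup>2 / 2 = - a\<^sup>2 / 2 + - b\<^sup>2 / 2"
      using cs by (simp add: add_divide_distrib[symmetric])
    then have "exp (- (c * a + s * b)\<^sup>2 / 2) * exp (- (- s * a + c * b)\<^sup>2 / 2) = exp (- a\<^sup>2 / 2) * exp (- b\<^sup>2 / 2)"
      unfolding exp_add[symmetric] by simp
    then show ?thesis unfolding std_normal_density_def
      by (simp only: mult.assoc mult.left_commute)
  qed
  then have "ennreal (std_normal_density a) * (ennreal (std_normal_density b) * f (c * a + s * b) (- s * a + c * b))
     = g (c * a + s * b) (- s * a + c * b)" for a b
    unfolding g_def mult.assoc[symmetric] by (simp add: ennreal_mult''[symmetric])
  then show ?thesis
    using nn_integral_lborel_rotate[of g c s, OF _ cs s]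
    by (subst (1 2) eq) (auto simp: g_def)
qed

abbreviation gauss :: "'i set \<Rightarrow> ('i \<Rightarrow> real) measure" where
  "gauss I \<equiv> PiM I (\<lambda>_. std_normal)"

abbreviation gauss2 :: "'i set \<Rightarrow> ('i \<Rightarrow> real \<times> real) measure" where
  "gauss2 I \<equiv> PiM I (\<lambda>_. std_normal \<Otimes>\<^sub>M std_normal)"

lemma product_prob_gauss: "product_prob_space (\<lambda>_::'i. std_normal)"
  by unfold_locales

lemma product_prob_gauss2: "product_prob_space (\<lambda>_::'i. std_normal \<Otimes>\<^sub>M std_normal)"
  by unfold_locales

lemma prob_space_gauss: "prob_space (gauss I)"
  by (rule prob_space_PiM) (rule prob_space_std_normal)

definition lin_comb :: "'i set \<Rightarrow> real \<Rightarrow> real \<Rightarrow> ('i \<Rightarrow> real) \<Rightarrow> ('i \<Rightarrow> real) \<Rightarrow> 'i \<Rightarrow> real" where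
  "lin_comb I c s x y = (\<lambda>i\<in>I. c * x i + s * y i)"

lemma measurable_gauss_component:
  "i \<in> I \<Longrightarrow> f \<in> measurable M (gauss I) \<Longrightarrow> (\<lambda>w. f w i) \<in> borel_measurable M"
proof -
  assume "i \<in> I" "f \<in> measurable M (gauss I)"
  from measurable_compose[OF this(2) measurable_component_singleton[OF this(1)]]
  show ?thesis by (simp add: measurable_cong_sets[OF refl sets_std_normal])
qed

lemma emeasure_distr_eq_nn_integral:
  assumes r: "r \<in> measurable M N" and A: "A \<in> sets N"
  shows "emeasure (distr M N r) A = (\<integral>\<^sup>+p. indicator A (r p) \<partial>M)"
proof -
  have "emeasure (distr M N r) A = (\<integral>\<^sup>+x. indicator A x \<partial>distr M N r)" using A by simp
  also have "\<dots> = (\<integral>\<^sup>+p. indicator A (r p) \<partial>M)"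
    using A by (intro nn_integral_distr r) auto
  finally show ?thesis .
qed

lemma measurable_lin_comb [measurable (raw)]:
  assumes "f \<in> measurable M (gauss I)" "g \<in> measurable M (gauss I)"
  shows "(\<lambda>w. lin_comb I c s (f w) (g w)) \<in> measurable M (gauss I)"
proof -
  have "(\<lambda>w. c * f w i + s * g w i) \<in> measurable M std_normal" if "i \<in> I" for i
  proof -
    have "(\<lambda>w. f w i) \<in> borel_measurable M" "(\<lambda>w. g w i) \<in> borel_measurable M"
      using that assms by (auto intro: measurable_gauss_component)
    then have "(\<lambda>w. c * f w i + s * g w i) \<in> borel_measurable M" by measurable
    then show ?thesis by (simp add: measurable_cong_sets[OF refl sets_std_normal])
  qed
  then show ?thesis unfolding lin_comb_def by (rule measurable_restrict)
qed

lemma nn_integral_gauss_prod: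
  assumes J: "finite J" "J \<subseteq> I" and g: "\<And>i. i \<in> J \<Longrightarrow> g i \<in> borel_measurable std_normal"
  shows "(\<integral>\<^sup>+x. (\<Prod>i\<in>J. g i (x i)) \<partial>gauss I) = (\<Prod>i\<in>J. \<integral>\<^sup>+a. g i a \<partial>std_normal)"
proof -
  interpret product_prob_space "\<lambda>_. std_normal" I by (rule product_prob_gauss)
  have gm: "(\<lambda>x. \<Prod>i\<in>J. g i (x i)) \<in> borel_measurable (gauss J)"
    using g by (intro borel_measurable_prod_ennreal measurable_compose[OF measurable_component_singleton]) auto
  have "(\<integral>\<^sup>+x. (\<Prod>i\<in>J. g i (x i)) \<partial>gauss I) = (\<integral>\<^sup>+x. (\<Prod>i\<in>J. g i (restrict x J i)) \<partial>gauss I)"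
    by (intro nn_integral_cong prod.cong) auto
  also have "\<dots> = (\<integral>\<^sup>+x. (\<Prod>i\<in>J. g i (x i)) \<partial>distr (gauss I) (gauss J) (\<lambda>x. restrict x J))"
    using J by (subst nn_integral_distr) (auto intro!: measurable_restrict_subset gm)
  also have "\<dots> = (\<Prod>i\<in>J. \<integral>\<^sup>+a. g i a \<partial>std_normal)"
    unfolding distr_PiM_restrict_finite[OF J] using J(1) g by (rule product_nn_integral_prod)
  finally show ?thesis .
qed

section \<open>Rotations of two independent Gaussian families\<close>

text \<open>A rotation acts on the pairs of coordinates with equal index, so a pair of families is
  recast as a family of pairs. The index set is infinite in the application; equality of laws is
  therefore checked on cylinder sets.\<close>

definition zip_fun :: "'i set \<Rightarrow> ('i \<Rightarrow> real) \<times> ('i \<Rightarrow> real) \<Rightarrow> 'i \<Rightarrow> real \<times> real" where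
  "zip_fun I p = (\<lambda>i\<in>I. (fst p i, snd p i))"

definition unzip_fun :: "'i set \<Rightarrow> ('i \<Rightarrow> real \<times> real) \<Rightarrow> ('i \<Rightarrow> real) \<times> ('i \<Rightarrow> real)" where
  "unzip_fun I w = ((\<lambda>i\<in>I. fst (w i)), (\<lambda>i\<in>I. snd (w i)))"

lemma measurable_zip_fun [measurable]: "zip_fun I \<in> measurable (gauss I \<Otimes>\<^sub>M gauss I) (gauss2 I)"
  unfolding zip_fun_def
  by (intro measurable_restrict measurable_Pair)
     (auto intro: measurable_compose[OF measurable_fst] measurable_compose[OF measurable_snd] measurable_component_singleton)

lemma measurable_unzip_fun [measurable]: "unzip_fun I \<in> measurable (gauss2 I) (gauss I \<Otimes>\<^sub>M gauss I)"
  unfolding unzip_fun_def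
  by (intro measurable_restrict measurable_Pair)
     (auto intro: measurable_compose[OF _ measurable_fst] measurable_compose[OF _ measurable_snd] measurable_component_singleton)

lemma distr_zip_fun: "distr (gauss I \<Otimes>\<^sub>M gauss I) (gauss2 I) (zip_fun I) = gauss2 I"
proof -
  interpret product_prob_space "\<lambda>_. std_normal \<Otimes>\<^sub>M std_normal" I by (rule product_prob_gauss2)
  interpret G: prob_space "gauss I" by (rule prob_space_gauss)
  interpret GG: pair_prob_space "gauss I" "gauss I" ..
  show ?thesis
  proof (rule PiM_eq)
    fix J F assume J: "finite J" "J \<subseteq> I" and F: "\<And>j. j \<in> J \<Longrightarrow> F j \<in> sets (std_normal \<Otimes>\<^sub>M std_normal)"
    have emb: "prod_emb I (\<lambda>_. std_normal \<Otimes>\<^sub>M std_normal) J (\<Pi>\<^sub>E j\<in>J. F j) \<in> sets (gauss2 I)"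
      using J F by (intro sets_PiM_I) auto
    define k :: "'a \<Rightarrow> real \<Rightarrow> real \<Rightarrow> ennreal" where "k j a b = indicator (F j) (a, b)" for j a b
    have k[measurable]: "(\<lambda>(a, b). k j a b) \<in> borel_measurable (std_normal \<Otimes>\<^sub>M std_normal)" if "j \<in> J" for j
      unfolding k_def using F[OF that] by measurable
    have k1: "(\<lambda>a. \<integral>\<^sup>+b. k j a b \<partial>std_normal) \<in> borel_measurable std_normal" if "j \<in> J" for j
      using k[OF that] by measurable
    have k2: "k j a \<in> borel_measurable std_normal" if "j \<in> J" for j a
      using measurable_Pair2[OF k[OF that], of a] by simp
    have mem: "indicator (prod_emb I (\<lambda>_. std_normal \<Otimes>\<^sub>M std_normal) J (\<Pi>\<^sub>E j\<in>J. F j)) (zip_fun I (x, y))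
        = (\<Prod>j\<in>J. k j (x j) (y j))" for x y
    proof -
      have "zip_fun I (x, y) \<in> prod_emb I (\<lambda>_. std_normal \<Otimes>\<^sub>M std_normal) J (\<Pi>\<^sub>E j\<in>J. F j) \<longleftrightarrow> (\<forall>j\<in>J. (x j, y j) \<in> F j)"
        using J by (auto simp: prod_emb_def zip_fun_def PiE_iff space_pair_measure restrict_def extensional_def subset_eq)
      then show ?thesis using J(1) by (auto simp: k_def indicator_def prod_zero_iff)
    qed
    have "emeasure (distr (gauss I \<Otimes>\<^sub>M gauss I) (gauss2 I) (zip_fun I)) (prod_emb I (\<lambda>_. std_normal \<Otimes>\<^sub>M std_normal) J (\<Pi>\<^sub>E j\<in>J. F j))
       = (\<integral>\<^sup>+p. indicator (prod_emb I (\<lambda>_. std_normal \<Otimes>\<^sub>M std_normal) J (\<Pi>\<^sub>E j\<in>J. F j)) (zip_fun I p) \<partial>(gauss I \<Otimes>\<^sub>M gauss I))"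
      by (rule emeasure_distr_eq_nn_integral[OF measurable_zip_fun emb])
    also have "\<dots> = (\<integral>\<^sup>+x. \<integral>\<^sup>+y. indicator (prod_emb I (\<lambda>_. std_normal \<Otimes>\<^sub>M std_normal) J (\<Pi>\<^sub>E j\<in>J. F j)) (zip_fun I (x, y)) \<partial>gauss I \<partial>gauss I)"
      by (rule G.nn_integral_fst[symmetric])
         (rule measurable_compose[OF measurable_zip_fun borel_measurable_indicator[OF emb]])
    also have "\<dots> = (\<integral>\<^sup>+x. (\<Prod>j\<in>J. \<integral>\<^sup>+b. k j (x j) b \<partial>std_normal) \<partial>gauss I)"
      unfolding mem by (intro nn_integral_cong nn_integral_gauss_prod J k2)
    also have "\<dots> = (\<Prod>j\<in>J. \<integral>\<^sup>+a. \<integral>\<^sup>+b. k j a b \<partial>std_normal \<partial>std_normal)"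
      by (intro nn_integral_gauss_prod J k1)
    also have "\<dots> = (\<Prod>j\<in>J. emeasure (std_normal \<Otimes>\<^sub>M std_normal) (F j))"
      using F by (intro prod.cong refl) (simp add: k_def sn.emeasure_pair_measure)
    finally show "emeasure (distr (gauss I \<Otimes>\<^sub>M gauss I) (gauss2 I) (zip_fun I)) (prod_emb I (\<lambda>_. std_normal \<Otimes>\<^sub>M std_normal) J (\<Pi>\<^sub>E j\<in>J. F j))
      = (\<Prod>j\<in>J. emeasure (std_normal \<Otimes>\<^sub>M std_normal) (F j))" .
  qed simp
qed

lemma distr_rotate_pair:
  assumes "c\<^sup>2 + s\<^sup>2 = 1" "s \<noteq> 0"
  shows "distr (std_normal \<Otimes>\<^sub>M std_normal) (std_normal \<Otimes>\<^sub>M std_normal) (\<lambda>(a, b). (c * a + s * b, - s * a + c * b))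
    = std_normal \<Otimes>\<^sub>M std_normal" (is "distr ?M ?M ?r = ?M")
proof (rule measure_eqI)
  have r[measurable]: "?r \<in> measurable ?M ?M" by measurable
  fix A assume "A \<in> sets (distr ?M ?M ?r)"
  then have A[measurable]: "A \<in> sets ?M" by simp
  define k :: "real \<Rightarrow> real \<Rightarrow> ennreal" where "k a b = indicator A (a, b)" for a b
  have km: "case_prod k \<in> borel_measurable ?M" unfolding k_def by measurable
  have sets: "sets ?M = sets (borel \<Otimes>\<^sub>M borel)" by (intro sets_pair_measure_cong) auto
  have km': "case_prod k \<in> borel_measurable (borel \<Otimes>\<^sub>M borel)"
    using km by (simp add: measurable_cong_sets[OF sets refl])
  have "emeasure (distr ?M ?M ?r) A = (\<integral>\<^sup>+p. case_prod k (?r p) \<partial>?M)"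
    by (subst emeasure_distr_eq_nn_integral[OF r A]) (auto intro!: nn_integral_cong simp: k_def)
  also have "\<dots> = (\<integral>\<^sup>+a. \<integral>\<^sup>+b. case_prod k (?r (a, b)) \<partial>std_normal \<partial>std_normal)"
    by (rule sn.nn_integral_fst[symmetric]) (rule measurable_compose[OF r km])
  also have "\<dots> = (\<integral>\<^sup>+a. \<integral>\<^sup>+b. k a b \<partial>std_normal \<partial>std_normal)"
    using nn_integral_std_normal_rotate[OF km' assms] by simp
  also have "\<dots> = emeasure ?M A" unfolding k_def by (rule sn.emeasure_pair_measure[OF A, symmetric])
  finally show "emeasure (distr ?M ?M ?r) A = emeasure ?M A" .
qed simp

text \<open>Under a coordinatewise map the preimage of a cylinder is a cylinder over the preimages,
  so invariance of one pair gives invariance of the product.\<close>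

lemma distr_rotate_gauss2:
  assumes "c\<^sup>2 + s\<^sup>2 = 1" "s \<noteq> 0"
  shows "distr (gauss2 I) (gauss2 I) (\<lambda>w. \<lambda>i\<in>I. (c * fst (w i) + s * snd (w i), - s * fst (w i) + c * snd (w i))) = gauss2 I"
proof -
  interpret product_prob_space "\<lambda>_. std_normal \<Otimes>\<^sub>M std_normal" I by (rule product_prob_gauss2)
  let ?M = "std_normal \<Otimes>\<^sub>M std_normal"
  define r where "r = (\<lambda>(a, b). (c * a + s * b, - s * a + c * b :: real))"
  have r[measurable]: "r \<in> measurable ?M ?M" unfolding r_def by measurable
  have R: "(\<lambda>w. \<lambda>i\<in>I. r (w i)) \<in> measurable (gauss2 I) (gauss2 I)"
  proof (rule measurable_restrict)
    fix i assume "i \<in> I"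
    then have "(\<lambda>w. w i) \<in> measurable (gauss2 I) ?M" by (rule measurable_component_singleton)
    from measurable_compose[OF this r] show "(\<lambda>w. r (w i)) \<in> measurable (gauss2 I) ?M" .
  qed
  have "distr (gauss2 I) (gauss2 I) (\<lambda>w. \<lambda>i\<in>I. r (w i)) = gauss2 I"
  proof (rule PiM_eq)
    fix J F assume J: "finite J" "J \<subseteq> I" and F: "\<And>j. j \<in> J \<Longrightarrow> F j \<in> sets ?M"
    have F': "r -` F j \<inter> space ?M \<in> sets ?M" if "j \<in> J" for j using measurable_sets[OF r F[OF that]] .
    have "(\<lambda>w. \<lambda>i\<in>I. r (w i)) -` prod_emb I (\<lambda>_. ?M) J (\<Pi>\<^sub>E j\<in>J. F j) \<inter> space (gauss2 I)
       = prod_emb I (\<lambda>_. ?M) J (\<Pi>\<^sub>E j\<in>J. r -` F j \<inter> space ?M)"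
      using J by (auto simp: prod_emb_def space_PiM PiE_iff space_pair_measure restrict_def extensional_def subset_eq)
    then have "emeasure (distr (gauss2 I) (gauss2 I) (\<lambda>w. \<lambda>i\<in>I. r (w i))) (prod_emb I (\<lambda>_. ?M) J (\<Pi>\<^sub>E j\<in>J. F j))
      = emeasure (gauss2 I) (prod_emb I (\<lambda>_. ?M) J (\<Pi>\<^sub>E j\<in>J. r -` F j \<inter> space ?M))"
      using J F by (subst emeasure_distr[OF R]) (auto intro!: sets_PiM_I)
    also have "\<dots> = (\<Prod>j\<in>J. emeasure ?M (r -` F j \<inter> space ?M))"
      using J F' by (intro emeasure_PiM_emb) auto
    also have "\<dots> = (\<Prod>j\<in>J. emeasure (distr ?M ?M r) (F j))"
      using F by (intro prod.cong refl) (simp add: emeasure_distr)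
    also have "distr ?M ?M r = ?M" unfolding r_def by (rule distr_rotate_pair[OF assms])
    finally show "emeasure (distr (gauss2 I) (gauss2 I) (\<lambda>w. \<lambda>i\<in>I. r (w i))) (prod_emb I (\<lambda>_. ?M) J (\<Pi>\<^sub>E j\<in>J. F j))
      = (\<Prod>j\<in>J. emeasure ?M (F j))" .
  qed simp
  then show ?thesis by (simp add: r_def case_prod_beta)
qed

text \<open>Two independent copies, rotated into each other, are again two independent copies. This
  makes all steps of the later interpolation identically distributed.\<close>

lemma nn_integral_gauss_rotate:
  fixes F :: "('i \<Rightarrow> real) \<times> ('i \<Rightarrow> real) \<Rightarrow> ennreal"
  assumes cs: "c\<^sup>2 + s\<^sup>2 = 1" "s \<noteq> 0" and F[measurable]: "F \<in> borel_measurable (gauss I \<Otimes>\<^sub>M gauss I)"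
  shows "(\<integral>\<^sup>+p. F (lin_comb I c s (fst p) (snd p), lin_comb I (- s) c (fst p) (snd p)) \<partial>(gauss I \<Otimes>\<^sub>M gauss I))
     = (\<integral>\<^sup>+p. F p \<partial>(gauss I \<Otimes>\<^sub>M gauss I))"
proof -
  let ?G = "gauss I \<Otimes>\<^sub>M gauss I"
  define R where "R w = (\<lambda>i\<in>I. (c * fst (w i) + s * snd (w i), - s * fst (w i) + c * snd (w i)))" for w :: "'i \<Rightarrow> real \<times> real"
  have Rm[measurable]: "R \<in> measurable (gauss2 I) (gauss2 I)"
  proof -
    have "(\<lambda>p. (c * fst p + s * snd p, - s * fst p + c * snd p)) \<in> measurable (std_normal \<Otimes>\<^sub>M std_normal) (std_normal \<Otimes>\<^sub>M std_normal)"
      by measurable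
    from measurable_compose[OF _ this] show ?thesis
      unfolding R_def by (intro measurable_restrict) auto
  qed
  have 1: "F (lin_comb I c s (fst p) (snd p), lin_comb I (- s) c (fst p) (snd p)) = F (unzip_fun I (R (zip_fun I p)))" for p
    by (intro arg_cong[where f=F]) (auto simp: unzip_fun_def R_def zip_fun_def lin_comb_def fun_eq_iff)
  have 2: "F (unzip_fun I (zip_fun I p)) = F p" if "p \<in> space ?G" for p
  proof -
    have "unzip_fun I (zip_fun I p) = p"
      using that by (cases p) (auto simp: unzip_fun_def zip_fun_def space_pair_measure space_PiM PiE_def extensional_def fun_eq_iff)
    then show ?thesis by simp
  qed
  have "(\<integral>\<^sup>+p. F (unzip_fun I (R (zip_fun I p))) \<partial>?G) = (\<integral>\<^sup>+w. F (unzip_fun I (R w)) \<partial>distr ?G (gauss2 I) (zip_fun I))"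
    by (rule nn_integral_distr[symmetric]) measurable
  also have "\<dots> = (\<integral>\<^sup>+w. F (unzip_fun I w) \<partial>distr (gauss2 I) (gauss2 I) R)"
    unfolding distr_zip_fun by (rule nn_integral_distr[symmetric]) measurable
  also have "distr (gauss2 I) (gauss2 I) R = distr ?G (gauss2 I) (zip_fun I)"
    unfolding distr_zip_fun unfolding R_def using cs by (rule distr_rotate_gauss2)
  also have "(\<integral>\<^sup>+w. F (unzip_fun I w) \<partial>distr ?G (gauss2 I) (zip_fun I)) = (\<integral>\<^sup>+p. F (unzip_fun I (zip_fun I p)) \<partial>?G)"
    by (rule nn_integral_distr) measurable
  also have "\<dots> = (\<integral>\<^sup>+p. F p \<partial>?G)" by (intro nn_integral_cong 2)
  finally show ?thesis unfolding 1 .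
qed

section \<open>Exponential moments of a log-partition function\<close>

text \<open>Jensen's inequality through exp u \<ge> 1 + u. The integral of exp u may be infinite,
  but the minorant max 0 (1 + u) is integrable.\<close>

lemma (in prob_space) nn_integral_exp_ge:
  assumes "integrable M u" "expectation u = 0"
  shows "1 \<le> (\<integral>\<^sup>+x. ennreal (exp (u x)) \<partial>M)"
proof -
  have i: "integrable M (\<lambda>x. max 0 (1 + u x))" using assms by (intro integrable_max) auto
  have "1 = expectation (\<lambda>x. 1 + u x)" using assms by (simp add: prob_space)
  also have "\<dots> \<le> expectation (\<lambda>x. max 0 (1 + u x))"
    using assms i by (intro integral_mono) auto
  finally have "ennreal 1 \<le> ennreal (expectation (\<lambda>x. max 0 (1 + u x)))" by (rule ennreal_leI)
  also have "\<dots> = (\<integral>\<^sup>+x. ennreal (max 0 (1 + u x)) \<partial>M)"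
    using i by (intro nn_integral_eq_integral[symmetric]) auto
  also have "\<dots> \<le> (\<integral>\<^sup>+x. ennreal (exp (u x)) \<partial>M)"
    by (intro nn_integral_mono ennreal_leI) (auto simp: exp_ge_add_one_self)
  finally show ?thesis by simp
qed

text \<open>For a fixed realisation, \<open>a\<close> is the (bounded) energy and \<open>log_mean_exp a\<close> its free energy.\<close>

locale bounded_energy = prob_space U for U :: "'c measure" +
  fixes a :: "'c \<Rightarrow> real" and b :: real
  assumes a_meas [measurable]: "a \<in> borel_measurable U" and a_bdd: "\<And>\<tau>. \<tau> \<in> space U \<Longrightarrow> \<bar>a \<tau>\<bar> \<le> b"
begin

lemma a_lo: "\<tau> \<in> space U \<Longrightarrow> - b \<le> a \<tau>"
  using a_bdd[of \<tau>] by linarith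

definition log_mean_exp where "log_mean_exp = ln (expectation (\<lambda>\<tau>. exp (a \<tau>)))"

lemma integrable_exp: "integrable U (\<lambda>\<tau>. exp (a \<tau>))"
  by (rule integrable_const_bound[of _ "exp b"]) (use a_bdd in \<open>auto intro!: AE_I2 simp: abs_le_iff\<close>)

lemma mean_exp_pos: "expectation (\<lambda>\<tau>. exp (a \<tau>)) > 0"
proof -
  have "exp (- b) = expectation (\<lambda>\<tau>. exp (- b))" by (simp add: prob_space)
  also have "\<dots> \<le> expectation (\<lambda>\<tau>. exp (a \<tau>))"
    by (intro integral_mono integrable_exp) (auto intro: a_lo)
  finally show ?thesis by (meson exp_gt_zero less_le_trans)
qed

lemma gibbs_integrable: "integrable U (\<lambda>\<tau>. exp (a \<tau> - log_mean_exp))"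
  unfolding exp_diff using integrable_exp by simp

lemma gibbs_mean: "expectation (\<lambda>\<tau>. exp (a \<tau> - log_mean_exp)) = 1"
  unfolding exp_diff using mean_exp_pos by (simp add: log_mean_exp_def)

lemma exp_lme: "ennreal (exp log_mean_exp) = (\<integral>\<^sup>+\<tau>. ennreal (exp (a \<tau>)) \<partial>U)"
  using mean_exp_pos by (subst nn_integral_eq_integral[OF integrable_exp]) (auto simp: log_mean_exp_def)

text \<open>Bounds negative powers of the partition function by single energies: with d = a -
  \<open>log_mean_exp\<close>, exp (- k d) \<ge> 1 - k d \<ge> 1 - k (exp d - 1), and exp d has mean
  1.\<close>

lemma exp_neg_lme_le:
  assumes "k \<ge> 0"
  shows "ennreal (exp (- k * log_mean_exp)) \<le> (\<integral>\<^sup>+\<tau>. ennreal (exp (- k * a \<tau>)) \<partial>U)"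
proof -
  have "1 = ennreal (expectation (\<lambda>\<tau>. 1 - k * (exp (a \<tau> - log_mean_exp) - 1)))"
    using gibbs_integrable gibbs_mean by (simp add: prob_space)
  also have "\<dots> \<le> ennreal (expectation (\<lambda>\<tau>. max 0 (1 - k * (exp (a \<tau> - log_mean_exp) - 1))))"
    using gibbs_integrable by (intro ennreal_leI integral_mono integrable_max) auto
  also have "\<dots> = (\<integral>\<^sup>+\<tau>. ennreal (max 0 (1 - k * (exp (a \<tau> - log_mean_exp) - 1))) \<partial>U)"
    using gibbs_integrable by (intro nn_integral_eq_integral[symmetric] integrable_max) auto
  also have "\<dots> \<le> (\<integral>\<^sup>+\<tau>. ennreal (exp (- k * (a \<tau> - log_mean_exp))) \<partial>U)"
  proof (intro nn_integral_mono ennreal_leI)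
    fix \<tau>
    have "k * (a \<tau> - log_mean_exp) \<le> k * (exp (a \<tau> - log_mean_exp) - 1)"
    proof (rule mult_left_mono[OF _ assms])
      show "a \<tau> - log_mean_exp \<le> exp (a \<tau> - log_mean_exp) - 1" using exp_ge_add_one_self[of "a \<tau> - log_mean_exp"] by linarith
    qed
    then show "max 0 (1 - k * (exp (a \<tau> - log_mean_exp) - 1)) \<le> exp (- k * (a \<tau> - log_mean_exp))"
      using exp_ge_add_one_self[of "- k * (a \<tau> - log_mean_exp)"] exp_ge_zero[of "- k * (a \<tau> - log_mean_exp)"]
      by (intro max.boundedI) linarith+
  qed
  also have "\<dots> = (\<integral>\<^sup>+\<tau>. ennreal (exp (k * log_mean_exp)) * ennreal (exp (- k * a \<tau>)) \<partial>U)"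
    by (simp add: ennreal_mult''[symmetric] exp_add[symmetric] algebra_simps)
  also have "\<dots> = ennreal (exp (k * log_mean_exp)) * (\<integral>\<^sup>+\<tau>. ennreal (exp (- k * a \<tau>)) \<partial>U)"
    by (rule nn_integral_cmult) measurable
  finally have "ennreal (exp (- k * log_mean_exp)) * 1 \<le> ennreal (exp (- k * log_mean_exp)) * (ennreal (exp (k * log_mean_exp)) * (\<integral>\<^sup>+\<tau>. ennreal (exp (- k * a \<tau>)) \<partial>U))"
    by (intro mult_left_mono) auto
  then show ?thesis by (simp add: mult.assoc[symmetric] ennreal_mult''[symmetric] exp_add[symmetric])
qed

lemma exp_convex_comb: "0 \<le> t \<Longrightarrow> t \<le> 1 \<Longrightarrow> exp (t * w) \<le> t * exp w + (1 - t)" for w t :: real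
  using convex_onD[OF exp_convex, of t 0 w] by (simp add: algebra_simps)

text \<open>Jensen for the concave power t of the Gibbs density, obtained from convexity of exp
  between 0 and a - \<open>log_mean_exp\<close>.\<close>

lemma gibbs_power_le:
  assumes "0 \<le> t" "t \<le> 1"
  shows "(\<integral>\<^sup>+\<tau>. ennreal (exp (t * (a \<tau> - log_mean_exp))) \<partial>U) \<le> 1"
proof -
  have "(\<integral>\<^sup>+\<tau>. ennreal (exp (t * (a \<tau> - log_mean_exp))) \<partial>U) \<le> (\<integral>\<^sup>+\<tau>. ennreal (t * exp (a \<tau> - log_mean_exp) + (1 - t)) \<partial>U)"
    using assms by (intro nn_integral_mono ennreal_leI exp_convex_comb)
  also have "\<dots> = ennreal (expectation (\<lambda>\<tau>. t * exp (a \<tau> - log_mean_exp) + (1 - t)))"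
    using assms gibbs_integrable by (intro nn_integral_eq_integral) (auto intro!: AE_I2 add_nonneg_nonneg)
  also have "\<dots> = 1" using gibbs_integrable gibbs_mean by (simp add: prob_space)
  finally show ?thesis .
qed

end

text \<open>The increment is the logarithm of the Gibbs average of exp v, so this is Jensen for the
  power B under the Gibbs measure of a.\<close>

lemma log_mean_exp_increment_power:
  assumes a: "bounded_energy U a b" and v: "bounded_energy U (\<lambda>\<tau>. a \<tau> + v \<tau>) b'" and B: "B \<ge> 1"
  shows "ennreal (exp (B * (bounded_energy.log_mean_exp U (\<lambda>\<tau>. a \<tau> + v \<tau>) - bounded_energy.log_mean_exp U a)))
    \<le> (\<integral>\<^sup>+\<tau>. ennreal (exp (a \<tau> - bounded_energy.log_mean_exp U a + B * v \<tau>)) \<partial>U)"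
proof -
  interpret a: bounded_energy U a b by fact
  interpret av: bounded_energy U "\<lambda>\<tau>. a \<tau> + v \<tau>" b' by fact
  have [measurable]: "v \<in> borel_measurable U"
    using borel_measurable_diff[OF av.a_meas a.a_meas] by simp
  have vb: "\<bar>v \<tau>\<bar> \<le> b + b'" if "\<tau> \<in> space U" for \<tau>
    using a.a_bdd[OF that] av.a_bdd[OF that] by linarith
  define q where "q = av.log_mean_exp - a.log_mean_exp"
  define g where "g \<tau> = exp (a \<tau> - a.log_mean_exp + B * v \<tau>)" for \<tau>
  have gi: "integrable U g"
    unfolding g_def
  proof (rule a.integrable_const_bound[of _ "exp (b + \<bar>a.log_mean_exp\<bar> + B * (b + b'))"])
    show "AE \<tau> in U. norm (exp (a \<tau> - a.log_mean_exp + B * v \<tau>)) \<le> exp (b + \<bar>a.log_mean_exp\<bar> + B * (b + b'))"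
    proof (rule AE_I2)
      fix \<tau> assume \<tau>: "\<tau> \<in> space U"
      have "B * v \<tau> \<le> B * (b + b')" using vb[OF \<tau>] B by (intro mult_left_mono) auto
      then show "norm (exp (a \<tau> - a.log_mean_exp + B * v \<tau>)) \<le> exp (b + \<bar>a.log_mean_exp\<bar> + B * (b + b'))"
        using a.a_bdd[OF \<tau>] by (auto simp: abs_le_iff)
    qed
  qed measurable
  have "1 = a.expectation (\<lambda>\<tau>. exp (a \<tau> + v \<tau> - av.log_mean_exp))" by (rule av.gibbs_mean[symmetric])
  also have "\<dots> \<le> a.expectation (\<lambda>\<tau>. exp (- B * q) / B * g \<tau> + (1 - 1 / B) * exp (a \<tau> - a.log_mean_exp))"
  proof (intro integral_mono av.gibbs_integrable)
    show "integrable U (\<lambda>\<tau>. exp (- B * q) / B * g \<tau> + (1 - 1 / B) * exp (a \<tau> - a.log_mean_exp))"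
      using gi a.gibbs_integrable by auto
    fix \<tau>
    \<comment> \<open>Convexity of exp between 0 and B (v - q) with weight 1 / B. By the choice of q
      the Gibbs average of exp (v - q) is 1, so averaging leaves a lower bound for the mean of
      g.\<close>
    have "exp (v \<tau> - q) = exp (1 / B * (B * (v \<tau> - q)))" using B by simp
    also have "\<dots> \<le> 1 / B * exp (B * (v \<tau> - q)) + (1 - 1 / B)"
      using B by (intro a.exp_convex_comb) auto
    finally have "exp (a \<tau> - a.log_mean_exp) * exp (v \<tau> - q) \<le> exp (a \<tau> - a.log_mean_exp) * (1 / B * exp (B * (v \<tau> - q)) + (1 - 1 / B))"
      by (intro mult_left_mono) auto
    also have "exp (a \<tau> - a.log_mean_exp) * exp (v \<tau> - q) = exp (a \<tau> + v \<tau> - av.log_mean_exp)"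
      by (simp add: exp_add[symmetric] q_def)
    also have "exp (a \<tau> - a.log_mean_exp) * (1 / B * exp (B * (v \<tau> - q)) + (1 - 1 / B)) = exp (- B * q) / B * g \<tau> + (1 - 1 / B) * exp (a \<tau> - a.log_mean_exp)"
    proof -
      have "exp (a \<tau> - a.log_mean_exp) * exp (B * (v \<tau> - q)) = exp (- B * q) * g \<tau>"
        by (simp add: g_def exp_add[symmetric] algebra_simps)
      then show ?thesis by (simp add: algebra_simps add_divide_distrib)
    qed
    finally show "exp (a \<tau> + v \<tau> - av.log_mean_exp) \<le> exp (- B * q) / B * g \<tau> + (1 - 1 / B) * exp (a \<tau> - a.log_mean_exp)" .
  qed
  also have "\<dots> = exp (- B * q) / B * a.expectation g + (1 - 1 / B)"
    using gi a.gibbs_integrable a.gibbs_mean by simp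
  finally have "1 \<le> exp (- B * q) * a.expectation g" using B by (simp add: field_simps)
  then have "exp (B * q) * 1 \<le> exp (B * q) * (exp (- B * q) * a.expectation g)" by (intro mult_left_mono) auto
  then have "exp (B * q) \<le> a.expectation g" by (simp add: mult.assoc[symmetric] exp_add[symmetric])
  then have "ennreal (exp (B * q)) \<le> ennreal (a.expectation g)" by (rule ennreal_leI)
  also have "\<dots> = (\<integral>\<^sup>+\<tau>. ennreal (g \<tau>) \<partial>U)"
    by (rule nn_integral_eq_integral[OF gi, symmetric]) (auto simp: g_def)
  finally show ?thesis unfolding q_def g_def .
qed

text \<open>Gaussianity enters through the rotation invariance of \<open>gauss I\<close>, the
  linearity of the energy on the full-measure set G and a bound on the moments of single energies.
  No derivative of the free energy in the disorder is taken.\<close>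

locale gaussian_energy = U: prob_space U for U :: "'c measure" +
  fixes I :: "'i set" and A :: "('i \<Rightarrow> real) \<Rightarrow> 'c \<Rightarrow> real" and G :: "('i \<Rightarrow> real) set" and V :: real
  assumes A_meas [measurable]: "(\<lambda>(x, \<tau>). A x \<tau>) \<in> borel_measurable (gauss I \<Otimes>\<^sub>M U)"
    and G_AE: "AE x in gauss I. x \<in> G"
    and A_lin: "\<And>c s x y \<tau>. x \<in> G \<Longrightarrow> y \<in> G \<Longrightarrow> \<tau> \<in> space U \<Longrightarrow> A (lin_comb I c s x y) \<tau> = c * A x \<tau> + s * A y \<tau>"
    and A_bdd: "\<And>x. x \<in> G \<Longrightarrow> \<exists>b. \<forall>\<tau>\<in>space U. \<bar>A x \<tau>\<bar> \<le> b"
    and A_mgf: "\<And>l \<tau>. \<tau> \<in> space U \<Longrightarrow> (\<integral>\<^sup>+x. ennreal (exp (l * A x \<tau>)) \<partial>gauss I) \<le> ennreal (exp (l\<^sup>2 * V / 2))"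
    and V_pos: "V > 0"
begin

definition log_mean where "log_mean x = ln (\<integral>\<tau>. exp (A x \<tau>) \<partial>U)"

sublocale P: prob_space "gauss I" by (rule prob_space_gauss)

sublocale PP: pair_prob_space "gauss I" "gauss I" ..

sublocale PU: pair_prob_space "gauss I" U ..

lemma A_sect: "x \<in> space (gauss I) \<Longrightarrow> A x \<in> borel_measurable U"
  using measurable_Pair2[OF A_meas] by simp

lemma A_sect': "\<tau> \<in> space U \<Longrightarrow> (\<lambda>x. A x \<tau>) \<in> borel_measurable (gauss I)"
  using measurable_Pair1[OF A_meas] by simp

lemma log_mean_meas [measurable]: "log_mean \<in> borel_measurable (gauss I)"
proof -
  have "(\<lambda>(x, \<tau>). exp (A x \<tau>)) \<in> borel_measurable (gauss I \<Otimes>\<^sub>M U)" by measurable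
  then have "(\<lambda>x. \<integral>\<tau>. exp (A x \<tau>) \<partial>U) \<in> borel_measurable (gauss I)"
    by (rule U.borel_measurable_lebesgue_integral)
  then show ?thesis unfolding log_mean_def by measurable
qed

lemma energy: "x \<in> G \<Longrightarrow> x \<in> space (gauss I) \<Longrightarrow> \<exists>b. bounded_energy U (A x) b"
  using A_bdd[of x] A_sect[of x] by (fastforce simp: bounded_energy_def bounded_energy_axioms_def U.prob_space_axioms)

lemma log_mean_eq_lme: "bounded_energy U (A x) b \<Longrightarrow> log_mean x = bounded_energy.log_mean_exp U (A x)"
  by (simp add: log_mean_def bounded_energy.log_mean_exp_def)

lemma neg_mgf:
  assumes "k \<ge> 0"
  shows "(\<integral>\<^sup>+x. ennreal (exp (- k * log_mean x)) \<partial>gauss I) \<le> ennreal (exp (k\<^sup>2 * V / 2))"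
proof -
  let ?P = "gauss I"
  have Pg: "AE x in ?P. x \<in> G \<and> x \<in> space ?P" using G_AE by (auto intro: AE_conjI)
  have "(\<integral>\<^sup>+x. ennreal (exp (- k * log_mean x)) \<partial>?P) \<le> (\<integral>\<^sup>+x. \<integral>\<^sup>+\<tau>. ennreal (exp (- k * A x \<tau>)) \<partial>U \<partial>?P)"
  proof (rule nn_integral_mono_AE, rule eventually_mono[OF Pg])
    fix x assume "x \<in> G \<and> x \<in> space ?P"
    then obtain b where b: "bounded_energy U (A x) b" using energy by blast
    show "ennreal (exp (- k * log_mean x)) \<le> (\<integral>\<^sup>+\<tau>. ennreal (exp (- k * A x \<tau>)) \<partial>U)"
      unfolding log_mean_eq_lme[OF b] by (rule bounded_energy.exp_neg_lme_le[OF b assms])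
  qed
  also have "\<dots> = (\<integral>\<^sup>+\<tau>. \<integral>\<^sup>+x. ennreal (exp (- k * A x \<tau>)) \<partial>?P \<partial>U)"
    by (rule PU.Fubini'[symmetric]) measurable
  also have "\<dots> \<le> (\<integral>\<^sup>+\<tau>. ennreal (exp ((- k)\<^sup>2 * V / 2)) \<partial>U)"
    by (intro nn_integral_mono A_mgf)
  also have "\<dots> = ennreal (exp (k\<^sup>2 * V / 2))" by (simp add: U.emeasure_space_1)
  finally show ?thesis .
qed

lemma pos_mgf: "(\<integral>\<^sup>+x. ennreal (exp (log_mean x)) \<partial>gauss I) \<le> ennreal (exp (V / 2))"
proof -
  let ?P = "gauss I"
  have Pg: "AE x in ?P. x \<in> G \<and> x \<in> space ?P" using G_AE by (auto intro: AE_conjI)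
  have "(\<integral>\<^sup>+x. ennreal (exp (log_mean x)) \<partial>?P) \<le> (\<integral>\<^sup>+x. \<integral>\<^sup>+\<tau>. ennreal (exp (A x \<tau>)) \<partial>U \<partial>?P)"
  proof (rule nn_integral_mono_AE, rule eventually_mono[OF Pg])
    fix x assume "x \<in> G \<and> x \<in> space ?P"
    then obtain b where b: "bounded_energy U (A x) b" using energy by blast
    show "ennreal (exp (log_mean x)) \<le> (\<integral>\<^sup>+\<tau>. ennreal (exp (A x \<tau>)) \<partial>U)"
      unfolding log_mean_eq_lme[OF b] bounded_energy.exp_lme[OF b] ..
  qed
  also have "\<dots> = (\<integral>\<^sup>+\<tau>. \<integral>\<^sup>+x. ennreal (exp (A x \<tau>)) \<partial>?P \<partial>U)"
    by (rule PU.Fubini'[symmetric]) measurable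
  also have "\<dots> \<le> (\<integral>\<^sup>+\<tau>. ennreal (exp (V / 2)) \<partial>U)"
    by (intro nn_integral_mono) (use A_mgf[of _ 1] in simp)
  also have "\<dots> = ennreal (exp (V / 2))" by (simp add: U.emeasure_space_1)
  finally show ?thesis .
qed

lemma log_mean_integrable: "integrable (gauss I) log_mean"
proof (rule integrableI_bounded)
  have "(\<integral>\<^sup>+x. ennreal (norm (log_mean x)) \<partial>gauss I) \<le> (\<integral>\<^sup>+x. ennreal (exp (log_mean x)) + ennreal (exp (- 1 * log_mean x)) \<partial>gauss I)"
  proof (rule nn_integral_mono)
    fix x
    have "log_mean x \<le> exp (log_mean x)" "- log_mean x \<le> exp (- log_mean x)" "exp (log_mean x) > 0" "exp (- log_mean x) > 0"
      using exp_ge_add_one_self[of "log_mean x"] exp_ge_add_one_self[of "- log_mean x"] by (linarith, linarith, simp_all)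
    then have "\<bar>log_mean x\<bar> \<le> exp (log_mean x) + exp (- log_mean x)" by linarith
    then have "norm (log_mean x) \<le> exp (log_mean x) + exp (- 1 * log_mean x)" by simp
    then show "ennreal (norm (log_mean x)) \<le> ennreal (exp (log_mean x)) + ennreal (exp (- 1 * log_mean x))"
      using ennreal_leI[of "norm (log_mean x)" "exp (log_mean x) + exp (- 1 * log_mean x)"] by simp
  qed
  also have "\<dots> = (\<integral>\<^sup>+x. ennreal (exp (log_mean x)) \<partial>gauss I) + (\<integral>\<^sup>+x. ennreal (exp (- 1 * log_mean x)) \<partial>gauss I)"
    by (rule nn_integral_add) measurable
  also have "\<dots> \<le> ennreal (exp (V / 2)) + ennreal (exp (1\<^sup>2 * V / 2))"
    by (intro add_mono pos_mgf neg_mgf) auto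
  also have "\<dots> < \<infinity>" by (simp add: ennreal_plus[symmetric] del: ennreal_plus)
  finally show "(\<integral>\<^sup>+x. ennreal (norm (log_mean x)) \<partial>gauss I) < \<infinity>" .
qed measurable

text \<open>The Gibbs measure of x does not depend on the fresh copy y, so averaging over y yields
  exp ((B s)^2 V / 2) pointwise. The drift - k A x with k = B (1 - c) turns the Gibbs density into
  its power 1 - k times exp (- k \<open>log_mean x\<close>); \<open>gibbs_power_le\<close> and
  \<open>neg_mgf\<close> control the two factors.\<close>

lemma increment_mgf:
  assumes B: "B \<ge> 1" and c: "0 \<le> B * (1 - c)" "B * (1 - c) \<le> 1"
  shows "(\<integral>\<^sup>+p. ennreal (exp (B * (log_mean (lin_comb I c s (fst p) (snd p)) - log_mean (fst p)))) \<partial>(gauss I \<Otimes>\<^sub>M gauss I))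
     \<le> ennreal (exp ((B * s)\<^sup>2 * V / 2) * exp ((B * (1 - c))\<^sup>2 * V / 2))"
proof -
  define k where "k = B * (1 - c)"
  let ?P = "gauss I"
  have [measurable]: "(\<lambda>x. A (g x) (h x)) \<in> borel_measurable M"
    if "g \<in> measurable M ?P" "h \<in> measurable M U" for g h and M :: "'z measure"
    using measurable_compose[OF measurable_Pair[OF that] A_meas] by simp
  have Pg: "AE x in ?P. x \<in> G \<and> x \<in> space ?P" using G_AE by (auto intro: AE_conjI)
  have step: "ennreal (exp (B * (log_mean (lin_comb I c s x y) - log_mean x)))
     \<le> (\<integral>\<^sup>+\<tau>. ennreal (exp (A x \<tau> - log_mean x - k * A x \<tau>)) * ennreal (exp (B * s * A y \<tau>)) \<partial>U)"
    if x: "x \<in> G" "x \<in> space ?P" and y: "y \<in> G" "y \<in> space ?P" for x y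
  proof -
    obtain b where b: "bounded_energy U (A x) b" using energy[OF x] by blast
    obtain b' where b': "bounded_energy U (A y) b'" using energy[OF y] by blast
    interpret x: bounded_energy U "A x" b by fact
    interpret y: bounded_energy U "A y" b' by fact
    define v where "v \<tau> = (c - 1) * A x \<tau> + s * A y \<tau>" for \<tau>
    have v: "bounded_energy U (\<lambda>\<tau>. A x \<tau> + v \<tau>) (\<bar>c\<bar> * b + \<bar>s\<bar> * b')"
    proof
      fix \<tau> assume \<tau>: "\<tau> \<in> space U"
      have "\<bar>c * A x \<tau>\<bar> \<le> \<bar>c\<bar> * b" "\<bar>s * A y \<tau>\<bar> \<le> \<bar>s\<bar> * b'"
        unfolding abs_mult using x.a_bdd[OF \<tau>] y.a_bdd[OF \<tau>] by (auto intro!: mult_left_mono)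
      moreover have "A x \<tau> + v \<tau> = c * A x \<tau> + s * A y \<tau>" by (simp add: v_def algebra_simps)
      ultimately show "\<bar>A x \<tau> + v \<tau>\<bar> \<le> \<bar>c\<bar> * b + \<bar>s\<bar> * b'" by linarith
    qed (unfold v_def, measurable)
    have "log_mean (lin_comb I c s x y) = ln (\<integral>\<tau>. exp (A x \<tau> + v \<tau>) \<partial>U)"
      unfolding log_mean_def using A_lin[OF x(1) y(1)]
      by (intro arg_cong[where f=ln] Bochner_Integration.integral_cong) (auto simp: v_def algebra_simps)
    then have "log_mean (lin_comb I c s x y) = bounded_energy.log_mean_exp U (\<lambda>\<tau>. A x \<tau> + v \<tau>)"
      using bounded_energy.log_mean_exp_def[OF v] by simp
    then have "ennreal (exp (B * (log_mean (lin_comb I c s x y) - log_mean x))) \<le> (\<integral>\<^sup>+\<tau>. ennreal (exp (A x \<tau> - log_mean x + B * v \<tau>)) \<partial>U)"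
      using log_mean_exp_increment_power[OF b v B] log_mean_eq_lme[OF b] by simp
    also have "\<dots> = (\<integral>\<^sup>+\<tau>. ennreal (exp (A x \<tau> - log_mean x - k * A x \<tau>)) * ennreal (exp (B * s * A y \<tau>)) \<partial>U)"
      by (intro nn_integral_cong)
         (simp add: ennreal_mult''[symmetric] exp_add[symmetric] v_def k_def algebra_simps)
    finally show ?thesis .
  qed
  have inner: "(\<integral>\<^sup>+y. \<integral>\<^sup>+\<tau>. ennreal (exp (A x \<tau> - log_mean x - k * A x \<tau>)) * ennreal (exp (B * s * A y \<tau>)) \<partial>U \<partial>?P)
     \<le> ennreal (exp ((B * s)\<^sup>2 * V / 2)) * ennreal (exp (- k * log_mean x))"
    if x: "x \<in> G" "x \<in> space ?P" for x
  proof -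
    obtain b where b: "bounded_energy U (A x) b" using energy[OF x] by blast
    interpret x: bounded_energy U "A x" b by fact
    have fx: "log_mean x = x.log_mean_exp" by (rule log_mean_eq_lme[OF b])
    have "(\<integral>\<^sup>+y. \<integral>\<^sup>+\<tau>. ennreal (exp (A x \<tau> - log_mean x - k * A x \<tau>)) * ennreal (exp (B * s * A y \<tau>)) \<partial>U \<partial>?P)
      = (\<integral>\<^sup>+\<tau>. \<integral>\<^sup>+y. ennreal (exp (A x \<tau> - log_mean x - k * A x \<tau>)) * ennreal (exp (B * s * A y \<tau>)) \<partial>?P \<partial>U)"
      by (rule PU.Fubini'[symmetric]) measurable
    also have "\<dots> = (\<integral>\<^sup>+\<tau>. ennreal (exp (A x \<tau> - log_mean x - k * A x \<tau>)) * (\<integral>\<^sup>+y. ennreal (exp (B * s * A y \<tau>)) \<partial>?P) \<partial>U)"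
      using A_sect' by (intro nn_integral_cong nn_integral_cmult) auto
    also have "\<dots> \<le> (\<integral>\<^sup>+\<tau>. ennreal (exp (A x \<tau> - log_mean x - k * A x \<tau>)) * ennreal (exp ((B * s)\<^sup>2 * V / 2)) \<partial>U)"
      by (intro nn_integral_mono mult_left_mono A_mgf) auto
    \<comment> \<open>With F = \<open>log_mean x\<close>: A - F - k A = - k F + (1 - k) (A -
      F).\<close>
    also have "\<dots> = (\<integral>\<^sup>+\<tau>. ennreal (exp ((B * s)\<^sup>2 * V / 2)) * ennreal (exp (- k * log_mean x)) * ennreal (exp ((1 - k) * (A x \<tau> - x.log_mean_exp))) \<partial>U)"
      by (intro nn_integral_cong) (simp add: fx ennreal_mult''[symmetric] exp_add[symmetric] algebra_simps)
    also have "\<dots> = ennreal (exp ((B * s)\<^sup>2 * V / 2)) * ennreal (exp (- k * log_mean x)) * (\<integral>\<^sup>+\<tau>. ennreal (exp ((1 - k) * (A x \<tau> - x.log_mean_exp))) \<partial>U)"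
      by (rule nn_integral_cmult) measurable
    also have "\<dots> \<le> ennreal (exp ((B * s)\<^sup>2 * V / 2)) * ennreal (exp (- k * log_mean x)) * 1"
      using c by (intro mult_left_mono x.gibbs_power_le) (auto simp: k_def)
    finally show ?thesis by simp
  qed

  have "(\<integral>\<^sup>+p. ennreal (exp (B * (log_mean (lin_comb I c s (fst p) (snd p)) - log_mean (fst p)))) \<partial>(?P \<Otimes>\<^sub>M ?P))
     = (\<integral>\<^sup>+x. \<integral>\<^sup>+y. ennreal (exp (B * (log_mean (lin_comb I c s x y) - log_mean x))) \<partial>?P \<partial>?P)"
  proof -
    have "(\<lambda>p. ennreal (exp (B * (log_mean (lin_comb I c s (fst p) (snd p)) - log_mean (fst p))))) \<in> borel_measurable (?P \<Otimes>\<^sub>M ?P)"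
      by measurable
    from P.nn_integral_fst[OF this] show ?thesis by simp
  qed
  also have "\<dots> \<le> (\<integral>\<^sup>+x. \<integral>\<^sup>+y. (\<integral>\<^sup>+\<tau>. ennreal (exp (A x \<tau> - log_mean x - k * A x \<tau>)) * ennreal (exp (B * s * A y \<tau>)) \<partial>U) \<partial>?P \<partial>?P)"
    by (intro nn_integral_mono_AE eventually_mono[OF Pg]) (use step in blast)
  also have "\<dots> \<le> (\<integral>\<^sup>+x. ennreal (exp ((B * s)\<^sup>2 * V / 2)) * ennreal (exp (- k * log_mean x)) \<partial>?P)"
    by (intro nn_integral_mono_AE eventually_mono[OF Pg] inner) auto
  also have "\<dots> = ennreal (exp ((B * s)\<^sup>2 * V / 2)) * (\<integral>\<^sup>+x. ennreal (exp (- k * log_mean x)) \<partial>?P)"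
    by (rule nn_integral_cmult) measurable
  also have "\<dots> \<le> ennreal (exp ((B * s)\<^sup>2 * V / 2)) * ennreal (exp (k\<^sup>2 * V / 2))"
    using c by (intro mult_left_mono neg_mgf) (auto simp: k_def)
  finally show ?thesis by (simp add: k_def ennreal_mult'')
qed


text \<open>The rotation \<open>X\<^sub>k = cos (k\<phi>) x + sin (k\<phi>) y\<close> leads from \<open>x\<close> to \<open>y\<close> in \<open>K\<close> steps with identically
  distributed pairs \<open>(X\<^sub>k, X\<^sub>k\<^sub>+\<^sub>1)\<close>: a discrete form of the Maurey--Pisier argument.\<close>

lemma symmetrized_mgf:
  assumes a: "a > 0"
  shows "(\<integral>\<^sup>+p. ennreal (exp (a * (log_mean (snd p) - log_mean (fst p)))) \<partial>(gauss I \<Otimes>\<^sub>M gauss I)) \<le> ennreal (exp (2 * a\<^sup>2 * V))"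
proof -
  let ?P = "gauss I"
  \<comment> \<open>K \<ge> 1 / a gives B \<ge> 1, K \<ge> 2 a gives B (1 - cos \<phi>) \<le> 1, and
    K \<ge> 2 gives \<phi> \<le> pi / 4.\<close>
  obtain K :: nat where K: "real K \<ge> 1 / a + 2 * a + 2" using real_arch_simple by blast
  have "1 / a > 0" using a by simp
  with K a have K2: "real K \<ge> 1 / a" "real K \<ge> 2 * a" "real K \<ge> 2" by linarith+
  then have K0: "K > 0" by (cases K) auto
  define \<phi> where "\<phi> = pi / 2 / real K"
  define B where "B = a * real K"
  have B: "B \<ge> 1" using K2(1) a by (simp add: B_def field_simps)
  have \<phi>: "\<phi> > 0" "\<phi> \<le> pi / 4" "real K * \<phi> = pi / 2" using K0 K2(3) by (auto simp: \<phi>_def field_simps)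
  define X where "X k p = lin_comb I (cos (real k * \<phi>)) (sin (real k * \<phi>)) (fst p) (snd p)" for k p
  have Xm: "X k \<in> measurable (?P \<Otimes>\<^sub>M ?P) ?P" for k unfolding X_def by measurable
  have fX[measurable]: "(\<lambda>p. log_mean (X k p)) \<in> borel_measurable (?P \<Otimes>\<^sub>M ?P)" for k
    by (rule measurable_compose[OF Xm log_mean_meas])
  have X0: "X 0 p = fst p" if "p \<in> space (?P \<Otimes>\<^sub>M ?P)" for p
    using that by (cases p) (auto simp: X_def lin_comb_def space_pair_measure space_PiM PiE_def extensional_def fun_eq_iff)
  have XK: "X K p = snd p" if "p \<in> space (?P \<Otimes>\<^sub>M ?P)" for p
    using that by (cases p) (auto simp: X_def \<phi>(3) lin_comb_def space_pair_measure space_PiM PiE_def extensional_def fun_eq_iff)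
  define C where "C = (B * sin \<phi>)\<^sup>2 * V / 2 + (B * (1 - cos \<phi>))\<^sup>2 * V / 2"
  have cos1: "1 - cos \<phi> \<le> \<phi>\<^sup>2 / 2"
  proof -
    have "1 - cos \<phi> = 2 * (sin (\<phi> / 2))\<^sup>2" using cos_double_sin[of "\<phi> / 2"] by simp
    also have "(sin (\<phi> / 2))\<^sup>2 \<le> (\<phi> / 2)\<^sup>2"
      using \<phi> by (intro power_mono sin_x_le_x sin_ge_zero) auto
    finally show ?thesis by (simp add: power_divide)
  qed
  have pi2: "pi\<^sup>2 \<le> 10"
  proof -
    have "pi \<le> 3.15" using pi_approx by simp
    then have "pi\<^sup>2 \<le> 3.15\<^sup>2" by (intro power_mono) auto
    also have "\<dots> \<le> (10 :: real)" by (simp add: power2_eq_square)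
    finally show ?thesis .
  qed
  have k1: "B * (1 - cos \<phi>) \<le> a * (pi\<^sup>2 / 8) / real K"
  proof -
    have "B * (1 - cos \<phi>) \<le> B * (\<phi>\<^sup>2 / 2)" using B cos1 by (intro mult_left_mono) auto
    also have "\<dots> = a * (pi\<^sup>2 / 8) / real K" using K0 by (simp add: B_def \<phi>_def power2_eq_square)
    finally show ?thesis .
  qed
  have k2: "a * (pi\<^sup>2 / 8) / real K \<le> a * (5/8)"
  proof -
    have "a * (pi\<^sup>2 / 8) / real K \<le> a * (10 / 8) / 2"
      using pi2 a K2(3) by (intro frac_le mult_left_mono) auto
    then show ?thesis by simp
  qed
  have k3: "a * (pi\<^sup>2 / 8) / real K \<le> 1"
  proof -
    have "a * (pi\<^sup>2 / 8) \<le> a * 2" using pi2 a by (intro mult_left_mono) auto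
    also have "\<dots> \<le> real K" using K2(2) by simp
    finally show ?thesis using K0 by simp
  qed
  \<comment> \<open>(B \<phi>)^2 = a^2 pi^2 / 4 \<le> 5 a^2 / 2, and the cosine part is at most 3
    a^2 / 2. Their sum 4 a^2 times V / 2 is the claimed exponent.\<close>
  have C: "C \<le> 2 * a\<^sup>2 * V"
  proof -
    have "\<bar>sin \<phi>\<bar> \<le> \<phi>" using \<phi> sin_x_le_x[of \<phi>] sin_ge_zero[of \<phi>] by auto
    then have "(sin \<phi>)\<^sup>2 \<le> \<phi>\<^sup>2" using power_mono[of "\<bar>sin \<phi>\<bar>" \<phi> 2] by simp
    then have "(B * sin \<phi>)\<^sup>2 \<le> B\<^sup>2 * \<phi>\<^sup>2" unfolding power_mult_distrib by (intro mult_left_mono) auto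
    also have "\<dots> = a\<^sup>2 * (pi\<^sup>2 / 4)" using K0 by (simp add: B_def \<phi>_def power_divide power_mult_distrib)
    also have "\<dots> \<le> a\<^sup>2 * (5/2)" using pi2 by (intro mult_left_mono) auto
    finally have 1: "(B * sin \<phi>)\<^sup>2 \<le> a\<^sup>2 * (5/2)" .
    have "(B * (1 - cos \<phi>))\<^sup>2 \<le> (a * (5/8))\<^sup>2"
      using k1 k2 B by (intro power_mono) auto
    then have 2: "(B * (1 - cos \<phi>))\<^sup>2 \<le> a\<^sup>2 * (3/2)" by (simp add: power_mult_distrib power2_eq_square)
       (smt (verit) mult_nonneg_nonneg a)
    have "(B * sin \<phi>)\<^sup>2 + (B * (1 - cos \<phi>))\<^sup>2 \<le> a\<^sup>2 * 4" using 1 2 by (simp add: algebra_simps)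
    then have "((B * sin \<phi>)\<^sup>2 + (B * (1 - cos \<phi>))\<^sup>2) * (V / 2) \<le> a\<^sup>2 * 4 * (V / 2)"
      using V_pos by (intro mult_right_mono) auto
    then show ?thesis by (simp add: C_def algebra_simps add_divide_distrib)
  qed
  have stepbound: "(\<integral>\<^sup>+p. ennreal (exp (B * (log_mean (X (Suc k) p) - log_mean (X k p)))) \<partial>(?P \<Otimes>\<^sub>M ?P)) \<le> ennreal (exp C)" if k: "k < K" for k
  proof -
    define c s where "c = cos (real k * \<phi>)" and "s = sin (real k * \<phi>)"
    define F where "F p = ennreal (exp (B * (log_mean (lin_comb I (cos \<phi>) (sin \<phi>) (fst p) (snd p)) - log_mean (fst p))))" for p
    have Fm: "F \<in> borel_measurable (?P \<Otimes>\<^sub>M ?P)" unfolding F_def by measurable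
    have Fb: "(\<integral>\<^sup>+p. F p \<partial>(?P \<Otimes>\<^sub>M ?P)) \<le> ennreal (exp C)"
      unfolding F_def C_def exp_add using B k1 k3 cos_le_one[of \<phi>] by (intro increment_mgf) auto
    have cs: "c\<^sup>2 + s\<^sup>2 = 1" by (simp add: c_def s_def)
    have XF: "ennreal (exp (B * (log_mean (X (Suc k) p) - log_mean (X k p)))) = F (lin_comb I c s (fst p) (snd p), lin_comb I (- s) c (fst p) (snd p))" for p
    proof -
      have "real (Suc k) * \<phi> = real k * \<phi> + \<phi>" by (simp add: algebra_simps)
      then have "X (Suc k) p = lin_comb I (cos \<phi>) (sin \<phi>) (lin_comb I c s (fst p) (snd p)) (lin_comb I (- s) c (fst p) (snd p))"
        unfolding X_def lin_comb_def by (auto simp: c_def s_def cos_add sin_add fun_eq_iff algebra_simps)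
      then show ?thesis by (simp add: F_def X_def c_def s_def)
    qed
    show ?thesis
    \<comment> \<open>The shear decomposition needs a nonzero sine. For k < K the angle is below pi
      / 2, so the sine vanishes only at k = 0, where the pair (x, y) is not rotated at all.\<close>
    proof (cases "s = 0")
      case False
      show ?thesis unfolding XF nn_integral_gauss_rotate[OF cs False Fm] by (rule Fb)
    next
      case True
      have "k = 0"
      proof (rule ccontr)
        assume "k \<noteq> 0"
        then have "0 < real k * \<phi>" using \<phi> by simp
        moreover have "real k * \<phi> < real K * \<phi>" using k \<phi> by simp
        ultimately have "sin (real k * \<phi>) > 0" using \<phi>(3) by (intro sin_gt_zero) auto
        with True show False by (simp add: s_def)
      qed
      then show ?thesis
      proof -
        assume k: "k = 0"
        have "(\<integral>\<^sup>+p. ennreal (exp (B * (log_mean (X (Suc k) p) - log_mean (X k p)))) \<partial>(?P \<Otimes>\<^sub>M ?P)) = (\<integral>\<^sup>+p. F p \<partial>(?P \<Otimes>\<^sub>M ?P))"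
          using X0 by (intro nn_integral_cong) (simp add: k F_def, simp add: X_def)
        then show ?thesis using Fb by simp
      qed
    qed
  qed
  have "(\<integral>\<^sup>+p. ennreal (exp (a * (log_mean (snd p) - log_mean (fst p)))) \<partial>(?P \<Otimes>\<^sub>M ?P))
      \<le> (\<integral>\<^sup>+p. (\<Sum>k<K. ennreal (1 / real K) * ennreal (exp (B * (log_mean (X (Suc k) p) - log_mean (X k p))))) \<partial>(?P \<Otimes>\<^sub>M ?P))"
  proof (rule nn_integral_mono)
    fix p assume p: "p \<in> space (?P \<Otimes>\<^sub>M ?P)"
    have "(\<Sum>k<K. log_mean (X (Suc k) p) - log_mean (X k p)) = log_mean (X K p) - log_mean (X 0 p)" by (rule sum_lessThan_telescope)
    \<comment> \<open>The increments telescope, and B = a K makes the exponent the average of K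
      scaled increments. Convexity of exp then separates the steps, although they are
      dependent.\<close>
    then have "a * (log_mean (snd p) - log_mean (fst p)) = (\<Sum>k<K. (1 / real K) *\<^sub>R (B * (log_mean (X (Suc k) p) - log_mean (X k p))))"
      using K0 X0[OF p] XK[OF p] by (simp add: B_def sum_distrib_left[symmetric])
    then have "exp (a * (log_mean (snd p) - log_mean (fst p))) = exp (\<Sum>k<K. (1 / real K) *\<^sub>R (B * (log_mean (X (Suc k) p) - log_mean (X k p))))" by simp
    also have "\<dots> \<le> (\<Sum>k<K. 1 / real K * exp (B * (log_mean (X (Suc k) p) - log_mean (X k p))))"
      using K0 by (intro convex_on_sum[OF _ _ exp_convex]) auto
    finally have "ennreal (exp (a * (log_mean (snd p) - log_mean (fst p)))) \<le> ennreal (\<Sum>k<K. 1 / real K * exp (B * (log_mean (X (Suc k) p) - log_mean (X k p))))"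
      by (rule ennreal_leI)
    also have "\<dots> = (\<Sum>k<K. ennreal (1 / real K) * ennreal (exp (B * (log_mean (X (Suc k) p) - log_mean (X k p)))))"
      by (subst sum_ennreal[symmetric]) (auto simp: ennreal_mult''[symmetric])
    finally show "ennreal (exp (a * (log_mean (snd p) - log_mean (fst p)))) \<le> (\<Sum>k<K. ennreal (1 / real K) * ennreal (exp (B * (log_mean (X (Suc k) p) - log_mean (X k p)))))" .
  qed
  also have "\<dots> = (\<Sum>k<K. ennreal (1 / real K) * (\<integral>\<^sup>+p. ennreal (exp (B * (log_mean (X (Suc k) p) - log_mean (X k p)))) \<partial>(?P \<Otimes>\<^sub>M ?P)))"
    by (subst nn_integral_sum) (auto intro!: sum.cong nn_integral_cmult)
  also have "\<dots> \<le> (\<Sum>k<K. ennreal (1 / real K) * ennreal (exp C))"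
    by (intro sum_mono mult_left_mono stepbound) auto
  also have "\<dots> = ennreal (exp C)"
    using K0 by (simp add: ennreal_of_nat_eq_real_of_nat ennreal_mult''[symmetric])
  also have "\<dots> \<le> ennreal (exp (2 * a\<^sup>2 * V))" using C by (intro ennreal_leI) simp
  finally show ?thesis .
qed

text \<open>The symmetrised integral is the product of the two centred ones. Each of them is at
  least 1 by \<open>nn_integral_exp_ge\<close>, so each is bounded by the product.\<close>

lemma centered_mgf:
  assumes a: "a > 0"
  shows "(\<integral>\<^sup>+x. ennreal (exp (a * (log_mean x - P.expectation log_mean))) \<partial>gauss I) \<le> ennreal (exp (2 * a\<^sup>2 * V))"
    and "(\<integral>\<^sup>+x. ennreal (exp (a * (P.expectation log_mean - log_mean x))) \<partial>gauss I) \<le> ennreal (exp (2 * a\<^sup>2 * V))"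
proof -
  let ?P = "gauss I"
  define m where "m = P.expectation log_mean"
  have m: "(\<lambda>p. ennreal (exp (a * (log_mean (snd p) - log_mean (fst p))))) \<in> borel_measurable (?P \<Otimes>\<^sub>M ?P)" by measurable
  have eq1: "(\<integral>\<^sup>+p. ennreal (exp (a * (log_mean (snd p) - log_mean (fst p)))) \<partial>(?P \<Otimes>\<^sub>M ?P)) = (\<integral>\<^sup>+x. \<integral>\<^sup>+y. ennreal (exp (a * (log_mean y - log_mean x))) \<partial>?P \<partial>?P)"
    using P.nn_integral_fst[OF m] by simp
  have eq2: "(\<integral>\<^sup>+x. \<integral>\<^sup>+y. ennreal (exp (a * (log_mean y - log_mean x))) \<partial>?P \<partial>?P) = (\<integral>\<^sup>+y. \<integral>\<^sup>+x. ennreal (exp (a * (log_mean y - log_mean x))) \<partial>?P \<partial>?P)"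
    by (rule PP.Fubini'[symmetric]) measurable
  have 1: "1 \<le> (\<integral>\<^sup>+y. ennreal (exp (a * (log_mean y - m))) \<partial>?P)" "1 \<le> (\<integral>\<^sup>+x. ennreal (exp (a * (m - log_mean x))) \<partial>?P)"
    using log_mean_integrable by (auto intro!: P.nn_integral_exp_ge simp: m_def P.prob_space)
  have "(\<integral>\<^sup>+x. ennreal (exp (a * (m - log_mean x))) \<partial>?P) \<le> (\<integral>\<^sup>+x. \<integral>\<^sup>+y. ennreal (exp (a * (log_mean y - log_mean x))) \<partial>?P \<partial>?P)"
  proof (rule nn_integral_mono)
    fix x
    have "(\<integral>\<^sup>+y. ennreal (exp (a * (log_mean y - log_mean x))) \<partial>?P) = (\<integral>\<^sup>+y. ennreal (exp (a * (m - log_mean x))) * ennreal (exp (a * (log_mean y - m))) \<partial>?P)"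
      by (intro nn_integral_cong) (simp add: ennreal_mult''[symmetric] exp_add[symmetric] algebra_simps)
    also have "\<dots> = ennreal (exp (a * (m - log_mean x))) * (\<integral>\<^sup>+y. ennreal (exp (a * (log_mean y - m))) \<partial>?P)"
      by (rule nn_integral_cmult) measurable
    finally show "ennreal (exp (a * (m - log_mean x))) \<le> (\<integral>\<^sup>+y. ennreal (exp (a * (log_mean y - log_mean x))) \<partial>?P)"
      using mult_left_mono[OF 1(1), of "ennreal (exp (a * (m - log_mean x)))"] by simp
  qed
  then show "(\<integral>\<^sup>+x. ennreal (exp (a * (P.expectation log_mean - log_mean x))) \<partial>gauss I) \<le> ennreal (exp (2 * a\<^sup>2 * V))"
    using symmetrized_mgf[OF a] unfolding eq1 m_def by (rule order_trans)
  have "(\<integral>\<^sup>+y. ennreal (exp (a * (log_mean y - m))) \<partial>?P) \<le> (\<integral>\<^sup>+y. \<integral>\<^sup>+x. ennreal (exp (a * (log_mean y - log_mean x))) \<partial>?P \<partial>?P)"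
  proof (rule nn_integral_mono)
    fix y
    have "(\<integral>\<^sup>+x. ennreal (exp (a * (log_mean y - log_mean x))) \<partial>?P) = (\<integral>\<^sup>+x. ennreal (exp (a * (log_mean y - m))) * ennreal (exp (a * (m - log_mean x))) \<partial>?P)"
      by (intro nn_integral_cong) (simp add: ennreal_mult''[symmetric] exp_add[symmetric] algebra_simps)
    also have "\<dots> = ennreal (exp (a * (log_mean y - m))) * (\<integral>\<^sup>+x. ennreal (exp (a * (m - log_mean x))) \<partial>?P)"
      by (rule nn_integral_cmult) measurable
    finally show "ennreal (exp (a * (log_mean y - m))) \<le> (\<integral>\<^sup>+x. ennreal (exp (a * (log_mean y - log_mean x))) \<partial>?P)"
      using mult_left_mono[OF 1(2), of "ennreal (exp (a * (log_mean y - m)))"] by simp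
  qed
  then show "(\<integral>\<^sup>+x. ennreal (exp (a * (log_mean x - P.expectation log_mean))) \<partial>gauss I) \<le> ennreal (exp (2 * a\<^sup>2 * V))"
    using symmetrized_mgf[OF a] unfolding eq1 eq2 m_def by (rule order_trans)
qed

lemma concentration:
  assumes t: "t > 0"
  shows "measure (gauss I) {x \<in> space (gauss I). \<bar>log_mean x - P.expectation log_mean\<bar> \<ge> t} \<le> 2 * exp (- t\<^sup>2 / (8 * V))"
proof -
  let ?P = "gauss I"
  define m where "m = P.expectation log_mean"
  \<comment> \<open>The minimiser of 2 a^2 V - a t.\<close>
  define a where "a = t / (4 * V)"
  have a: "a > 0" using t V_pos by (simp add: a_def)
  have ex: "2 * a\<^sup>2 * V - a * t = - t\<^sup>2 / (8 * V)" using V_pos by (simp add: a_def power2_eq_square field_simps)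
  have tail: "measure ?P {x \<in> space ?P. g x \<ge> t} \<le> exp (- t\<^sup>2 / (8 * V))"
    if [measurable]: "g \<in> borel_measurable ?P" and g: "(\<integral>\<^sup>+x. ennreal (exp (a * g x)) \<partial>?P) \<le> ennreal (exp (2 * a\<^sup>2 * V))" for g
  proof -
    have "emeasure ?P {x \<in> space ?P. g x \<ge> t} \<le> emeasure ?P ({x \<in> space ?P. 1 \<le> ennreal (exp (- a * t)) * ennreal (exp (a * g x))} \<inter> space ?P)"
    proof (rule emeasure_mono)
      show "{x \<in> space ?P. g x \<ge> t} \<subseteq> {x \<in> space ?P. 1 \<le> ennreal (exp (- a * t)) * ennreal (exp (a * g x))} \<inter> space ?P"
      proof safe
        fix x assume "t \<le> g x"
        then have "0 \<le> - a * t + a * g x" using a by simp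
        then have "1 \<le> exp (- a * t + a * g x)" by simp
        then show "1 \<le> ennreal (exp (- a * t)) * ennreal (exp (a * g x))"
          by (simp add: ennreal_mult''[symmetric] exp_add[symmetric])
      qed
    qed measurable
    also have "\<dots> \<le> ennreal (exp (- a * t)) * (\<integral>\<^sup>+x. ennreal (exp (a * g x)) * indicator (space ?P) x \<partial>?P)"
      using nn_integral_Markov_inequality[of "\<lambda>x. ennreal (exp (a * g x))" "space ?P" ?P "ennreal (exp (- a * t))"]
      by (simp add: Int_def conj_commute)
    also have "\<dots> = ennreal (exp (- a * t)) * (\<integral>\<^sup>+x. ennreal (exp (a * g x)) \<partial>?P)"
      by (intro arg_cong2[where f="(*)"] nn_integral_cong) auto
    also have "\<dots> \<le> ennreal (exp (- a * t)) * ennreal (exp (2 * a\<^sup>2 * V))" by (intro mult_left_mono g) auto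
    also have "\<dots> = ennreal (exp (- t\<^sup>2 / (8 * V)))"
      unfolding ex[symmetric] by (simp add: ennreal_mult''[symmetric] exp_add[symmetric])
    finally show ?thesis unfolding P.emeasure_eq_measure by (simp add: ennreal_le_iff)
  qed
  have "measure ?P {x \<in> space ?P. \<bar>log_mean x - m\<bar> \<ge> t} \<le> measure ?P ({x \<in> space ?P. log_mean x - m \<ge> t} \<union> {x \<in> space ?P. m - log_mean x \<ge> t})"
    by (intro P.finite_measure_mono) (auto simp: abs_if split: if_splits)
  also have "\<dots> \<le> measure ?P {x \<in> space ?P. log_mean x - m \<ge> t} + measure ?P {x \<in> space ?P. m - log_mean x \<ge> t}"
    by (intro measure_Un_le) measurable
  also have "\<dots> \<le> exp (- t\<^sup>2 / (8 * V)) + exp (- t\<^sup>2 / (8 * V))"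
    using centered_mgf[OF a] by (intro add_mono tail) (auto simp: m_def)
  finally show ?thesis by (simp add: m_def)
qed

end

section \<open>Norms of Gaussian tensors\<close>

lemma finite_multi_indices: "finite (multi_indices N p)"
proof -
  have "multi_indices N p = {is. set is \<subseteq> {..<N} \<and> length is = p}" by (auto simp: multi_indices_def)
  then show ?thesis by (simp add: finite_lists_length_eq)
qed

lemma multi_indices_0 [simp]: "multi_indices N 0 = {[]}"
  by (auto simp: multi_indices_def)

lemma multi_indices_Suc: "multi_indices N (Suc p) = (\<lambda>(i, is). i # is) ` ({..<N} \<times> multi_indices N p)"
proof (intro equalityI subsetI)
  fix xs assume "xs \<in> multi_indices N (Suc p)"
  then show "xs \<in> (\<lambda>(i, is). i # is) ` ({..<N} \<times> multi_indices N p)"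
    by (cases xs) (auto simp: multi_indices_def image_iff)
qed (auto simp: multi_indices_def)

lemma sum_multi_indices_Suc:
  "(\<Sum>is\<in>multi_indices N (Suc p). g is) = (\<Sum>i<N. \<Sum>is\<in>multi_indices N p. g (i # is))"
  unfolding multi_indices_Suc
  by (subst sum.reindex) (auto simp: inj_on_def sum.cartesian_product case_prod_beta)

text \<open>The multilinear form with coefficients J. The recursion contracts the first argument
  into the coefficients, so bounds over all orders go by induction on the list with J
  arbitrary.\<close>

fun tensor_form :: "nat \<Rightarrow> (nat list \<Rightarrow> real) \<Rightarrow> (nat \<Rightarrow> real) list \<Rightarrow> real" where
  "tensor_form N J [] = J []"
| "tensor_form N J (x # xs) = tensor_form N (\<lambda>is. \<Sum>i<N. x i * J (i # is)) xs"

fun rank1 :: "(nat \<Rightarrow> real) list \<Rightarrow> nat list \<Rightarrow> real" where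
  "rank1 (x # xs) (i # is) = x i * rank1 xs is"
| "rank1 _ _ = 1"

lemma tensor_form_eq: "tensor_form N J xs = (\<Sum>is\<in>multi_indices N (length xs). J is * rank1 xs is)"
proof (induction xs arbitrary: J)
  case (Cons x xs)
  have "tensor_form N J (x # xs) = (\<Sum>is\<in>multi_indices N (length xs). (\<Sum>i<N. x i * J (i # is)) * rank1 xs is)"
    by (simp add: Cons.IH)
  also have "\<dots> = (\<Sum>is\<in>multi_indices N (length xs). \<Sum>i<N. J (i # is) * (x i * rank1 xs is))"
    by (simp add: sum_distrib_right sum_distrib_left mult_ac)
  also have "\<dots> = (\<Sum>i<N. \<Sum>is\<in>multi_indices N (length xs). J (i # is) * (x i * rank1 xs is))" by (rule sum.swap)
  also have "\<dots> = (\<Sum>is\<in>multi_indices N (Suc (length xs)). J is * rank1 (x # xs) is)"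
    unfolding sum_multi_indices_Suc by simp
  finally show ?case by simp
qed simp

lemma rank1_replicate: "length is = p \<Longrightarrow> rank1 (replicate p x) is = prod_list (map x is)"
  by (induction p arbitrary: "is") (auto simp: length_Suc_conv)

lemma pure_hamiltonian_tens:
  "pure_hamiltonian N \<gamma> J p m = \<gamma> p / real N powr ((real p - 1) / 2) * tensor_form N J (replicate p m)"
  unfolding pure_hamiltonian_def tensor_form_eq
  by (intro arg_cong2[where f="(*)"] sum.cong) (auto simp: rank1_replicate multi_indices_def)

lemma tensor_form_Cons: "tensor_form N J (x # xs) = (\<Sum>i<N. x i * tensor_form N (\<lambda>is. J (i # is)) xs)"
  unfolding tensor_form_eq by (simp add: sum_multi_indices_Suc sum_distrib_left mult_ac)

lemma tensor_form_add_scale: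
  "tensor_form N (\<lambda>is. c * J is + s * J' is) xs = c * tensor_form N J xs + s * tensor_form N J' xs"
  unfolding tensor_form_eq by (simp add: sum.distrib sum_distrib_left algebra_simps)

lemma tensor_form_cong: "(\<And>is. is \<in> multi_indices N (length xs) \<Longrightarrow> J is = J' is) \<Longrightarrow> tensor_form N J xs = tensor_form N J' xs"
  unfolding tensor_form_eq by (intro sum.cong) auto

section \<open>Finite nets of the unit ball\<close>

definition is_net :: "nat \<Rightarrow> real \<Rightarrow> (nat \<Rightarrow> real) set \<Rightarrow> bool" where
  "is_net N h Y \<longleftrightarrow> (\<forall>x. L2_set x {..<N} \<le> 1 \<longrightarrow> (\<exists>y\<in>Y. L2_set (\<lambda>i. x i - y i) {..<N} \<le> h))"

text \<open>Testing on the normalised coefficient vector: its norm \<open>l\<close> satisfies \<open>l \<le> M + h l\<close>.\<close>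

lemma linear_net_bound:
  assumes net: "is_net N h Y" and h: "0 \<le> h" "h < 1" and M: "\<And>y. y \<in> Y \<Longrightarrow> \<bar>\<Sum>i<N. y i * c i\<bar> \<le> M"
  shows "\<bar>\<Sum>i<N. x i * c i\<bar> \<le> M / (1 - h) * L2_set x {..<N}"
proof -
  define l where "l = L2_set c {..<N}"
  have cs: "\<bar>\<Sum>i<N. x i * c i\<bar> \<le> L2_set x {..<N} * l" for x
  proof -
    have "\<bar>\<Sum>i<N. x i * c i\<bar> \<le> (\<Sum>i<N. \<bar>x i\<bar> * \<bar>c i\<bar>)"
      by (rule order_trans[OF sum_abs]) (simp add: abs_mult)
    also have "\<dots> \<le> L2_set x {..<N} * l" unfolding l_def by (rule L2_set_mult_ineq)
    finally show ?thesis .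
  qed
  have "l \<le> M / (1 - h)"
  proof (cases "l = 0")
    case True
    have "L2_set (\<lambda>_. 0) {..<N} \<le> 1" by (simp add: L2_set_def)
    then obtain y where "y \<in> Y" using net unfolding is_net_def by blast
    from M[OF this] have "M \<ge> 0" by linarith
    then show ?thesis using True h by simp
  next
    case False
    then have l: "l > 0" unfolding l_def using L2_set_nonneg[of c "{..<N}"] by linarith
    define x where "x i = c i / l" for i
    have "L2_set x {..<N} = 1 / l * L2_set c {..<N}"
      unfolding x_def using l L2_set_right_distrib[of "1 / l" c "{..<N}"] by simp
    then have "L2_set x {..<N} = 1" using l by (simp add: l_def)
    then obtain y where y: "y \<in> Y" "L2_set (\<lambda>i. x i - y i) {..<N} \<le> h"
      using net unfolding is_net_def by (metis order_refl)
    have "(\<Sum>i<N. x i * c i) = (\<Sum>i<N. (c i)\<^sup>2) / l"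
      by (simp add: x_def power2_eq_square sum_divide_distrib)
    also have "(\<Sum>i<N. (c i)\<^sup>2) = l * l"
      by (simp add: l_def L2_set_def sum_nonneg)
    finally have "l = (\<Sum>i<N. y i * c i) + (\<Sum>i<N. (x i - y i) * c i)"
      using l by (simp add: left_diff_distrib sum_subtractf)
    also have "\<dots> \<le> M + h * l"
    proof -
      have "L2_set (\<lambda>i. x i - y i) {..<N} * l \<le> h * l" using y(2) l by (intro mult_right_mono) auto
      then show ?thesis using M[OF y(1)] cs[of "\<lambda>i. x i - y i"] by linarith
    qed
    finally have "l * (1 - h) \<le> M" by (simp add: algebra_simps)
    then show ?thesis using h by (simp add: pos_le_divide_eq)
  qed
  then have "L2_set x {..<N} * l \<le> L2_set x {..<N} * (M / (1 - h))" by (intro mult_left_mono) auto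
  with cs[of x] show ?thesis by (simp add: mult.commute)
qed

text \<open>The arguments are freed from the net one at a time: with the others fixed the form is
  linear, and \<open>linear_net_bound\<close> costs 1 / (1 - h).\<close>

lemma tensor_form_net_bound:
  assumes net: "is_net N h Y" and h: "0 \<le> h" "h < 1"
    and M: "\<And>ys. set ys \<subseteq> Y \<Longrightarrow> length ys = p \<Longrightarrow> \<bar>tensor_form N J ys\<bar> \<le> M" and xs: "length xs = p"
  shows "\<bar>tensor_form N J xs\<bar> \<le> M / (1 - h) ^ p * prod_list (map (\<lambda>x. L2_set x {..<N}) xs)"
  using M xs
proof (induction p arbitrary: J M xs)
  case 0
  then show ?case by simp
next
  case (Suc p)
  then obtain x xs' where xs: "xs = x # xs'" "length xs' = p" by (auto simp: length_Suc_conv)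
  define J' where "J' = (\<lambda>is. \<Sum>i<N. x i * J (i # is))"
  define l where "l = L2_set x {..<N}"
  have "\<bar>tensor_form N J' ys\<bar> \<le> M / (1 - h) * l" if ys: "set ys \<subseteq> Y" "length ys = p" for ys
  proof -
    have "tensor_form N J' ys = (\<Sum>i<N. x i * tensor_form N (\<lambda>is. J (i # is)) ys)"
      using tensor_form_Cons[of N J x ys] by (simp add: J'_def)
    also have "\<bar>\<dots>\<bar> \<le> M / (1 - h) * l"
      unfolding l_def
    proof (rule linear_net_bound[OF net h])
      fix y assume "y \<in> Y"
      then show "\<bar>\<Sum>i<N. y i * tensor_form N (\<lambda>is. J (i # is)) ys\<bar> \<le> M"
        using Suc.prems(1)[of "y # ys"] ys by (simp add: tensor_form_Cons[symmetric] del: tensor_form.simps)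
    qed
    finally show ?thesis .
  qed
  from Suc.IH[OF this xs(2)] have "\<bar>tensor_form N J' xs'\<bar> \<le> M / (1 - h) * l / (1 - h) ^ p * prod_list (map (\<lambda>x. L2_set x {..<N}) xs')" .
  then show ?case by (simp add: xs J'_def[symmetric] l_def mult_ac)
qed

definition tensor_form_bound :: "nat \<Rightarrow> nat \<Rightarrow> (nat list \<Rightarrow> real) \<Rightarrow> real \<Rightarrow> bool" where
  "tensor_form_bound N p J b \<longleftrightarrow> (\<forall>xs. length xs = p \<longrightarrow> \<bar>tensor_form N J xs\<bar> \<le> b * prod_list (map (\<lambda>x. L2_set x {..<N}) xs))"

text \<open>The p slots are changed from x to y one after the other. A slot already changed is
  contracted into the coefficients, which multiplies the bound b by R.\<close>

lemma tensor_form_diff_bound: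
  assumes "tensor_form_bound N p J b" "b \<ge> 0" "L2_set x {..<N} \<le> R" "L2_set y {..<N} \<le> R"
  shows "\<bar>tensor_form N J (replicate p x) - tensor_form N J (replicate p y)\<bar> \<le> real p * b * R ^ (p - 1) * L2_set (\<lambda>i. x i - y i) {..<N}"
  using assms(1,2)
proof (induction p arbitrary: J b)
  case 0
  then show ?case by simp
next
  case (Suc p)
  have R: "R \<ge> 0" using assms(3) L2_set_nonneg[of x "{..<N}"] by linarith
  define d where "d = L2_set (\<lambda>i. x i - y i) {..<N}"
  have d: "d \<ge> 0" by (simp add: d_def)
  define J' where "J' = (\<lambda>is. \<Sum>i<N. y i * J (i # is))"
  have J': "tensor_form_bound N p J' (b * R)"
    unfolding tensor_form_bound_def
  proof (intro allI impI)
    fix xs :: "(nat \<Rightarrow> real) list" assume "length xs = p"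
    then have "\<bar>tensor_form N J (y # xs)\<bar> \<le> b * (L2_set y {..<N} * prod_list (map (\<lambda>x. L2_set x {..<N}) xs))"
      using Suc.prems(1) unfolding tensor_form_bound_def by (metis length_Cons list.simps(9) prod_list.Cons)
    also have "\<dots> \<le> b * (R * prod_list (map (\<lambda>x. L2_set x {..<N}) xs))"
      using assms(4) Suc.prems(2) by (intro mult_left_mono mult_right_mono prod_list_nonneg) auto
    finally show "\<bar>tensor_form N J' xs\<bar> \<le> b * R * prod_list (map (\<lambda>x. L2_set x {..<N}) xs)"
      by (simp add: J'_def mult_ac)
  qed
  have "tensor_form N J (x # replicate p x) - tensor_form N J (y # replicate p y)
     = tensor_form N J ((\<lambda>i. x i - y i) # replicate p x) + (tensor_form N J' (replicate p x) - tensor_form N J' (replicate p y))"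
    unfolding J'_def tensor_form_Cons by (simp add: tensor_form_Cons[symmetric] flip: tensor_form.simps(2))
       (simp add: tensor_form_Cons left_diff_distrib sum_subtractf del: tensor_form.simps)
  moreover have "\<bar>tensor_form N J ((\<lambda>i. x i - y i) # replicate p x)\<bar> \<le> b * (d * R ^ p)"
  proof -
    have "\<bar>tensor_form N J ((\<lambda>i. x i - y i) # replicate p x)\<bar> \<le> b * prod_list (map (\<lambda>x. L2_set x {..<N}) ((\<lambda>i. x i - y i) # replicate p x))"
      using Suc.prems(1) unfolding tensor_form_bound_def by (metis length_Cons length_replicate)
    also have "\<dots> = b * (d * L2_set x {..<N} ^ p)" by (simp add: d_def)
    also have "\<dots> \<le> b * (d * R ^ p)"
      using assms(3) d Suc.prems(2) by (intro mult_left_mono power_mono) auto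
    finally show ?thesis .
  qed
  moreover have "\<bar>tensor_form N J' (replicate p x) - tensor_form N J' (replicate p y)\<bar> \<le> real p * (b * R) * R ^ (p - 1) * d"
    unfolding d_def using Suc.prems(2) R by (intro Suc.IH J') auto
  moreover have "real p * (b * R) * R ^ (p - 1) * d = real p * b * R ^ p * d" by (cases p) auto
  ultimately have "\<bar>tensor_form N J (replicate (Suc p) x) - tensor_form N J (replicate (Suc p) y)\<bar> \<le> b * (d * R ^ p) + real p * b * R ^ p * d"
    unfolding replicate_Suc by linarith
  then show ?case by (simp add: d_def algebra_simps del: tensor_form.simps replicate.simps)
qed

text \<open>The points of a scaled integer lattice with bounded coordinate sum form a net; rounding is towards zero,
  and \<open>\<Sum>\<bar>x\<^sub>i\<bar> \<le> sqrt N\<close> on the unit ball.\<close>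

definition lattice_cell :: "nat \<Rightarrow> real \<Rightarrow> (nat \<Rightarrow> real) \<Rightarrow> nat \<Rightarrow> int" where
  "lattice_cell N h x = (\<lambda>i\<in>{..<N}. \<lfloor>sqrt (real N) * \<bar>x i\<bar> / h\<rfloor> * (if x i < 0 then - 1 else 1))"

definition lattice_box :: "nat \<Rightarrow> real \<Rightarrow> (nat \<Rightarrow> int) set" where
  "lattice_box N L = {z \<in> {..<N} \<rightarrow>\<^sub>E {- \<lfloor>L\<rfloor>..\<lfloor>L\<rfloor>}. real_of_int (\<Sum>i<N. \<bar>z i\<bar>) \<le> L}"

lemma geometric_sum_le: "(\<Sum>k\<in>{- int n..int n}. (1/2::real) ^ nat \<bar>k\<bar>) \<le> 3 - 2 * (1/2)^n"
proof (induction n)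
  case (Suc n)
  have "{- int (Suc n)..int (Suc n)} = insert (int (Suc n)) (insert (- int (Suc n)) {- int n..int n})" by auto
  then show ?case using Suc by (simp add: nat_add_distrib nat_diff_distrib)
qed simp

lemma finite_lattice_box: "finite (lattice_box N L)"
  unfolding lattice_box_def by (rule finite_subset[OF _ finite_PiE[of "{..<N}" "\<lambda>_. {- \<lfloor>L\<rfloor>..\<lfloor>L\<rfloor>}"]]) auto

text \<open>Counting by weights: a point z has weight 2^(- |z|_1), at least 2^(- L) in the set,
  while the total weight over a larger cube factorises into N sums of (1/2)^|k|, each at most
  3.\<close>

lemma card_lattice_box:
  assumes "L \<ge> 0"
  shows "real (card (lattice_box N L)) \<le> 3 ^ N * 2 powr L"
proof -
  define n where "n = nat \<lfloor>L\<rfloor>"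
  have n: "int n = \<lfloor>L\<rfloor>" using assms by (simp add: n_def)
  let ?w = "\<lambda>z. (\<Prod>i<N. (1/2::real) ^ nat \<bar>z i\<bar>)"
  have w: "?w z = 2 powr (- real_of_int (\<Sum>i<N. \<bar>z i\<bar>))" for z :: "nat \<Rightarrow> int"
  proof -
    have "?w z = (\<Prod>i<N. 2 powr (- real_of_int \<bar>z i\<bar>))"
    proof (rule prod.cong[OF refl])
      fix i
      have "(2::real) powr (- real_of_int \<bar>z i\<bar>) = inverse (2 powr real (nat \<bar>z i\<bar>))"
        by (simp add: powr_minus)
      also have "\<dots> = (1/2) ^ nat \<bar>z i\<bar>"
        by (subst powr_realpow) (simp_all add: power_one_over inverse_eq_divide)
      finally show "(1/2::real) ^ nat \<bar>z i\<bar> = 2 powr (- real_of_int \<bar>z i\<bar>)" by simp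
    qed
    also have "\<dots> = 2 powr (\<Sum>i<N. - real_of_int \<bar>z i\<bar>)" by (rule powr_sum[symmetric]) simp
    finally show ?thesis by (simp add: sum_negf)
  qed
  have "real (card (lattice_box N L)) * 2 powr (- L) = (\<Sum>z\<in>lattice_box N L. 2 powr (- L))" by simp
  also have "\<dots> \<le> (\<Sum>z\<in>lattice_box N L. ?w z)"
    unfolding w
  proof (rule sum_mono)
    fix z assume "z \<in> lattice_box N L"
    then have "real_of_int (\<Sum>i<N. \<bar>z i\<bar>) \<le> L" unfolding lattice_box_def by blast
    then show "2 powr (- L) \<le> 2 powr (- real_of_int (\<Sum>i<N. \<bar>z i\<bar>))" by (intro powr_mono) linarith+
  qed
  also have "\<dots> \<le> (\<Sum>z\<in>{..<N} \<rightarrow>\<^sub>E {- int n..int n}. ?w z)"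
    unfolding n
  proof (rule sum_mono2)
    show "lattice_box N L \<subseteq> {..<N} \<rightarrow>\<^sub>E {- \<lfloor>L\<rfloor>..\<lfloor>L\<rfloor>}" unfolding lattice_box_def by blast
    show "finite ({..<N} \<rightarrow>\<^sub>E {- \<lfloor>L\<rfloor>..\<lfloor>L\<rfloor>})" by (intro finite_PiE finite_lessThan finite_atLeastAtMost_int)
    show "0 \<le> (\<Prod>i<N. (1/2::real) ^ nat \<bar>z i\<bar>)" for z :: "nat \<Rightarrow> int" by (intro prod_nonneg) simp
  qed
  also have "\<dots> = (\<Prod>i<N. \<Sum>k\<in>{- int n..int n}. (1/2::real) ^ nat \<bar>k\<bar>)"
    by (rule prod_sum_PiE[symmetric]) auto
  also have "\<dots> \<le> (\<Prod>i<N. 3)"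
    using geometric_sum_le[of n] by (intro prod_mono conjI sum_nonneg) (auto intro: order_trans)
  also have "\<dots> = 3 ^ N" by simp
  finally have "real (card (lattice_box N L)) * 2 powr (- L) * 2 powr L \<le> 3 ^ N * 2 powr L"
    by (intro mult_right_mono) auto
  then show ?thesis by (simp add: mult.assoc powr_add[symmetric])
qed

lemma lattice_cell_in_box:
  assumes h: "h > 0" and x: "L2_set x {..<N} \<le> 1"
  shows "lattice_cell N h x \<in> lattice_box N (real N / h)"
proof -
  have abs: "\<bar>lattice_cell N h x i\<bar> = \<lfloor>sqrt (real N) * \<bar>x i\<bar> / h\<rfloor>" if "i < N" for i
    using that h by (simp add: lattice_cell_def abs_mult)
  have "(\<Sum>i<N. \<bar>x i\<bar> * \<bar>1\<bar>) \<le> L2_set x {..<N} * L2_set (\<lambda>_. 1) {..<N}"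
    by (rule L2_set_mult_ineq)
  also have "L2_set (\<lambda>_. 1 :: real) {..<N} = sqrt (real N)" by (simp add: L2_set_def)
  also have "L2_set x {..<N} * sqrt (real N) \<le> 1 * sqrt (real N)" using x by (intro mult_right_mono) auto
  finally have l1: "(\<Sum>i<N. \<bar>x i\<bar>) \<le> sqrt (real N)" by simp
  have "real_of_int (\<Sum>i<N. \<bar>lattice_cell N h x i\<bar>) \<le> (\<Sum>i<N. sqrt (real N) * \<bar>x i\<bar> / h)"
    by (simp add: abs sum_mono)
  also have "\<dots> = sqrt (real N) / h * (\<Sum>i<N. \<bar>x i\<bar>)" by (simp add: sum_distrib_left)
  also have "\<dots> \<le> sqrt (real N) / h * sqrt (real N)" using l1 h by (intro mult_left_mono) auto
  finally have S: "real_of_int (\<Sum>i<N. \<bar>lattice_cell N h x i\<bar>) \<le> real N / h" by simp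
  have "\<bar>lattice_cell N h x i\<bar> \<le> \<lfloor>real N / h\<rfloor>" if "i < N" for i
  proof -
    have "\<bar>lattice_cell N h x i\<bar> \<le> (\<Sum>i<N. \<bar>lattice_cell N h x i\<bar>)" using that by (intro member_le_sum) auto
    then have "real_of_int \<bar>lattice_cell N h x i\<bar> \<le> real_of_int (\<Sum>i<N. \<bar>lattice_cell N h x i\<bar>)"
      by (rule of_int_le_iff[THEN iffD2])
    with S have "real_of_int \<bar>lattice_cell N h x i\<bar> \<le> real N / h" by linarith
    then show ?thesis by (rule le_floor_iff[THEN iffD2])
  qed
  then have "lattice_cell N h x i \<in> {- \<lfloor>real N / h\<rfloor>..\<lfloor>real N / h\<rfloor>}" if "i < N" for i
    using that by (simp add: abs_le_iff minus_le_iff)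
  moreover have "lattice_cell N h x \<in> extensional {..<N}" by (simp add: lattice_cell_def)
  ultimately show ?thesis using S by (auto simp: lattice_box_def PiE_iff)
qed

lemma L2_set_le_sqrt:
  assumes "\<And>i. i < N \<Longrightarrow> \<bar>x i\<bar> \<le> d / sqrt (real N)" "d \<ge> 0"
  shows "L2_set x {..<N} \<le> d"
proof (cases "N = 0")
  case False
  have "(\<Sum>i<N. (x i)\<^sup>2) \<le> (\<Sum>i<N. (d / sqrt (real N))\<^sup>2)"
    using assms by (intro sum_mono) (metis abs_ge_zero lessThan_iff power2_abs power_mono)
  also have "\<dots> = d\<^sup>2" using False by (simp add: power_divide)
  finally show ?thesis using assms(2) by (simp add: L2_set_def real_le_lsqrt)
qed (simp add: assms L2_set_def)

definition lattice_point :: "nat \<Rightarrow> real \<Rightarrow> (nat \<Rightarrow> int) \<Rightarrow> nat \<Rightarrow> real" where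
  "lattice_point N h z = (\<lambda>i. h * real_of_int (z i) / sqrt (real N))"

lemma lattice_cell_close:
  assumes h: "h > 0" and N: "N \<ge> 1" and i: "i < N"
  shows "\<bar>x i - lattice_point N h (lattice_cell N h x) i\<bar> \<le> h / sqrt (real N)"
    and "\<bar>lattice_point N h (lattice_cell N h x) i\<bar> \<le> \<bar>x i\<bar>"
proof -
  define r where "r = sqrt (real N)"
  have r: "r > 0" using N by (simp add: r_def)
  define t where "t = r * \<bar>x i\<bar> / h"
  define k where "k = real_of_int \<lfloor>t\<rfloor>"
  have t: "t \<ge> 0" using r h by (simp add: t_def)
  have k: "0 \<le> k" "k \<le> t" "t \<le> k + 1"
  proof -
    show "0 \<le> k" using t by (simp add: k_def)
    show "k \<le> t" by (simp add: k_def)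
    show "t \<le> k + 1" unfolding k_def by (rule real_of_int_floor_add_one_ge)
  qed
  have xt: "\<bar>x i\<bar> = h * t / r" using r h by (simp add: t_def)
  have p: "lattice_point N h (lattice_cell N h x) i = (if x i < 0 then - 1 else 1) * (h * k / r)"
    using i by (simp add: lattice_point_def lattice_cell_def k_def t_def r_def)
  have kt: "h * k / r \<le> h * t / r" using k r h by (intro divide_right_mono mult_left_mono) auto
  have kt': "h * t / r \<le> h * k / r + h / r"
  proof -
    have "h * t \<le> h * (k + 1)" using k h by (intro mult_left_mono) auto
    then have "h * t / r \<le> (h * k + h) / r" using r by (intro divide_right_mono) (auto simp: algebra_simps)
    then show ?thesis by (simp add: add_divide_distrib)
  qed
  have k0: "0 \<le> h * k / r" using h k r by simp
  show "\<bar>lattice_point N h (lattice_cell N h x) i\<bar> \<le> \<bar>x i\<bar>"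
    unfolding p xt using kt k0 by (simp add: abs_mult)
  show "\<bar>x i - lattice_point N h (lattice_cell N h x) i\<bar> \<le> h / sqrt (real N)"
    unfolding p r_def[symmetric] using kt kt' xt by (cases "x i < 0") auto
qed

definition ball_net :: "nat \<Rightarrow> real \<Rightarrow> (nat \<Rightarrow> real) set" where
  "ball_net N h = {y \<in> lattice_point N h ` lattice_box N (real N / h). L2_set y {..<N} \<le> 1}"

lemma ball_net_is_net:
  assumes "h > 0" "N \<ge> 1" shows "is_net N h (ball_net N h)"
  unfolding is_net_def
proof (intro allI impI)
  fix x :: "nat \<Rightarrow> real" assume x: "L2_set x {..<N} \<le> 1"
  let ?y = "lattice_point N h (lattice_cell N h x)"
  have "L2_set ?y {..<N} \<le> L2_set x {..<N}"
    unfolding L2_set_def using lattice_cell_close(2)[OF assms]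
    by (intro real_sqrt_le_mono sum_mono) (simp add: abs_le_square_iff[symmetric])
  then have "?y \<in> ball_net N h" using lattice_cell_in_box[OF assms(1) x] x by (auto simp: ball_net_def)
  moreover have "L2_set (\<lambda>i. x i - ?y i) {..<N} \<le> h"
    using lattice_cell_close(1)[OF assms] assms by (intro L2_set_le_sqrt) auto
  ultimately show "\<exists>y\<in>ball_net N h. L2_set (\<lambda>i. x i - y i) {..<N} \<le> h" by blast
qed

lemma finite_ball_net: "finite (ball_net N h)"
  unfolding ball_net_def by (simp add: finite_lattice_box)

lemma card_ball_net: "h > 0 \<Longrightarrow> real (card (ball_net N h)) \<le> 3 ^ N * 2 powr (real N / h)"
proof -
  assume h: "h > 0"
  have "card (ball_net N h) \<le> card (lattice_point N h ` lattice_box N (real N / h))"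
    unfolding ball_net_def by (intro card_mono finite_imageI finite_lattice_box) auto
  also have "\<dots> \<le> card (lattice_box N (real N / h))" by (rule card_image_le[OF finite_lattice_box])
  finally have "real (card (ball_net N h)) \<le> real (card (lattice_box N (real N / h)))" by simp
  also have "\<dots> \<le> 3 ^ N * 2 powr (real N / h)" using h by (intro card_lattice_box) auto
  finally show ?thesis .
qed

text \<open>With mesh h = 1 / (p + 1) the loss (1 / (1 - h))^p equals (1 + 1 / p)^p and stays below
  3 for all p \<ge> 1.\<close>

definition net_lists :: "nat \<Rightarrow> nat \<Rightarrow> (nat \<Rightarrow> real) list set" where
  "net_lists N p = {ys. set ys \<subseteq> ball_net N (1 / (real p + 1)) \<and> length ys = p}"

lemma finite_net_lists: "finite (net_lists N p)"
  unfolding net_lists_def by (rule finite_lists_length_eq[OF finite_ball_net])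

lemma card_net_lists:
  assumes "p \<ge> 1"
  shows "real (card (net_lists N p)) \<le> exp (3 * real N * (real p)\<^sup>2)"
proof -
  have "real (card (net_lists N p)) = real (card (ball_net N (1 / (real p + 1)))) ^ p"
    unfolding net_lists_def by (simp add: card_lists_length_eq[OF finite_ball_net])
  also have "\<dots> \<le> (exp (3 * real N * real p)) ^ p"
  proof (rule power_mono)
    have "real (card (ball_net N (1 / (real p + 1)))) \<le> 3 ^ N * 2 powr (real N / (1 / (real p + 1)))"
      by (rule card_ball_net) simp
    also have "\<dots> = (3 * 2 ^ (p + 1)) ^ N"
    proof -
      have "real N / (1 / (real p + 1)) = real ((p + 1) * N)" by (simp add: algebra_simps)
      then have "2 powr (real N / (1 / (real p + 1))) = 2 ^ ((p + 1) * N)"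
        by (simp only:) (rule powr_realpow, simp)
      then show ?thesis by (simp only: power_mult_distrib power_mult)
    qed
    \<comment> \<open>3 * 2^(p + 1) = 6 * 2^p \<le> 12^p, and 12 lies below exp 3.\<close>
    also have "\<dots> \<le> (12 ^ p) ^ N"
    proof (rule power_mono)
      have "(6::real) ^ 1 \<le> 6 ^ p" using assms by (intro power_increasing) auto
      then have "6 * 2 ^ p \<le> (6::real) ^ p * 2 ^ p" by (intro mult_right_mono) auto
      also have "\<dots> = 12 ^ p" by (simp add: power_mult_distrib[symmetric])
      finally show "3 * 2 ^ (p + 1) \<le> (12::real) ^ p" by simp
    qed auto
    also have "\<dots> \<le> ((exp 3) ^ p) ^ N"
    proof (intro power_mono)
      have "(2.5 :: real) ^ 3 \<le> exp 1 ^ 3"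
      proof (rule power_mono)
        have "1 + 1 + 1\<^sup>2 / 2 \<le> exp (1::real)" by (rule exp_lower_Taylor_quadratic) simp
        then show "2.5 \<le> exp (1::real)" by simp
      qed simp
      moreover have "exp 1 ^ 3 = exp (3::real)" by (simp add: exp_of_nat_mult[symmetric])
      ultimately show "12 \<le> exp (3::real)" by (simp add: power3_eq_cube)
    qed auto
    also have "\<dots> = exp (3 * real N * real p)"
      by (simp add: exp_of_nat_mult[symmetric] mult_ac)
    finally show "real (card (ball_net N (1 / (real p + 1)))) \<le> exp (3 * real N * real p)" .
  qed simp
  also have "\<dots> = exp (3 * real N * (real p)\<^sup>2)"
    by (simp add: exp_of_nat_mult[symmetric] power2_eq_square mult_ac)
  finally show ?thesis .
qed

text \<open>An upper bound for the injective norm rather than the norm itself: a maximum over a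
  finite net is measurable at once, and the factor 3 pays for passing from the net to all vectors.
  \<open>insert 0\<close> makes the maximum nonnegative.\<close>

definition tensor_norm :: "nat \<Rightarrow> nat \<Rightarrow> (nat list \<Rightarrow> real) \<Rightarrow> real" where
  "tensor_norm N p J = 3 * Max (insert 0 ((\<lambda>ys. \<bar>tensor_form N J ys\<bar>) ` net_lists N p))"

lemma tensor_norm_nonneg: "tensor_norm N p J \<ge> 0"
  unfolding tensor_norm_def using finite_net_lists by simp

lemma tensor_norm_tens_bound:
  assumes N: "N \<ge> 1" shows "tensor_form_bound N p J (tensor_norm N p J)"
  unfolding tensor_form_bound_def
proof (intro allI impI)
  fix xs :: "(nat \<Rightarrow> real) list" assume xs: "length xs = p"
  define M where "M = Max (insert 0 ((\<lambda>ys. \<bar>tensor_form N J ys\<bar>) ` net_lists N p))"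
  define h where "h = 1 / (real p + 1)"
  have M0: "M \<ge> 0" unfolding M_def using finite_net_lists by simp
  show "\<bar>tensor_form N J xs\<bar> \<le> tensor_norm N p J * prod_list (map (\<lambda>x. L2_set x {..<N}) xs)"
  proof (cases "p = 0")
    case True
    have "[] \<in> net_lists N 0" by (simp add: net_lists_def)
    then have "\<bar>tensor_form N J []\<bar> \<in> insert 0 ((\<lambda>ys. \<bar>tensor_form N J ys\<bar>) ` net_lists N 0)" by blast
    then have "\<bar>tensor_form N J []\<bar> \<le> M" unfolding M_def True by (intro Max_ge finite.insertI finite_imageI finite_net_lists)
    moreover have "tensor_norm N p J = 3 * M" by (simp add: tensor_norm_def M_def)
    moreover have "xs = []" using True xs by simp
    ultimately show ?thesis using M0 by (simp del: tensor_form.simps)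
  next
    case False
    have "\<bar>tensor_form N J xs\<bar> \<le> M / (1 - h) ^ p * prod_list (map (\<lambda>x. L2_set x {..<N}) xs)"
    proof (rule tensor_form_net_bound[OF ball_net_is_net _ _ _ xs])
      fix ys assume "set ys \<subseteq> ball_net N h" "length ys = p"
      then have "ys \<in> net_lists N p" by (simp add: net_lists_def h_def)
      then show "\<bar>tensor_form N J ys\<bar> \<le> M" unfolding M_def using finite_net_lists by (intro Max_ge) auto
    qed (use N False in \<open>auto simp: h_def\<close>)
    also have "\<dots> \<le> 3 * M * prod_list (map (\<lambda>x. L2_set x {..<N}) xs)"
    proof (intro mult_right_mono prod_list_nonneg)
      have "(1 + 1 / real p) ^ p \<le> exp (1 / real p) ^ p"
        by (intro power_mono) (auto simp: exp_ge_add_one_self)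
      also have "\<dots> = exp 1" using False by (simp add: exp_of_nat_mult[symmetric])
      also have "\<dots> \<le> 3" by (rule exp_le)
      finally have "(1 + 1 / real p) ^ p \<le> 3" .
      moreover have "1 / (1 - h) = 1 + 1 / real p" using False by (simp add: h_def field_simps)
      ultimately have "(1 / (1 - h)) ^ p \<le> 3" by simp
      then have "M * (1 / (1 - h)) ^ p \<le> M * 3" using M0 by (rule mult_left_mono)
      then show "M / (1 - h) ^ p \<le> 3 * M" by (simp add: power_one_over divide_inverse power_inverse mult.commute)
    qed auto
    finally show ?thesis by (simp add: tensor_norm_def M_def)
  qed
qed

section \<open>Exponential moments of Gaussian tensors\<close>

declare leb_PiM_component [measurable del]

lemma std_normal_mgf: "(\<integral>\<^sup>+x. ennreal (exp (t * x)) \<partial>std_normal) = ennreal (exp (t\<^sup>2 / 2))"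
proof -
  have eq: "std_normal_density x * exp (t * x) = exp (t\<^sup>2 / 2) * std_normal_density (x + - t)" for x
  proof -
    have "- x\<^sup>2 / 2 + t * x = t\<^sup>2 / 2 + - (x + - t)\<^sup>2 / 2"
      by (simp add: power2_eq_square field_simps)
    then have "exp (- x\<^sup>2 / 2) * exp (t * x) = exp (t\<^sup>2 / 2) * exp (- (x + - t)\<^sup>2 / 2)"
      unfolding exp_add[symmetric] by (simp only:)
    then show ?thesis unfolding std_normal_density_def by (simp only: mult.assoc mult.left_commute)
  qed
  have "(\<integral>\<^sup>+x. ennreal (exp (t * x)) \<partial>std_normal) = (\<integral>\<^sup>+x. ennreal (std_normal_density x) * ennreal (exp (t * x)) \<partial>lborel)"
    by (rule nn_integral_std_normal) measurable
  also have "\<dots> = (\<integral>\<^sup>+x. ennreal (exp (t\<^sup>2 / 2)) * ennreal (std_normal_density (x + - t)) \<partial>lborel)"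
    by (intro nn_integral_cong) (simp add: ennreal_mult''[symmetric] eq[symmetric] del: add_uminus_conv_diff)
  also have "\<dots> = ennreal (exp (t\<^sup>2 / 2)) * (\<integral>\<^sup>+x. ennreal (std_normal_density (x + - t)) \<partial>lborel)"
    by (rule nn_integral_cmult) measurable
  also have "(\<integral>\<^sup>+x. ennreal (std_normal_density (x + - t)) \<partial>lborel) = (\<integral>\<^sup>+x. ennreal (std_normal_density x) \<partial>lborel)"
    by (rule nn_integral_lborel_shift) measurable
  also have "\<dots> = (\<integral>\<^sup>+x. 1 \<partial>std_normal)"
    by (subst nn_integral_std_normal) auto
  also have "\<dots> = 1" using sn.emeasure_space_1 by simp
  finally show ?thesis by simp
qed

lemma gauss_linear_mgf:
  assumes "finite B" "B \<subseteq> I"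
  shows "(\<integral>\<^sup>+x. ennreal (exp (\<Sum>k\<in>B. c k * x k)) \<partial>gauss I) = ennreal (exp ((\<Sum>k\<in>B. (c k)\<^sup>2) / 2))"
proof -
  have "(\<integral>\<^sup>+x. ennreal (exp (\<Sum>k\<in>B. c k * x k)) \<partial>gauss I) = (\<integral>\<^sup>+x. (\<Prod>k\<in>B. ennreal (exp (c k * x k))) \<partial>gauss I)"
    using assms by (intro nn_integral_cong) (simp add: exp_sum prod_ennreal)
  also have "\<dots> = (\<Prod>k\<in>B. \<integral>\<^sup>+a. ennreal (exp (c k * a)) \<partial>std_normal)"
    using assms by (intro nn_integral_gauss_prod) measurable
  also have "\<dots> = ennreal (exp ((\<Sum>k\<in>B. (c k)\<^sup>2) / 2))"
    using assms by (simp add: std_normal_mgf prod_ennreal exp_sum[symmetric] sum_divide_distrib)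
  finally show ?thesis .
qed

text \<open>The couplings of all orders together; lists of different length are different indices.
  The set is infinite for N \<ge> 1.\<close>

definition all_indices :: "nat \<Rightarrow> nat list set" where
  "all_indices N = (\<Union>p\<in>{1..}. multi_indices N p)"

lemma multi_indices_subset: "p \<ge> 1 \<Longrightarrow> multi_indices N p \<subseteq> all_indices N"
  by (auto simp: all_indices_def)

abbreviation disorder :: "nat \<Rightarrow> (nat list \<Rightarrow> real) measure" where
  "disorder N \<equiv> gauss (all_indices N)"

lemma sum_rank1_prod:
  "length xs = length ys \<Longrightarrow> (\<Sum>is\<in>multi_indices N (length xs). rank1 xs is * rank1 ys is)
    = prod_list (map2 (\<lambda>x y. \<Sum>i<N. x i * y i) xs ys)"
proof (induction xs ys rule: list_induct2)
  case (Cons x xs y ys)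
  have "(\<Sum>is\<in>multi_indices N (Suc (length xs)). rank1 (x # xs) is * rank1 (y # ys) is)
     = (\<Sum>i<N. \<Sum>is\<in>multi_indices N (length xs). (x i * y i) * (rank1 xs is * rank1 ys is))"
    unfolding sum_multi_indices_Suc by (simp add: mult_ac)
  also have "\<dots> = (\<Sum>i<N. x i * y i) * (\<Sum>is\<in>multi_indices N (length xs). rank1 xs is * rank1 ys is)"
    by (simp add: sum_distrib_left[symmetric] sum_distrib_right)
  finally show ?case using Cons.IH by simp
qed simp

lemma sum_rank1_sq:
  "(\<Sum>is\<in>multi_indices N (length xs). (rank1 xs is)\<^sup>2) = prod_list (map (\<lambda>x. (L2_set x {..<N})\<^sup>2) xs)"
proof -
  have "map2 (\<lambda>x y. \<Sum>i<N. x i * y i) xs xs = map (\<lambda>x. (L2_set x {..<N})\<^sup>2) xs"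
    by (induction xs) (auto simp: L2_set_def sum_nonneg power2_eq_square)
  then show ?thesis using sum_rank1_prod[of xs xs N] by (simp add: power2_eq_square)
qed

lemma tensor_form_measurable [measurable]:
  assumes "length xs \<ge> 1" shows "(\<lambda>x. tensor_form N x xs) \<in> borel_measurable (disorder N)"
proof -
  have [measurable]: "(\<lambda>x. x is) \<in> borel_measurable (disorder N)" if "is \<in> multi_indices N (length xs)" for "is"
    by (rule measurable_gauss_component[of _ "all_indices N" "\<lambda>x. x"])
       (use that multi_indices_subset[OF assms, of N] in auto)
  show ?thesis unfolding tensor_form_eq by measurable
qed

text \<open>The form is a linear combination of the couplings with coefficients
  \<open>rank1 ys\<close>. Their sum of squares factorises into the squared norms of the arguments,
  all at most 1.\<close>

lemma tensor_form_mgf: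
  assumes ys: "ys \<in> net_lists N p" and p: "p \<ge> 1"
  shows "(\<integral>\<^sup>+x. ennreal (exp (l * tensor_form N x ys)) \<partial>disorder N) \<le> ennreal (exp (l\<^sup>2 / 2))"
proof -
  have len: "length ys = p" using ys by (simp add: net_lists_def)
  have le1: "L2_set y {..<N} \<le> 1" if "y \<in> set ys" for y
    using ys that by (auto simp: net_lists_def ball_net_def)
  have "prod_list (map (\<lambda>x. (L2_set x {..<N})\<^sup>2) zs) \<le> 1" if "\<And>y. y \<in> set zs \<Longrightarrow> L2_set y {..<N} \<le> 1" for zs
    using that
  proof (induction zs)
    case (Cons z zs)
    have "(L2_set z {..<N})\<^sup>2 * prod_list (map (\<lambda>x. (L2_set x {..<N})\<^sup>2) zs) \<le> 1 * 1"
      using Cons by (intro mult_mono power_le_one prod_list_nonneg) auto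
    then show ?case by simp
  qed simp
  then have sq: "(\<Sum>is\<in>multi_indices N p. (rank1 ys is)\<^sup>2) \<le> 1"
    using le1 sum_rank1_sq[of ys N] by (simp add: len)
  have "(\<integral>\<^sup>+x. ennreal (exp (l * tensor_form N x ys)) \<partial>disorder N) = (\<integral>\<^sup>+x. ennreal (exp (\<Sum>is\<in>multi_indices N p. (l * rank1 ys is) * x is)) \<partial>disorder N)"
    unfolding tensor_form_eq len by (simp add: sum_distrib_left mult_ac)
  also have "\<dots> = ennreal (exp ((\<Sum>is\<in>multi_indices N p. (l * rank1 ys is)\<^sup>2) / 2))"
    using p by (intro gauss_linear_mgf finite_multi_indices multi_indices_subset)
  also have "(\<Sum>is\<in>multi_indices N p. (l * rank1 ys is)\<^sup>2) = l\<^sup>2 * (\<Sum>is\<in>multi_indices N p. (rank1 ys is)\<^sup>2)"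
    by (simp add: power_mult_distrib sum_distrib_left)
  also have "ennreal (exp (l\<^sup>2 * (\<Sum>is\<in>multi_indices N p. (rank1 ys is)\<^sup>2) / 2)) \<le> ennreal (exp (l\<^sup>2 / 2))"
    using mult_left_mono[OF sq, of "l\<^sup>2"] by (intro ennreal_leI) simp
  finally show ?thesis .
qed

lemma tensor_norm_measurable [measurable]:
  assumes p: "p \<ge> 1" shows "tensor_norm N p \<in> borel_measurable (disorder N)"
proof -
  let ?M = "\<lambda>x. Max (insert 0 ((\<lambda>ys. \<bar>tensor_form N x ys\<bar>) ` net_lists N p))"
  have tm[measurable]: "(\<lambda>x. tensor_form N x ys) \<in> borel_measurable (disorder N)" if "ys \<in> net_lists N p" for ys
    using that p by (intro tensor_form_measurable) (simp add: net_lists_def)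
  have "?M \<in> borel_measurable (disorder N)"
    unfolding borel_measurable_iff_le
  proof
    fix a
    have "{x \<in> space (disorder N). ?M x \<le> a} = {x \<in> space (disorder N). 0 \<le> a \<and> (\<forall>ys\<in>net_lists N p. \<bar>tensor_form N x ys\<bar> \<le> a)}"
      using finite_net_lists[of N p] by auto
    also have "\<dots> \<in> sets (disorder N)" using finite_net_lists[of N p] by measurable
    finally show "{x \<in> space (disorder N). ?M x \<le> a} \<in> sets (disorder N)" .
  qed
  then show ?thesis unfolding tensor_norm_def[abs_def] by measurable
qed

text \<open>The exponential of the maximum is at most 1 plus the sum over net points and signs. The
  multiplier l = p sqrt N balances entropy and variance: the net contributes exp (3 N p^2), a single
  form exp (l^2 / 2) \<le> exp (N p^2).\<close>

lemma tensor_norm_mgf: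
  assumes p: "p \<ge> 1" and N: "N \<ge> 1"
  shows "(\<integral>\<^sup>+x. ennreal (exp (real p * sqrt (real N) * tensor_norm N p x / 3)) \<partial>disorder N) \<le> ennreal (3 * exp (4 * real N * (real p)\<^sup>2))"
proof -
  interpret P: prob_space "disorder N" by (rule prob_space_gauss)
  define l where "l = real p * sqrt (real N)"
  have l: "l \<ge> 0" by (simp add: l_def)
  have tm[measurable]: "(\<lambda>x. tensor_form N x ys) \<in> borel_measurable (disorder N)" if "ys \<in> net_lists N p" for ys
    using that p by (intro tensor_form_measurable) (simp add: net_lists_def)
  let ?S = "\<lambda>x. \<Sum>ys\<in>net_lists N p. ennreal (exp (l * tensor_form N x ys)) + ennreal (exp (- l * tensor_form N x ys))"
  have pt: "ennreal (exp (l * tensor_norm N p x / 3)) \<le> 1 + ?S x" for x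
  proof -
    let ?T = "insert 0 ((\<lambda>ys. \<bar>tensor_form N x ys\<bar>) ` net_lists N p)"
    have "Max ?T \<in> ?T" using finite_net_lists by (intro Max_in) auto
    then consider "Max ?T = 0" | ys where "ys \<in> net_lists N p" "Max ?T = \<bar>tensor_form N x ys\<bar>" by auto
    then show ?thesis
    proof cases
      case 1
      then show ?thesis by (simp add: tensor_norm_def)
    next
      case 2
      have "ennreal (exp (l * tensor_norm N p x / 3)) = ennreal (exp (l * \<bar>tensor_form N x ys\<bar>))" by (simp add: tensor_norm_def 2)
      also have "\<dots> \<le> ennreal (exp (l * tensor_form N x ys)) + ennreal (exp (- l * tensor_form N x ys))"
        by (cases "tensor_form N x ys \<ge> 0") (auto simp: add_increasing add_increasing2)
      also have "\<dots> \<le> ?S x" using 2 finite_net_lists by (intro member_le_sum) auto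
      finally show ?thesis by (simp add: add_increasing)
    qed
  qed
  have "(\<integral>\<^sup>+x. ennreal (exp (l * tensor_norm N p x / 3)) \<partial>disorder N) \<le> (\<integral>\<^sup>+x. 1 + ?S x \<partial>disorder N)"
    by (intro nn_integral_mono pt)
  also have "\<dots> = 1 + (\<Sum>ys\<in>net_lists N p. (\<integral>\<^sup>+x. ennreal (exp (l * tensor_form N x ys)) \<partial>disorder N) + (\<integral>\<^sup>+x. ennreal (exp (- l * tensor_form N x ys)) \<partial>disorder N))"
  proof -
    have m: "(\<lambda>x. ennreal (exp (l * tensor_form N x ys))) \<in> borel_measurable (disorder N)"
      "(\<lambda>x. ennreal (exp (- l * tensor_form N x ys))) \<in> borel_measurable (disorder N)" if "ys \<in> net_lists N p" for ys
      using tm[OF that] by measurable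
    have "(\<integral>\<^sup>+x. 1 + ?S x \<partial>disorder N) = (\<integral>\<^sup>+x. 1 \<partial>disorder N) + (\<integral>\<^sup>+x. ?S x \<partial>disorder N)"
      by (intro nn_integral_add borel_measurable_sum borel_measurable_add m) auto
    also have "(\<integral>\<^sup>+x. ?S x \<partial>disorder N) = (\<Sum>ys\<in>net_lists N p. (\<integral>\<^sup>+x. ennreal (exp (l * tensor_form N x ys)) + ennreal (exp (- l * tensor_form N x ys)) \<partial>disorder N))"
      by (intro nn_integral_sum borel_measurable_add m)
    also have "\<dots> = (\<Sum>ys\<in>net_lists N p. (\<integral>\<^sup>+x. ennreal (exp (l * tensor_form N x ys)) \<partial>disorder N) + (\<integral>\<^sup>+x. ennreal (exp (- l * tensor_form N x ys)) \<partial>disorder N))"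
      by (intro sum.cong refl nn_integral_add m)
    finally show ?thesis by (simp add: P.emeasure_space_1)
  qed
  also have "\<dots> \<le> 1 + (\<Sum>ys\<in>net_lists N p. ennreal (exp (l\<^sup>2 / 2)) + ennreal (exp (l\<^sup>2 / 2)))"
    using tensor_form_mgf[OF _ p, of _ N l] tensor_form_mgf[OF _ p, of _ N "- l"] by (intro add_left_mono sum_mono add_mono) auto
  also have "\<dots> = ennreal (1 + real (card (net_lists N p)) * (2 * exp (l\<^sup>2 / 2)))"
  proof -
    have "ennreal (exp (l\<^sup>2 / 2)) + ennreal (exp (l\<^sup>2 / 2)) = ennreal (2 * exp (l\<^sup>2 / 2))"
      by (subst ennreal_plus[symmetric]) auto
    then have "(\<Sum>ys\<in>net_lists N p. ennreal (exp (l\<^sup>2 / 2)) + ennreal (exp (l\<^sup>2 / 2))) = ennreal (real (card (net_lists N p)) * (2 * exp (l\<^sup>2 / 2)))"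
      by (simp add: ennreal_of_nat_eq_real_of_nat ennreal_mult)
    then show ?thesis by (simp add: ennreal_plus)
  qed
  also have "\<dots> \<le> ennreal (3 * exp (4 * real N * (real p)\<^sup>2))"
  proof (rule ennreal_leI)
    have "l\<^sup>2 / 2 \<le> real N * (real p)\<^sup>2" by (simp add: l_def power_mult_distrib)
    then have "real (card (net_lists N p)) * (2 * exp (l\<^sup>2 / 2)) \<le> exp (3 * real N * (real p)\<^sup>2) * (2 * exp (real N * (real p)\<^sup>2))"
      using card_net_lists[OF p, of N] by (intro mult_mono) auto
    also have "\<dots> = 2 * exp (4 * real N * (real p)\<^sup>2)" by (simp add: exp_add[symmetric])
    finally have F: "real (card (net_lists N p)) * (2 * exp (l\<^sup>2 / 2)) \<le> 2 * exp (4 * real N * (real p)\<^sup>2)" .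
    have "1 \<le> exp (4 * real N * (real p)\<^sup>2)" by simp
    with F show "1 + real (card (net_lists N p)) * (2 * exp (l\<^sup>2 / 2)) \<le> 3 * exp (4 * real N * (real p)\<^sup>2)"
      by linarith
  qed
  finally show ?thesis by (simp add: l_def)
qed

text \<open>Integrates y \<le> exp (y - c) + c for y = l T / 3, T being the norm, with c = 4 N p^2 =
  4 l^2 taken from the moment bound. This gives 3 / l * (3 + 4 l^2), at most 21 l because l^2 \<ge>
  1.\<close>

lemma tensor_norm_mean:
  assumes p: "p \<ge> 1" and N: "N \<ge> 1"
  shows "(\<integral>\<^sup>+x. ennreal (tensor_norm N p x) \<partial>disorder N) \<le> ennreal (21 * real p * sqrt (real N))"
proof -
  interpret P: prob_space "disorder N" by (rule prob_space_gauss)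
  note [measurable] = tensor_norm_measurable[OF p, of N]
  define l where "l = real p * sqrt (real N)"
  have l: "l > 0" using p N by (simp add: l_def)
  define c where "c = 4 * real N * (real p)\<^sup>2"
  have c0: "c \<ge> 0" by (simp add: c_def)
  have l2: "l * l = real N * (real p)\<^sup>2" by (simp add: l_def power2_eq_square mult_ac)
  have l1: "l * l \<ge> 1"
  proof -
    have "real N * (real p)\<^sup>2 \<ge> 1 * 1" using p N by (intro mult_mono one_le_power) auto
    then show ?thesis using l2 by simp
  qed
  have "(\<integral>\<^sup>+x. ennreal (tensor_norm N p x) \<partial>disorder N)
     \<le> (\<integral>\<^sup>+x. ennreal (3 / l) * (ennreal (exp (- c)) * ennreal (exp (l * tensor_norm N p x / 3)) + ennreal c) \<partial>disorder N)"
  proof (rule nn_integral_mono)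
    fix x
    have "l * tensor_norm N p x / 3 \<le> exp (l * tensor_norm N p x / 3 - c) + c"
      using exp_ge_add_one_self[of "l * tensor_norm N p x / 3 - c"] by linarith
    then have "3 / l * (l * tensor_norm N p x / 3) \<le> 3 / l * (exp (l * tensor_norm N p x / 3 - c) + c)"
      using l by (intro mult_left_mono) auto
    then have "tensor_norm N p x \<le> 3 / l * (exp (- c) * exp (l * tensor_norm N p x / 3) + c)"
      using l by (simp add: exp_add[symmetric])
    then have "ennreal (tensor_norm N p x) \<le> ennreal (3 / l * (exp (- c) * exp (l * tensor_norm N p x / 3) + c))" by (rule ennreal_leI)
    also have "\<dots> = ennreal (3 / l) * (ennreal (exp (- c)) * ennreal (exp (l * tensor_norm N p x / 3)) + ennreal c)"
      using l c0 by (subst ennreal_mult) (simp_all add: ennreal_mult)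
    finally show "ennreal (tensor_norm N p x) \<le> ennreal (3 / l) * (ennreal (exp (- c)) * ennreal (exp (l * tensor_norm N p x / 3)) + ennreal c)" .
  qed
  also have "\<dots> = ennreal (3 / l) * (ennreal (exp (- c)) * (\<integral>\<^sup>+x. ennreal (exp (l * tensor_norm N p x / 3)) \<partial>disorder N) + ennreal c)"
    by (simp add: nn_integral_cmult nn_integral_add P.emeasure_space_1)
  also have "\<dots> \<le> ennreal (3 / l) * (ennreal (exp (- c)) * ennreal (3 * exp c) + ennreal c)"
    using tensor_norm_mgf[OF p N] by (intro mult_left_mono add_right_mono) (auto simp: l_def c_def)
  also have "\<dots> = ennreal (3 / l * (exp (- c) * (3 * exp c) + c))"
    using l c0 by (subst (2) ennreal_mult) (simp_all add: ennreal_mult)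
  also have "\<dots> \<le> ennreal (21 * l)"
  proof (rule ennreal_leI)
    have "exp (- c) * (3 * exp c) + c = 3 + 4 * (l * l)"
      using exp_add[of "- c" c] by (simp add: c_def l2)
    also have "\<dots> \<le> 7 * (l * l)" using l1 by simp
    finally have "3 / l * (exp (- c) * (3 * exp c) + c) \<le> 3 / l * (7 * (l * l))" using l by (intro mult_left_mono) auto
    also have "\<dots> = 21 * l" using l by simp
    finally show "3 / l * (exp (- c) * (3 * exp c) + c) \<le> 21 * l" .
  qed
  finally show ?thesis by (simp add: l_def mult_ac)
qed

lemma tensor_norm_tail:
  assumes p: "p \<ge> 1" and N: "N \<ge> 1"
  shows "emeasure (disorder N) {x \<in> space (disorder N). tensor_norm N p x > 3 * real p * sqrt (real N) * s}
     \<le> ennreal (3 * exp (- (real N * (real p)\<^sup>2 * (s - 4))))"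
proof -
  note [measurable] = tensor_norm_measurable[OF p, of N]
  define l where "l = real p * sqrt (real N)"
  have l: "l > 0" using p N by (simp add: l_def)
  have l2: "l * l = real N * (real p)\<^sup>2" by (simp add: l_def power2_eq_square mult_ac)
  let ?P = "disorder N"
  have "emeasure ?P {x \<in> space ?P. tensor_norm N p x > 3 * real p * sqrt (real N) * s}
     \<le> emeasure ?P ({x \<in> space ?P. 1 \<le> ennreal (exp (- (l * l * s))) * ennreal (exp (l * tensor_norm N p x / 3))})"
  proof (rule emeasure_mono)
    show "{x \<in> space ?P. tensor_norm N p x > 3 * real p * sqrt (real N) * s} \<subseteq> {x \<in> space ?P. 1 \<le> ennreal (exp (- (l * l * s))) * ennreal (exp (l * tensor_norm N p x / 3))}"
    proof safe
      fix x assume "3 * real p * sqrt (real N) * s < tensor_norm N p x"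
      then have "3 * (l * s) \<le> tensor_norm N p x" by (simp add: l_def mult_ac)
      then have "l * (3 * (l * s)) \<le> l * tensor_norm N p x" using l by (intro mult_left_mono) auto
      then have "0 \<le> - (l * l * s) + l * tensor_norm N p x / 3" by simp
      then have "1 \<le> exp (- (l * l * s) + l * tensor_norm N p x / 3)" by simp
      then show "1 \<le> ennreal (exp (- (l * l * s))) * ennreal (exp (l * tensor_norm N p x / 3))"
        by (simp add: ennreal_mult''[symmetric] exp_add[symmetric])
    qed
  qed measurable
  also have "\<dots> \<le> ennreal (exp (- (l * l * s))) * (\<integral>\<^sup>+x. ennreal (exp (l * tensor_norm N p x / 3)) * indicator (space ?P) x \<partial>?P)"
    using nn_integral_Markov_inequality[of "\<lambda>x. ennreal (exp (l * tensor_norm N p x / 3))" "space ?P" ?P "ennreal (exp (- (l * l * s)))"]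
    by simp
  also have "\<dots> = ennreal (exp (- (l * l * s))) * (\<integral>\<^sup>+x. ennreal (exp (l * tensor_norm N p x / 3)) \<partial>?P)"
    by (intro arg_cong2[where f="(*)"] nn_integral_cong) auto
  also have "\<dots> \<le> ennreal (exp (- (l * l * s))) * ennreal (3 * exp (4 * (l * l)))"
    using tensor_norm_mgf[OF p N] by (intro mult_left_mono) (auto simp: l_def power2_eq_square mult_ac)
  also have "\<dots> = ennreal (3 * exp (- (l * l * (s - 4))))"
    by (simp add: ennreal_mult''[symmetric] exp_add[symmetric] algebra_simps)
  finally show ?thesis by (simp add: l2)
qed

section \<open>The Hamiltonian\<close>

locale mixture =
  fixes \<gamma> :: "nat \<Rightarrow> real"
  assumes gamma_nonneg: "\<And>p. p \<ge> 1 \<Longrightarrow> 0 \<le> \<gamma> p"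
    and gamma_decay: "decays_exponentially \<gamma>"
begin

lemma gamma_Suc_nonneg: "0 \<le> \<gamma> (Suc p)" by (rule gamma_nonneg) simp

text \<open>Half of the exponential decay absorbs p^2; the other half leaves a geometric
  series.\<close>

lemma summable_gamma_sq: "summable (\<lambda>p. \<gamma> (Suc p) * (real (Suc p))\<^sup>2)"
proof -
  obtain C a where C: "a > 0" "\<And>p. p \<ge> 1 \<Longrightarrow> \<gamma> p \<le> C * exp (- a * real p)"
    using gamma_decay unfolding decays_exponentially_def by blast
  have C0: "C \<ge> 0"
  proof -
    have "0 \<le> C * exp (- a * real 1)" using C(2)[of 1] gamma_nonneg[of 1] by linarith
    then show ?thesis by (simp add: zero_le_mult_iff)
  qed
  \<comment> \<open>From y^2 / 2 \<le> exp y at y = a p / 2.\<close>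
  define K where "K = 8 / a\<^sup>2"
  have sq: "(real p)\<^sup>2 \<le> K * exp (a / 2 * real p)" for p
  proof -
    have "(a / 2 * real p)\<^sup>2 / 2 \<le> exp (a / 2 * real p)"
    proof -
      have "0 \<le> a / 2 * real p" using C(1) by simp
      from exp_lower_Taylor_quadratic[OF this] this show ?thesis by linarith
    qed
    then have "K * ((a / 2 * real p)\<^sup>2 / 2) \<le> K * exp (a / 2 * real p)"
      by (intro mult_left_mono) (auto simp: K_def)
    moreover have "K * ((a / 2 * real p)\<^sup>2 / 2) = (real p)\<^sup>2"
      using C(1) by (simp add: K_def power_mult_distrib power_divide)
    ultimately show ?thesis by simp
  qed
  have bound: "\<gamma> (Suc p) * (real (Suc p))\<^sup>2 \<le> C * K * exp (- a / 2) ^ Suc p" for p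
  proof -
    have "\<gamma> (Suc p) * (real (Suc p))\<^sup>2 \<le> (C * exp (- a * real (Suc p))) * (K * exp (a / 2 * real (Suc p)))"
      using C(2)[of "Suc p"] sq[of "Suc p"] C0 by (intro mult_mono) auto
    also have "\<dots> = C * K * exp (- a / 2 * real (Suc p))"
    proof -
      have "exp (- a * real (Suc p)) * exp (a / 2 * real (Suc p)) = exp (- a / 2 * real (Suc p))"
        by (simp add: exp_add[symmetric] algebra_simps del: of_nat_Suc)
      then show ?thesis by (simp add: mult_ac del: of_nat_Suc)
    qed
    also have "\<dots> = C * K * exp (- a / 2) ^ Suc p"
      by (subst exp_of_nat_mult[symmetric]) (simp add: mult.commute)
    finally show ?thesis .
  qed
  have "summable (\<lambda>p. C * K * exp (- a / 2) ^ Suc p)"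
    using C(1) by (intro summable_mult summable_Suc_iff[THEN iffD2] summable_geometric) auto
  then show ?thesis
    by (rule summable_comparison_test'[of _ 0]) (use bound gamma_Suc_nonneg in auto)
qed

lemma summable_gamma2: "summable (\<lambda>p. (\<gamma> (Suc p))\<^sup>2 * real (Suc p))"
proof -
  obtain C a where C: "a > 0" "\<And>p. p \<ge> 1 \<Longrightarrow> \<gamma> p \<le> C * exp (- a * real p)"
    using gamma_decay unfolding decays_exponentially_def by blast
  have bd: "\<gamma> (Suc p) \<le> \<bar>C\<bar>" for p
  proof -
    have "\<gamma> (Suc p) \<le> \<bar>C\<bar> * exp (- a * real (Suc p))"
      by (rule order_trans[OF C(2) mult_right_mono[OF abs_ge_self]]) auto
    also have "\<dots> \<le> \<bar>C\<bar> * 1" using C(1) by (intro mult_left_mono) auto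
    finally show ?thesis by simp
  qed
  have le: "(\<gamma> (Suc p))\<^sup>2 * real (Suc p) \<le> \<bar>C\<bar> * (\<gamma> (Suc p) * (real (Suc p))\<^sup>2)" for p
  proof -
    have "real (Suc p) * 1 \<le> real (Suc p) * real (Suc p)" by (intro mult_left_mono) auto
    then have "(\<gamma> (Suc p) * \<gamma> (Suc p)) * real (Suc p) \<le> (\<bar>C\<bar> * \<gamma> (Suc p)) * (real (Suc p) * real (Suc p))"
      using bd[of p] gamma_Suc_nonneg[of p] by (intro mult_mono mult_right_mono) auto
    then show ?thesis by (simp only: power2_eq_square mult.assoc)
  qed
  have "norm ((\<gamma> (Suc p))\<^sup>2 * real (Suc p)) \<le> \<bar>C\<bar> * (\<gamma> (Suc p) * (real (Suc p))\<^sup>2)" for p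
    using le[of p] by (simp only: real_norm_def abs_of_nonneg mult_nonneg_nonneg zero_le_power2 of_nat_0_le_iff)
  then show ?thesis
    by (rule summable_comparison_test'[OF summable_mult[OF summable_gamma_sq]])
qed

lemma summable_gamma2': "summable (\<lambda>p. (\<gamma> (Suc p))\<^sup>2)"
  by (rule summable_comparison_test'[OF summable_gamma2, of 0])
     (simp add: mult_le_cancel_left1 algebra_simps)

text \<open>In terms of the mixture, \<open>D1\<close> is \<nu>(1) and \<open>D2\<close> is
  \<nu>'(1). \<open>S1\<close> governs the Lipschitz constant: one factor p comes from the p slots
  of the form, the other from the size p sqrt N of the tensor norm.\<close>

definition S1 where "S1 = (\<Sum>p. \<gamma> (Suc p) * (real (Suc p))\<^sup>2)"
definition D1 where "D1 = (\<Sum>p. (\<gamma> (Suc p))\<^sup>2)"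
definition D2 where "D2 = (\<Sum>p. (\<gamma> (Suc p))\<^sup>2 * real (Suc p))"

lemma S1_nonneg: "S1 \<ge> 0" unfolding S1_def by (intro suminf_nonneg summable_gamma_sq) (simp add: gamma_Suc_nonneg)
lemma D1_nonneg: "D1 \<ge> 0" unfolding D1_def by (intro suminf_nonneg summable_gamma2') simp
lemma D2_nonneg: "D2 \<ge> 0" unfolding D2_def by (intro suminf_nonneg summable_gamma2) simp

text \<open>Lipschitz constant of the term of order p + 1 on the ball of radius sqrt N: the power of
  sqrt N from the p untouched slots cancels the normalisation of the Hamiltonian.\<close>

definition lip_term :: "nat \<Rightarrow> (nat list \<Rightarrow> real) \<Rightarrow> nat \<Rightarrow> real" where
  "lip_term N x p = \<gamma> (Suc p) * real (Suc p) * tensor_norm N (Suc p) x"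

definition lip_const :: "nat \<Rightarrow> (nat list \<Rightarrow> real) \<Rightarrow> real" where
  "lip_const N x = (\<Sum>p. lip_term N x p)"

text \<open>A condition on the disorder alone. On this set the Hamiltonian converges and is
  Lipschitz at all m of the closed ball simultaneously, and it is linear in the disorder.\<close>

definition good :: "nat \<Rightarrow> (nat list \<Rightarrow> real) set" where
  "good N = {x \<in> space (disorder N). summable (lip_term N x)}"

lemma lip_term_nonneg: "lip_term N x p \<ge> 0"
  unfolding lip_term_def by (intro mult_nonneg_nonneg gamma_Suc_nonneg tensor_norm_nonneg) auto

lemma lip_term_measurable [measurable]: "(\<lambda>x. lip_term N x p) \<in> borel_measurable (disorder N)"
  unfolding lip_term_def using tensor_norm_measurable[of "Suc p" N] by measurable

lemma lip_const_measurable [measurable]: "lip_const N \<in> borel_measurable (disorder N)"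
  unfolding lip_const_def[abs_def] by measurable

lemma lip_const_nonneg: "x \<in> good N \<Longrightarrow> lip_const N x \<ge> 0"
  unfolding lip_const_def good_def by (intro suminf_nonneg lip_term_nonneg) auto

lemma good_iff: "x \<in> good N \<longleftrightarrow> x \<in> space (disorder N) \<and> (\<Sum>p. ennreal (lip_term N x p)) \<noteq> top"
proof -
  have "summable (lip_term N x) \<longleftrightarrow> (\<Sum>p. ennreal (lip_term N x p)) \<noteq> top"
    using summable_suminf_not_top[of "lip_term N x"] suminf_ennreal2[of "lip_term N x"] lip_term_nonneg
    by (metis ennreal_neq_top)
  then show ?thesis unfolding good_def by simp
qed

lemma good_sets: "good N \<in> sets (disorder N)"
proof -
  have "good N = {x \<in> space (disorder N). (\<Sum>p. ennreal (lip_term N x p)) \<noteq> top}" using good_iff by blast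
  also have "\<dots> \<in> sets (disorder N)" by measurable
  finally show ?thesis .
qed

lemma lip_const_nn_mean:
  assumes N: "N \<ge> 1"
  shows "(\<integral>\<^sup>+x. (\<Sum>p. ennreal (lip_term N x p)) \<partial>disorder N) \<le> ennreal (21 * sqrt (real N) * S1)"
proof -
  have "(\<integral>\<^sup>+x. (\<Sum>p. ennreal (lip_term N x p)) \<partial>disorder N) = (\<Sum>p. \<integral>\<^sup>+x. ennreal (lip_term N x p) \<partial>disorder N)"
    by (rule nn_integral_suminf) measurable
  also have "\<dots> \<le> (\<Sum>p. ennreal (21 * sqrt (real N) * (\<gamma> (Suc p) * (real (Suc p))\<^sup>2)))"
  proof (intro suminf_le)
    fix p
    have "(\<integral>\<^sup>+x. ennreal (lip_term N x p) \<partial>disorder N) = ennreal (\<gamma> (Suc p) * real (Suc p)) * (\<integral>\<^sup>+x. ennreal (tensor_norm N (Suc p) x) \<partial>disorder N)"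
      unfolding lip_term_def using gamma_Suc_nonneg[of p] tensor_norm_measurable[of "Suc p" N]
      by (subst nn_integral_cmult[symmetric]) (auto simp: ennreal_mult tensor_norm_nonneg)
    also have "\<dots> \<le> ennreal (\<gamma> (Suc p) * real (Suc p)) * ennreal (21 * real (Suc p) * sqrt (real N))"
      using N by (intro mult_left_mono tensor_norm_mean) auto
    also have "\<dots> = ennreal (21 * sqrt (real N) * (\<gamma> (Suc p) * (real (Suc p))\<^sup>2))"
      using gamma_Suc_nonneg[of p] by (subst ennreal_mult[symmetric]) (auto simp: power2_eq_square mult_ac)
    finally show "(\<integral>\<^sup>+x. ennreal (lip_term N x p) \<partial>disorder N) \<le> ennreal (21 * sqrt (real N) * (\<gamma> (Suc p) * (real (Suc p))\<^sup>2))" .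
  qed auto
  also have "\<dots> = ennreal (\<Sum>p. 21 * sqrt (real N) * (\<gamma> (Suc p) * (real (Suc p))\<^sup>2))"
    using gamma_Suc_nonneg summable_gamma_sq by (intro suminf_ennreal2 summable_mult) auto
  also have "\<dots> = ennreal (21 * sqrt (real N) * S1)"
    unfolding S1_def by (subst suminf_mult[OF summable_gamma_sq]) simp
  finally show ?thesis .
qed

lemma good_AE:
  assumes N: "N \<ge> 1" shows "AE x in disorder N. x \<in> good N"
proof -
  have "AE x in disorder N. (\<Sum>p. ennreal (lip_term N x p)) \<noteq> \<infinity>"
    using lip_const_nn_mean[OF N] by (intro nn_integral_PInf_AE) (auto simp: top_unique)
  then show ?thesis by (auto simp: good_iff)
qed

lemma lip_const_mean:
  assumes N: "N \<ge> 1"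
  shows "integrable (disorder N) (lip_const N)" "(\<integral>x. lip_const N x \<partial>disorder N) \<le> 21 * sqrt (real N) * S1"
proof -
  have nn: "(\<integral>\<^sup>+x. ennreal (lip_const N x) \<partial>disorder N) \<le> ennreal (21 * sqrt (real N) * S1)"
  proof -
    have "(\<integral>\<^sup>+x. ennreal (lip_const N x) \<partial>disorder N) = (\<integral>\<^sup>+x. (\<Sum>p. ennreal (lip_term N x p)) \<partial>disorder N)"
      using good_AE[OF N]
      by (intro nn_integral_cong_AE) (auto elim!: eventually_mono simp: good_def lip_const_def suminf_ennreal2 lip_term_nonneg)
    then show ?thesis using lip_const_nn_mean[OF N] by simp
  qed
  have pos: "AE x in disorder N. 0 \<le> lip_const N x" using good_AE[OF N] by eventually_elim (rule lip_const_nonneg)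
  show i: "integrable (disorder N) (lip_const N)"
    using nn pos by (intro integrableI_nonneg) (auto simp: le_less_trans)
  have "ennreal (\<integral>x. lip_const N x \<partial>disorder N) \<le> ennreal (21 * sqrt (real N) * S1)"
    using nn nn_integral_eq_integral[OF i pos] by simp
  then show "(\<integral>x. lip_const N x \<partial>disorder N) \<le> 21 * sqrt (real N) * S1"
    using S1_nonneg by (simp add: ennreal_le_iff)
qed

text \<open>Union bound over the orders. The threshold s = 5 + c leaves 3 exp (- N p^2 (1 + c)) at
  order p after the entropy 4 N p^2; with q = exp (- N (1 + c)) \<le> 1/2 the geometric series sums
  to at most 6 q.\<close>

lemma lip_const_tail:
  assumes N: "N \<ge> 1" and c: "c \<ge> 0"
  shows "measure (disorder N) {x \<in> space (disorder N). \<not> (x \<in> good N \<and> lip_const N x \<le> 3 * (5 + c) * sqrt (real N) * S1)} \<le> 6 * exp (- (real N * (1 + c)))"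
proof -
  interpret P: prob_space "disorder N" by (rule prob_space_gauss)
  define s where "s = 5 + c"
  define A where "A p = {x \<in> space (disorder N). tensor_norm N (Suc p) x > 3 * real (Suc p) * sqrt (real N) * s}" for p
  have [measurable]: "A p \<in> sets (disorder N)" for p
    unfolding A_def using tensor_norm_measurable[of "Suc p" N] by measurable
  have sub: "{x \<in> space (disorder N). \<not> (x \<in> good N \<and> lip_const N x \<le> 3 * s * sqrt (real N) * S1)} \<subseteq> (\<Union>p. A p)"
  proof (rule subsetI, rule ccontr)
    fix x assume x: "x \<in> {x \<in> space (disorder N). \<not> (x \<in> good N \<and> lip_const N x \<le> 3 * s * sqrt (real N) * S1)}" "x \<notin> (\<Union>p. A p)"
    have t: "lip_term N x p \<le> 3 * s * sqrt (real N) * (\<gamma> (Suc p) * (real (Suc p))\<^sup>2)" for p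
    proof -
      have "tensor_norm N (Suc p) x \<le> 3 * real (Suc p) * sqrt (real N) * s" using x by (auto simp: A_def not_less)
      then have "\<gamma> (Suc p) * real (Suc p) * tensor_norm N (Suc p) x \<le> \<gamma> (Suc p) * real (Suc p) * (3 * real (Suc p) * sqrt (real N) * s)"
        using gamma_Suc_nonneg[of p] by (intro mult_left_mono) auto
      then show ?thesis by (simp add: lip_term_def power2_eq_square mult_ac)
    qed
    have sm: "summable (\<lambda>p. 3 * s * sqrt (real N) * (\<gamma> (Suc p) * (real (Suc p))\<^sup>2))"
      by (intro summable_mult summable_gamma_sq)
    have sl: "summable (lip_term N x)"
      by (rule summable_comparison_test'[OF sm, of 0]) (use t lip_term_nonneg in auto)
    have "lip_const N x \<le> (\<Sum>p. 3 * s * sqrt (real N) * (\<gamma> (Suc p) * (real (Suc p))\<^sup>2))"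
      unfolding lip_const_def by (intro suminf_le t sl sm)
    also have "\<dots> = 3 * s * sqrt (real N) * S1" unfolding S1_def by (rule suminf_mult[OF summable_gamma_sq])
    finally show False using x(1) sl by (simp add: good_def)
  qed
  define q where "q = exp (- (real N * (1 + c)))"
  have q: "0 < q" "q \<le> 1/2"
  proof -
    have "1 * 1 \<le> real N * (1 + c)" using N c by (intro mult_mono) auto
    then have "q \<le> exp (- 1)" by (simp add: q_def)
    also have "exp (- 1) \<le> (1/2 :: real)"
      using exp_ge_add_one_self[of "1::real"] by (simp add: exp_minus field_simps)
    finally show "q \<le> 1/2" .
  qed (simp add: q_def)
  have "emeasure (disorder N) {x \<in> space (disorder N). \<not> (x \<in> good N \<and> lip_const N x \<le> 3 * s * sqrt (real N) * S1)} \<le> emeasure (disorder N) (\<Union>p. A p)"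
    by (rule emeasure_mono[OF sub]) measurable
  also have "\<dots> \<le> (\<Sum>p. emeasure (disorder N) (A p))"
    by (rule emeasure_subadditive_countably) auto
  also have "\<dots> \<le> (\<Sum>p. ennreal (3 * q ^ Suc p))"
  proof (intro suminf_le)
    fix p
    have "emeasure (disorder N) (A p) \<le> ennreal (3 * exp (- (real N * (real (Suc p))\<^sup>2 * (s - 4))))"
      unfolding A_def by (rule tensor_norm_tail[OF _ N]) simp
    also have "\<dots> \<le> ennreal (3 * q ^ Suc p)"
    proof (intro ennreal_leI mult_left_mono)
      have "real (Suc p) * 1 \<le> real (Suc p) * real (Suc p)" by (intro mult_left_mono) auto
      then have "(real N * (1 + c)) * real (Suc p) \<le> (real N * (1 + c)) * (real (Suc p))\<^sup>2"
        using c unfolding power2_eq_square by (intro mult_left_mono) auto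
      then have "exp (- (real N * (real (Suc p))\<^sup>2 * (s - 4))) \<le> exp (- ((real N * (1 + c)) * real (Suc p)))"
        unfolding exp_le_cancel_iff by (simp add: s_def mult_ac)
      also have "\<dots> = exp (real (Suc p) * (- (real N * (1 + c))))" by (simp add: mult_ac)
      also have "\<dots> = q ^ Suc p" unfolding q_def by (rule exp_of_nat_mult)
      finally show "exp (- (real N * (real (Suc p))\<^sup>2 * (s - 4))) \<le> q ^ Suc p" .
    qed simp
    finally show "emeasure (disorder N) (A p) \<le> ennreal (3 * q ^ Suc p)" .
  qed auto
  also have "\<dots> = ennreal (\<Sum>p. 3 * q ^ Suc p)"
    using q by (intro suminf_ennreal2 summable_mult summable_Suc_iff[THEN iffD2] summable_geometric) auto
  also have "(\<Sum>p. 3 * q ^ Suc p) = 3 * q * (1 / (1 - q))"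
  proof -
    have "(\<Sum>p. 3 * q ^ Suc p) = (\<Sum>p. (3 * q) * q ^ p)" by (simp add: mult_ac)
    also have "\<dots> = 3 * q * (\<Sum>p. q ^ p)" using q by (intro suminf_mult summable_geometric) auto
    also have "(\<Sum>p. q ^ p) = 1 / (1 - q)" using q by (intro suminf_geometric) auto
    finally show ?thesis .
  qed
  also have "ennreal (3 * q * (1 / (1 - q))) \<le> ennreal (6 * q)"
    using q by (intro ennreal_leI) (simp add: field_simps)
  finally have "emeasure (disorder N) {x \<in> space (disorder N). \<not> (x \<in> good N \<and> lip_const N x \<le> 3 * s * sqrt (real N) * S1)} \<le> ennreal (6 * q)" .
  then show ?thesis using q unfolding P.emeasure_eq_measure s_def q_def by (simp add: ennreal_le_iff)
qed

lemma pure_diff_le: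
  assumes N: "N \<ge> 1" and m: "L2_set m {..<N} \<le> sqrt (real N)" "L2_set m' {..<N} \<le> sqrt (real N)"
  shows "\<bar>pure_hamiltonian N \<gamma> x (Suc p) m - pure_hamiltonian N \<gamma> x (Suc p) m'\<bar> \<le> lip_term N x p * L2_set (\<lambda>i. m i - m' i) {..<N}"
proof -
  have pw: "real N powr ((real (Suc p) - 1) / 2) = sqrt (real N) ^ p"
  proof -
    have "real N powr ((real (Suc p) - 1) / 2) = real N powr (1/2 * real p)" by simp
    also have "\<dots> = (real N powr (1/2)) powr real p" by (simp only: powr_powr)
    also have "\<dots> = sqrt (real N) ^ p" using N by (simp add: powr_half_sqrt powr_realpow)
    finally show ?thesis .
  qed
  have s: "sqrt (real N) ^ p > 0" using N by simp
  let ?d = "L2_set (\<lambda>i. m i - m' i) {..<N}"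
  have "\<bar>tensor_form N x (replicate (Suc p) m) - tensor_form N x (replicate (Suc p) m')\<bar> \<le> real (Suc p) * tensor_norm N (Suc p) x * sqrt (real N) ^ (Suc p - 1) * ?d"
    by (rule tensor_form_diff_bound[OF tensor_norm_tens_bound[OF N] tensor_norm_nonneg m])
  then have "\<gamma> (Suc p) / sqrt (real N) ^ p * \<bar>tensor_form N x (replicate (Suc p) m) - tensor_form N x (replicate (Suc p) m')\<bar>
     \<le> \<gamma> (Suc p) / sqrt (real N) ^ p * (real (Suc p) * tensor_norm N (Suc p) x * sqrt (real N) ^ p * ?d)"
    using s gamma_Suc_nonneg[of p] by (intro mult_left_mono) auto
  also have "\<dots> = lip_term N x p * ?d" using s by (simp add: lip_term_def)
  also have "\<gamma> (Suc p) / sqrt (real N) ^ p * \<bar>tensor_form N x (replicate (Suc p) m) - tensor_form N x (replicate (Suc p) m')\<bar>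
     = \<bar>\<gamma> (Suc p) / sqrt (real N) ^ p * (tensor_form N x (replicate (Suc p) m) - tensor_form N x (replicate (Suc p) m'))\<bar>"
    using s gamma_Suc_nonneg[of p] by (simp add: abs_mult)
  also have "\<dots> = \<bar>pure_hamiltonian N \<gamma> x (Suc p) m - pure_hamiltonian N \<gamma> x (Suc p) m'\<bar>"
    unfolding pure_hamiltonian_tens pw by (simp only: right_diff_distrib)
  finally show ?thesis .
qed

lemma pure_zero: "pure_hamiltonian N \<gamma> x (Suc p) (\<lambda>_. 0) = 0"
  unfolding pure_hamiltonian_tens by (simp add: tensor_form_Cons del: tensor_form.simps)

lemma pure_abs_le:
  assumes N: "N \<ge> 1" and m: "L2_set m {..<N} \<le> sqrt (real N)"
  shows "\<bar>pure_hamiltonian N \<gamma> x (Suc p) m\<bar> \<le> lip_term N x p * sqrt (real N)"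
proof -
  have "L2_set (\<lambda>_. 0) {..<N} \<le> sqrt (real N)" by (simp add: L2_set_def)
  from pure_diff_le[OF N m this, of x p]
  have "\<bar>pure_hamiltonian N \<gamma> x (Suc p) m\<bar> \<le> lip_term N x p * L2_set m {..<N}" by (simp add: pure_zero)
  also have "\<dots> \<le> lip_term N x p * sqrt (real N)" using m lip_term_nonneg by (intro mult_left_mono)
  finally show ?thesis .
qed

lemma summable_pure:
  assumes "N \<ge> 1" "x \<in> good N" "L2_set m {..<N} \<le> sqrt (real N)"
  shows "summable (\<lambda>p. pure_hamiltonian N \<gamma> x (Suc p) m)"
proof -
  have "summable (\<lambda>p. lip_term N x p * sqrt (real N))"
    using assms(2) by (intro summable_mult2) (simp add: good_def)
  then show ?thesis
    by (rule summable_comparison_test'[of _ 0]) (use pure_abs_le[OF assms(1,3)] in auto)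
qed

lemma hamiltonian_abs_le:
  assumes "N \<ge> 1" "x \<in> good N" "L2_set m {..<N} \<le> sqrt (real N)"
  shows "\<bar>hamiltonian N \<gamma> x m\<bar> \<le> lip_const N x * sqrt (real N)"
proof -
  have sl: "summable (lip_term N x)" using assms(2) by (simp add: good_def)
  have "\<bar>hamiltonian N \<gamma> x m\<bar> \<le> (\<Sum>p. lip_term N x p * sqrt (real N))"
    unfolding hamiltonian_def real_norm_def[symmetric]
    using pure_abs_le[OF assms(1,3)] sl by (intro norm_suminf_le summable_mult2) auto
  also have "\<dots> = lip_const N x * sqrt (real N)" unfolding lip_const_def by (rule suminf_mult2[OF sl, symmetric])
  finally show ?thesis .
qed

lemma hamiltonian_lipschitz:
  assumes N: "N \<ge> 1" and x: "x \<in> good N"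
  shows "lipschitz_N N (lip_const N x) (hamiltonian N \<gamma> x)"
  unfolding lipschitz_N_def
proof (intro ballI impI)
  fix m m' :: "nat \<Rightarrow> real" assume m: "L2_set m {..<N} \<le> sqrt (real N)" "L2_set m' {..<N} \<le> sqrt (real N)"
  let ?d = "L2_set (\<lambda>i. m i - m' i) {..<N}"
  have sl: "summable (lip_term N x)" using x by (simp add: good_def)
  have "hamiltonian N \<gamma> x m - hamiltonian N \<gamma> x m' = (\<Sum>p. pure_hamiltonian N \<gamma> x (Suc p) m - pure_hamiltonian N \<gamma> x (Suc p) m')"
    unfolding hamiltonian_def by (intro suminf_diff summable_pure N x m)
  also have "\<bar>\<dots>\<bar> \<le> (\<Sum>p. lip_term N x p * ?d)"
    unfolding real_norm_def[symmetric]
    using pure_diff_le[OF N m, of x] sl by (intro norm_suminf_le summable_mult2) auto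
  also have "\<dots> = lip_const N x * ?d" unfolding lip_const_def by (rule suminf_mult2[OF sl, symmetric])
  finally show "\<bar>hamiltonian N \<gamma> x m - hamiltonian N \<gamma> x m'\<bar> \<le> lip_const N x * ?d" .
qed

lemma pure_comb:
  "pure_hamiltonian N \<gamma> (lin_comb (all_indices N) c s x y) (Suc p) m
    = c * pure_hamiltonian N \<gamma> x (Suc p) m + s * pure_hamiltonian N \<gamma> y (Suc p) m"
proof -
  have "tensor_form N (lin_comb (all_indices N) c s x y) (replicate (Suc p) m) = tensor_form N (\<lambda>is. c * x is + s * y is) (replicate (Suc p) m)"
    using multi_indices_subset[of "Suc p" N] by (intro tensor_form_cong) (auto simp: lin_comb_def)
  then show ?thesis unfolding pure_hamiltonian_tens tensor_form_add_scale by (simp add: algebra_simps)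
qed

lemma hamiltonian_comb:
  assumes "N \<ge> 1" "x \<in> good N" "y \<in> good N" "L2_set m {..<N} \<le> sqrt (real N)"
  shows "hamiltonian N \<gamma> (lin_comb (all_indices N) c s x y) m = c * hamiltonian N \<gamma> x m + s * hamiltonian N \<gamma> y m"
  unfolding hamiltonian_def pure_comb
  using summable_pure[OF assms(1,2,4)] summable_pure[OF assms(1,3,4)]
  by (simp add: suminf_add[symmetric] suminf_mult summable_mult)

text \<open>The Hamiltonian reads couplings of positive order only, so an arbitrary family of
  couplings can be replaced by a point of the canonical product space.\<close>

lemma hamiltonian_restrict:
  "hamiltonian N \<gamma> (restrict J (all_indices N)) m = hamiltonian N \<gamma> J m"
proof -
  have "tensor_form N (restrict J (all_indices N)) (replicate (Suc p) m) = tensor_form N J (replicate (Suc p) m)" for p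
    using multi_indices_subset[of "Suc p" N] by (intro tensor_form_cong) auto
  then show ?thesis unfolding hamiltonian_def pure_hamiltonian_tens by simp
qed

lemma hamiltonian_measurable:
  assumes f: "f \<in> measurable M (disorder N)" and g: "\<And>i. i < N \<Longrightarrow> (\<lambda>w. g w i) \<in> borel_measurable M"
  shows "(\<lambda>w. hamiltonian N \<gamma> (f w) (g w)) \<in> borel_measurable M"
proof -
  have "(\<lambda>w. pure_hamiltonian N \<gamma> (f w) (Suc p) (g w)) \<in> borel_measurable M" for p
  proof -
    have "(\<lambda>w. prod_list (map (g w) is)) \<in> borel_measurable M" if "set is \<subseteq> {..<N}" for "is"
      using that by (induction "is") (auto intro!: borel_measurable_times g)
    moreover have "(\<lambda>w. f w is) \<in> borel_measurable M" if "is \<in> multi_indices N (Suc p)" for "is"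
      using that multi_indices_subset[of "Suc p" N] by (intro measurable_gauss_component[OF _ f]) auto
    ultimately show ?thesis unfolding pure_hamiltonian_def
      by (intro borel_measurable_times borel_measurable_sum borel_measurable_const) (auto simp: multi_indices_def)
  qed
  then show ?thesis unfolding hamiltonian_def by (intro borel_measurable_suminf)
qed

end

section \<open>Concentration and continuity of the free energy\<close>

text \<open>The inner product of the q-th tensor powers of v and w; it turns variances of
  Hamiltonians into powers of overlaps.\<close>

lemma sum_prod_list_pair:
  assumes N: "N \<ge> 1"
  shows "(\<Sum>is\<in>multi_indices N q. prod_list (map v is) * prod_list (map w is)) = real N ^ q * overlap N v w ^ q"
proof -
  have "(\<Sum>is\<in>multi_indices N q. prod_list (map v is) * prod_list (map w is))
     = (\<Sum>is\<in>multi_indices N (length (replicate q v)). rank1 (replicate q v) is * rank1 (replicate q w) is)"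
    by (simp, intro sum.cong) (auto simp: rank1_replicate multi_indices_def)
  also have "\<dots> = prod_list (map2 (\<lambda>x y. \<Sum>i<N. x i * y i) (replicate q v) (replicate q w))"
    by (rule sum_rank1_prod) simp
  also have "\<dots> = (\<Sum>i<N. v i * w i) ^ q" by (simp add: zip_replicate)
  also have "(\<Sum>i<N. v i * w i) = real N * overlap N v w" using N by (simp add: overlap_def)
  finally show ?thesis by (simp add: power_mult_distrib)
qed

lemma power_diff_le:
  fixes a b :: real
  assumes "\<bar>a\<bar> \<le> 1" "\<bar>b\<bar> \<le> 1"
  shows "\<bar>a ^ q - b ^ q\<bar> \<le> real q * \<bar>a - b\<bar>"
  using norm_power_diff[of a b q] assms by simp

text \<open>Off the diagonal R i j, r i and r j are all close to c, so the four powers cancel up to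
  q (\<rho> + 2 \<delta>). Only the n diagonal terms remain of order 1, which is the gain over the
  trivial bound of order n^2.\<close>

lemma replica_covariance_le:
  fixes R :: "nat \<Rightarrow> nat \<Rightarrow> real" and r :: "nat \<Rightarrow> real"
  assumes b: "\<And>i j. i < n \<Longrightarrow> j < n \<Longrightarrow> \<bar>R i j\<bar> \<le> 1" "\<And>i. i < n \<Longrightarrow> \<bar>r i\<bar> \<le> 1" "\<bar>c\<bar> \<le> 1"
    and off: "\<And>i j. i < n \<Longrightarrow> j < n \<Longrightarrow> i \<noteq> j \<Longrightarrow> \<bar>R i j - c\<bar> \<le> \<rho>" "\<And>i. i < n \<Longrightarrow> \<bar>r i - c\<bar> \<le> \<delta>"
    and nn: "0 \<le> \<rho>" "0 \<le> \<delta>"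
  shows "(\<Sum>i<n. \<Sum>j<n. R i j ^ q - r i ^ q - r j ^ q + c ^ q) \<le> 4 * real n + (real n)\<^sup>2 * real q * (\<rho> + 2 * \<delta>)"
proof -
  define e where "e = real q * (\<rho> + 2 * \<delta>)"
  have e: "e \<ge> 0" using nn by (simp add: e_def)
  have pw: "\<bar>x ^ q\<bar> \<le> 1" if "\<bar>x\<bar> \<le> 1" for x :: real using that by (simp add: power_abs power_le_one)
  have each: "R i j ^ q - r i ^ q - r j ^ q + c ^ q \<le> (if i = j then 4 else 0) + e" if ij: "i < n" "j < n" for i j
  proof (cases "i = j")
    case True
    then show ?thesis using pw[OF b(1)[OF ij]] pw[OF b(2)[OF ij(1)]] pw[OF b(3)] e by (simp add: abs_le_iff)
  next
    case False
    have "\<bar>R i j ^ q - c ^ q\<bar> \<le> real q * \<rho>"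
      using power_diff_le[OF b(1)[OF ij] b(3), of q] mult_left_mono[OF off(1)[OF ij False], of "real q"] by simp
    moreover have "\<bar>r k ^ q - c ^ q\<bar> \<le> real q * \<delta>" if "k < n" for k
      using power_diff_le[OF b(2)[OF that] b(3), of q] mult_left_mono[OF off(2)[OF that], of "real q"] by simp
    from this[OF ij(1)] this[OF ij(2)]
    have "\<bar>r i ^ q - c ^ q\<bar> \<le> real q * \<delta>" "\<bar>r j ^ q - c ^ q\<bar> \<le> real q * \<delta>" .
    moreover have "e = real q * \<rho> + real q * \<delta> + real q * \<delta>" by (simp add: e_def algebra_simps)
    ultimately have "R i j ^ q - r i ^ q - r j ^ q + c ^ q \<le> e" by linarith
    then show ?thesis using False by simp
  qed
  have "(\<Sum>i<n. \<Sum>j<n. R i j ^ q - r i ^ q - r j ^ q + c ^ q) \<le> (\<Sum>i<n. \<Sum>j<n. (if i = j then 4 else 0) + e)"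
    by (intro sum_mono each) auto
  also have "\<dots> = 4 * real n + (real n)\<^sup>2 * e" by (simp add: sum.distrib power2_eq_square algebra_simps)
  finally show ?thesis by (simp add: e_def mult.assoc)
qed

context mixture
begin

text \<open>Variance bound of the summed energy differences. \<open>D1 + 1\<close> in place of
  \<open>D1\<close> keeps it positive when the mixture vanishes, as \<open>gaussian_energy\<close>
  asks for V > 0.\<close>

definition replica_var :: "nat \<Rightarrow> nat \<Rightarrow> real \<Rightarrow> real \<Rightarrow> real" where
  "replica_var N n \<rho> \<delta> = real N * (4 * real n * (D1 + 1) + (real n)\<^sup>2 * (\<rho> + 2 * \<delta>) * D2)"

text \<open>Truncating the series at a finite order leaves a finite Gaussian sum, whose moment
  generating function is explicit. The variances are bounded uniformly in the truncation, and
  Fatou's lemma passes to the full series.\<close>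

lemma replica_mgf:
  assumes N: "N \<ge> 1" and \<sigma>: "\<And>i. i < n \<Longrightarrow> L2_set (\<sigma> i) {..<N} \<le> sqrt (real N)" and m: "L2_set m {..<N} \<le> sqrt (real N)"
    and off: "\<And>i j. i < n \<Longrightarrow> j < n \<Longrightarrow> i \<noteq> j \<Longrightarrow> \<bar>overlap N (\<sigma> i) (\<sigma> j) - overlap N m m\<bar> \<le> \<rho>"
      "\<And>i. i < n \<Longrightarrow> \<bar>overlap N (\<sigma> i) m - overlap N m m\<bar> \<le> \<delta>"
    and nn: "0 \<le> \<rho>" "0 \<le> \<delta>"
  shows "(\<integral>\<^sup>+x. ennreal (exp (l * (\<Sum>i<n. hamiltonian N \<gamma> x (\<sigma> i) - hamiltonian N \<gamma> x m))) \<partial>disorder N)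
    \<le> ennreal (exp (l\<^sup>2 * replica_var N n \<rho> \<delta> / 2))"
proof -
  define V where "V = replica_var N n \<rho> \<delta>"
  have ov1: "\<bar>overlap N x y\<bar> \<le> 1" if "L2_set x {..<N} \<le> sqrt (real N)" "L2_set y {..<N} \<le> sqrt (real N)" for x y
  proof -
    have "L2_set x {..<N} * L2_set y {..<N} \<le> sqrt (real N) * sqrt (real N)" using that by (intro mult_mono) auto
    then have "L2_set x {..<N} * L2_set y {..<N} / real N \<le> 1" using N by simp
    then show ?thesis using abs_overlap_le[of N x y] by linarith
  qed
  define g where "g p = \<gamma> p / real N powr ((real p - 1) / 2)" for p
  define d where "d i is = prod_list (map (\<sigma> i) is) - prod_list (map m is)" for i "is"
  define cf where "cf is = g (length is) * (\<Sum>i<n. d i is)" for "is"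
  have lenI: "length is = p" if "is \<in> multi_indices N p" for "is" p using that by (simp add: multi_indices_def)
  have pure_eq: "(\<Sum>i<n. pure_hamiltonian N \<gamma> x (Suc p) (\<sigma> i) - pure_hamiltonian N \<gamma> x (Suc p) m) = (\<Sum>is\<in>multi_indices N (Suc p). cf is * x is)" for x p
  proof -
    have "(\<Sum>i<n. pure_hamiltonian N \<gamma> x (Suc p) (\<sigma> i) - pure_hamiltonian N \<gamma> x (Suc p) m)
      = (\<Sum>i<n. \<Sum>is\<in>multi_indices N (Suc p). g (Suc p) * d i is * x is)"
      unfolding pure_hamiltonian_def g_def[symmetric] right_diff_distrib[symmetric] sum_subtractf[symmetric]
        sum_distrib_left
      by (intro sum.cong refl) (simp only: d_def algebra_simps)
    also have "\<dots> = (\<Sum>is\<in>multi_indices N (Suc p). \<Sum>i<n. g (Suc p) * d i is * x is)" by (rule sum.swap)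
    also have "\<dots> = (\<Sum>is\<in>multi_indices N (Suc p). cf is * x is)"
      by (intro sum.cong refl) (simp add: cf_def lenI sum_distrib_left sum_distrib_right)
    finally show ?thesis .
  qed
  have var: "(\<Sum>is\<in>multi_indices N (Suc p). (cf is)\<^sup>2) \<le> real N * (\<gamma> (Suc p))\<^sup>2 * (4 * real n + (real n)\<^sup>2 * real (Suc p) * (\<rho> + 2 * \<delta>))" for p
  proof -
    have g2: "(g (Suc p))\<^sup>2 * real N ^ Suc p = real N * (\<gamma> (Suc p))\<^sup>2"
    proof -
      have "(real N powr ((real (Suc p) - 1) / 2))\<^sup>2 = real N powr real p"
        by (simp add: power2_eq_square powr_add[symmetric])
      also have "\<dots> = real N ^ p" using N by (simp add: powr_realpow)
      finally show ?thesis using N by (simp add: g_def power_divide)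
    qed
    have dd: "(\<Sum>is\<in>multi_indices N (Suc p). d i is * d j is)
       = real N ^ Suc p * (overlap N (\<sigma> i) (\<sigma> j) ^ Suc p - overlap N (\<sigma> i) m ^ Suc p - overlap N (\<sigma> j) m ^ Suc p + overlap N m m ^ Suc p)" for i j
    proof -
      have "(\<Sum>is\<in>multi_indices N (Suc p). d i is * d j is)
        = (\<Sum>is\<in>multi_indices N (Suc p). prod_list (map (\<sigma> i) is) * prod_list (map (\<sigma> j) is))
        - (\<Sum>is\<in>multi_indices N (Suc p). prod_list (map (\<sigma> i) is) * prod_list (map m is))
        - (\<Sum>is\<in>multi_indices N (Suc p). prod_list (map (\<sigma> j) is) * prod_list (map m is))
        + (\<Sum>is\<in>multi_indices N (Suc p). prod_list (map m is) * prod_list (map m is))"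
        unfolding sum_subtractf[symmetric] sum.distrib[symmetric] by (intro sum.cong refl) (simp add: d_def algebra_simps)
      then show ?thesis unfolding sum_prod_list_pair[OF N] by (simp add: algebra_simps)
    qed
    have "(\<Sum>is\<in>multi_indices N (Suc p). (cf is)\<^sup>2) = (\<Sum>is\<in>multi_indices N (Suc p). \<Sum>i<n. \<Sum>j<n. (g (Suc p))\<^sup>2 * (d i is * d j is))"
    proof (intro sum.cong refl)
      fix "is" assume "is \<in> multi_indices N (Suc p)"
      then show "(cf is)\<^sup>2 = (\<Sum>i<n. \<Sum>j<n. (g (Suc p))\<^sup>2 * (d i is * d j is))"
        by (simp add: cf_def lenI power_mult_distrib power2_eq_square[of "sum _ _"] sum_product sum_distrib_left[symmetric])
    qed
    also have "\<dots> = (\<Sum>i<n. \<Sum>is\<in>multi_indices N (Suc p). \<Sum>j<n. (g (Suc p))\<^sup>2 * (d i is * d j is))" by (rule sum.swap)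
    also have "\<dots> = (\<Sum>i<n. \<Sum>j<n. \<Sum>is\<in>multi_indices N (Suc p). (g (Suc p))\<^sup>2 * (d i is * d j is))"
      by (intro sum.cong refl sum.swap)
    also have "\<dots> = (g (Suc p))\<^sup>2 * real N ^ Suc p * (\<Sum>i<n. \<Sum>j<n. overlap N (\<sigma> i) (\<sigma> j) ^ Suc p - overlap N (\<sigma> i) m ^ Suc p - overlap N (\<sigma> j) m ^ Suc p + overlap N m m ^ Suc p)"
      unfolding sum_distrib_left[symmetric] dd by (simp only: sum_distrib_left[symmetric] mult.assoc)
    also have "\<dots> \<le> (g (Suc p))\<^sup>2 * real N ^ Suc p * (4 * real n + (real n)\<^sup>2 * real (Suc p) * (\<rho> + 2 * \<delta>))"
    proof (rule mult_left_mono)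
      show "(\<Sum>i<n. \<Sum>j<n. overlap N (\<sigma> i) (\<sigma> j) ^ Suc p - overlap N (\<sigma> i) m ^ Suc p - overlap N (\<sigma> j) m ^ Suc p + overlap N m m ^ Suc p) \<le> 4 * real n + (real n)\<^sup>2 * real (Suc p) * (\<rho> + 2 * \<delta>)"
        by (rule replica_covariance_le) (use ov1 \<sigma> m off nn in auto)
    qed simp
    finally show ?thesis unfolding g2 .
  qed
  define B where "B P = (\<Union>p<P. multi_indices N (Suc p))" for P
  have B: "finite (B P)" "B P \<subseteq> all_indices N" for P
    unfolding B_def using finite_multi_indices multi_indices_subset by (auto simp: subset_iff all_indices_def)
  have sumB: "(\<Sum>is\<in>B P. f is) = (\<Sum>p<P. \<Sum>is\<in>multi_indices N (Suc p). f is)" for f :: "nat list \<Rightarrow> real" and P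
    unfolding B_def by (rule sum.UNION_disjoint) (auto simp: finite_multi_indices lenI dest: lenI)
  have varB: "(\<Sum>is\<in>B P. (cf is)\<^sup>2) \<le> V" for P
  proof -
    have sq: "summable (\<lambda>p. (4 * real n) * (\<gamma> (Suc p))\<^sup>2)" "summable (\<lambda>p. ((real n)\<^sup>2 * (\<rho> + 2 * \<delta>)) * ((\<gamma> (Suc p))\<^sup>2 * real (Suc p)))"
      by (intro summable_mult summable_gamma2' summable_gamma2)+
    have "(\<Sum>is\<in>B P. (cf is)\<^sup>2) \<le> (\<Sum>p<P. real N * (\<gamma> (Suc p))\<^sup>2 * (4 * real n + (real n)\<^sup>2 * real (Suc p) * (\<rho> + 2 * \<delta>)))"
      unfolding sumB by (intro sum_mono var)
    also have "\<dots> = real N * (\<Sum>p<P. (4 * real n) * (\<gamma> (Suc p))\<^sup>2 + ((real n)\<^sup>2 * (\<rho> + 2 * \<delta>)) * ((\<gamma> (Suc p))\<^sup>2 * real (Suc p)))"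
      unfolding sum_distrib_left by (intro sum.cong refl) (simp add: algebra_simps del: of_nat_Suc)
    also have "\<dots> \<le> real N * (\<Sum>p. (4 * real n) * (\<gamma> (Suc p))\<^sup>2 + ((real n)\<^sup>2 * (\<rho> + 2 * \<delta>)) * ((\<gamma> (Suc p))\<^sup>2 * real (Suc p)))"
      using nn sq by (intro mult_left_mono sum_le_suminf summable_add) (auto intro!: add_nonneg_nonneg mult_nonneg_nonneg)
    also have "(\<Sum>p. (4 * real n) * (\<gamma> (Suc p))\<^sup>2 + ((real n)\<^sup>2 * (\<rho> + 2 * \<delta>)) * ((\<gamma> (Suc p))\<^sup>2 * real (Suc p))) = 4 * real n * D1 + (real n)\<^sup>2 * (\<rho> + 2 * \<delta>) * D2"
      unfolding suminf_add[OF sq, symmetric] D1_def D2_def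
      by (simp only: suminf_mult[OF summable_gamma2'] suminf_mult[OF summable_gamma2])
    also have "real N * (4 * real n * D1 + (real n)\<^sup>2 * (\<rho> + 2 * \<delta>) * D2) \<le> V"
      unfolding V_def replica_var_def by (intro mult_left_mono) (auto simp: algebra_simps)
    finally show ?thesis .
  qed
  define A where "A P x = (\<Sum>is\<in>B P. cf is * x is)" for P x
  have Am: "(\<lambda>x. A P x) \<in> borel_measurable (disorder N)" for P
    unfolding A_def using B(2)[of P]
    by (intro borel_measurable_sum borel_measurable_times borel_measurable_const
        measurable_gauss_component[of _ "all_indices N" "\<lambda>x. x"]) auto
  have lim: "(\<lambda>P. A P x) \<longlonglongrightarrow> (\<Sum>i<n. hamiltonian N \<gamma> x (\<sigma> i) - hamiltonian N \<gamma> x m)" if x: "x \<in> good N" for x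
  proof -
    have "A P x = (\<Sum>i<n. (\<Sum>p<P. pure_hamiltonian N \<gamma> x (Suc p) (\<sigma> i)) - (\<Sum>p<P. pure_hamiltonian N \<gamma> x (Suc p) m))" for P
      unfolding A_def sumB pure_eq[symmetric] sum_subtractf[symmetric] by (rule sum.swap)
    moreover have "(\<lambda>P. (\<Sum>i<n. (\<Sum>p<P. pure_hamiltonian N \<gamma> x (Suc p) (\<sigma> i)) - (\<Sum>p<P. pure_hamiltonian N \<gamma> x (Suc p) m)))
       \<longlonglongrightarrow> (\<Sum>i<n. hamiltonian N \<gamma> x (\<sigma> i) - hamiltonian N \<gamma> x m)"
      unfolding hamiltonian_def using summable_pure[OF N x] \<sigma> m
      by (intro tendsto_sum tendsto_diff summable_LIMSEQ) auto
    ultimately show ?thesis by simp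
  qed
  have "(\<integral>\<^sup>+x. ennreal (exp (l * (\<Sum>i<n. hamiltonian N \<gamma> x (\<sigma> i) - hamiltonian N \<gamma> x m))) \<partial>disorder N)
     = (\<integral>\<^sup>+x. liminf (\<lambda>P. ennreal (exp (l * A P x))) \<partial>disorder N)"
  proof (rule nn_integral_cong_AE, rule eventually_mono[OF good_AE[OF N]])
    fix x assume "x \<in> good N"
    from lim[OF this] have "(\<lambda>P. ennreal (exp (l * A P x))) \<longlonglongrightarrow> ennreal (exp (l * (\<Sum>i<n. hamiltonian N \<gamma> x (\<sigma> i) - hamiltonian N \<gamma> x m)))"
      by (intro tendsto_ennrealI tendsto_intros)
    then show "ennreal (exp (l * (\<Sum>i<n. hamiltonian N \<gamma> x (\<sigma> i) - hamiltonian N \<gamma> x m))) = liminf (\<lambda>P. ennreal (exp (l * A P x)))"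
      by (intro lim_imp_Liminf[symmetric]) auto
  qed
  also have "\<dots> \<le> liminf (\<lambda>P. \<integral>\<^sup>+x. ennreal (exp (l * A P x)) \<partial>disorder N)"
    by (intro nn_integral_liminf measurable_compose[OF _ measurable_ennreal]
        measurable_compose[OF _ borel_measurable_exp] borel_measurable_times borel_measurable_const Am)
  also have "\<dots> \<le> ennreal (exp (l\<^sup>2 * V / 2))"
  proof (rule order_trans[OF Liminf_mono])
    show "\<forall>\<^sub>F P in sequentially. (\<integral>\<^sup>+x. ennreal (exp (l * A P x)) \<partial>disorder N) \<le> ennreal (exp (l\<^sup>2 * V / 2))"
    proof (rule always_eventually, rule allI)
      fix P
      have "(\<integral>\<^sup>+x. ennreal (exp (l * A P x)) \<partial>disorder N) = (\<integral>\<^sup>+x. ennreal (exp (\<Sum>is\<in>B P. (l * cf is) * x is)) \<partial>disorder N)"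
        unfolding A_def by (simp add: sum_distrib_left mult.assoc)
      also have "\<dots> = ennreal (exp ((\<Sum>is\<in>B P. (l * cf is)\<^sup>2) / 2))"
        using B by (intro gauss_linear_mgf)
      also have "(\<Sum>is\<in>B P. (l * cf is)\<^sup>2) = l\<^sup>2 * (\<Sum>is\<in>B P. (cf is)\<^sup>2)"
        by (simp add: power_mult_distrib sum_distrib_left)
      also have "ennreal (exp (l\<^sup>2 * (\<Sum>is\<in>B P. (cf is)\<^sup>2) / 2)) \<le> ennreal (exp (l\<^sup>2 * V / 2))"
        using mult_left_mono[OF varB[of P], of "l\<^sup>2"] by (intro ennreal_leI) simp
      finally show "(\<integral>\<^sup>+x. ennreal (exp (l * A P x)) \<partial>disorder N) \<le> ennreal (exp (l\<^sup>2 * V / 2))" .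
    qed
  qed (simp add: Liminf_const)
  finally show ?thesis unfolding V_def .
qed

end

section \<open>Concentration of the free energy at a fixed centre\<close>

locale model = haar N \<mu> + mixture \<gamma> for N \<mu> \<gamma> +
  fixes \<beta> :: real and n :: nat and \<rho> \<delta> :: real
  assumes \<beta>_pos: "\<beta> > 0" and n_pos: "n \<ge> 1" and \<rho>_pos: "\<rho> > 0" and \<delta>_pos: "\<delta> > 0"
begin

definition free_energy :: "(nat \<Rightarrow> real) \<Rightarrow> (nat list \<Rightarrow> real) \<Rightarrow> real" where
  "free_energy m x = multi_free_energy N \<mu> \<beta> (hamiltonian N \<gamma> x) m n \<rho> \<delta>"

definition partition_fun :: "(nat \<Rightarrow> real) \<Rightarrow> (nat list \<Rightarrow> real) \<Rightarrow> ennreal" where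
  "partition_fun m x = partition_nn N \<mu> \<beta> (hamiltonian N \<gamma> x) m n \<rho> \<delta>"

definition band_volume :: "(nat \<Rightarrow> real) \<Rightarrow> ennreal" where
  "band_volume m = emeasure (PiM {..<n} (\<lambda>_. \<mu>)) (replica_band N m n \<rho> \<delta>)"

definition energy :: "(nat \<Rightarrow> real) \<Rightarrow> (nat list \<Rightarrow> real) \<Rightarrow> (nat \<Rightarrow> nat \<Rightarrow> real) \<Rightarrow> real" where
  "energy m x \<sigma> = \<beta> * (\<Sum>i<n. hamiltonian N \<gamma> x (\<sigma> i) - hamiltonian N \<gamma> x m)"

lemma hamiltonian_vec_measurable: "x \<in> space (disorder N) \<Longrightarrow> hamiltonian N \<gamma> x \<in> borel_measurable (vec_borel N)"
  by (rule hamiltonian_measurable[of "\<lambda>_. x"]) auto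

lemma free_energy_eq: "x \<in> space (disorder N) \<Longrightarrow> free_energy m x = 1 / (real N * real n) * ln (enn2real (partition_fun m x))"
  unfolding free_energy_def partition_fun_def by (rule multi_free_energy_eq[OF hamiltonian_vec_measurable])

lemma prob_space_replicas: "prob_space (PiM {..<n} (\<lambda>_. \<mu>))"
  by (intro prob_space_PiM prob_space_axioms)

lemma energy_measurable:
  "(\<lambda>(x, \<sigma>). energy m x \<sigma>) \<in> borel_measurable (disorder N \<Otimes>\<^sub>M PiM {..<n} (\<lambda>_. \<mu>))"
proof -
  let ?M = "disorder N \<Otimes>\<^sub>M PiM {..<n} (\<lambda>_. \<mu>)"
  have 1: "(\<lambda>w. hamiltonian N \<gamma> (fst w) (snd w i)) \<in> borel_measurable ?M" if "i < n" for i
  proof (rule hamiltonian_measurable)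
    fix j assume "j < N"
    from measurable_compose[OF measurable_snd measurable_PiM_haar[OF that this]]
    show "(\<lambda>w. snd w i j) \<in> borel_measurable ?M" .
  qed simp
  have 2: "(\<lambda>w. hamiltonian N \<gamma> (fst w) m) \<in> borel_measurable ?M"
    by (rule hamiltonian_measurable) auto
  show ?thesis unfolding energy_def case_prod_beta
    by (intro borel_measurable_times borel_measurable_sum borel_measurable_diff borel_measurable_const 1 2) auto
qed

lemma partition_fun_measurable: "partition_fun m \<in> borel_measurable (disorder N)"
proof -
  interpret R: prob_space "PiM {..<n} (\<lambda>_. \<mu>)" by (rule prob_space_replicas)
  note [measurable] = energy_measurable[of m] sets_replica_band[of m n \<rho> \<delta>]
  have "(\<lambda>(x, \<sigma>). indicator (replica_band N m n \<rho> \<delta>) \<sigma> * ennreal (exp (energy m x \<sigma>))) \<in> borel_measurable (disorder N \<Otimes>\<^sub>M PiM {..<n} (\<lambda>_. \<mu>))"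
    by measurable
  from R.borel_measurable_nn_integral[OF this]
  show ?thesis unfolding partition_fun_def partition_nn_def energy_def .
qed

lemma free_energy_measurable: "free_energy m \<in> borel_measurable (disorder N)"
proof -
  note [measurable] = partition_fun_measurable[of m]
  have "(\<lambda>x. 1 / (real N * real n) * ln (enn2real (partition_fun m x))) \<in> borel_measurable (disorder N)" by measurable
  then show ?thesis by (subst measurable_cong[OF free_energy_eq])
qed

lemma band_volume_finite: "band_volume m < top"
proof -
  interpret R: prob_space "PiM {..<n} (\<lambda>_. \<mu>)" by (rule prob_space_replicas)
  show ?thesis unfolding band_volume_def by (simp add: less_top[symmetric])
qed

lemma partition_fun_null: "band_volume m = 0 \<Longrightarrow> partition_fun m x = 0"
proof -
  assume "band_volume m = 0"
  then have "AE \<sigma> in PiM {..<n} (\<lambda>_. \<mu>). \<sigma> \<notin> replica_band N m n \<rho> \<delta>"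
    unfolding band_volume_def using sets_replica_band by (intro AE_not_in) (auto simp: null_sets_def)
  then have "(\<integral>\<^sup>+\<sigma>. indicator (replica_band N m n \<rho> \<delta>) \<sigma> * ennreal (exp (\<beta> * (\<Sum>i<n. hamiltonian N \<gamma> x (\<sigma> i) - hamiltonian N \<gamma> x m))) \<partial>PiM {..<n} (\<lambda>_. \<mu>)) = (\<integral>\<^sup>+\<sigma>. 0 \<partial>PiM {..<n} (\<lambda>_. \<mu>))"
    by (intro nn_integral_cong_AE) (auto elim!: eventually_mono)
  then show ?thesis by (simp add: partition_fun_def partition_nn_def)
qed

text \<open>8 V / (N n^2), where V bounds the variance of the total energy. In the normalisation by
  N n the tail at t becomes exp (- N t^2 / \<open>rate\<close>), and \<open>rate\<close> tends to 0
  when n grows and \<rho>, \<delta> vanish.\<close>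

definition rate :: real where
  "rate = 8 * \<beta>\<^sup>2 * (4 * (D1 + 1) / real n + (\<rho> + 2 * \<delta>) * D2)"

text \<open>The partition function is the band volume times a mean exponential under the uniform
  measure on the band. The logarithm of the volume is deterministic and disappears on centring, so
  it suffices that the volume is not 0.\<close>

lemma free_energy_concentration_pos:
  assumes m: "L2_set m {..<N} \<le> sqrt (real N)" and v: "band_volume m \<noteq> 0" and t: "t > 0"
  shows "integrable (disorder N) (free_energy m)"
    and "measure (disorder N) {x \<in> space (disorder N). \<bar>free_energy m x - (\<integral>x. free_energy m x \<partial>disorder N)\<bar> \<ge> t} \<le> 2 * exp (- (real N * t\<^sup>2 / rate))"
proof -
  let ?R = "PiM {..<n} (\<lambda>_. \<mu>)" and ?B = "replica_band N m n \<rho> \<delta>" and ?P = "disorder N"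
  interpret R: prob_space ?R by (rule prob_space_replicas)
  interpret P: prob_space ?P by (rule prob_space_gauss)
  note Bs[measurable] = sets_replica_band[of m n \<rho> \<delta>]
  define U where "U = uniform_measure ?R ?B"
  have B0: "emeasure ?R ?B \<noteq> 0" "emeasure ?R ?B \<noteq> \<infinity>" using v by (auto simp: band_volume_def)
  interpret U: prob_space U unfolding U_def using B0 by (intro prob_space_uniform_measure) auto
  have sU[measurable_cong]: "sets U = sets ?R" by (simp add: U_def)
  define A where "A x \<sigma> = indicator ?B \<sigma> * energy m x \<sigma>" for x \<sigma>
  define V where "V = \<beta>\<^sup>2 * replica_var N n \<rho> \<delta>"
  have Vpos: "V > 0"
  proof -
    have "4 * real n * (D1 + 1) > 0" using n_pos D1_nonneg by (intro mult_pos_pos) auto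
    moreover have "(real n)\<^sup>2 * (\<rho> + 2 * \<delta>) * D2 \<ge> 0" using D2_nonneg \<rho>_pos \<delta>_pos by (intro mult_nonneg_nonneg) auto
    ultimately have "4 * real n * (D1 + 1) + (real n)\<^sup>2 * (\<rho> + 2 * \<delta>) * D2 > 0" by linarith
    moreover have "real N > 0" "\<beta>\<^sup>2 > 0" using N1 \<beta>_pos by auto
    ultimately show ?thesis unfolding V_def replica_var_def by (intro mult_pos_pos)
  qed
  have Bsp: "L2_set (\<sigma> i) {..<N} \<le> sqrt (real N)" if "\<sigma> \<in> ?B" "i < n" for \<sigma> i
    using that by (auto simp: replica_band_def PiE_iff Band_def sphere_N_L2)
  have G: "gaussian_energy U (all_indices N) A (good N) V"
  proof
    note [measurable] = energy_measurable[of m]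
    have "(\<lambda>(x, \<sigma>). A x \<sigma>) \<in> borel_measurable (?P \<Otimes>\<^sub>M ?R)" unfolding A_def by measurable
    moreover have "sets (?P \<Otimes>\<^sub>M U) = sets (?P \<Otimes>\<^sub>M ?R)" by (intro sets_pair_measure_cong) (auto simp: sU)
    ultimately show "(\<lambda>(x, \<tau>). A x \<tau>) \<in> borel_measurable (?P \<Otimes>\<^sub>M U)"
      using measurable_cong_sets by blast
    show "AE x in ?P. x \<in> good N" by (rule good_AE[OF N1])
    show "A (lin_comb (all_indices N) c s x y) \<tau> = c * A x \<tau> + s * A y \<tau>" if "x \<in> good N" "y \<in> good N" for c s x y \<tau>
    proof (cases "\<tau> \<in> ?B")
      case True
      have "hamiltonian N \<gamma> (lin_comb (all_indices N) c s x y) z = c * hamiltonian N \<gamma> x z + s * hamiltonian N \<gamma> y z"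
        if "z = m \<or> (\<exists>i<n. z = \<tau> i)" for z
        using that Bsp[OF True] m \<open>x \<in> good N\<close> \<open>y \<in> good N\<close> by (intro hamiltonian_comb N1) auto
      then have "hamiltonian N \<gamma> (lin_comb (all_indices N) c s x y) m = c * hamiltonian N \<gamma> x m + s * hamiltonian N \<gamma> y m"
        "\<And>i. i < n \<Longrightarrow> hamiltonian N \<gamma> (lin_comb (all_indices N) c s x y) (\<tau> i) = c * hamiltonian N \<gamma> x (\<tau> i) + s * hamiltonian N \<gamma> y (\<tau> i)"
        by blast+
      then show ?thesis using True
        by (simp add: A_def energy_def sum_distrib_left sum.distrib[symmetric]) (intro sum.cong, auto simp: algebra_simps)
    qed (simp add: A_def)
    show "\<exists>b. \<forall>\<tau>\<in>space U. \<bar>A x \<tau>\<bar> \<le> b" if x: "x \<in> good N" for x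
    proof (intro exI ballI)
      fix \<tau>
      define h where "h = lip_const N x * sqrt (real N)"
      have h: "h \<ge> 0" using lip_const_nonneg[OF x] by (simp add: h_def)
      show "\<bar>A x \<tau>\<bar> \<le> \<beta> * (real n * (2 * h))"
      proof (cases "\<tau> \<in> ?B")
        case True
        have "\<bar>hamiltonian N \<gamma> x (\<tau> i) - hamiltonian N \<gamma> x m\<bar> \<le> 2 * h" if "i < n" for i
          using hamiltonian_abs_le[OF N1 x Bsp[OF True that]] hamiltonian_abs_le[OF N1 x m] unfolding h_def by linarith
        then have "(\<Sum>i<n. \<bar>hamiltonian N \<gamma> x (\<tau> i) - hamiltonian N \<gamma> x m\<bar>) \<le> (\<Sum>i<n. 2 * h)" by (intro sum_mono) auto
        also have "\<dots> = real n * (2 * h)" by simp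
        finally have S: "(\<Sum>i<n. \<bar>hamiltonian N \<gamma> x (\<tau> i) - hamiltonian N \<gamma> x m\<bar>) \<le> real n * (2 * h)" .
        have "\<bar>\<Sum>i<n. hamiltonian N \<gamma> x (\<tau> i) - hamiltonian N \<gamma> x m\<bar> \<le> real n * (2 * h)"
          by (rule order_trans[OF sum_abs S])
        then have "\<beta> * \<bar>\<Sum>i<n. hamiltonian N \<gamma> x (\<tau> i) - hamiltonian N \<gamma> x m\<bar> \<le> \<beta> * (real n * (2 * h))"
          using \<beta>_pos by (intro mult_left_mono) auto
        then show ?thesis using True \<beta>_pos by (simp add: A_def energy_def abs_mult)
      qed (use h \<beta>_pos in \<open>simp add: A_def\<close>)
    qed
    show "(\<integral>\<^sup>+x. ennreal (exp (l * A x \<tau>)) \<partial>?P) \<le> ennreal (exp (l\<^sup>2 * V / 2))" for l \<tau>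
    proof (cases "\<tau> \<in> ?B")
      case True
      have off: "\<bar>overlap N (\<tau> i) m - overlap N m m\<bar> \<le> \<delta>" if "i < n" for i
      proof -
        have "\<bar>overlap N (\<lambda>k. \<tau> i k - m k) m\<bar> \<le> \<delta> * L2_set m {..<N} / sqrt (real N)"
          using True that by (auto simp: replica_band_def PiE_iff Band_def)
        also have "\<dots> \<le> \<delta> * sqrt (real N) / sqrt (real N)"
          using m \<delta>_pos by (intro divide_right_mono mult_left_mono) auto
        also have "\<dots> = \<delta>" using N1 by simp
        finally show ?thesis by (simp add: overlap_diff_left)
      qed
      have "(\<integral>\<^sup>+x. ennreal (exp (l * A x \<tau>)) \<partial>?P) = (\<integral>\<^sup>+x. ennreal (exp ((l * \<beta>) * (\<Sum>i<n. hamiltonian N \<gamma> x (\<tau> i) - hamiltonian N \<gamma> x m))) \<partial>?P)"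
        using True by (simp add: A_def energy_def mult.assoc)
      also have "\<dots> \<le> ennreal (exp ((l * \<beta>)\<^sup>2 * replica_var N n \<rho> \<delta> / 2))"
      proof (rule replica_mgf[OF N1 Bsp[OF True] m _ off])
        show "\<bar>overlap N (\<tau> i) (\<tau> j) - overlap N m m\<bar> \<le> \<rho>" if "i < n" "j < n" "i \<noteq> j" for i j
          using True that by (auto simp: replica_band_def less_imp_le)
      qed (use \<rho>_pos \<delta>_pos in auto)
      finally show ?thesis by (simp add: V_def power_mult_distrib mult.assoc)
    next
      case False
      then show ?thesis using Vpos by (simp add: A_def P.emeasure_space_1)
    qed
    show "V > 0" by (rule Vpos)
  qed
  interpret G: gaussian_energy U "all_indices N" A "good N" V by (rule G)
  define v where "v = enn2real (band_volume m)"
  have v0: "v > 0" "band_volume m = ennreal v"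
    using v band_volume_finite[of m] by (auto simp: v_def enn2real_positive_iff less_top pos2 zero_less_iff_neq_zero)
  define k where "k = real N * real n"
  have k: "k > 0" using N1 n_pos by (simp add: k_def)
  have FEf: "free_energy m x = (ln v + G.log_mean x) / k" if x: "x \<in> good N" "x \<in> space ?P" for x
  proof -
    obtain b where b: "bounded_energy U (A x) b" using G.energy[OF x] by blast
    have em: "energy m x \<in> borel_measurable ?R"
      using measurable_Pair2[OF energy_measurable[of m] x(2)] by simp
    have "ennreal (exp (G.log_mean x)) = (\<integral>\<^sup>+\<sigma>. ennreal (exp (A x \<sigma>)) \<partial>U)"
      unfolding G.log_mean_eq_lme[OF b] by (rule bounded_energy.exp_lme[OF b])
    also have "\<dots> = (\<integral>\<^sup>+\<sigma>. ennreal (exp (A x \<sigma>)) * indicator ?B \<sigma> \<partial>?R) / band_volume m"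
      unfolding U_def band_volume_def
    proof (rule nn_integral_uniform_measure)
      note [measurable] = em
      show "(\<lambda>\<sigma>. ennreal (exp (A x \<sigma>))) \<in> borel_measurable ?R" unfolding A_def by measurable
    qed (rule Bs)
    also have "(\<integral>\<^sup>+\<sigma>. ennreal (exp (A x \<sigma>)) * indicator ?B \<sigma> \<partial>?R) = partition_fun m x"
      unfolding partition_fun_def partition_nn_def by (intro nn_integral_cong) (auto simp: A_def energy_def split: split_indicator)
    finally have "partition_fun m x / ennreal v = ennreal (exp (G.log_mean x))" using v0 by simp
    moreover have "partition_fun m x = ennreal v * (partition_fun m x / ennreal v)"
      using v0(1) by (simp add: ennreal_times_divide mult_divide_eq_ennreal mult.commute[of "ennreal v"])
    ultimately have "partition_fun m x = ennreal v * ennreal (exp (G.log_mean x))" by simp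
    then have "enn2real (partition_fun m x) = v * exp (G.log_mean x)" using v0 by (simp add: ennreal_mult''[symmetric])
    then have "ln (enn2real (partition_fun m x)) = ln v + G.log_mean x" using v0 by (simp add: ln_mult)
    then show ?thesis unfolding free_energy_eq[OF x(2)] by (simp add: k_def)
  qed
  have AEeq: "AE x in ?P. free_energy m x = (ln v + G.log_mean x) / k"
    using AE_conjI[OF good_AE[OF N1] AE_space] by eventually_elim (rule FEf, auto)
  have int: "integrable ?P (\<lambda>x. (ln v + G.log_mean x) / k)" using G.log_mean_integrable by auto
  show "integrable ?P (free_energy m)"
    by (rule integrable_cong_AE[THEN iffD2, OF _ _ AEeq int]) (use free_energy_measurable G.log_mean_meas in measurable)
  have mean: "(\<integral>x. free_energy m x \<partial>?P) = (ln v + P.expectation G.log_mean) / k"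
  proof -
    have "(\<integral>x. free_energy m x \<partial>?P) = (\<integral>x. (ln v + G.log_mean x) / k \<partial>?P)"
      by (rule integral_cong_AE[OF _ _ AEeq]) (use free_energy_measurable G.log_mean_meas in measurable)
    also have "\<dots> = (ln v + P.expectation G.log_mean) / k" using G.log_mean_integrable by (simp add: P.prob_space)
    finally show ?thesis .
  qed
  have "measure ?P {x \<in> space ?P. \<bar>free_energy m x - (\<integral>x. free_energy m x \<partial>?P)\<bar> \<ge> t} = measure ?P {x \<in> space ?P. \<bar>G.log_mean x - P.expectation G.log_mean\<bar> \<ge> t * k}"
  proof (rule P.finite_measure_eq_AE)
    show "AE x in ?P. x \<in> {x \<in> space ?P. \<bar>free_energy m x - (\<integral>x. free_energy m x \<partial>?P)\<bar> \<ge> t} \<longleftrightarrow> x \<in> {x \<in> space ?P. \<bar>G.log_mean x - P.expectation G.log_mean\<bar> \<ge> t * k}"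
      using AEeq
    proof eventually_elim
      case (elim x)
      have "free_energy m x - (\<integral>x. free_energy m x \<partial>?P) = (G.log_mean x - P.expectation G.log_mean) / k"
        unfolding elim mean by (simp add: diff_divide_distrib[symmetric])
      then show ?case using k by (simp add: pos_le_divide_eq)
    qed
    note [measurable] = free_energy_measurable[of m] G.log_mean_meas
    show "{x \<in> space ?P. \<bar>free_energy m x - (\<integral>x. free_energy m x \<partial>?P)\<bar> \<ge> t} \<in> sets ?P" by measurable
    show "{x \<in> space ?P. \<bar>G.log_mean x - P.expectation G.log_mean\<bar> \<ge> t * k} \<in> sets ?P" by measurable
  qed
  also have "\<dots> \<le> 2 * exp (- (t * k)\<^sup>2 / (8 * V))" using t k by (intro G.concentration) simp
  also have "(t * k)\<^sup>2 / (8 * V) = real N * t\<^sup>2 / rate"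
  proof -
    have V2: "8 * V = real N * (real n)\<^sup>2 * rate"
      using n_pos by (simp add: V_def replica_var_def rate_def power2_eq_square field_simps)
    have "real N * (real n)\<^sup>2 > 0" using N1 n_pos by simp
    moreover have "(t * k)\<^sup>2 = real N * (real n)\<^sup>2 * (real N * t\<^sup>2)" by (simp add: k_def power2_eq_square)
    ultimately show ?thesis unfolding V2 using n_pos by auto
  qed
  then have "- (t * k)\<^sup>2 / (8 * V) = - (real N * t\<^sup>2 / rate)" by simp
  finally show "measure ?P {x \<in> space ?P. \<bar>free_energy m x - (\<integral>x. free_energy m x \<partial>?P)\<bar> \<ge> t} \<le> 2 * exp (- (real N * t\<^sup>2 / rate))" .
qed

end

section \<open>Comparison and continuity in the centre\<close>

text \<open>The mutual bounds force a and b to be 0 together and infinite together; in these cases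
  \<open>enn2real\<close> and \<open>ln 0 = 0\<close> give both the same value. Otherwise both
  inequalities can be passed to logarithms.\<close>

lemma ln_enn2real_close:
  fixes a b :: ennreal
  assumes ab: "a \<le> ennreal K * b" and ba: "b \<le> ennreal K * a" and K: "K \<ge> 1"
  shows "\<bar>ln (enn2real a) - ln (enn2real b)\<bar> \<le> ln K"
proof (cases "a = 0 \<or> a = top \<or> b = 0 \<or> b = top")
  case True
  then have "(a = 0 \<and> b = 0) \<or> (a = top \<and> b = top)"
    using ab ba K by (auto simp: top_unique ennreal_mult_eq_top_iff)
  then show ?thesis using K by auto
next
  case False
  then obtain u v where uv: "a = ennreal u" "b = ennreal v" "u > 0" "v > 0"
    by (cases a; cases b) (auto simp: less_le)
  have "u \<le> K * v" "v \<le> K * u"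
    using ab ba uv K by (auto simp: ennreal_mult''[symmetric])
  then have "ln u \<le> ln (K * v)" "ln v \<le> ln (K * u)"
    using uv K by (simp_all del: ln_mult)
  then have "ln u \<le> ln K + ln v" "ln v \<le> ln K + ln u"
    using uv K by (simp_all add: ln_mult)
  then show ?thesis using uv by (simp add: abs_le_iff)
qed

context model begin

lemma free_energy_null: "band_volume m = 0 \<Longrightarrow> x \<in> space (disorder N) \<Longrightarrow> free_energy m x = 0"
  by (simp add: free_energy_eq partition_fun_null)

lemma free_energy_concentration:
  assumes m: "L2_set m {..<N} \<le> sqrt (real N)" and t: "t > 0"
  shows "integrable (disorder N) (free_energy m)"
    and "measure (disorder N) {x \<in> space (disorder N). \<bar>free_energy m x - (\<integral>x. free_energy m x \<partial>disorder N)\<bar> \<ge> t} \<le> 2 * exp (- (real N * t\<^sup>2 / rate))"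
proof -
  have "integrable (disorder N) (free_energy m) \<and>
    measure (disorder N) {x \<in> space (disorder N). \<bar>free_energy m x - (\<integral>x. free_energy m x \<partial>disorder N)\<bar> \<ge> t} \<le> 2 * exp (- (real N * t\<^sup>2 / rate))"
  proof (cases "band_volume m = 0")
    case True
    have i: "integrable (disorder N) (free_energy m)"
      by (subst Bochner_Integration.integrable_cong[OF refl free_energy_null[OF True]]) auto
    have 0: "(\<integral>x. free_energy m x \<partial>disorder N) = (\<integral>x. 0 \<partial>disorder N)"
      by (rule Bochner_Integration.integral_cong[OF refl free_energy_null[OF True]])
    have e: "{x \<in> space (disorder N). \<bar>free_energy m x - (\<integral>x. free_energy m x \<partial>disorder N)\<bar> \<ge> t} = {}"
      using t by (auto simp: 0 free_energy_null[OF True])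
    show ?thesis unfolding e using i by simp
  qed (use free_energy_concentration_pos[OF m _ t] in auto)
  then show "integrable (disorder N) (free_energy m)"
    and "measure (disorder N) {x \<in> space (disorder N). \<bar>free_energy m x - (\<integral>x. free_energy m x \<partial>disorder N)\<bar> \<ge> t} \<le> 2 * exp (- (real N * t\<^sup>2 / rate))"
    by auto
qed

text \<open>The logarithm of \<open>partition_compare\<close> in both directions, divided by N n.
  The density factor contributes \<alpha> + 1 / N, by ln (1 + \<alpha>) \<le> \<alpha> and - ln (1 -
  \<alpha>) \<le> 1, and the choices of axes contribute (n + 1) / n times ln N / N.\<close>

lemma free_energy_compare:
  assumes g: "g \<in> good N" and \<alpha>: "0 < \<alpha>" "\<alpha> \<le> 1/2" and u: "u \<in> sphere_N N" "u' \<in> sphere_N N"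
    and s: "0 < s" "s \<le> 1" "0 < s'" "s' \<le> 1" "\<bar>s - s'\<bar> \<le> r"
    and x: "0 < x" "8 * x + 2 * r \<le> \<delta> * \<alpha>\<^sup>2 / 2" "8 * x + 2 * r \<le> \<rho> * \<alpha>\<^sup>2 / 2" "x \<le> 1 / 4"
    and big: "(real n + 1) * (1 + 1 / x\<^sup>2) \<le> real N"
  shows "\<bar>free_energy (scaled N s u) g - free_energy (scaled N s' u') g\<bar>
    \<le> \<beta> * (lip_const N g / sqrt (real N)) * (8 * \<alpha> + r + 2 * L2_set (\<lambda>i. u i - u' i) {..<N} / sqrt (real N))
      + \<alpha> + 1 / real N + 2 * ln (real N) / real N"
proof -
  have gs: "g \<in> space (disorder N)" using g by (simp add: good_def)
  define L where "L = lip_const N g"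
  define d where "d = L2_set (\<lambda>i. u i - u' i) {..<N}"
  have L: "L \<ge> 0" using lip_const_nonneg[OF g] by (simp add: L_def)
  have d: "d \<ge> 0" by (simp add: d_def)
  have r: "r \<ge> 0" using s by linarith
  define E where "E = \<beta> * (real n * (L * (sqrt (real N) * (8 * \<alpha> + r) + 2 * d)))"
  have E: "E \<ge> 0" unfolding E_def using \<beta>_pos L d r \<alpha> by (intro mult_nonneg_nonneg add_nonneg_nonneg) auto
  define Q where "Q = (1 + \<alpha>) ^ N / (1 - \<alpha>)"
  have Q: "Q \<ge> 1"
  proof -
    have "1 - \<alpha> \<le> (1 + \<alpha>) ^ N" using one_le_power[of "1 + \<alpha>" N] \<alpha> by linarith
    then show ?thesis using \<alpha> by (simp add: Q_def)
  qed
  define K where "K = exp E * Q ^ n * real N ^ (n + 1)"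
  have K: "K \<ge> 1"
  proof -
    have "1 \<le> exp E" "1 \<le> Q ^ n" "1 \<le> real N ^ (n + 1)" using E one_le_power[OF Q] N1 by (auto intro: one_le_power simp del: power_Suc)
    then have "1 * 1 * 1 \<le> exp E * Q ^ n * real N ^ (n + 1)" by (intro mult_mono) auto
    then show ?thesis by (simp add: K_def)
  qed
  have "\<bar>s' - s\<bar> \<le> r" using s by linarith
  have b: "\<beta> \<ge> 0" using \<beta>_pos by simp
  have lip: "lipschitz_N N L (hamiltonian N \<gamma> g)" unfolding L_def by (rule hamiltonian_lipschitz[OF N1 g])
  have d': "L2_set (\<lambda>i. u' i - u i) {..<N} = d" unfolding d_def by (rule L2_set_minus_commute)
  note pc = partition_compare[OF hamiltonian_vec_measurable[OF gs] b lip L \<alpha>]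
  have "partition_fun (scaled N s u) g \<le> ennreal K * partition_fun (scaled N s' u') g"
    using pc[OF u s x big] unfolding partition_fun_def K_def E_def Q_def d_def .
  moreover have "partition_fun (scaled N s' u') g \<le> ennreal K * partition_fun (scaled N s u) g"
    using pc[OF u(2,1) s(3,4,1,2) \<open>\<bar>s' - s\<bar> \<le> r\<close> x big] unfolding partition_fun_def K_def E_def Q_def d' .
  ultimately have 1: "\<bar>ln (enn2real (partition_fun (scaled N s u) g)) - ln (enn2real (partition_fun (scaled N s' u') g))\<bar> \<le> ln K"
    using K by (rule ln_enn2real_close)
  have N0: "real N > 0" "real n \<ge> 1" using N1 n_pos by auto
  define k where "k = real N * real n"
  have k: "k > 0" using N0 by (simp add: k_def)
  have lnQ: "ln Q \<le> real N * \<alpha> + 1"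
  proof -
    have "ln Q = real N * ln (1 + \<alpha>) - ln (1 - \<alpha>)" using \<alpha> by (simp add: Q_def ln_div ln_realpow)
    moreover have "real N * ln (1 + \<alpha>) \<le> real N * \<alpha>" using \<alpha> by (intro mult_left_mono ln_add_one_self_le_self) auto
    moreover have "- ln (1 - \<alpha>) \<le> 1"
    proof -
      have "ln (1 / (1 - \<alpha>)) \<le> 1 / (1 - \<alpha>) - 1" using \<alpha> by (intro ln_le_minus_one) auto
      moreover have "1 / (1 - \<alpha>) \<le> 2" using \<alpha> by (simp add: field_simps)
      ultimately show ?thesis using \<alpha> by (simp add: ln_div)
    qed
    ultimately show ?thesis by linarith
  qed
  have lnN: "ln (real N) \<ge> 0" using N1 by simp
  have "ln K = E + real n * ln Q + (real n + 1) * ln (real N)"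
    using Q N0 by (simp add: K_def ln_mult ln_realpow algebra_simps)
  also have "\<dots> \<le> E + real n * (real N * \<alpha> + 1) + (2 * real n) * ln (real N)"
    using lnQ lnN N0 by (intro add_mono mult_left_mono mult_right_mono) auto
  also have "\<dots> = k * (\<beta> * (L * sqrt (real N) / real N) * (8 * \<alpha> + r) + \<beta> * (L / real N) * (2 * d) + \<alpha> + 1 / real N + 2 * ln (real N) / real N)"
    using N0 by (simp add: E_def k_def field_simps)
  also have "L * sqrt (real N) / real N = L / sqrt (real N)"
    using N0 by (simp add: divide_simps)
  also have "L / real N = L / sqrt (real N) / sqrt (real N)" using N0 by simp
  also have "\<beta> * (L / sqrt (real N)) * (8 * \<alpha> + r) + \<beta> * (L / sqrt (real N) / sqrt (real N)) * (2 * d)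
      = \<beta> * (L / sqrt (real N)) * (8 * \<alpha> + r + 2 * d / sqrt (real N))" by (simp add: distrib_left)
  finally have 2: "ln K \<le> k * (\<beta> * (L / sqrt (real N)) * (8 * \<alpha> + r + 2 * d / sqrt (real N)) + \<alpha> + 1 / real N + 2 * ln (real N) / real N)" .
  have "\<bar>free_energy (scaled N s u) g - free_energy (scaled N s' u') g\<bar> = \<bar>ln (enn2real (partition_fun (scaled N s u) g)) - ln (enn2real (partition_fun (scaled N s' u') g))\<bar> / k"
    unfolding free_energy_eq[OF gs] using k by (simp add: k_def[symmetric] diff_divide_distrib[symmetric])
  also have "\<dots> \<le> \<beta> * (L / sqrt (real N)) * (8 * \<alpha> + r + 2 * d / sqrt (real N)) + \<alpha> + 1 / real N + 2 * ln (real N) / real N"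
    using 1 2 k by (simp add: pos_divide_le_eq mult.commute)
  finally show ?thesis by (simp add: L_def d_def)
qed

text \<open>With all replicas but the i-th fixed, the condition describes a slice in
  \<open>\<sigma> i\<close>, null by \<open>overlap_slice_null\<close>.\<close>

lemma overlap_pair_null:
  assumes ij: "i < n" "j < n" "i \<noteq> j"
  shows "AE \<sigma> in PiM {..<n} (\<lambda>_. \<mu>). overlap N (\<sigma> i) (\<sigma> j) \<noteq> t"
proof -
  interpret product_sigma_finite "\<lambda>_::nat. \<mu>"
    by standard
  let ?R = "PiM {..<n} (\<lambda>_. \<mu>)"
  define I where "I = {..<n} - {i}"
  have I: "{..<n} = insert i I" "finite I" "i \<notin> I" "j \<in> I" using ij by (auto simp: I_def)
  have meas: "{\<sigma> \<in> space ?R. overlap N (\<sigma> i) (\<sigma> j) = t} \<in> sets ?R"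
  proof -
    have "(\<lambda>\<sigma>. overlap N (\<sigma> i) (\<sigma> j)) \<in> borel_measurable ?R"
      unfolding overlap_def using ij by (intro borel_measurable_divide borel_measurable_sum borel_measurable_times measurable_PiM_haar) auto
    then show ?thesis by measurable
  qed
  have "emeasure ?R {\<sigma> \<in> space ?R. overlap N (\<sigma> i) (\<sigma> j) = t} = (\<integral>\<^sup>+\<sigma>. indicator {\<sigma> \<in> space ?R. overlap N (\<sigma> i) (\<sigma> j) = t} \<sigma> \<partial>PiM (insert i I) (\<lambda>_. \<mu>))"
    using meas by (simp add: I(1)[symmetric])
  also have "\<dots> = (\<integral>\<^sup>+ x. (\<integral>\<^sup>+ y. indicator {\<sigma> \<in> space ?R. overlap N (\<sigma> i) (\<sigma> j) = t} (x(i := y)) \<partial>\<mu>) \<partial>PiM I (\<lambda>_. \<mu>))"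
    using meas by (intro product_nn_integral_insert I) (simp add: I(1)[symmetric])
  also have "\<dots> = (\<integral>\<^sup>+ x. 0 \<partial>PiM I (\<lambda>_. \<mu>))"
  proof (rule nn_integral_cong)
    fix x assume x: "x \<in> space (PiM I (\<lambda>_. \<mu>))"
    then have "x j \<in> sphere_N N" using I space_haar by (auto simp: space_PiM)
    then have "L2_set (x j) {..<N} \<noteq> 0" using sphere_N_L2[of "x j" N] N1 by auto
    from overlap_slice_null[OF this, of t]
    have "(\<integral>\<^sup>+ y. indicator {\<sigma> \<in> space ?R. overlap N (\<sigma> i) (\<sigma> j) = t} (x(i := y)) \<partial>\<mu>) = (\<integral>\<^sup>+ y. 0 \<partial>\<mu>)"
      using ij by (intro nn_integral_cong_AE) (auto elim!: eventually_mono split: split_indicator)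
    then show "(\<integral>\<^sup>+ y. indicator {\<sigma> \<in> space ?R. overlap N (\<sigma> i) (\<sigma> j) = t} (x(i := y)) \<partial>\<mu>) = 0" by simp
  qed
  finally have "emeasure ?R {\<sigma> \<in> space ?R. overlap N (\<sigma> i) (\<sigma> j) = t} = 0" by simp
  then show ?thesis using meas by (intro AE_I[of _ _ "{\<sigma> \<in> space ?R. overlap N (\<sigma> i) (\<sigma> j) = t}"]) auto
qed

text \<open>Dominated convergence. The indicator of the band converges unless some constraint holds
  with equality, a null event by the slice lemmas; for the band condition these require m \<noteq>
  0. Positive volume makes the limiting integral positive, so ln is continuous there.\<close>

lemma free_energy_continuous:
  assumes g: "g \<in> good N"
    and mk: "\<And>k. mk k \<in> {..<N} \<rightarrow>\<^sub>E UNIV" "\<And>k. L2_set (mk k) {..<N} \<le> sqrt (real N)"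
    and m: "m \<in> {..<N} \<rightarrow>\<^sub>E UNIV" "L2_set m {..<N} \<le> sqrt (real N)" "L2_set m {..<N} \<noteq> 0" "band_volume m \<noteq> 0"
    and lim: "\<And>i. i < N \<Longrightarrow> (\<lambda>k. mk k i) \<longlonglongrightarrow> m i"
  shows "(\<lambda>k. free_energy (mk k) g) \<longlonglongrightarrow> free_energy m g"
proof -
  let ?R = "PiM {..<n} (\<lambda>_. \<mu>)"
  interpret R: prob_space ?R by (rule prob_space_replicas)
  have gs: "g \<in> space (disorder N)" using g by (simp add: good_def)
  define h where "h = hamiltonian N \<gamma> g"
  define b where "b = lip_const N g * sqrt (real N)"
  have hb: "\<bar>h y\<bar> \<le> b" if "L2_set y {..<N} \<le> sqrt (real N)" for y
    using hamiltonian_abs_le[OF N1 g that] by (simp add: h_def b_def)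
  have hmeas: "h \<in> borel_measurable (vec_borel N)" unfolding h_def by (rule hamiltonian_vec_measurable[OF gs])
  have limL2: "(\<lambda>k. L2_set (mk k) {..<N}) \<longlonglongrightarrow> L2_set m {..<N}"
    unfolding L2_set_def by (intro tendsto_intros lim) auto
  have limd: "(\<lambda>k. L2_set (\<lambda>i. mk k i - m i) {..<N}) \<longlonglongrightarrow> 0"
  proof -
    have "(\<lambda>k. L2_set (\<lambda>i. mk k i - m i) {..<N}) \<longlonglongrightarrow> L2_set (\<lambda>i. m i - m i) {..<N}"
      unfolding L2_set_def by (intro tendsto_intros lim) auto
    then show ?thesis by (simp add: L2_set_def)
  qed
  have limh: "(\<lambda>k. h (mk k)) \<longlonglongrightarrow> h m"
  proof (rule LIM_zero_cancel, rule tendsto_0_le[OF limd, where K = "lip_const N g"], rule always_eventually, rule allI)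
    fix k
    show "norm (h (mk k) - h m) \<le> norm (L2_set (\<lambda>i. mk k i - m i) {..<N}) * lip_const N g"
      using lipschitz_ND[OF hamiltonian_lipschitz[OF N1 g] mk(1) m(1) mk(2) m(2), of k] by (simp add: h_def mult.commute)
  qed
  have limo: "(\<lambda>k. overlap N y (mk k)) \<longlonglongrightarrow> overlap N y m" for y
    unfolding overlap_def using N1 by (intro tendsto_intros lim) auto
  have limoo: "(\<lambda>k. overlap N (mk k) (mk k)) \<longlonglongrightarrow> overlap N m m"
    unfolding overlap_def using N1 by (intro tendsto_intros lim) auto
  have limdd: "(\<lambda>k. overlap N (\<lambda>i. y i - mk k i) (mk k)) \<longlonglongrightarrow> overlap N (\<lambda>i. y i - m i) m" for y
    unfolding overlap_def using N1 by (intro tendsto_intros lim) auto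
  define bd where "bd = \<delta> * L2_set m {..<N} / sqrt (real N)"
  have limbd: "(\<lambda>k. \<delta> * L2_set (mk k) {..<N} / sqrt (real N)) \<longlonglongrightarrow> bd"
    unfolding bd_def using N1 by (intro tendsto_intros limL2) auto
  define f where "f m \<sigma> = indicator (replica_band N m n \<rho> \<delta>) \<sigma> *\<^sub>R exp (\<beta> * (\<Sum>i<n. h (\<sigma> i) - h m))" for m \<sigma>
  have fmeas: "f m \<in> borel_measurable ?R" for m
    unfolding f_def by (intro borel_measurable_scaleR borel_measurable_indicator sets_replica_band partition_integrand_measurable hmeas)
  have Bsp: "L2_set (\<sigma> i) {..<N} \<le> sqrt (real N)" if "\<sigma> \<in> space ?R" "i < n" for \<sigma> i
    using that space_haar by (auto simp: space_PiM PiE_iff sphere_N_L2)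
  have eb: "\<bar>\<Sum>i<n. h (\<sigma> i) - h y\<bar> \<le> real n * (2 * b)" if "\<sigma> \<in> space ?R" "L2_set y {..<N} \<le> sqrt (real N)" for \<sigma> y
  proof -
    have "\<bar>h (\<sigma> i) - h y\<bar> \<le> 2 * b" if i: "i < n" for i
      using hb[OF Bsp[OF \<open>\<sigma> \<in> space ?R\<close> i]] hb[OF \<open>L2_set y {..<N} \<le> sqrt (real N)\<close>] by linarith
    then have "(\<Sum>i<n. \<bar>h (\<sigma> i) - h y\<bar>) \<le> (\<Sum>i<n. 2 * b)" by (intro sum_mono) auto
    also have "\<dots> = real n * (2 * b)" by simp
    finally show ?thesis by (rule order_trans[OF sum_abs])
  qed
  have ebb: "\<bar>\<beta> * (\<Sum>i<n. h (\<sigma> i) - h y)\<bar> \<le> \<beta> * (real n * (2 * b))" if "\<sigma> \<in> space ?R" "L2_set y {..<N} \<le> sqrt (real N)" for \<sigma> y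
    using mult_left_mono[OF eb[OF that], of \<beta>] \<beta>_pos by (simp add: abs_mult)
  have fb: "norm (f y \<sigma>) \<le> exp (\<beta> * (real n * (2 * b)))" if "\<sigma> \<in> space ?R" "L2_set y {..<N} \<le> sqrt (real N)" for y \<sigma>
    using ebb[OF that] by (auto simp: f_def abs_le_iff split: split_indicator)
  have A1: "AE \<sigma> in ?R. \<forall>i\<in>{..<n}. overlap N (\<sigma> i) m \<noteq> overlap N m m + bd \<and> overlap N (\<sigma> i) m \<noteq> overlap N m m - bd"
  proof (rule AE_finite_allI)
    fix i assume i: "i \<in> {..<n}"
    have "AE y in \<mu>. overlap N y m \<noteq> overlap N m m + bd \<and> overlap N y m \<noteq> overlap N m m - bd"
      by (intro AE_conjI overlap_slice_null[OF m(3)])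
    then show "AE \<sigma> in ?R. overlap N (\<sigma> i) m \<noteq> overlap N m m + bd \<and> overlap N (\<sigma> i) m \<noteq> overlap N m m - bd"
      by (intro AE_PiM_component[OF prob_space_axioms i])
  qed simp
  have A2: "AE \<sigma> in ?R. \<forall>i\<in>{..<n}. \<forall>j\<in>{..<n}. i \<noteq> j \<longrightarrow> overlap N (\<sigma> i) (\<sigma> j) \<noteq> overlap N m m + \<rho> \<and> overlap N (\<sigma> i) (\<sigma> j) \<noteq> overlap N m m - \<rho>"
  proof (intro AE_finite_allI finite_lessThan AE_impI AE_conjI)
    fix i j assume "i \<in> {..<n}" "j \<in> {..<n}" "i \<noteq> j"
    then show "AE \<sigma> in ?R. overlap N (\<sigma> i) (\<sigma> j) \<noteq> overlap N m m + \<rho>" "AE \<sigma> in ?R. overlap N (\<sigma> i) (\<sigma> j) \<noteq> overlap N m m - \<rho>"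
      by (auto intro: overlap_pair_null)
  qed
  have pt: "AE \<sigma> in ?R. (\<lambda>k. f (mk k) \<sigma>) \<longlonglongrightarrow> f m \<sigma>"
    using A1 A2 AE_space
  proof eventually_elim
    case (elim \<sigma>)
    have sp: "\<sigma> \<in> {..<n} \<rightarrow>\<^sub>E sphere_N N" using elim(3) space_haar by (auto simp: space_PiM)
    have iff: "\<sigma> \<in> replica_band N y n \<rho> \<delta> \<longleftrightarrow> (\<forall>i\<in>{..<n}. \<bar>overlap N (\<lambda>k. \<sigma> i k - y k) y\<bar> \<le> \<delta> * L2_set y {..<N} / sqrt (real N)) \<and>
       (\<forall>i\<in>{..<n}. \<forall>j\<in>{..<n}. i \<noteq> j \<longrightarrow> \<bar>overlap N (\<sigma> i) (\<sigma> j) - overlap N y y\<bar> < \<rho>)" for y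
      using sp by (auto simp: replica_band_def Band_def PiE_iff)
    have odd: "overlap N (\<lambda>k. y k - m k) m = overlap N y m - overlap N m m" for y
      by (simp add: overlap_def left_diff_distrib sum_subtractf diff_divide_distrib)
    have e1: "eventually (\<lambda>k. \<forall>i\<in>{..<n}. (\<bar>overlap N (\<lambda>l. \<sigma> i l - mk k l) (mk k)\<bar> \<le> \<delta> * L2_set (mk k) {..<N} / sqrt (real N)) \<longleftrightarrow> (\<bar>overlap N (\<lambda>k. \<sigma> i k - m k) m\<bar> \<le> bd)) sequentially"
    proof (rule eventually_ball_finite[OF finite_lessThan], rule ballI)
      fix i assume i: "i \<in> {..<n}"
      let ?l = "\<lambda>k. \<bar>overlap N (\<lambda>l. \<sigma> i l - mk k l) (mk k)\<bar> - \<delta> * L2_set (mk k) {..<N} / sqrt (real N)"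
      have l: "?l \<longlonglongrightarrow> \<bar>overlap N (\<lambda>k. \<sigma> i k - m k) m\<bar> - bd" by (intro tendsto_intros limdd limbd)
      have "overlap N (\<sigma> i) m \<noteq> overlap N m m + bd" "overlap N (\<sigma> i) m \<noteq> overlap N m m - bd" using elim(1) i by auto
      then have "\<bar>overlap N (\<lambda>k. \<sigma> i k - m k) m\<bar> - bd \<noteq> 0" unfolding odd by arith
      then consider "\<bar>overlap N (\<lambda>k. \<sigma> i k - m k) m\<bar> - bd < 0" | "\<bar>overlap N (\<lambda>k. \<sigma> i k - m k) m\<bar> - bd > 0" by linarith
      then show "eventually (\<lambda>k. (\<bar>overlap N (\<lambda>l. \<sigma> i l - mk k l) (mk k)\<bar> \<le> \<delta> * L2_set (mk k) {..<N} / sqrt (real N)) \<longleftrightarrow> (\<bar>overlap N (\<lambda>k. \<sigma> i k - m k) m\<bar> \<le> bd)) sequentially"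
        by cases (use order_tendstoD[OF l, of 0] in \<open>auto elim!: eventually_mono\<close>)
    qed
    have e2: "eventually (\<lambda>k. \<forall>i\<in>{..<n}. \<forall>j\<in>{..<n}. i \<noteq> j \<longrightarrow> ((\<bar>overlap N (\<sigma> i) (\<sigma> j) - overlap N (mk k) (mk k)\<bar> < \<rho>) \<longleftrightarrow> (\<bar>overlap N (\<sigma> i) (\<sigma> j) - overlap N m m\<bar> < \<rho>))) sequentially"
    proof (rule eventually_ball_finite[OF finite_lessThan], rule ballI, rule eventually_ball_finite[OF finite_lessThan], rule ballI)
      fix i j assume ij: "i \<in> {..<n}" "j \<in> {..<n}"
      show "eventually (\<lambda>k. i \<noteq> j \<longrightarrow> ((\<bar>overlap N (\<sigma> i) (\<sigma> j) - overlap N (mk k) (mk k)\<bar> < \<rho>) \<longleftrightarrow> (\<bar>overlap N (\<sigma> i) (\<sigma> j) - overlap N m m\<bar> < \<rho>))) sequentially"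
      proof (cases "i = j")
        case False
        let ?l = "\<lambda>k. \<bar>overlap N (\<sigma> i) (\<sigma> j) - overlap N (mk k) (mk k)\<bar> - \<rho>"
        have l: "?l \<longlonglongrightarrow> \<bar>overlap N (\<sigma> i) (\<sigma> j) - overlap N m m\<bar> - \<rho>" by (intro tendsto_intros limoo)
        have "overlap N (\<sigma> i) (\<sigma> j) \<noteq> overlap N m m + \<rho>" "overlap N (\<sigma> i) (\<sigma> j) \<noteq> overlap N m m - \<rho>" using elim(2) ij False by auto
        then have "\<bar>overlap N (\<sigma> i) (\<sigma> j) - overlap N m m\<bar> - \<rho> \<noteq> 0" by arith
        then consider "\<bar>overlap N (\<sigma> i) (\<sigma> j) - overlap N m m\<bar> - \<rho> < 0" | "\<bar>overlap N (\<sigma> i) (\<sigma> j) - overlap N m m\<bar> - \<rho> > 0" by linarith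
        then show ?thesis
          by cases (use order_tendstoD[OF l, of 0] in \<open>auto elim!: eventually_mono\<close>)
      qed simp
    qed
    have "eventually (\<lambda>k. indicator (replica_band N (mk k) n \<rho> \<delta>) \<sigma> = (indicator (replica_band N m n \<rho> \<delta>) \<sigma> :: real)) sequentially"
      using e1 e2
    proof eventually_elim
      case (elim k)
      have "\<sigma> \<in> replica_band N (mk k) n \<rho> \<delta> \<longleftrightarrow> \<sigma> \<in> replica_band N m n \<rho> \<delta>"
        unfolding iff bd_def[symmetric] using elim by blast
      then show ?case by (simp split: split_indicator)
    qed
    then have i: "(\<lambda>k. indicator (replica_band N (mk k) n \<rho> \<delta>) \<sigma> :: real) \<longlonglongrightarrow> indicator (replica_band N m n \<rho> \<delta>) \<sigma>"
      by (rule tendsto_eventually)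
    show ?case unfolding f_def by (intro tendsto_intros i limh)
  qed
  have I: "(\<lambda>k. LINT \<sigma>|?R. f (mk k) \<sigma>) \<longlonglongrightarrow> (LINT \<sigma>|?R. f m \<sigma>)"
    by (rule integral_dominated_convergence[OF fmeas fmeas _ pt, of "\<lambda>_. exp (\<beta> * (real n * (2 * b)))"])
      (use fb mk(2) in auto)
  have pos: "(LINT \<sigma>|?R. f m \<sigma>) > 0"
  proof -
    have "0 < measure ?R (replica_band N m n \<rho> \<delta>)"
      using m(4) by (simp add: band_volume_def R.emeasure_eq_measure zero_less_measure_iff)
    then have "0 < measure ?R (replica_band N m n \<rho> \<delta>) * exp (- (\<beta> * (real n * (2 * b))))" by simp
    also have "\<dots> = (LINT \<sigma>|?R. indicator (replica_band N m n \<rho> \<delta>) \<sigma> * exp (- (\<beta> * (real n * (2 * b)))))"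
      using sets_replica_band by simp
    also have "\<dots> \<le> (LINT \<sigma>|?R. f m \<sigma>)"
    proof (rule integral_mono)
      show "integrable ?R (f m)"
        by (rule R.integrable_const_bound[OF _ fmeas, of _ "exp (\<beta> * (real n * (2 * b)))"]) (use fb m(2) in auto)
      show "integrable ?R (\<lambda>\<sigma>. indicator (replica_band N m n \<rho> \<delta>) \<sigma> * exp (- (\<beta> * (real n * (2 * b)))))"
        by (intro integrable_mult_left integrable_real_indicator sets_replica_band) (simp add: R.emeasure_eq_measure)
      show "indicator (replica_band N m n \<rho> \<delta>) \<sigma> * exp (- (\<beta> * (real n * (2 * b)))) \<le> f m \<sigma>" if "\<sigma> \<in> space ?R" for \<sigma>
        using ebb[OF that m(2)] by (auto simp: f_def abs_le_iff split: split_indicator)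
    qed
    finally show ?thesis .
  qed
  have FEf: "free_energy y g = 1 / (real N * real n) * ln (LINT \<sigma>|?R. f y \<sigma>)" for y
    by (simp add: free_energy_def multi_free_energy_def set_lebesgue_integral_def f_def h_def)
  show ?thesis unfolding FEf using pos by (intro tendsto_intros I) auto
qed

end

section \<open>Uniformity over the ball\<close>

lemma same_floor_close:
  fixes a b r :: real
  assumes "r > 0" "\<lfloor>a / r\<rfloor> = \<lfloor>b / r\<rfloor>" shows "\<bar>a - b\<bar> \<le> r"
proof -
  have "\<bar>a / r - b / r\<bar> \<le> 1"
    using of_int_floor_le[of "a / r"] of_int_floor_le[of "b / r"] real_of_int_floor_add_one_gt[of "a / r"]
      real_of_int_floor_add_one_gt[of "b / r"] assms(2) by linarith
  then have "\<bar>a - b\<bar> / r \<le> 1" using assms(1) by (simp add: diff_divide_distrib[symmetric])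
  then show ?thesis using assms(1) by (simp add: divide_le_eq)
qed

context model begin

definition mean_free_energy :: "(nat \<Rightarrow> real) \<Rightarrow> real" where
  "mean_free_energy m = (\<integral>x. free_energy m x \<partial>disorder N)"

definition deviation :: "(nat \<Rightarrow> real) \<Rightarrow> (nat list \<Rightarrow> real) \<Rightarrow> real" where
  "deviation m x = \<bar>free_energy m x - mean_free_energy m\<bar>"

lemma open_ball_L2: "m \<in> open_ball_N N \<Longrightarrow> L2_set m {..<N} < sqrt (real N)"
  by (auto simp: open_ball_N_def intro: real_less_rsqrt)

lemma zero_in_open_ball: "restrict (\<lambda>_. 0) {..<N} \<in> open_ball_N N"
  using N1 by (simp add: open_ball_N_def L2_set_def)

lemma zero_L2_unique:
  assumes "m \<in> open_ball_N N" "L2_set m {..<N} = 0" shows "m = restrict (\<lambda>_. 0) {..<N}"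
proof
  fix i
  have "m i = 0" if "i < N" using assms(2) that by (simp add: L2_set_eq_0_iff)
  moreover have "m i = undefined" if "\<not> i < N" using assms(1) that by (auto simp: open_ball_N_def PiE_iff extensional_def)
  ultimately show "m i = restrict (\<lambda>_. 0) {..<N} i" by auto
qed

lemma deviation_null:
  assumes "band_volume m = 0" "x \<in> space (disorder N)" shows "deviation m x = 0"
proof -
  have "mean_free_energy m = (\<integral>x. 0 \<partial>disorder N)"
    unfolding mean_free_energy_def by (rule Bochner_Integration.integral_cong[OF refl free_energy_null[OF assms(1)]])
  then show ?thesis by (simp add: deviation_def free_energy_null[OF assms])
qed

lemma deviation_measurable: "deviation m \<in> borel_measurable (disorder N)"
  unfolding deviation_def[abs_def] using free_energy_measurable[of m] by measurable

text \<open>Density is taken in the graph of \<open>mean_free_energy\<close>: then no continuity of \<open>mean_free_energy\<close> itself is needed.\<close>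

lemma countable_control:
  obtains D where "countable D" "D \<subseteq> open_ball_N N"
    "\<forall>x\<in>good N. \<forall>s. (\<forall>m\<in>D. deviation m x \<le> s) \<longrightarrow> (\<forall>m\<in>open_ball_N N. deviation m x \<le> s)"
proof -
  \<comment> \<open>The centres at which continuity is available. The origin enters D as a point of
    its own, and centres with a null band have deviation 0.\<close>
  define V where "V = {m \<in> open_ball_N N. L2_set m {..<N} \<noteq> 0 \<and> band_volume m \<noteq> 0}"
  define z where "z = restrict (\<lambda>_. 0::real) {..<N}"
  obtain T where T: "countable T" "T \<subseteq> (\<lambda>m. (m, mean_free_energy m)) ` V" "(\<lambda>m. (m, mean_free_energy m)) ` V \<subseteq> closure T"
    using separable by blast
  define D where "D = insert z (fst ` T)"
  show thesis
  proof
    show "countable D" using T(1) by (simp add: D_def)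
    show "D \<subseteq> open_ball_N N" using T(2) zero_in_open_ball by (auto simp: D_def z_def V_def)
    show "\<forall>x\<in>good N. \<forall>s. (\<forall>m\<in>D. deviation m x \<le> s) \<longrightarrow> (\<forall>m\<in>open_ball_N N. deviation m x \<le> s)"
    proof (intro ballI allI impI)
    fix x s m
    assume x: "x \<in> good N" and le: "\<forall>m\<in>D. deviation m x \<le> s" and m: "m \<in> open_ball_N N"
    have xs: "x \<in> space (disorder N)" using x by (simp add: good_def)
    consider "L2_set m {..<N} = 0" | "band_volume m = 0" | "m \<in> V" using m by (auto simp: V_def)
    then show "deviation m x \<le> s"
    proof cases
      case 1
      then show ?thesis using zero_L2_unique[OF m] le by (simp add: D_def z_def)
    next
      case 2
      \<comment> \<open>The bound at z, which belongs to D, shows that s is nonnegative.\<close>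
      have "0 \<le> deviation z x" by (simp add: deviation_def)
      also have "\<dots> \<le> s" using le by (simp add: D_def)
      finally show ?thesis by (simp add: deviation_null[OF 2 xs])
    next
      case 3
      then have "(m, mean_free_energy m) \<in> closure T" using T(3) by blast
      then obtain w where w: "\<And>k. w k \<in> T" "w \<longlonglongrightarrow> (m, mean_free_energy m)" by (auto simp: closure_sequential)
      define mk where "mk k = fst (w k)" for k
      have mkV: "mk k \<in> V" and EFk: "snd (w k) = mean_free_energy (mk k)" and mkD: "mk k \<in> D" for k
        using w(1)[of k] T(2) by (auto simp: mk_def D_def)
      have mkm: "mk \<longlonglongrightarrow> m" using tendsto_fst[OF w(2)] by (simp add: mk_def[abs_def])
      have E: "(\<lambda>k. mean_free_energy (mk k)) \<longlonglongrightarrow> mean_free_energy m" using tendsto_snd[OF w(2)] by (simp add: EFk)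
      have coord: "(\<lambda>k. mk k i) \<longlonglongrightarrow> m i" for i
        using continuous_on_tendsto_compose[OF continuous_on_product_coordinates mkm, of i] by simp
      have bd: "y \<in> {..<N} \<rightarrow>\<^sub>E UNIV" "L2_set y {..<N} \<le> sqrt (real N)" if "y \<in> V" for y
        using that open_ball_L2[of y] by (auto simp: V_def open_ball_N_def)
      have "(\<lambda>k. free_energy (mk k) x) \<longlonglongrightarrow> free_energy m x"
        using 3 by (intro free_energy_continuous[OF x bd(1) bd(2) bd(1) bd(2)] mkV coord) (auto simp: V_def)
      then have "(\<lambda>k. deviation (mk k) x) \<longlonglongrightarrow> deviation m x"
        unfolding deviation_def by (intro tendsto_intros E)
      then show ?thesis by (rule LIMSEQ_le_const2) (use le mkD in auto)
    qed
    qed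
  qed
qed

text \<open>The supremum is taken in \<open>ereal\<close>, where it exists without a proof of
  boundedness; \<open>good\<close> is the set on which \<open>countable_control\<close>
  applies.\<close>

definition sup_event :: "real \<Rightarrow> (nat list \<Rightarrow> real) set" where
  "sup_event t = {x \<in> good N. (SUP m\<in>open_ball_N N. ereal (deviation m x)) < ereal t}"

lemma sup_event_sets: "sup_event t \<in> sets (disorder N)"
proof -
  obtain D where D: "countable D" "D \<subseteq> open_ball_N N"
    "\<forall>x\<in>good N. \<forall>s. (\<forall>m\<in>D. deviation m x \<le> s) \<longrightarrow> (\<forall>m\<in>open_ball_N N. deviation m x \<le> s)"
    by (rule countable_control)
  \<comment> \<open>A supremum below t leaves a gap 1 / (k + 1), which turns the strict bound into
    the non-strict ones that \<open>countable_control\<close> passes from D to the ball.\<close>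
  have "sup_event t = (\<Union>k. good N \<inter> {x \<in> space (disorder N). \<forall>m\<in>D. deviation m x \<le> t - inverse (real (Suc k))})"
    (is "_ = ?R")
  proof (intro set_eqI iffI)
    fix x assume "x \<in> sup_event t"
    then have x: "x \<in> good N" "(SUP m\<in>open_ball_N N. ereal (deviation m x)) < ereal t" by (auto simp: sup_event_def)
    obtain r where r: "(SUP m\<in>open_ball_N N. ereal (deviation m x)) < ereal r" "r < t"
      using ereal_dense2[OF x(2)] by auto
    obtain k where k: "inverse (real (Suc k)) < t - r" using reals_Archimedean[of "t - r"] r(2) by auto
    have "deviation m x \<le> t - inverse (real (Suc k))" if "m \<in> D" for m
    proof -
      have "ereal (deviation m x) \<le> (SUP m\<in>open_ball_N N. ereal (deviation m x))" using D(2) that by (intro SUP_upper) auto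
      also note r(1)
      finally show ?thesis using k by simp
    qed
    then show "x \<in> ?R" using x(1) by (auto simp: good_def)
  next
    fix x assume "x \<in> ?R"
    then obtain k where x: "x \<in> good N" and le: "\<And>m. m \<in> D \<Longrightarrow> deviation m x \<le> t - inverse (real (Suc k))" by blast
    have "(SUP m\<in>open_ball_N N. ereal (deviation m x)) \<le> ereal (t - inverse (real (Suc k)))"
      using D(3) x le by (intro SUP_least) simp
    also have "\<dots> < ereal t" by simp
    finally show "x \<in> sup_event t" using x by (simp add: sup_event_def)
  qed
  also have "\<dots> \<in> sets (disorder N)"
  proof (intro sets.countable_UN image_subsetI sets.Int good_sets)
    fix k
    have "{x \<in> space (disorder N). \<forall>m\<in>D. deviation m x \<le> t - inverse (real (Suc k))}
      = space (disorder N) - (\<Union>m\<in>D. {x \<in> space (disorder N). t - inverse (real (Suc k)) < deviation m x})"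
      by (auto simp: not_le)
    also have "\<dots> \<in> sets (disorder N)"
    proof (intro sets.Diff sets.top sets.countable_UN' D(1) image_subsetI)
      fix m
      note [measurable] = deviation_measurable[of m]
      show "{x \<in> space (disorder N). t - inverse (real (Suc k)) < deviation m x} \<in> sets (disorder N)" by measurable
    qed
    finally show "{x \<in> space (disorder N). \<forall>m\<in>D. deviation m x \<le> t - inverse (real (Suc k))} \<in> sets (disorder N)" .
  qed
  finally show ?thesis .
qed

text \<open>Index of a box in polar coordinates, with the direction rounded at scale h and the
  relative radius at scale r. Indexing by boxes allows representatives inside the ball, chosen by
  \<open>inv_into\<close>.\<close>

definition cell :: "real \<Rightarrow> real \<Rightarrow> (nat \<Rightarrow> real) \<Rightarrow> (nat \<Rightarrow> int) \<times> int" where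
  "cell h r m = (lattice_cell N h (\<lambda>i. vdir N m i / sqrt (real N)), \<lfloor>L2_set m {..<N} / sqrt (real N) / r\<rfloor>)"

lemma L2_vdir: "L2_set m {..<N} \<noteq> 0 \<Longrightarrow> L2_set (vdir N m) {..<N} = sqrt (real N)"
  by (rule sphere_N_L2[OF vdir_in_sphere_N[OF N1]])

lemma cell_range:
  assumes h: "h > 0" and r: "r > 0" and m: "m \<in> open_ball_N N" "L2_set m {..<N} \<noteq> 0"
  shows "cell h r m \<in> lattice_box N (real N / h) \<times> {0..\<lfloor>1 / r\<rfloor>}"
proof -
  have "L2_set (\<lambda>i. (1 / sqrt (real N)) * vdir N m i) {..<N} = (1 / sqrt (real N)) * L2_set (vdir N m) {..<N}"
    by (rule L2_set_right_distrib[symmetric]) simp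
  then have "L2_set (\<lambda>i. vdir N m i / sqrt (real N)) {..<N} \<le> 1" using L2_vdir[OF m(2)] N1 by simp
  from lattice_cell_in_box[OF h this]
  have 1: "lattice_cell N h (\<lambda>i. vdir N m i / sqrt (real N)) \<in> lattice_box N (real N / h)" .
  have "L2_set m {..<N} / sqrt (real N) \<le> 1" using open_ball_L2[OF m(1)] N1 by simp
  then have "L2_set m {..<N} / sqrt (real N) / r \<le> 1 / r" using r by (intro divide_right_mono) auto
  then have "\<lfloor>L2_set m {..<N} / sqrt (real N) / r\<rfloor> \<le> \<lfloor>1 / r\<rfloor>" by (rule floor_mono)
  moreover have "0 \<le> \<lfloor>L2_set m {..<N} / sqrt (real N) / r\<rfloor>" using r by simp
  ultimately show ?thesis using 1 by (simp add: cell_def)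
qed

lemma same_cell:
  assumes h: "h > 0" and r: "r > 0" and c: "cell h r m = cell h r m'"
  shows "\<bar>L2_set m {..<N} / sqrt (real N) - L2_set m' {..<N} / sqrt (real N)\<bar> \<le> r"
    and "L2_set (\<lambda>i. vdir N m i - vdir N m' i) {..<N} \<le> 2 * h * sqrt (real N)"
proof -
  show "\<bar>L2_set m {..<N} / sqrt (real N) - L2_set m' {..<N} / sqrt (real N)\<bar> \<le> r"
    using c by (intro same_floor_close[OF r]) (simp add: cell_def)
  have sN: "sqrt (real N) > 0" using N1 by simp
  show "L2_set (\<lambda>i. vdir N m i - vdir N m' i) {..<N} \<le> 2 * h * sqrt (real N)"
  proof (rule L2_set_le_sqrt)
    fix i assume i: "i < N"
    let ?p = "lattice_point N h (lattice_cell N h (\<lambda>i. vdir N m i / sqrt (real N))) i"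
    have "?p = lattice_point N h (lattice_cell N h (\<lambda>i. vdir N m' i / sqrt (real N))) i" using c by (simp add: cell_def)
    then have "\<bar>vdir N m i / sqrt (real N) - vdir N m' i / sqrt (real N)\<bar> \<le> 2 * h / sqrt (real N)"
      using lattice_cell_close(1)[OF h N1 i, of "\<lambda>i. vdir N m i / sqrt (real N)"]
        lattice_cell_close(1)[OF h N1 i, of "\<lambda>i. vdir N m' i / sqrt (real N)"] by linarith
    then have "\<bar>(vdir N m i - vdir N m' i) / sqrt (real N)\<bar> \<le> 2 * h / sqrt (real N)" by (simp add: diff_divide_distrib)
    then have "\<bar>vdir N m i - vdir N m' i\<bar> \<le> 2 * h" using sN by (simp add: abs_divide divide_le_cancel)
    then show "\<bar>vdir N m i - vdir N m' i\<bar> \<le> 2 * h * sqrt (real N) / sqrt (real N)" using sN by simp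
  qed (use h in simp)
qed

lemma polar_form:
  assumes "m \<in> open_ball_N N" "L2_set m {..<N} \<noteq> 0"
  shows "scaled N (L2_set m {..<N} / sqrt (real N)) (vdir N m) = m"
proof
  fix i
  show "scaled N (L2_set m {..<N} / sqrt (real N)) (vdir N m) i = m i"
    using assms N1 by (cases "i < N") (auto simp: scaled_def vdir_def open_ball_N_def PiE_iff extensional_def)
qed

text \<open>Union bound over the origin and one representative per cell. Off the exceptional events
  the deviation is at most 3 t / 4: a quarter at the representative, a quarter for comparing free
  energies, a quarter for comparing their means. The remaining quarter makes the bound on the
  supremum strict.\<close>

lemma sup_event_prob:
  assumes \<alpha>: "0 < \<alpha>" "\<alpha> \<le> 1/2" and h: "h > 0" and r: "r > 0"
    and x: "0 < x" "8 * x + 2 * r \<le> \<delta> * \<alpha>\<^sup>2 / 2" "8 * x + 2 * r \<le> \<rho> * \<alpha>\<^sup>2 / 2" "x \<le> 1 / 4"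
    and big: "(real n + 1) * (1 + 1 / x\<^sup>2) \<le> real N"
    and c: "c \<ge> 0" and t: "t > 0" and C: "21 * S1 \<le> C" "3 * (5 + c) * S1 \<le> C"
    and small: "\<beta> * C * (8 * \<alpha> + r + 4 * h) + \<alpha> + 1 / real N + 2 * ln (real N) / real N \<le> t / 4"
  shows "1 - measure (disorder N) (sup_event t)
    \<le> 6 * exp (- (real N * (1 + c))) + (3 ^ N * 2 powr (real N / h) * (1 / r + 1) + 1) * (2 * exp (- (real N * (t / 4)\<^sup>2 / rate)))"
proof -
  let ?P = "disorder N"
  interpret P: prob_space ?P by (rule prob_space_gauss)
  define z where "z = restrict (\<lambda>_. 0::real) {..<N}"
  define B where "B = {m \<in> open_ball_N N. L2_set m {..<N} \<noteq> 0}"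
  \<comment> \<open>z is the origin, which B leaves out for want of a direction.\<close>
  define R where "R = insert z (inv_into B (cell h r) ` cell h r ` B)"
  have cB: "cell h r ` B \<subseteq> lattice_box N (real N / h) \<times> {0..\<lfloor>1 / r\<rfloor>}"
    by (rule image_subsetI, rule cell_range[OF h r]) (simp_all add: B_def)
  have fin: "finite (lattice_box N (real N / h) \<times> {0..\<lfloor>1 / r\<rfloor>})" using finite_lattice_box by simp
  have finB: "finite (cell h r ` B)" using cB fin by (rule finite_subset)
  then have finR: "finite R" by (simp add: R_def)
  have Rb: "R \<subseteq> open_ball_N N"
  proof -
    have "inv_into B (cell h r) q \<in> B" if "q \<in> cell h r ` B" for q by (rule inv_into_into[OF that])
    then show ?thesis using zero_in_open_ball by (auto simp: R_def z_def B_def)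
  qed
  have cardR: "real (card R) \<le> 3 ^ N * 2 powr (real N / h) * (1 / r + 1) + 1"
  proof -
    have "card R \<le> Suc (card (inv_into B (cell h r) ` cell h r ` B))" unfolding R_def by (rule card_insert_le_m1) auto
    also have "card (inv_into B (cell h r) ` cell h r ` B) \<le> card (cell h r ` B)" by (rule card_image_le[OF finB])
    also have "\<dots> \<le> card (lattice_box N (real N / h) \<times> {0..\<lfloor>1 / r\<rfloor>})" by (rule card_mono[OF fin cB])
    also have "\<dots> = card (lattice_box N (real N / h)) * nat (\<lfloor>1 / r\<rfloor> + 1)" by (simp add: card_cartesian_product)
    finally have "real (card R) \<le> real (card (lattice_box N (real N / h)) * nat (\<lfloor>1 / r\<rfloor> + 1)) + 1" by linarith
    also have "\<dots> = real (card (lattice_box N (real N / h))) * real (nat (\<lfloor>1 / r\<rfloor> + 1)) + 1" by simp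
    also have "\<dots> \<le> 3 ^ N * 2 powr (real N / h) * (1 / r + 1) + 1"
    proof (intro add_right_mono mult_mono)
      show "real (card (lattice_box N (real N / h))) \<le> 3 ^ N * 2 powr (real N / h)" using h by (intro card_lattice_box) simp
      have "0 \<le> \<lfloor>1 / r\<rfloor>" using r by simp
      then have "real (nat (\<lfloor>1 / r\<rfloor> + 1)) = of_int \<lfloor>1 / r\<rfloor> + 1" by simp
      then show "real (nat (\<lfloor>1 / r\<rfloor> + 1)) \<le> 1 / r + 1" using of_int_floor_le[of "1 / r"] by linarith
    qed auto
    finally show ?thesis .
  qed
  \<comment> \<open>Affine in the Lipschitz constant, so its expectation is its value at the mean.
    The hypotheses on C serve both uses: 21 \<open>S1\<close> for the mean, 3 (5 + c)
    \<open>S1\<close> for the value off the event X.\<close>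
  define G where "G y = \<beta> * (y / sqrt (real N)) * (8 * \<alpha> + r + 4 * h) + \<alpha> + 1 / real N + 2 * ln (real N) / real N" for y
  have sN: "sqrt (real N) > 0" using N1 by simp
  have w: "8 * \<alpha> + r + 4 * h \<ge> 0" using \<alpha> h r by simp
  have Gle: "G y \<le> t / 4" if "y \<le> C * sqrt (real N)" for y
  proof -
    have "y / sqrt (real N) \<le> C" using that sN by (simp add: divide_le_eq)
    then have "\<beta> * (y / sqrt (real N)) * (8 * \<alpha> + r + 4 * h) \<le> \<beta> * C * (8 * \<alpha> + r + 4 * h)"
      using \<beta>_pos w by (intro mult_right_mono mult_left_mono) auto
    then show ?thesis using small unfolding G_def by linarith
  qed
  have cmp: "\<bar>free_energy m g - free_energy m' g\<bar> \<le> G (lip_const N g)"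
    if m: "m \<in> B" "m' \<in> B" "cell h r m = cell h r m'" and g: "g \<in> good N" for m m' g
  proof -
    have s: "0 < L2_set m {..<N} / sqrt (real N)" "L2_set m {..<N} / sqrt (real N) \<le> 1" "vdir N m \<in> sphere_N N" if "m \<in> B" for m
    proof -
      have mb: "m \<in> open_ball_N N" "L2_set m {..<N} \<noteq> 0" using that by (auto simp: B_def)
      have "L2_set m {..<N} > 0" using mb(2) L2_set_nonneg[of m "{..<N}"] by linarith
      then show "0 < L2_set m {..<N} / sqrt (real N)" using sN by (rule divide_pos_pos)
      show "L2_set m {..<N} / sqrt (real N) \<le> 1" using open_ball_L2[OF mb(1)] sN by simp
      show "vdir N m \<in> sphere_N N" by (rule vdir_in_sphere_N[OF N1 mb(2)])
    qed
    note sc = same_cell[OF h r m(3)]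
    have p: "scaled N (L2_set m {..<N} / sqrt (real N)) (vdir N m) = m" if "m \<in> B" for m
      using that by (intro polar_form) (auto simp: B_def)
    have "2 * L2_set (\<lambda>i. vdir N m i - vdir N m' i) {..<N} / sqrt (real N) \<le> 4 * h"
      using sc(2) sN by (simp add: divide_le_eq)
    moreover have "\<beta> * (lip_const N g / sqrt (real N)) \<ge> 0" using \<beta>_pos lip_const_nonneg[OF g] by simp
    ultimately have "\<beta> * (lip_const N g / sqrt (real N)) * (8 * \<alpha> + r + 2 * L2_set (\<lambda>i. vdir N m i - vdir N m' i) {..<N} / sqrt (real N))
        \<le> \<beta> * (lip_const N g / sqrt (real N)) * (8 * \<alpha> + r + 4 * h)" by (intro mult_left_mono) auto
    then show ?thesis
      using free_energy_compare[OF g \<alpha> s(3)[OF m(1)] s(3)[OF m(2)] s(1,2)[OF m(1)] s(1,2)[OF m(2)] sc(1) x big]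
      unfolding p[OF m(1)] p[OF m(2)] G_def by linarith
  qed
  have ballL2: "L2_set m {..<N} \<le> sqrt (real N)" if "m \<in> open_ball_N N" for m using open_ball_L2[OF that] by simp
  note int = free_energy_concentration(1)[OF ballL2 t]
  have intG: "integrable ?P (\<lambda>g. G (lip_const N g))"
    unfolding G_def by (intro Bochner_Integration.integrable_add integrable_mult_left integrable_mult_right integrable_divide lip_const_mean(1)[OF N1] P.integrable_const)
  have meanG: "(\<integral>g. G (lip_const N g) \<partial>?P) = G (\<integral>g. lip_const N g \<partial>?P)"
    unfolding G_def using lip_const_mean(1)[OF N1] by (simp add: P.prob_space)
  have cmpE: "\<bar>mean_free_energy m - mean_free_energy m'\<bar> \<le> t / 4" if m: "m \<in> B" "m' \<in> B" "cell h r m = cell h r m'" for m m'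
  proof -
    have mb: "m \<in> open_ball_N N" "m' \<in> open_ball_N N" using m by (auto simp: B_def)
    have "mean_free_energy m - mean_free_energy m' = (\<integral>g. free_energy m g - free_energy m' g \<partial>?P)" unfolding mean_free_energy_def using int mb by simp
    then have "\<bar>mean_free_energy m - mean_free_energy m'\<bar> \<le> (\<integral>g. \<bar>free_energy m g - free_energy m' g\<bar> \<partial>?P)" using integral_abs_bound[of ?P "\<lambda>g. free_energy m g - free_energy m' g"] by simp
    also have "\<dots> \<le> (\<integral>g. G (lip_const N g) \<partial>?P)"
    proof (rule integral_mono_AE)
      show "AE g in ?P. \<bar>free_energy m g - free_energy m' g\<bar> \<le> G (lip_const N g)"
        using good_AE[OF N1] by eventually_elim (rule cmp[OF m])
    qed (use int mb intG in auto)
    also have "\<dots> \<le> t / 4" unfolding meanG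
    proof (rule Gle)
      have "21 * sqrt (real N) * S1 \<le> C * sqrt (real N)" using mult_right_mono[OF C(1), of "sqrt (real N)"] by (simp add: mult_ac)
      then show "(\<integral>g. lip_const N g \<partial>?P) \<le> C * sqrt (real N)" using lip_const_mean(2)[OF N1] by linarith
    qed
    finally show ?thesis .
  qed
  define X where "X = {g \<in> space ?P. \<not> (g \<in> good N \<and> lip_const N g \<le> 3 * (5 + c) * sqrt (real N) * S1)}"
  define Y where "Y m = {g \<in> space ?P. deviation m g \<ge> t / 4}" for m
  have Xs: "X \<in> sets ?P"
  proof -
    have "X = space ?P - (good N \<inter> {g \<in> space ?P. lip_const N g \<le> 3 * (5 + c) * sqrt (real N) * S1})" by (auto simp: X_def)
    also have "\<dots> \<in> sets ?P" by (intro sets.Diff sets.Int good_sets sets.top) measurable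
    finally show ?thesis .
  qed
  have Ys: "Y m \<in> sets ?P" for m
    unfolding Y_def using deviation_measurable[of m] by measurable
  have incl: "space ?P - sup_event t \<subseteq> X \<union> (\<Union>m\<in>R. Y m)"
  proof
    fix g assume g: "g \<in> space ?P - sup_event t"
    show "g \<in> X \<union> (\<Union>m\<in>R. Y m)"
    proof (rule ccontr)
      assume "g \<notin> X \<union> (\<Union>m\<in>R. Y m)"
      then have gg: "g \<in> good N" "lip_const N g \<le> 3 * (5 + c) * sqrt (real N) * S1" and dR: "\<And>m. m \<in> R \<Longrightarrow> deviation m g < t / 4"
        using g by (auto simp: X_def Y_def not_le)
      have "3 * (5 + c) * sqrt (real N) * S1 \<le> C * sqrt (real N)" using mult_right_mono[OF C(2), of "sqrt (real N)"] by (simp add: mult_ac)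
      then have Gt: "G (lip_const N g) \<le> t / 4" using gg(2) by (intro Gle) linarith
      have "deviation m g \<le> 3 * t / 4" if m: "m \<in> open_ball_N N" for m
      proof (cases "m \<in> B")
        case True
        define m' where "m' = inv_into B (cell h r) (cell h r m)"
        have m': "m' \<in> B" "cell h r m = cell h r m'"
          using inv_into_into[of "cell h r m" "cell h r" B] f_inv_into_f[of "cell h r m" "cell h r" B] True by (auto simp: m'_def)
        have "m' \<in> R" using True by (simp add: R_def m'_def)
        then have "\<bar>free_energy m' g - mean_free_energy m'\<bar> < t / 4" using dR by (simp add: deviation_def)
        then show ?thesis using cmp[OF True m' gg(1)] cmpE[OF True m'] Gt unfolding deviation_def by linarith
      next
        case False
        then have "m = z" using m zero_L2_unique by (auto simp: B_def z_def)
        then have "deviation m g < t / 4" by (intro dR) (simp add: R_def)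
        then show ?thesis using t by linarith
      qed
      then have "(SUP m\<in>open_ball_N N. ereal (deviation m g)) \<le> ereal (3 * t / 4)" by (intro SUP_least) simp
      also have "\<dots> < ereal t" using t by simp
      finally show False using g gg(1) by (simp add: sup_event_def)
    qed
  qed
  have "1 - measure ?P (sup_event t) = measure ?P (space ?P - sup_event t)"
    using P.prob_compl[OF sup_event_sets] by simp
  also have "\<dots> \<le> measure ?P (X \<union> (\<Union>m\<in>R. Y m))"
    using Xs Ys finR by (intro P.finite_measure_mono incl) auto
  also have "\<dots> \<le> measure ?P X + measure ?P (\<Union>m\<in>R. Y m)"
    using Xs Ys finR by (intro measure_Un_le) auto
  also have "measure ?P (\<Union>m\<in>R. Y m) \<le> (\<Sum>m\<in>R. measure ?P (Y m))"
    using Ys finR by (intro P.finite_measure_subadditive_finite) auto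
  also have "\<dots> \<le> (\<Sum>m\<in>R. 2 * exp (- (real N * (t / 4)\<^sup>2 / rate)))"
  proof (rule sum_mono)
    fix m assume "m \<in> R"
    then have "L2_set m {..<N} \<le> sqrt (real N)" using Rb ballL2 by blast
    from free_energy_concentration(2)[OF this, of "t / 4"] t
    show "measure ?P (Y m) \<le> 2 * exp (- (real N * (t / 4)\<^sup>2 / rate))" by (simp add: Y_def deviation_def mean_free_energy_def)
  qed
  also have "\<dots> = real (card R) * (2 * exp (- (real N * (t / 4)\<^sup>2 / rate)))" by simp
  also have "\<dots> \<le> (3 ^ N * 2 powr (real N / h) * (1 / r + 1) + 1) * (2 * exp (- (real N * (t / 4)\<^sup>2 / rate)))"
    by (intro mult_right_mono cardR) simp
  also have "measure ?P X \<le> 6 * exp (- (real N * (1 + c)))" unfolding X_def by (rule lip_const_tail[OF N1 c])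
  finally show ?thesis by simp
qed

end

section \<open>Transfer to arbitrary disorder and choice of parameters\<close>

lemma disorder_distr:
  assumes iid: "iid_gaussian_disorder N M J" and N: "N \<ge> 1"
  shows "(\<lambda>\<omega>. \<lambda>is\<in>all_indices N. J is \<omega>) \<in> measurable M (disorder N)"
    and "distr M (disorder N) (\<lambda>\<omega>. \<lambda>is\<in>all_indices N. J is \<omega>) = disorder N"
proof -
  interpret prob_space M using iid by (simp add: iid_gaussian_disorder_def)
  have d: "distributed M lborel (J is) std_normal_density" if "is \<in> all_indices N" for "is"
    using iid that by (auto simp: iid_gaussian_disorder_def all_indices_def)
  have rv: "J is \<in> borel_measurable M" if "is \<in> all_indices N" for "is"
    using distributed_measurable[OF d[OF that]] by simp
  have dist: "distr M borel (J is) = std_normal" if "is \<in> all_indices N" for "is"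
  proof -
    have "distr M borel (J is) = distr M lborel (J is)" by (rule distr_cong) auto
    then show ?thesis using distributed_distr_eq_density[OF d[OF that]] by (simp add: std_normal_def)
  qed
  have s: "sets (PiM (all_indices N) (\<lambda>_. borel)) = sets (disorder N)"
    by (intro sets_PiM_cong) auto
  have X: "(\<lambda>\<omega>. \<lambda>is\<in>all_indices N. J is \<omega>) \<in> measurable M (PiM (all_indices N) (\<lambda>_. borel))"
    by (intro measurable_restrict rv)
  then show "(\<lambda>\<omega>. \<lambda>is\<in>all_indices N. J is \<omega>) \<in> measurable M (disorder N)"
    using measurable_cong_sets[OF refl s] by blast
  have "replicate 1 0 \<in> multi_indices N 1" using N by (auto simp: multi_indices_def)
  then have ne: "all_indices N \<noteq> {}" using multi_indices_subset[of 1 N] by auto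
  have iv: "indep_vars (\<lambda>_. borel) J (all_indices N)" using iid by (simp add: iid_gaussian_disorder_def all_indices_def)
  have "distr M (disorder N) (\<lambda>\<omega>. \<lambda>is\<in>all_indices N. J is \<omega>) = distr M (PiM (all_indices N) (\<lambda>_. borel)) (\<lambda>\<omega>. \<lambda>is\<in>all_indices N. J is \<omega>)"
    by (intro distr_cong s[symmetric] refl)
  also have "\<dots> = PiM (all_indices N) (\<lambda>is. distr M borel (J is))"
    using indep_vars_iff_distr_eq_PiM'[OF ne rv] iv by simp
  also have "\<dots> = disorder N" by (intro PiM_cong refl dist)
  finally show "distr M (disorder N) (\<lambda>\<omega>. \<lambda>is\<in>all_indices N. J is \<omega>) = disorder N" .
qed

context model begin

text \<open>The event on M involves an uncountable supremum. It contains the preimage of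
  \<open>sup_event\<close> and exceeds it only within the null set where the disorder is not good,
  hence it is measurable in the completion.\<close>

lemma sup_event_transfer:
  assumes iid: "iid_gaussian_disorder N M J"
  defines "F \<equiv> \<lambda>m \<omega>. multi_free_energy N \<mu> \<beta> (hamiltonian N \<gamma> (\<lambda>is. J is \<omega>)) m n \<rho> \<delta>"
  shows "measure (disorder N) (sup_event t)
    \<le> measure (completion M) {\<omega> \<in> space M. (SUP m\<in>open_ball_N N. ereal \<bar>F m \<omega> - integral\<^sup>L M (F m)\<bar>) < ereal t}"
proof -
  interpret M: prob_space M using iid by (simp add: iid_gaussian_disorder_def)
  interpret cM: prob_space "completion M" by (rule M.prob_space_completion)
  define X where "X = (\<lambda>\<omega>. \<lambda>is\<in>all_indices N. J is \<omega>)"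
  have X[measurable]: "X \<in> measurable M (disorder N)" and dX: "distr M (disorder N) X = disorder N"
    unfolding X_def by (rule disorder_distr[OF iid N1])+
  have FX: "F m \<omega> = free_energy m (X \<omega>)" for m \<omega>
  proof -
    have "hamiltonian N \<gamma> (X \<omega>) = hamiltonian N \<gamma> (\<lambda>is. J is \<omega>)"
      unfolding X_def by (rule ext, rule hamiltonian_restrict)
    then show ?thesis by (simp add: F_def free_energy_def)
  qed
  have EX: "integral\<^sup>L M (F m) = mean_free_energy m" for m
  proof -
    have "integral\<^sup>L M (F m) = (\<integral>\<omega>. free_energy m (X \<omega>) \<partial>M)" by (rule arg_cong[of _ _ "integral\<^sup>L M"]) (rule ext, rule FX)
    also have "\<dots> = integral\<^sup>L (distr M (disorder N) X) (free_energy m)" by (rule integral_distr[OF X free_energy_measurable, symmetric])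
    finally show ?thesis by (simp add: dX mean_free_energy_def)
  qed
  define S where "S = {\<omega> \<in> space M. (SUP m\<in>open_ball_N N. ereal \<bar>F m \<omega> - integral\<^sup>L M (F m)\<bar>) < ereal t}"
  have S: "S = {\<omega> \<in> space M. (SUP m\<in>open_ball_N N. ereal (deviation m (X \<omega>))) < ereal t}"
    by (simp add: S_def FX EX deviation_def)
  define A where "A = X -` sup_event t \<inter> space M"
  define Z where "Z = X -` (space (disorder N) - good N) \<inter> space M"
  have As: "A \<in> sets M" unfolding A_def by (rule measurable_sets[OF X sup_event_sets])
  have Zn: "Z \<in> null_sets M"
  proof
    have c: "space (disorder N) - good N \<in> sets (disorder N)" using good_sets by auto
    show "Z \<in> sets M" unfolding Z_def by (rule measurable_sets[OF X c])
    have "emeasure M Z = emeasure (distr M (disorder N) X) (space (disorder N) - good N)"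
      unfolding Z_def by (rule emeasure_distr[OF X c, symmetric])
    also have "\<dots> = emeasure (disorder N) (space (disorder N) - good N)" by (simp only: dX)
    also have "\<dots> = emeasure (disorder N) {x \<in> space (disorder N). \<not> x \<in> good N}" by (rule arg_cong2[of _ _ _ _ emeasure]) auto
    also have "\<dots> = 0"
      using good_AE[OF N1] c by (subst (asm) AE_iff_measurable[of "{x \<in> space (disorder N). \<not> x \<in> good N}"]) (auto simp: set_diff_eq)
    finally show "emeasure M Z = 0" .
  qed
  have AS: "A \<subseteq> S" by (auto simp: A_def S sup_event_def)
  have "S = A \<union> (S \<inter> Z)"
    using AS measurable_space[OF X] by (auto simp: A_def S Z_def sup_event_def)
  then have Sc: "S \<in> sets (completion M)"
    by (rule sets_completionI[OF _ Int_lower2 Zn As])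
  have "measure (disorder N) (sup_event t) = measure (distr M (disorder N) X) (sup_event t)" by (simp only: dX)
  also have "\<dots> = measure M A" unfolding A_def by (rule measure_distr[OF X sup_event_sets])
  also have "\<dots> = measure (completion M) A" using As by simp
  also have "\<dots> \<le> measure (completion M) S" by (rule cM.finite_measure_mono[OF AS Sc])
  finally show ?thesis by (simp add: S_def)
qed

text \<open>Takes h = \<alpha>, x = \<open>\<alpha>\<^sup>2\<close> w / 32 and r = q =
  \<open>\<alpha>\<^sup>2\<close> w / 8, so that 8 x and 2 q share the slack w
  \<open>\<alpha>\<^sup>2\<close> / 2 equally; 13 bounds 8 + 1 + 4 by q \<le> \<alpha>. There are at
  most 2 exp (N (3 + 1 / \<alpha>)) representatives, and the hypothesis on \<open>rate\<close> makes
  the tail at each at most 2 exp (- N (4 + c + 1 / \<alpha>)). With the Lipschitz event this is 10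
  exp (- N (1 + c)), and 10 < exp N.\<close>

lemma sup_event_prob_exp:
  assumes \<alpha>: "0 < \<alpha>" "\<alpha> \<le> 1/2" and w: "0 < w" "w \<le> 1" "w \<le> \<delta>" "w \<le> \<rho>"
    and big: "(real n + 1) * (1 + 1 / (\<alpha>\<^sup>2 * w / 32)\<^sup>2) \<le> real N"
    and r: "8 / (\<alpha>\<^sup>2 * w) + 1 \<le> exp (real N)"
    and c: "c \<ge> 0" and t: "t > 0"
    and small: "\<alpha> * (13 * (\<beta> * ((21 + 3 * c) * S1)) + 1) \<le> t / 8" "1 / real N + 2 * ln (real N) / real N \<le> t / 8"
    and rate: "rate * (4 + c + 1 / \<alpha>) \<le> (t / 4)\<^sup>2" and N10: "N \<ge> 10"
  shows "measure (disorder N) (sup_event t) > 1 - exp (- (real N * c))"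
proof -
  define C where "C = (21 + 3 * c) * S1"
  have C: "21 * S1 \<le> C" "3 * (5 + c) * S1 \<le> C" "C \<ge> 0"
    using S1_nonneg c by (auto simp: C_def intro!: mult_right_mono mult_nonneg_nonneg)
  define x where "x = \<alpha>\<^sup>2 * w / 32"
  define q where "q = \<alpha>\<^sup>2 * w / 8"
  have aw: "\<alpha>\<^sup>2 * w > 0" using \<alpha> w by simp
  have aw1: "\<alpha>\<^sup>2 * w \<le> \<alpha>"
  proof -
    have "\<alpha>\<^sup>2 * w \<le> \<alpha>\<^sup>2 * 1" using w by (intro mult_left_mono) auto
    also have "\<dots> \<le> \<alpha>" using \<alpha> by (simp add: power2_eq_square mult_le_cancel_left1)
    finally show ?thesis .
  qed
  have xq: "8 * x + 2 * q = w * \<alpha>\<^sup>2 / 2" by (simp add: x_def q_def)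
  have x: "0 < x" "8 * x + 2 * q \<le> \<delta> * \<alpha>\<^sup>2 / 2" "8 * x + 2 * q \<le> \<rho> * \<alpha>\<^sup>2 / 2" "x \<le> 1 / 4"
  proof -
    show "0 < x" using aw by (simp add: x_def)
    show "8 * x + 2 * q \<le> \<delta> * \<alpha>\<^sup>2 / 2" "8 * x + 2 * q \<le> \<rho> * \<alpha>\<^sup>2 / 2"
      unfolding xq using w by (auto intro!: divide_right_mono mult_right_mono)
    show "x \<le> 1 / 4" unfolding x_def using aw1 \<alpha> by linarith
  qed
  have q: "q > 0" "q \<le> \<alpha>" using aw aw1 by (auto simp: q_def)
  have sm: "\<beta> * C * (8 * \<alpha> + q + 4 * \<alpha>) + \<alpha> + 1 / real N + 2 * ln (real N) / real N \<le> t / 4"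
  proof -
    have "\<beta> * C * (8 * \<alpha> + q + 4 * \<alpha>) \<le> \<beta> * C * (13 * \<alpha>)" using q C \<beta>_pos by (intro mult_left_mono) auto
    moreover have "\<alpha> * (13 * (\<beta> * C) + 1) = \<beta> * C * (13 * \<alpha>) + \<alpha>" by (simp add: algebra_simps)
    ultimately show ?thesis using small unfolding C_def[symmetric] by linarith
  qed
  have rp: "rate > 0"
  proof -
    have "(\<rho> + 2 * \<delta>) * D2 \<ge> 0" using D2_nonneg \<rho>_pos \<delta>_pos by (intro mult_nonneg_nonneg) auto
    moreover have "4 * (D1 + 1) / real n > 0" using D1_nonneg n_pos by (intro divide_pos_pos) auto
    ultimately have "4 * (D1 + 1) / real n + (\<rho> + 2 * \<delta>) * D2 > 0" by linarith
    then show ?thesis using \<beta>_pos by (simp add: rate_def)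
  qed
  have "4 + c + 1 / \<alpha> \<le> (t / 4)\<^sup>2 / rate" using rate rp by (simp add: pos_le_divide_eq mult.commute)
  then have "real N * (4 + c + 1 / \<alpha>) \<le> real N * ((t / 4)\<^sup>2 / rate)" by (intro mult_left_mono) auto
  then have e: "exp (- (real N * (t / 4)\<^sup>2 / rate)) \<le> exp (- (real N * (4 + c + 1 / \<alpha>)))" by simp
  have k: "3 ^ N * 2 powr (real N / \<alpha>) * (1 / q + 1) + 1 \<le> 2 * exp (real N * (3 + 1 / \<alpha>))"
  proof -
    have "(3::real) ^ N \<le> exp (real N * 2)"
    proof -
      have "(3::real) ^ N \<le> exp 2 ^ N" using exp_ge_add_one_self[of "2::real"] by (intro power_mono) linarith+
      then show ?thesis by (simp add: exp_of_nat_mult)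
    qed
    moreover have "2 powr (real N / \<alpha>) \<le> exp (real N / \<alpha>)"
    proof -
      have "real N / \<alpha> * ln 2 \<le> real N / \<alpha> * 1" using \<alpha> ln_le_minus_one[of "2::real"] by (intro mult_left_mono) auto
      then show ?thesis by (simp add: powr_def mult.commute)
    qed
    moreover have "1 / q + 1 \<le> exp (real N)" using r by (simp add: q_def)
    ultimately have "3 ^ N * 2 powr (real N / \<alpha>) * (1 / q + 1) \<le> exp (real N * 2) * exp (real N / \<alpha>) * exp (real N)"
      using q by (intro mult_mono) auto
    also have "\<dots> = exp (real N * (3 + 1 / \<alpha>))" by (simp add: exp_add[symmetric] algebra_simps)
    finally have "3 ^ N * 2 powr (real N / \<alpha>) * (1 / q + 1) \<le> exp (real N * (3 + 1 / \<alpha>))" .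
    moreover have "1 \<le> exp (real N * (3 + 1 / \<alpha>))" using \<alpha> by simp
    ultimately show ?thesis by linarith
  qed
  have "(3 ^ N * 2 powr (real N / \<alpha>) * (1 / q + 1) + 1) * (2 * exp (- (real N * (t / 4)\<^sup>2 / rate)))
     \<le> (2 * exp (real N * (3 + 1 / \<alpha>))) * (2 * exp (- (real N * (4 + c + 1 / \<alpha>))))"
    using k e by (intro mult_mono) auto
  also have "\<dots> = 4 * exp (- (real N * (1 + c)))"
    by (simp add: exp_add[symmetric] algebra_simps)
  finally have "1 - measure (disorder N) (sup_event t) \<le> 10 * exp (- (real N * (1 + c)))"
    using sup_event_prob[OF \<alpha> \<alpha>(1) q(1) x big[folded x_def] c t C(1,2) sm] by linarith
  also have "\<dots> = (10 * exp (- real N)) * exp (- (real N * c))" by (simp add: exp_add[symmetric] algebra_simps)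
  also have "\<dots> < 1 * exp (- (real N * c))"
  proof (rule mult_strict_right_mono)
    have "10 < exp (real N)" using exp_ge_add_one_self[of "real N"] N10 by linarith
    then show "10 * exp (- real N) < 1" by (simp add: exp_minus field_simps)
  qed simp
  finally show ?thesis by simp
qed

end

theorem proposition1:
  fixes \<gamma> :: "nat \<Rightarrow> real" and \<beta> :: real
  assumes gamma_nonneg: "\<forall>p\<ge>1. 0 \<le> \<gamma> p"
    and gamma_decay: "decays_exponentially \<gamma>"
    and beta_pos: "0 < \<beta>"
  shows "\<exists>(\<delta>0 :: nat \<Rightarrow> real) (\<rho>0 :: nat \<Rightarrow> real) (n0 :: nat \<Rightarrow> nat).
    \<delta>0 \<longlonglongrightarrow> 0 \<and> \<rho>0 \<longlonglongrightarrow> 0 \<and> filterlim n0 at_top sequentially \<and>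
    (\<forall>(\<delta> :: nat \<Rightarrow> real) (\<rho> :: nat \<Rightarrow> real) (n :: nat \<Rightarrow> nat).
      (\<forall>N\<ge>1. 0 < \<delta> N \<and> \<delta>0 N \<le> \<delta> N \<and> 0 < \<rho> N \<and> \<rho>0 N \<le> \<rho> N \<and> n N \<le> n0 N) \<longrightarrow>
      \<delta> \<longlonglongrightarrow> 0 \<longrightarrow> \<rho> \<longlonglongrightarrow> 0 \<longrightarrow> filterlim n at_top sequentially \<longrightarrow>
      (\<forall>t>0. \<forall>c>0. \<exists>N0. \<forall>N\<ge>N0.
        \<forall>(\<mu> :: (nat \<Rightarrow> real) measure) (M :: 'a measure) (J :: nat list \<Rightarrow> 'a \<Rightarrow> real).
          sphere_haar N \<mu> \<longrightarrow> iid_gaussian_disorder N M J \<longrightarrow>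
          (let F = (\<lambda>m \<omega>. multi_free_energy N \<mu> \<beta> (hamiltonian N \<gamma> (\<lambda>is. J is \<omega>))
                            m (n N) (\<rho> N) (\<delta> N))
           in measure (completion M)
                {\<omega> \<in> space M.
                  (SUP m\<in>open_ball_N N. ereal \<bar>F m \<omega> - integral\<^sup>L M (F m)\<bar>) < ereal t}
              > 1 - exp (- (real N * c)))))"
proof -
  interpret mixture \<gamma> using gamma_nonneg gamma_decay by unfold_locales auto
  \<comment> \<open>With tolerances at least N^(- 1/8) the parameter x is of that order, so the axes
    spoiled by the replicas, about n0 / x^2, number at most of order N^(1/2), below the N
    available.\<close>
  define w :: "nat \<Rightarrow> real" where "w N = real N powr (- 1 / 8)" for N
  define n0 :: "nat \<Rightarrow> nat" where "n0 N = nat \<lfloor>real N powr (1 / 4)\<rfloor>" for N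
  have w0: "w \<longlonglongrightarrow> 0" unfolding w_def by real_asymp
  have n00: "filterlim n0 at_top sequentially" unfolding n0_def by real_asymp
  show ?thesis
  proof (rule exI[of _ w], rule exI[of _ w], rule exI[of _ n0], intro conjI w0 n00 allI impI)
    fix \<delta> \<rho> :: "nat \<Rightarrow> real" and n :: "nat \<Rightarrow> nat" and t c :: real
    assume b: "\<forall>N\<ge>1. 0 < \<delta> N \<and> w N \<le> \<delta> N \<and> 0 < \<rho> N \<and> w N \<le> \<rho> N \<and> n N \<le> n0 N"
      and lims: "\<delta> \<longlonglongrightarrow> 0" "\<rho> \<longlonglongrightarrow> 0" "filterlim n at_top sequentially" and t: "0 < t" and c: "0 < c"
    define K where "K = 13 * (\<beta> * ((21 + 3 * c) * S1)) + 1"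
    have K: "K \<ge> 1" using beta_pos c S1_nonneg by (simp add: K_def)
    \<comment> \<open>Keeps the Lipschitz cost and the density cost of a pull together below t / 8.
      It depends on t and c but not on N, so 1 / \<alpha> is a constant in the exponent of the net
      size.\<close>
    define \<alpha> where "\<alpha> = min (1/2) (t / (8 * K))"
    have \<alpha>: "0 < \<alpha>" "\<alpha> \<le> 1/2" using t K by (auto simp: \<alpha>_def)
    have \<alpha>K: "\<alpha> * K \<le> t / 8"
    proof -
      have "\<alpha> * K \<le> t / (8 * K) * K" using K by (intro mult_right_mono) (auto simp: \<alpha>_def)
      then show ?thesis using K by simp
    qed
    have ninf: "filterlim (\<lambda>N. real (n N)) at_top sequentially"
      by (rule filterlim_compose[OF filterlim_real_sequentially lims(3)])
    \<comment> \<open>This is \<open>rate\<close> times the exponent 4 + c + 1 / \<alpha> demanded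
      by the net; it tends to 0 whatever t and c are.\<close>
    have "((\<lambda>N. 8 * \<beta>\<^sup>2 * (4 * (D1 + 1) / real (n N) + (\<rho> N + 2 * \<delta> N) * D2) * (4 + c + 1 / \<alpha>)) \<longlongrightarrow>
        8 * \<beta>\<^sup>2 * (0 + (0 + 2 * 0) * D2) * (4 + c + 1 / \<alpha>)) sequentially"
      by (intro tendsto_intros lims tendsto_divide_0[OF tendsto_const] filterlim_at_top_imp_at_infinity ninf)
    then have "eventually (\<lambda>N. 8 * \<beta>\<^sup>2 * (4 * (D1 + 1) / real (n N) + (\<rho> N + 2 * \<delta> N) * D2) * (4 + c + 1 / \<alpha>) < (t / 4)\<^sup>2) sequentially"
      using t by (intro order_tendstoD(2)) auto
    moreover have "eventually (\<lambda>N. n N \<ge> 1) sequentially"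
      using lims(3) by (simp add: filterlim_at_top)
    moreover have "eventually (\<lambda>N. (real N powr (1/4) + 1) * (1 + 1 / (\<alpha>\<^sup>2 * real N powr (-1/8) / 32)\<^sup>2) \<le> real N) sequentially"
      using \<alpha>(1) by real_asymp
    moreover have "eventually (\<lambda>N. 8 / (\<alpha>\<^sup>2 * real N powr (-1/8)) + 1 \<le> exp (real N)) sequentially"
      using \<alpha>(1) by real_asymp
    moreover have "eventually (\<lambda>N. 1 / real N + 2 * ln (real N) / real N \<le> t / 8) sequentially"
      using t by real_asymp
    moreover have "eventually (\<lambda>N::nat. N \<ge> 10) sequentially" by (rule eventually_ge_at_top)
    ultimately have "eventually (\<lambda>N. 
        \<forall>(\<mu> :: (nat \<Rightarrow> real) measure) (M :: 'a measure) (J :: nat list \<Rightarrow> 'a \<Rightarrow> real).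
          sphere_haar N \<mu> \<longrightarrow> iid_gaussian_disorder N M J \<longrightarrow>
          measure (completion M)
                {\<omega> \<in> space M.
                  (SUP m\<in>open_ball_N N. ereal \<bar>multi_free_energy N \<mu> \<beta> (hamiltonian N \<gamma> (\<lambda>is. J is \<omega>)) m (n N) (\<rho> N) (\<delta> N)
                    - integral\<^sup>L M (\<lambda>\<omega>. multi_free_energy N \<mu> \<beta> (hamiltonian N \<gamma> (\<lambda>is. J is \<omega>)) m (n N) (\<rho> N) (\<delta> N))\<bar>) < ereal t}
              > 1 - exp (- (real N * c))) sequentially"
    proof eventually_elim
      case (elim N)
      show ?case
      proof (intro allI impI)
        fix \<mu> :: "(nat \<Rightarrow> real) measure" and M :: "'a measure" and J :: "nat list \<Rightarrow> 'a \<Rightarrow> real"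
        assume haar: "sphere_haar N \<mu>" and iid: "iid_gaussian_disorder N M J"
        have N1: "N \<ge> 1" using elim by simp
        then have bN: "0 < \<delta> N" "w N \<le> \<delta> N" "0 < \<rho> N" "w N \<le> \<rho> N" "n N \<le> n0 N" using b by auto
        interpret model N \<mu> \<gamma> \<beta> "n N" "\<rho> N" "\<delta> N"
          using haar elim bN beta_pos by unfold_locales auto
        have wN: "0 < w N" "w N \<le> 1" using N1 powr_mono[of "- 1 / 8" 0 "real N"] by (auto simp: w_def)
        have "real (n N) \<le> real (n0 N)" using bN by simp
        also have "\<dots> \<le> real N powr (1/4)" by (simp add: n0_def)
        finally have "(real (n N) + 1) * (1 + 1 / (\<alpha>\<^sup>2 * w N / 32)\<^sup>2) \<le> (real N powr (1/4) + 1) * (1 + 1 / (\<alpha>\<^sup>2 * w N / 32)\<^sup>2)"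
          by (intro mult_right_mono) auto
        then have big: "(real (n N) + 1) * (1 + 1 / (\<alpha>\<^sup>2 * w N / 32)\<^sup>2) \<le> real N"
          using elim(3) unfolding w_def by linarith
        have "1 - exp (- (real N * c)) < measure (disorder N) (sup_event t)"
        proof (rule sup_event_prob_exp[OF \<alpha> wN bN(2,4) big])
          show "8 / (\<alpha>\<^sup>2 * w N) + 1 \<le> exp (real N)" using elim(4) by (simp add: w_def)
          show "\<alpha> * (13 * (\<beta> * ((21 + 3 * c) * S1)) + 1) \<le> t / 8" using \<alpha>K by (simp add: K_def)
          show "rate * (4 + c + 1 / \<alpha>) \<le> (t / 4)\<^sup>2" unfolding rate_def using elim(1) by (rule less_imp_le)
        qed (use elim c t in auto)
        also note sup_event_transfer[OF iid]
        finally show "measure (completion M)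
                {\<omega> \<in> space M.
                  (SUP m\<in>open_ball_N N. ereal \<bar>multi_free_energy N \<mu> \<beta> (hamiltonian N \<gamma> (\<lambda>is. J is \<omega>)) m (n N) (\<rho> N) (\<delta> N)
                    - integral\<^sup>L M (\<lambda>\<omega>. multi_free_energy N \<mu> \<beta> (hamiltonian N \<gamma> (\<lambda>is. J is \<omega>)) m (n N) (\<rho> N) (\<delta> N))\<bar>) < ereal t}
              > 1 - exp (- (real N * c))" .
      qed
    qed
    then show "\<exists>N0. \<forall>N\<ge>N0.
        \<forall>(\<mu> :: (nat \<Rightarrow> real) measure) (M :: 'a measure) (J :: nat list \<Rightarrow> 'a \<Rightarrow> real).
          sphere_haar N \<mu> \<longrightarrow> iid_gaussian_disorder N M J \<longrightarrow>
          (let F = (\<lambda>m \<omega>. multi_free_energy N \<mu> \<beta> (hamiltonian N \<gamma> (\<lambda>is. J is \<omega>))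
                            m (n N) (\<rho> N) (\<delta> N))
           in measure (completion M)
                {\<omega> \<in> space M.
                  (SUP m\<in>open_ball_N N. ereal \<bar>F m \<omega> - integral\<^sup>L M (F m)\<bar>) < ereal t}
              > 1 - exp (- (real N * c)))"
      unfolding eventually_sequentially Let_def .
  qed
qed

end
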